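(* Let $k\ge1$, let $(\Omega_j,\mathcal F_j,H_j,P_j)$, $j\in\{1,\dots,k+1\}$, be projection valued measure spaces, $\Omega=\Omega_1\times\cdots\times\Omega_{k+1}$, $P=P_1\otimes\cdots\otimes P_{k+1}$, $\boldsymbol P=(P_1,\dots,P_{k+1})$, and let $1\le m\le k$. (i) If $\varphi,\psi\in L^\infty(\Omega_1,P_1)\hat\otimes_i\cdots\hat\otimes_iL^\infty(\Omega_{k+1},P_{k+1})$ and $\alpha\in\mathbb C$, then $I^{\boldsymbol P}(\varphi+\alpha\psi)=I^{\boldsymbol P}\varphi+\alpha\,I^{\boldsymbol P}\psi$. (ii) If $\psi_1\in L^\infty(\Omega_1,P_1)\hat\otimes_i\cdots\hat\otimes_iL^\infty(\Omega_m,P_m)$ and $\psi_2\in L^\infty(\Omega_{m+1},P_{m+1})\hat\otimes_i\cdots\hat\otimes_iL^\infty(\Omega_{k+1},P_{k+1})$, then (the $P$-a.e. class of) the function $(\psi_1\otimes\psi_2)(\omega_1,\dots,\omega_{k+1}):=\psi_1(\omega_1,\dots,\omega_m)\,\psi_2(\omega_{m+1},\dots,\omega_{k+1})$ belongs to $L^\infty(\Omega_1,P_1)\hat\otimes_i\cdots\hat\otimes_iL^\infty(\Omega_{k+1},P_{k+1})$ and $$\big(I^{\boldsymbol P}(\psi_1\otimes\psi_2)\big)[b]=\big(I^{P_1,\dots,P_m}\psi_1\big)[b_1,\dots,b_{m-1}]\,b_m\,\big(I^{P_{m+1},\dots,P_{k+1}}\psi_2\big)[b_{m+1},\dots,b_k]$$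 for all $b=(b_1,\dots,b_k)\in B(H_2;H_1)\times\cdots\times B(H_{k+1};H_k)$. (iii) If $\psi\in L^\infty(\Omega_m,P_m)\hat\otimes_iL^\infty(\Omega_{m+1},P_{m+1})$, $\tilde\psi(\omega_1,\dots,\omega_{k+1}):=\psi(\omega_m,\omega_{m+1})$ for $(\omega_1,\dots,\omega_{k+1})\in\Omega$, and $\varphi\in L^\infty(\Omega_1,P_1)\hat\otimes_i\cdots\hat\otimes_iL^\infty(\Omega_{k+1},P_{k+1})$, then $$\big(I^{\boldsymbol P}(\varphi\tilde\psi)\big)[b]=\big(I^{\boldsymbol P}\varphi\big)\big[b_1,\dots,b_{m-1},\big(I^{P_m,P_{m+1}}\psi\big)[b_m],b_{m+1},\dots,b_k\big]$$ for all $b=(b_1,\dots,b_k)\in B(H_2;H_1)\times\cdots\times B(H_{k+1};H_k)$.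
   Context: Hilbert spaces are complex (not assumed separable), inner products linear in the first argument. A projection valued measure space $(\Xi,\mathcal G,K,Q)$: $(\Xi,\mathcal G)$ measurable space, $K$ Hilbert space, $Q:\mathcal G\to B(K)$ with $Q(\Xi)=\mathrm{id}_K$, $Q(G)^2=Q(G)=Q(G)^*$, countably additive in the weak operator topology. $L^\infty(\Xi,Q)$: $Q$-a.e. classes of bounded measurable functions, $\|f\|_{L^\infty(Q)}=\inf\{c\ge0:Q(|f|>c)=0\}$. For $f\in L^\infty(\Xi,Q)$, $Q(f)\in B(K)$ is given by $\langle Q(f)h,k\rangle=\int f\,dQ_{h,k}$, $Q_{h,k}(G)=\langle Q(G)h,k\rangle$. For projection valued measure spaces indexed by $j=1,\dots,n$, $P_1\otimes\cdots\otimes P_n$ is the unique projection valued measure on $\prod_j\Omega_j$ with the product $\sigma$-algebra, acting on the Hilbert space tensor product of the $H_j$, with $(P_1\otimes\cdots\otimes P_n)(G_1\times\cdots\times G_n)=P_1(G_1)\otimes\cdots\otimes P_n(G_n)$. Upper integral of arbitrary $h:\Sigma\to[0,\infty]$: $\overline{\int_\Sigma}h\,d\rho=\inf\{\int\tilde h\,d\rho:h\le\tilde h\ \rho\text{-a.e.},\ \tilde h\text{ measurable}\}$. An $L^\infty_{P_1\otimes\cdots\otimes P_n}$-integral projective decomposition of $\varphi:\Omega_1\times\cdots\times\Omega_n\to\mathbb C$: a tuple $(\Sigma,\rho,\varphi_1,\dots,\varphi_n)$ with $(\Sigma,\mathcal H,\rho)$ $\sigma$-finite, $\varphi_j:\Omega_j\times\Sigma\to\mathbb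 C$ measurable, (i) $\varphi_j(\cdot,\sigma)\in L^\infty(\Omega_j,P_j)$ for all $j,\sigma$; (ii) $\overline{\int_\Sigma}\prod_j\|\varphi_j(\cdot,\sigma)\|_{L^\infty(P_j)}\,\rho(d\sigma)<\infty$; (iii) $\varphi(\omega_1,\dots,\omega_n)=\int_\Sigma\prod_j\varphi_j(\omega_j,\sigma)\,\rho(d\sigma)$ for $P_1\otimes\cdots\otimes P_n$-a.e. $(\omega_1,\dots,\omega_n)$. $L^\infty(\Omega_1,P_1)\hat\otimes_i\cdots\hat\otimes_iL^\infty(\Omega_n,P_n)$ is the set of a.e. classes of functions admitting such a decomposition. The multiple operator integral is $(I^{P_1,\dots,P_n}\varphi)[b_1,\dots,b_{n-1}]:=\int_\Sigma P_1(\varphi_1(\cdot,\sigma))\,b_1\cdots P_{n-1}(\varphi_{n-1}(\cdot,\sigma))\,b_{n-1}\,P_n(\varphi_n(\cdot,\sigma))\,\rho(d\sigma)\in B(H_n;H_1)$ for $b_j\in B(H_{j+1};H_j)$ and any such decomposition (the result does not depend on the choice); the integral is the pointwise Pettis integral: the unique bounded operator $T$ with $\langle Th,h'\rangle=\int_\Sigma\langle F(\sigma)h,h'\rangle\,\rho(d\sigma)$ for all $h\in H_n,h'\in H_1$, $F$ being the integrand. For $n=1$ (which occurs in (ii) when $m=1$ or $m=k$) the tensor product is just $L^\infty(\Omega_1,P_1)$ and $I^{P_1}\varphi=P_1(\varphi)$, with no operator arguments. *)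

theory Defs
  imports "HOL-Analysis.Analysis" "HOL-Library.Function_Algebras"
begin

section \<open>Complex Hilbert spaces\<close>

class complex_vector = ab_group_add +
  fixes scaleC :: "complex \<Rightarrow> 'a \<Rightarrow> 'a"  (infixr \<open>*\<^sub>C\<close> 75)
  assumes scaleC_add_right: "c *\<^sub>C (x + y) = c *\<^sub>C x + c *\<^sub>C y"
    and scaleC_add_left: "(c + d) *\<^sub>C x = c *\<^sub>C x + d *\<^sub>C x"
    and scaleC_scaleC: "c *\<^sub>C d *\<^sub>C x = (c * d) *\<^sub>C x"
    and scaleC_one: "1 *\<^sub>C x = x"

instantiation complex :: complex_vector
begin
definition "scaleC c (z :: complex) = c * z"
instance by standard (simp_all add: scaleC_complex_def algebra_simps)
end

instantiation "fun" :: (type, complex_vector) complex_vector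
begin
definition "scaleC c (f :: 'a \<Rightarrow> 'b) = (\<lambda>x. c *\<^sub>C f x)"
instance
  by standard (simp_all add: scaleC_fun_def fun_eq_iff scaleC_add_right scaleC_add_left
      scaleC_scaleC scaleC_one)
end

text \<open>
  A family of Hilbert spaces with varying members cannot be a family of types.  A Hilbert space is
  therefore a linear subspace of an ambient complex vector space (a mere set of vectors, without
  topology) with an inner product of its own.  Any family of Hilbert spaces has this form: take
  the algebraic direct sum as the ambient space.
\<close>

record 'h hspace =
  vecs :: "'h set"
  ip :: "'h \<Rightarrow> 'h \<Rightarrow> complex"

definition hnorm :: "'h hspace \<Rightarrow> 'h \<Rightarrow> real" where
  "hnorm H x = sqrt (Re (ip H x x))"

locale hilbert_space =
  fixes H :: "'h::complex_vector hspace"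
  assumes zero_mem: "0 \<in> vecs H"
    and add_mem: "\<lbrakk>x \<in> vecs H; y \<in> vecs H\<rbrakk> \<Longrightarrow> x + y \<in> vecs H"
    and scaleC_mem: "x \<in> vecs H \<Longrightarrow> c *\<^sub>C x \<in> vecs H"
    and ip_add: "\<lbrakk>x \<in> vecs H; y \<in> vecs H; z \<in> vecs H\<rbrakk> \<Longrightarrow> ip H (x + y) z = ip H x z + ip H y z"
    and ip_scaleC: "\<lbrakk>x \<in> vecs H; y \<in> vecs H\<rbrakk> \<Longrightarrow> ip H (c *\<^sub>C x) y = c * ip H x y"
    and ip_commute: "\<lbrakk>x \<in> vecs H; y \<in> vecs H\<rbrakk> \<Longrightarrow> ip H y x = cnj (ip H x y)"
    and ip_nonneg: "x \<in> vecs H \<Longrightarrow> 0 \<le> Re (ip H x x)"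
    and ip_definite: "\<lbrakk>x \<in> vecs H; ip H x x = 0\<rbrakk> \<Longrightarrow> x = 0"
    and complete: "\<lbrakk>\<And>n::nat. s n \<in> vecs H;
        \<And>e. 0 < e \<Longrightarrow> \<exists>N. \<forall>m\<ge>N. \<forall>n\<ge>N. hnorm H (s m - s n) < e\<rbrakk>
      \<Longrightarrow> \<exists>x\<in>vecs H. (\<lambda>n. hnorm H (s n - x)) \<longlonglongrightarrow> 0"

text \<open>
  Elements of \<open>B(H; K)\<close> are represented by functions whose values outside \<open>vecs H\<close> are
  irrelevant; equality of operators means agreement on \<open>vecs H\<close>.
\<close>

definition bounded_op :: "'h::complex_vector hspace \<Rightarrow> 'k::complex_vector hspace \<Rightarrow> ('h \<Rightarrow> 'k) \<Rightarrow> bool"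
  where "bounded_op H K T \<longleftrightarrow>
    (\<forall>x\<in>vecs H. T x \<in> vecs K) \<and>
    (\<forall>x\<in>vecs H. \<forall>y\<in>vecs H. T (x + y) = T x + T y) \<and>
    (\<forall>x\<in>vecs H. \<forall>c. T (c *\<^sub>C x) = c *\<^sub>C T x) \<and>
    (\<exists>C. \<forall>x\<in>vecs H. hnorm K (T x) \<le> C * hnorm H x)"

text \<open>
  \<open>K\<close> with \<open>\<iota> x\<close> in the role of the elementary tensor of the \<open>x i\<close> (\<open>i \<in> I\<close>).  Multilinearity of
  \<open>\<iota>\<close> follows from the formula for the inner products and definiteness.
\<close>

definition hilbert_tensor ::
    "'i set \<Rightarrow> ('i \<Rightarrow> 'h::complex_vector hspace) \<Rightarrow> 'k::complex_vector hspace \<Rightarrow> (('i \<Rightarrow> 'h) \<Rightarrow> 'k) \<Rightarrow> bool"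
  where "hilbert_tensor I H K \<iota> \<longleftrightarrow>
    hilbert_space K \<and>
    (\<forall>x \<in> (\<Pi>\<^sub>E i\<in>I. vecs (H i)). \<iota> x \<in> vecs K) \<and>
    (\<forall>x \<in> (\<Pi>\<^sub>E i\<in>I. vecs (H i)). \<forall>y \<in> (\<Pi>\<^sub>E i\<in>I. vecs (H i)).
       ip K (\<iota> x) (\<iota> y) = (\<Prod>i\<in>I. ip (H i) (x i) (y i))) \<and>
    (\<forall>v \<in> vecs K. \<forall>e>0. \<exists>(n::nat) c x. (\<forall>l<n. x l \<in> (\<Pi>\<^sub>E i\<in>I. vecs (H i))) \<and>
       hnorm K (v - (\<Sum>l<n. c l *\<^sub>C \<iota> (x l))) < e)"

section \<open>Projection valued measure spaces\<close>

text \<open>Of \<open>msp\<close> only the underlying set and the sigma algebra matter.\<close>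

record ('w, 'h) pvms =
  msp :: "'w measure"
  hsp :: "'h hspace"
  prj :: "'w set \<Rightarrow> 'h \<Rightarrow> 'h"

locale pvm_space = hilbert_space "hsp X" for X :: "('w, 'h::complex_vector) pvms" +
  assumes bounded: "G \<in> sets (msp X) \<Longrightarrow> bounded_op (hsp X) (hsp X) (prj X G)"
    and total: "h \<in> vecs (hsp X) \<Longrightarrow> prj X (space (msp X)) h = h"
    and idem: "\<lbrakk>G \<in> sets (msp X); h \<in> vecs (hsp X)\<rbrakk> \<Longrightarrow> prj X G (prj X G h) = prj X G h"
    and selfadj: "\<lbrakk>G \<in> sets (msp X); h \<in> vecs (hsp X); k \<in> vecs (hsp X)\<rbrakk>
      \<Longrightarrow> ip (hsp X) (prj X G h) k = ip (hsp X) h (prj X G k)"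
    and weakly_additive: "\<lbrakk>range A \<subseteq> sets (msp X); disjoint_family (A :: nat \<Rightarrow> 'w set);
        h \<in> vecs (hsp X); k \<in> vecs (hsp X)\<rbrakk>
      \<Longrightarrow> (\<lambda>n. ip (hsp X) (prj X (A n) h) k) sums ip (hsp X) (prj X (\<Union>n. A n) h) k"

definition pvm_null :: "('w, 'h::complex_vector) pvms \<Rightarrow> 'w set \<Rightarrow> bool" where
  "pvm_null X N \<longleftrightarrow> (\<forall>h\<in>vecs (hsp X). prj X N h = 0)"

definition pvm_AE :: "('w, 'h::complex_vector) pvms \<Rightarrow> ('w \<Rightarrow> bool) \<Rightarrow> bool" where
  "pvm_AE X p \<longleftrightarrow> (\<exists>N\<in>sets (msp X). pvm_null X N \<and> {\<omega>\<in>space (msp X). \<not> p \<omega>} \<subseteq> N)"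

text \<open>
  Almost everywhere classes are handled through arbitrary representatives: \<open>f\<close> represents an
  element of \<open>L\<^sup>\<infinity>\<close> if it agrees almost everywhere with a bounded measurable function.
\<close>

definition bdd_meas :: "'w measure \<Rightarrow> ('w \<Rightarrow> complex) set" where
  "bdd_meas M = {g \<in> borel_measurable M. \<exists>C. \<forall>\<omega>\<in>space M. cmod (g \<omega>) \<le> C}"

definition Linf :: "('w, 'h::complex_vector) pvms \<Rightarrow> ('w \<Rightarrow> complex) set" where
  "Linf X = {f. \<exists>g\<in>bdd_meas (msp X). pvm_AE X (\<lambda>\<omega>. f \<omega> = g \<omega>)}"

definition Linf_norm :: "('w, 'h::complex_vector) pvms \<Rightarrow> ('w \<Rightarrow> complex) \<Rightarrow> real" where
  "Linf_norm X f = Inf {c. 0 \<le> c \<and> pvm_null X {\<omega>\<in>space (msp X). c < cmod (f \<omega>)}}"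

text \<open>
  Integral with respect to a complex measure \<open>\<nu>\<close>, reduced to finite positive measures by writing
  \<open>\<nu> = \<mu>\<^sub>0 + \<i> \<mu>\<^sub>1 - \<mu>\<^sub>2 - \<i> \<mu>\<^sub>3\<close>.  For bounded measurable \<open>f\<close> the value does not depend on the choice
  of such \<open>\<mu>\<close>.
\<close>

definition has_cmeasure_integral ::
    "'w measure \<Rightarrow> ('w set \<Rightarrow> complex) \<Rightarrow> ('w \<Rightarrow> complex) \<Rightarrow> complex \<Rightarrow> bool"
  where "has_cmeasure_integral M \<nu> f z \<longleftrightarrow>
    (\<exists>\<mu> :: nat \<Rightarrow> 'w measure.
       (\<forall>p<4. finite_measure (\<mu> p) \<and> sets (\<mu> p) = sets M \<and> integrable (\<mu> p) f) \<and>
       (\<forall>G\<in>sets M. \<nu> G = (\<Sum>p<4. \<i> ^ p * of_real (measure (\<mu> p) G))) \<and>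
       z = (\<Sum>p<4. \<i> ^ p * (LINT \<omega>|\<mu> p. f \<omega>)))"

definition pvm_int :: "('w, 'h::complex_vector) pvms \<Rightarrow> ('w \<Rightarrow> complex) \<Rightarrow> 'h \<Rightarrow> 'h" where
  "pvm_int X f = (SOME T. bounded_op (hsp X) (hsp X) T \<and>
     (\<exists>g\<in>bdd_meas (msp X). pvm_AE X (\<lambda>\<omega>. f \<omega> = g \<omega>) \<and>
        (\<forall>h\<in>vecs (hsp X). \<forall>k\<in>vecs (hsp X).
           has_cmeasure_integral (msp X) (\<lambda>G. ip (hsp X) (prj X G h) k) g (ip (hsp X) (T h) k))))"

text \<open>
  The tensor product is determined up to a unitary equivalence that intertwines the projections;
  functions \<open>(nat \<Rightarrow> 'h) \<Rightarrow> complex\<close> leave enough room for a model, namely the Hilbert space with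
  reproducing kernel \<open>\<Prod>i\<in>I. ip (H i) (x i) (y i)\<close>.  For an index set \<open>{a..b}\<close>, a function of
  \<open>(\<omega>\<^sub>a, \<dots>, \<omega>\<^sub>b)\<close> is a function on \<open>space (\<Pi>\<^sub>M i\<in>{a..b}. msp (X i))\<close>.
\<close>

definition is_tensor_pvms ::
    "nat set \<Rightarrow> (nat \<Rightarrow> ('w, 'h::complex_vector) pvms) \<Rightarrow> (nat \<Rightarrow> 'w, 'k::complex_vector) pvms \<Rightarrow> bool"
  where "is_tensor_pvms I X Y \<longleftrightarrow>
    msp Y = (\<Pi>\<^sub>M i\<in>I. msp (X i)) \<and> pvm_space Y \<and>
    (\<exists>\<iota>. hilbert_tensor I (\<lambda>i. hsp (X i)) (hsp Y) \<iota> \<and>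
       (\<forall>G x. (\<forall>i\<in>I. G i \<in> sets (msp (X i))) \<longrightarrow> x \<in> (\<Pi>\<^sub>E i\<in>I. vecs (hsp (X i))) \<longrightarrow>
          prj Y (\<Pi>\<^sub>E i\<in>I. G i) (\<iota> x) = \<iota> (\<lambda>i\<in>I. prj (X i) (G i) (x i))))"

definition tensor_pvms ::
    "nat set \<Rightarrow> (nat \<Rightarrow> ('w, 'h::complex_vector) pvms) \<Rightarrow> (nat \<Rightarrow> 'w, (nat \<Rightarrow> 'h) \<Rightarrow> complex) pvms"
  where "tensor_pvms I X = (SOME Y. is_tensor_pvms I X Y)"

section \<open>Integral projective tensor products and multiple operator integrals\<close>

definition upper_integral :: "'s measure \<Rightarrow> ('s \<Rightarrow> ennreal) \<Rightarrow> ennreal" where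
  "upper_integral \<rho> h =
     Inf {\<integral>\<^sup>+\<sigma>. g \<sigma> \<partial>\<rho> | g. g \<in> borel_measurable \<rho> \<and> (AE \<sigma> in \<rho>. h \<sigma> \<le> g \<sigma>)}"

text \<open>
  Decompositions of functions of \<open>(\<omega>\<^sub>a, \<dots>, \<omega>\<^sub>b)\<close>.  The Bochner integrability contained in the last
  clause follows from the preceding clauses for almost every \<open>\<omega>\<close>.
\<close>

definition is_ipd ::
    "nat \<Rightarrow> nat \<Rightarrow> (nat \<Rightarrow> ('w, 'h::complex_vector) pvms) \<Rightarrow> ((nat \<Rightarrow> 'w) \<Rightarrow> complex) \<Rightarrow>
     's measure \<Rightarrow> (nat \<Rightarrow> 'w \<times> 's \<Rightarrow> complex) \<Rightarrow> bool"
  where "is_ipd a b X \<phi> \<rho> f \<longleftrightarrow>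
    sigma_finite_measure \<rho> \<and>
    (\<forall>j\<in>{a..b}. f j \<in> borel_measurable (msp (X j) \<Otimes>\<^sub>M \<rho>)) \<and>
    (\<forall>j\<in>{a..b}. \<forall>\<sigma>\<in>space \<rho>. (\<lambda>\<omega>. f j (\<omega>, \<sigma>)) \<in> Linf (X j)) \<and>
    upper_integral \<rho> (\<lambda>\<sigma>. ennreal (\<Prod>j=a..b. Linf_norm (X j) (\<lambda>\<omega>. f j (\<omega>, \<sigma>)))) < \<infinity> \<and>
    pvm_AE (tensor_pvms {a..b} X)
      (\<lambda>\<omega>. has_bochner_integral \<rho> (\<lambda>\<sigma>. \<Prod>j=a..b. f j (\<omega> j, \<sigma>)) (\<phi> \<omega>))"

text \<open>
  The set of functions representing elements of the integral projective tensor product of the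
  \<open>L\<^sup>\<infinity>(\<Omega>\<^sub>j, P\<^sub>j)\<close>, \<open>a \<le> j \<le> b\<close>.  Since one cannot quantify over types, the type \<open>'s\<close> of the points of
  the parameter spaces \<open>\<Sigma>\<close> is a parameter; \<open>\<Sigma>\<close> itself is any sigma-finite measure space on any
  subset of \<open>'s\<close>.
\<close>

definition iptp ::
    "'s itself \<Rightarrow> nat \<Rightarrow> nat \<Rightarrow> (nat \<Rightarrow> ('w, 'h::complex_vector) pvms) \<Rightarrow> ((nat \<Rightarrow> 'w) \<Rightarrow> complex) set"
  where "iptp S a b X =
    (if a = b then {\<phi>. (\<lambda>x. \<phi> (\<lambda>i\<in>{a}. x)) \<in> Linf (X a)}
     else {\<phi>. \<exists>(\<rho> :: 's measure) f. is_ipd a b X \<phi> \<rho> f})"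

text \<open>\<open>op_chain A B a n = A\<^sub>a B\<^sub>a A\<^sub>a\<^sub>+\<^sub>1 B\<^sub>a\<^sub>+\<^sub>1 \<cdots> B\<^sub>a\<^sub>+\<^sub>n\<^sub>-\<^sub>1 A\<^sub>a\<^sub>+\<^sub>n\<close>\<close>

primrec op_chain :: "(nat \<Rightarrow> 'h \<Rightarrow> 'h) \<Rightarrow> (nat \<Rightarrow> 'h \<Rightarrow> 'h) \<Rightarrow> nat \<Rightarrow> nat \<Rightarrow> 'h \<Rightarrow> 'h" where
  "op_chain A B a 0 = A a"
| "op_chain A B a (Suc n) = op_chain A B a n \<circ> B (a + n) \<circ> A (Suc (a + n))"

definition is_pettis_integral ::
    "'h::complex_vector hspace \<Rightarrow> 'k::complex_vector hspace \<Rightarrow> 's measure \<Rightarrow> ('s \<Rightarrow> 'h \<Rightarrow> 'k) \<Rightarrow>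
     ('h \<Rightarrow> 'k) \<Rightarrow> bool"
  where "is_pettis_integral H K \<rho> F T \<longleftrightarrow> bounded_op H K T \<and>
    (\<forall>h\<in>vecs H. \<forall>k\<in>vecs K. has_bochner_integral \<rho> (\<lambda>\<sigma>. ip K (F \<sigma> h) k) (ip K (T h) k))"

text \<open>
  The operator \<open>(I \<phi>)[B\<^sub>a, \<dots>, B\<^sub>b\<^sub>-\<^sub>1]\<close> for the projection valued measures with indices \<open>a, \<dots>, b\<close>;
  only the arguments \<open>B j\<close> with \<open>a \<le> j < b\<close> are used.
\<close>

definition moi ::
    "'s itself \<Rightarrow> nat \<Rightarrow> nat \<Rightarrow> (nat \<Rightarrow> ('w, 'h::complex_vector) pvms) \<Rightarrow> ((nat \<Rightarrow> 'w) \<Rightarrow> complex) \<Rightarrow>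
     (nat \<Rightarrow> 'h \<Rightarrow> 'h) \<Rightarrow> 'h \<Rightarrow> 'h"
  where "moi S a b X \<phi> B =
    (if a = b then pvm_int (X a) (\<lambda>x. \<phi> (\<lambda>i\<in>{a}. x))
     else (SOME T. \<exists>(\<rho> :: 's measure) f. is_ipd a b X \<phi> \<rho> f \<and>
       is_pettis_integral (hsp (X b)) (hsp (X a)) \<rho>
         (\<lambda>\<sigma>. op_chain (\<lambda>j. pvm_int (X j) (\<lambda>\<omega>. f j (\<omega>, \<sigma>))) B a (b - a)) T))"

definition op_args ::
    "nat \<Rightarrow> nat \<Rightarrow> (nat \<Rightarrow> ('w, 'h::complex_vector) pvms) \<Rightarrow> (nat \<Rightarrow> 'h \<Rightarrow> 'h) set"
  where "op_args a b X = {B. \<forall>j\<in>{a..<b}. bounded_op (hsp (X (Suc j))) (hsp (X j)) (B j)}"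

end

theory Submission
  imports Defs
begin

text \<open>
  Everything reduces to the independence of the multiple operator integral from the decomposition,
  which in turn reduces (form the disjoint sum of one decomposition and the negative of the other) to
  decompositions of \<open>0\<close>.  If all arguments \<open>B\<^sub>j\<close> have rank one, the integrand \<open>\<langle>F(\<sigma>)h, k\<rangle>\<close> is a product of
  functions \<open>\<langle>P\<^sub>j(\<phi>\<^sub>j(\<cdot>, \<sigma>))x\<^sub>j, y\<^sub>j\<rangle>\<close>, and its integral vanishes by Fubini because the product of the measures
  \<open>\<langle>P\<^sub>j(\<cdot>)x\<^sub>j, y\<^sub>j\<rangle>\<close> is absolutely continuous with respect to the tensor product.  General \<open>B\<^sub>j\<close> are reached one
  slot at a time by finite rank approximation and dominated convergence: although the Hilbert spaces need not be
  separable, the measurable vector fields \<open>\<sigma> \<mapsto> F(\<sigma>)h\<close> take values in separable subspaces.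
  The three identities then follow by evaluating the operator integral on suitable decompositions: disjoint
  sums of parameter spaces for (i), products of parameter spaces for (ii) and (iii).
\<close>

section \<open>Hilbert spaces\<close>

text \<open>Three objects are chosen by \<open>SOME\<close> (\<open>pvm_int\<close>,
  \<open>tensor_pvms\<close>, \<open>moi\<close>) and stay opaque until existence is proved. This
  explains the amount of foundations: Riesz representation for the spectral integral, and a concrete
  tensor product, modelled on l2 over tuples of basis vectors, with the projections of rectangles
  extended by Caratheodory. The main consequence is a description of null sets: a set is null for
  the tensor product iff it is null for every product of scalar spectral measures
  \<open>pmu (X i) (z i)\<close>. These are positive measures, so Fubini applies to them, and
  polarization passes to pairs of different vectors. The product of essential norms need not be
  measurable in \<sigma>, hence the upper integral in the definition; every estimate refers instead
  to an integrable majorant. Polarization costs a factor 2 in operator bounds, which is harmless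
  because constants only have to be independent of \<sigma>. Decompositions must have their
  parameter space on the fixed type \<open>'s\<close>, while the constructions produce sums and
  products of types; they return to \<open>'s\<close> along injections, which exist because
  \<open>'s\<close> is infinite.\<close>

lemma scaleC_zero_right [simp]: "c *\<^sub>C (0::'a::complex_vector) = 0"
  using scaleC_add_right[of c 0 "0::'a"] by simp

lemma scaleC_zero_left [simp]: "0 *\<^sub>C (x::'a::complex_vector) = 0"
  using scaleC_add_left[of 0 0 x] by simp

lemma scaleC_minus_left: "(- c) *\<^sub>C (x::'a::complex_vector) = - (c *\<^sub>C x)"
  using scaleC_add_left[of "- c" c x] by (simp add: eq_neg_iff_add_eq_0)

lemma scaleC_minus1: "(- 1) *\<^sub>C (x::'a::complex_vector) = - x"
  by (simp add: scaleC_minus_left scaleC_one)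

lemma scaleC_minus_right: "c *\<^sub>C (- x::'a::complex_vector) = - (c *\<^sub>C x)"
  using scaleC_add_right[of c "- x" x] by (simp add: eq_neg_iff_add_eq_0)

lemma scaleC_diff_right: "c *\<^sub>C (x - y::'a::complex_vector) = c *\<^sub>C x - c *\<^sub>C y"
  using scaleC_add_right[of c x "- y"] by (simp add: scaleC_minus_right)

lemma scaleC_sum_right: "c *\<^sub>C (\<Sum>i\<in>A. f i :: 'a::complex_vector) = (\<Sum>i\<in>A. c *\<^sub>C f i)"
  by (induction A rule: infinite_finite_induct) (simp_all add: scaleC_add_right)

lemma sum_lessThan_4: "(\<Sum>p<4::nat. f p) = f 0 + f 1 + f 2 + (f 3 :: 'a::comm_monoid_add)"
  by (simp add: numeral_eq_Suc)

section \<open>Vocabulary: complements, closed subspaces, orthonormal sets, polarization\<close>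

definition perp :: "'h::complex_vector hspace \<Rightarrow> 'h set \<Rightarrow> 'h set" where
  "perp H C = {x\<in>vecs H. \<forall>c\<in>C. ip H x c = 0}"

text \<open>Closedness is sequential and expressed through \<open>hnorm\<close>, because the ambient
  vectors carry no topology of their own.\<close>

definition closed_sub :: "'h::complex_vector hspace \<Rightarrow> 'h set \<Rightarrow> bool" where
  "closed_sub H S \<longleftrightarrow> S \<subseteq> vecs H \<and> 0 \<in> S \<and> (\<forall>x\<in>S. \<forall>y\<in>S. x + y \<in> S) \<and> (\<forall>x\<in>S. \<forall>c. c *\<^sub>C x \<in> S) \<and>
     (\<forall>s x. (\<forall>n::nat. s n \<in> S) \<longrightarrow> x \<in> vecs H \<longrightarrow> (\<lambda>n. hnorm H (s n - x)) \<longlonglongrightarrow> 0 \<longrightarrow> x \<in> S)"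

definition orthonormal :: "'h::complex_vector hspace \<Rightarrow> 'h set \<Rightarrow> bool" where
  "orthonormal H E \<longleftrightarrow> E \<subseteq> vecs H \<and> (\<forall>e\<in>E. \<forall>e'\<in>E. ip H e e' = (if e = e' then 1 else 0))"

text \<open>Maximality is taken as the definition; the expansion of vectors
  (\<open>onb_approx\<close>, \<open>parseval\<close>) is then a theorem. The set may be
  uncountable.\<close>

definition onb :: "'h::complex_vector hspace \<Rightarrow> 'h set \<Rightarrow> bool" where
  "onb H E \<longleftrightarrow> orthonormal H E \<and> (\<forall>x\<in>vecs H. (\<forall>e\<in>E. ip H x e = 0) \<longrightarrow> x = 0)"

text \<open>The factor 1/2 frees both \<open>polarization\<close> and \<open>pol_norm_sum\<close>
  from prefactors. The powers of \<i> are those attached to the four measures in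
  \<open>has_cmeasure_integral\<close>.\<close>

definition pol :: "nat \<Rightarrow> 'h::complex_vector \<Rightarrow> 'h \<Rightarrow> 'h" where
  "pol p h k = (1/2) *\<^sub>C (h + \<i> ^ p *\<^sub>C k)"

context hilbert_space
begin

lemma uminus_mem: "x \<in> vecs H \<Longrightarrow> - x \<in> vecs H"
  using scaleC_mem[of x "- 1"] by (simp add: scaleC_minus1)

lemma diff_mem: "\<lbrakk>x \<in> vecs H; y \<in> vecs H\<rbrakk> \<Longrightarrow> x - y \<in> vecs H"
  using add_mem[of x "- y"] uminus_mem by simp

lemma sum_mem: "(\<And>i. i \<in> A \<Longrightarrow> f i \<in> vecs H) \<Longrightarrow> sum f A \<in> vecs H"
  by (induction A rule: infinite_finite_induct) (simp_all add: zero_mem add_mem)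

lemma pol_mem: "\<lbrakk>x \<in> vecs H; y \<in> vecs H\<rbrakk> \<Longrightarrow> pol p x y \<in> vecs H"
  by (simp add: pol_def add_mem scaleC_mem)

lemmas mem = zero_mem add_mem scaleC_mem uminus_mem diff_mem sum_mem pol_mem

lemma ip_add_right:
  assumes "x \<in> vecs H" "y \<in> vecs H" "z \<in> vecs H"
  shows "ip H x (y + z) = ip H x y + ip H x z"
proof -
  have "ip H x (y + z) = cnj (ip H (y + z) x)" using assms ip_commute add_mem by blast
  also have "\<dots> = ip H x y + ip H x z"
    using assms ip_commute[of y x] ip_commute[of z x] by (simp add: ip_add)
  finally show ?thesis .
qed

lemma ip_scaleC_right:
  assumes "x \<in> vecs H" "y \<in> vecs H"
  shows "ip H x (c *\<^sub>C y) = cnj c * ip H x y"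
proof -
  have "ip H x (c *\<^sub>C y) = cnj (ip H (c *\<^sub>C y) x)" using assms ip_commute scaleC_mem by blast
  also have "\<dots> = cnj c * ip H x y"
    using assms ip_commute[of y x] by (simp add: ip_scaleC)
  finally show ?thesis .
qed

lemma ip_zero_left [simp]: "x \<in> vecs H \<Longrightarrow> ip H 0 x = 0"
  using ip_scaleC[of x x 0] by simp

lemma ip_zero_right [simp]: "x \<in> vecs H \<Longrightarrow> ip H x 0 = 0"
  using ip_scaleC_right[of x x 0] by simp

lemma ip_minus_left: "\<lbrakk>x \<in> vecs H; y \<in> vecs H\<rbrakk> \<Longrightarrow> ip H (- x) y = - ip H x y"
  using ip_scaleC[of x y "- 1"] by (simp add: scaleC_minus1)

lemma ip_minus_right: "\<lbrakk>x \<in> vecs H; y \<in> vecs H\<rbrakk> \<Longrightarrow> ip H x (- y) = - ip H x y"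
  using ip_scaleC_right[of x y "- 1"] by (simp add: scaleC_minus1)

lemma ip_diff_left: "\<lbrakk>x \<in> vecs H; y \<in> vecs H; z \<in> vecs H\<rbrakk> \<Longrightarrow> ip H (x - y) z = ip H x z - ip H y z"
  using ip_add[of x "- y" z] by (simp add: uminus_mem ip_minus_left)

lemma ip_diff_right: "\<lbrakk>x \<in> vecs H; y \<in> vecs H; z \<in> vecs H\<rbrakk> \<Longrightarrow> ip H x (y - z) = ip H x y - ip H x z"
  using ip_add_right[of x y "- z"] by (simp add: uminus_mem ip_minus_right)

lemma ip_sum_left:
  "\<lbrakk>\<And>i. i \<in> A \<Longrightarrow> f i \<in> vecs H; y \<in> vecs H\<rbrakk> \<Longrightarrow> ip H (\<Sum>i\<in>A. f i) y = (\<Sum>i\<in>A. ip H (f i) y)"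
  by (induction A rule: infinite_finite_induct) (simp_all add: mem ip_add)

lemma ip_sum_right:
  "\<lbrakk>\<And>i. i \<in> A \<Longrightarrow> f i \<in> vecs H; y \<in> vecs H\<rbrakk> \<Longrightarrow> ip H y (\<Sum>i\<in>A. f i) = (\<Sum>i\<in>A. ip H y (f i))"
  by (induction A rule: infinite_finite_induct) (simp_all add: mem ip_add_right)

lemmas ip_simps = ip_add ip_add_right ip_scaleC ip_scaleC_right ip_diff_left ip_diff_right
  ip_minus_left ip_minus_right

lemma hnorm_nonneg [simp]: "x \<in> vecs H \<Longrightarrow> 0 \<le> hnorm H x"
  by (simp add: hnorm_def ip_nonneg)

lemma ip_self: assumes "x \<in> vecs H" shows "ip H x x = of_real ((hnorm H x)\<^sup>2)"
proof -
  have "ip H x x = cnj (ip H x x)" using assms ip_commute by blast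
  then have "Im (ip H x x) = 0" by (metis Reals_cnj_iff complex_is_Real_iff)
  then show ?thesis using assms by (simp add: complex_eq_iff hnorm_def ip_nonneg)
qed

lemma hnorm_sq: "x \<in> vecs H \<Longrightarrow> (hnorm H x)\<^sup>2 = Re (ip H x x)"
  by (simp add: hnorm_def ip_nonneg)

lemma hnorm_zero [simp]: "hnorm H 0 = 0"
  using zero_mem by (simp add: hnorm_def)

lemma hnorm_eq_0: "x \<in> vecs H \<Longrightarrow> hnorm H x = 0 \<longleftrightarrow> x = 0"
  using ip_definite ip_self by auto

lemma hnorm_add_sq:
  assumes "x \<in> vecs H" "y \<in> vecs H"
  shows "(hnorm H (x + y))\<^sup>2 = (hnorm H x)\<^sup>2 + (hnorm H y)\<^sup>2 + 2 * Re (ip H x y)"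
  using assms ip_commute[of x y] by (simp add: hnorm_sq add_mem ip_simps)

lemma hnorm_diff_sq:
  assumes "x \<in> vecs H" "y \<in> vecs H"
  shows "(hnorm H (x - y))\<^sup>2 = (hnorm H x)\<^sup>2 + (hnorm H y)\<^sup>2 - 2 * Re (ip H x y)"
  using assms ip_commute[of x y] by (simp add: hnorm_sq diff_mem ip_simps)

lemma hnorm_scaleC: assumes "x \<in> vecs H" shows "hnorm H (c *\<^sub>C x) = cmod c * hnorm H x"
proof -
  have "(hnorm H (c *\<^sub>C x))\<^sup>2 = Re (c * cnj c * ip H x x)"
    using assms by (simp add: hnorm_sq mem ip_simps mult_ac)
  also have "\<dots> = (cmod c * hnorm H x)\<^sup>2"
    by (simp only: ip_self[OF assms] complex_norm_square[symmetric] of_real_mult[symmetric] Re_complex_of_real power_mult_distrib)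
  finally show ?thesis using assms by (simp add: mem)
qed

lemma hnorm_minus: "x \<in> vecs H \<Longrightarrow> hnorm H (- x) = hnorm H x"
  using hnorm_scaleC[of x "- 1"] by (simp add: scaleC_minus1)

lemma hnorm_commute: "\<lbrakk>x \<in> vecs H; y \<in> vecs H\<rbrakk> \<Longrightarrow> hnorm H (x - y) = hnorm H (y - x)"
  using hnorm_minus[of "x - y"] by (simp add: mem)

lemma cauchy_schwarz:
  assumes [simp]: "x \<in> vecs H" "y \<in> vecs H"
  shows "cmod (ip H x y) \<le> hnorm H x * hnorm H y"
proof (cases "y = 0")
  case False
  define a N where "a = ip H x y" and "N = (hnorm H y)\<^sup>2"
  have N: "N > 0" using False hnorm_eq_0[of y] by (simp add: N_def)
  \<comment> \<open>The coefficient of the orthogonal projection of \<open>x\<close> on the line of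
    \<open>y\<close>: it minimizes the distance from \<open>x\<close> to the multiples of
    \<open>y\<close>.\<close>
  define c where "c = a / of_real N"
  have cn: "cmod c = cmod a / N" using N by (simp add: c_def norm_divide)
  have "Re (cnj c * a) = Re (a * cnj a / of_real N)" by (simp add: c_def mult.commute)
  also have "\<dots> = (cmod a)\<^sup>2 / N"
    by (simp only: complex_norm_square[symmetric] of_real_divide[symmetric] Re_complex_of_real)
  finally have r: "Re (cnj c * a) = (cmod a)\<^sup>2 / N" .
  have "0 \<le> (hnorm H (x - c *\<^sub>C y))\<^sup>2" by simp
  also have "\<dots> = (hnorm H x)\<^sup>2 + (cmod c)\<^sup>2 * N - 2 * Re (cnj c * a)"
    by (simp add: hnorm_diff_sq mem hnorm_scaleC power_mult_distrib N_def ip_simps a_def)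
  also have "\<dots> = (hnorm H x)\<^sup>2 - (cmod a)\<^sup>2 / N"
    using N by (simp only: cn r) (simp add: power_divide power2_eq_square)
  finally have "(cmod a)\<^sup>2 \<le> (hnorm H x * hnorm H y)\<^sup>2"
    using N by (simp add: field_simps N_def power_mult_distrib)
  then show ?thesis unfolding a_def by (rule power2_le_imp_le) simp
qed simp

lemma hnorm_triangle:
  assumes [simp]: "x \<in> vecs H" "y \<in> vecs H"
  shows "hnorm H (x + y) \<le> hnorm H x + hnorm H y"
proof (rule power2_le_imp_le)
  have "Re (ip H x y) \<le> hnorm H x * hnorm H y"
    using cauchy_schwarz[OF assms] complex_Re_le_cmod[of "ip H x y"] by linarith
  then show "(hnorm H (x + y))\<^sup>2 \<le> (hnorm H x + hnorm H y)\<^sup>2"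
    by (simp add: hnorm_add_sq power2_sum)
qed simp

lemma hnorm_triangle_diff:
  assumes "x \<in> vecs H" "y \<in> vecs H" "z \<in> vecs H"
  shows "hnorm H (x - z) \<le> hnorm H (x - y) + hnorm H (y - z)"
  using hnorm_triangle[of "x - y" "y - z"] assms by (simp add: mem)

lemma parallelogram:
  assumes "x \<in> vecs H" "y \<in> vecs H"
  shows "(hnorm H (x + y))\<^sup>2 + (hnorm H (x - y))\<^sup>2 = 2 * (hnorm H x)\<^sup>2 + 2 * (hnorm H y)\<^sup>2"
  using assms by (simp add: hnorm_add_sq hnorm_diff_sq)

lemma vec_eqI:
  assumes "x \<in> vecs H" "y \<in> vecs H" "\<And>k. k \<in> vecs H \<Longrightarrow> ip H x k = ip H y k"
  shows "x = y"
  using ip_definite[of "x - y"] assms by (simp add: ip_diff_left mem)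

lemma tendsto_ip:
  assumes "\<And>n. s n \<in> vecs H" "x \<in> vecs H" "y \<in> vecs H" "((\<lambda>n. hnorm H (s n - x)) \<longlongrightarrow> 0) F"
  shows "((\<lambda>n. ip H (s n) y) \<longlongrightarrow> ip H x y) F"
proof -
  have "((\<lambda>n. ip H (s n) y - ip H x y) \<longlongrightarrow> 0) F"
  proof (rule Lim_null_comparison)
    show "\<forall>\<^sub>F n in F. norm (ip H (s n) y - ip H x y) \<le> hnorm H (s n - x) * hnorm H y"
      using cauchy_schwarz[of "s _ - x" y] assms(1-3) by (auto simp: ip_simps mem)
    show "((\<lambda>n. hnorm H (s n - x) * hnorm H y) \<longlongrightarrow> 0) F"
      using tendsto_mult_left_zero[OF assms(4)] by simp
  qed
  then show ?thesis by (simp add: LIM_zero_iff)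
qed

section \<open>Orthogonal projections and the Riesz representation\<close>

lemma closed_sub_perp: assumes "C \<subseteq> vecs H" shows "closed_sub H (perp H C)"
  unfolding closed_sub_def
proof (intro conjI)
  have CV: "c \<in> vecs H" if "c \<in> C" for c using that assms by blast
  show "perp H C \<subseteq> vecs H" by (auto simp: perp_def)
  show "0 \<in> perp H C" using CV by (simp add: perp_def zero_mem)
  show "\<forall>x\<in>perp H C. \<forall>y\<in>perp H C. x + y \<in> perp H C"
    using CV by (simp add: perp_def add_mem ip_add)
  show "\<forall>x\<in>perp H C. \<forall>c. c *\<^sub>C x \<in> perp H C"
    using CV by (simp add: perp_def scaleC_mem ip_scaleC)
  show "\<forall>s x. (\<forall>n. s n \<in> perp H C) \<longrightarrow> x \<in> vecs H \<longrightarrow> (\<lambda>n. hnorm H (s n - x)) \<longlonglongrightarrow> 0 \<longrightarrow> x \<in> perp H C"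
  proof (intro allI impI)
    fix s x assume s: "\<forall>n::nat. s n \<in> perp H C" and x: "x \<in> vecs H"
      and l: "(\<lambda>n. hnorm H (s n - x)) \<longlonglongrightarrow> 0"
    have "ip H x c = 0" if "c \<in> C" for c
    proof -
      have "(\<lambda>n. ip H (s n) c) \<longlonglongrightarrow> ip H x c"
        using s x l CV[OF that] by (intro tendsto_ip) (auto simp: perp_def)
      moreover have "(\<lambda>n. ip H (s n) c) = (\<lambda>n. 0)" using s that by (auto simp: perp_def)
      ultimately show ?thesis by (simp add: LIMSEQ_const_iff)
    qed
    then show "x \<in> perp H C" using x by (simp add: perp_def)
  qed
qed

text \<open>A minimizing sequence for the distance from \<open>x\<close> is Cauchy by the
  parallelogram law. Its limit stays in \<open>S\<close>, and minimality against small multiples of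
  any \<open>y\<close> in \<open>S\<close> forces orthogonality.\<close>

theorem projection:
  assumes S: "closed_sub H S" and x [simp]: "x \<in> vecs H"
  shows "\<exists>p\<in>S. x - p \<in> perp H S"
proof -
  have SV: "\<And>y. y \<in> S \<Longrightarrow> y \<in> vecs H" and S0: "0 \<in> S"
    and Sadd: "\<And>x y. \<lbrakk>x \<in> S; y \<in> S\<rbrakk> \<Longrightarrow> x + y \<in> S" and Sscale: "\<And>x c. x \<in> S \<Longrightarrow> c *\<^sub>C x \<in> S"
    using S by (auto simp: closed_sub_def)
  have Slim: "\<And>s x. \<lbrakk>\<And>n::nat. s n \<in> S; x \<in> vecs H; (\<lambda>n. hnorm H (s n - x)) \<longlonglongrightarrow> 0\<rbrakk> \<Longrightarrow> x \<in> S"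
    using S unfolding closed_sub_def by meson
  define D where "D = (\<lambda>y. (hnorm H (x - y))\<^sup>2) ` S"
  define d where "d = Inf D"
  have bdd: "bdd_below D" by (auto simp: D_def intro!: bdd_belowI[of _ 0])
  have d_le: "d \<le> (hnorm H (x - y))\<^sup>2" if "y \<in> S" for y
    unfolding d_def by (rule cInf_lower[OF _ bdd]) (use that in \<open>auto simp: D_def\<close>)
  have "\<exists>y\<in>S. (hnorm H (x - y))\<^sup>2 < d + 1 / real (Suc n)" for n
    using cInf_lessD[of D "d + 1 / real (Suc n)"] S0 by (auto simp: D_def d_def)
  then obtain s where s: "\<And>n. s n \<in> S" "\<And>n. (hnorm H (x - s n))\<^sup>2 < d + 1 / real (Suc n)" by metis
  have sV [simp]: "s n \<in> vecs H" for n using s SV by blast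
  have cau: "(hnorm H (s m - s n))\<^sup>2 \<le> 2 / real (Suc m) + 2 / real (Suc n)" for m n
  proof -
    \<comment> \<open>The midpoint of two members of the sequence is again in \<open>S\<close>, so
      its squared distance from \<open>x\<close> is at least the infimum \<open>d\<close>.\<close>
    have "d \<le> (hnorm H (x - (1/2) *\<^sub>C (s m + s n)))\<^sup>2" by (intro d_le Sscale Sadd s)
    also have "x - (1/2) *\<^sub>C (s m + s n) = (1/2) *\<^sub>C ((x - s m) + (x - s n))"
    proof -
      have "x = (1/2) *\<^sub>C (x + x)" by (simp add: scaleC_add_right scaleC_add_left[symmetric] scaleC_one)
      then have "x - (1/2) *\<^sub>C (s m + s n) = (1/2) *\<^sub>C (x + x) - (1/2) *\<^sub>C (s m + s n)" by simp
      also have "\<dots> = (1/2) *\<^sub>C ((x - s m) + (x - s n))" by (simp add: scaleC_diff_right[symmetric] algebra_simps)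
      finally show ?thesis .
    qed
    also have "(hnorm H \<dots>)\<^sup>2 = (hnorm H ((x - s m) + (x - s n)))\<^sup>2 / 4"
      by (simp add: hnorm_scaleC mem power_mult_distrib norm_divide power_divide)
    finally have "4 * d \<le> (hnorm H ((x - s m) + (x - s n)))\<^sup>2" by simp
    moreover have "(hnorm H ((x - s m) + (x - s n)))\<^sup>2 + (hnorm H ((x - s m) - (x - s n)))\<^sup>2
        = 2 * (hnorm H (x - s m))\<^sup>2 + 2 * (hnorm H (x - s n))\<^sup>2"
      by (intro parallelogram) (auto simp: mem)
    moreover have "(hnorm H ((x - s m) - (x - s n))) = hnorm H (s m - s n)"
      using hnorm_commute[of "s n" "s m"] by simp
    ultimately have "(hnorm H (s m - s n))\<^sup>2 \<le> 2 * (hnorm H (x - s m))\<^sup>2 + 2 * (hnorm H (x - s n))\<^sup>2 - 4 * d" by simp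
    then show ?thesis using s(2)[of m] s(2)[of n] by (simp only: divide_inverse)
  qed
  have "\<exists>N. \<forall>m\<ge>N. \<forall>n\<ge>N. hnorm H (s m - s n) < e" if "e > 0" for e
  proof -
    obtain N where N: "4 / e\<^sup>2 < real N" using reals_Archimedean2 by blast
    have "hnorm H (s m - s n) < e" if "m \<ge> N" "n \<ge> N" for m n
    proof -
      have "0 < 4 / e\<^sup>2" using \<open>e > 0\<close> by simp
      then have Npos: "real N > 0" using N by linarith
      have "2 / real (Suc m) \<le> 2 / real N" "2 / real (Suc n) \<le> 2 / real N"
        using that Npos by (auto simp: frac_le)
      moreover have "2 / real N + 2 / real N < e\<^sup>2" using N Npos \<open>e > 0\<close> by (simp add: field_simps)
      ultimately have "(hnorm H (s m - s n))\<^sup>2 < e\<^sup>2" using cau[of m n] by linarith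
      then show ?thesis using \<open>e > 0\<close> power2_less_imp_less by fastforce
    qed
    then show ?thesis by blast
  qed
  then obtain p where p [simp]: "p \<in> vecs H" and lim: "(\<lambda>n. hnorm H (s n - p)) \<longlonglongrightarrow> 0"
    using complete[of s] by auto
  have pS: "p \<in> S" using Slim[OF s(1) p lim] .
  have min: "(hnorm H (x - p))\<^sup>2 \<le> (hnorm H (x - y))\<^sup>2" if "y \<in> S" for y
  proof -
    have "(\<lambda>n. sqrt (d + 1 / real (Suc n)) + hnorm H (s n - p)) \<longlonglongrightarrow> sqrt (d + 0) + 0"
      by (intro tendsto_intros lim LIMSEQ_Suc[OF lim_1_over_n])
    moreover have "hnorm H (x - p) \<le> sqrt (d + 1 / real (Suc n)) + hnorm H (s n - p)" for n
    proof -
      have "hnorm H (x - s n) \<le> sqrt (d + 1 / real (Suc n))" using s(2)[of n] by (intro real_le_rsqrt) auto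
      then show ?thesis using hnorm_triangle_diff[of x "s n" p] by simp
    qed
    ultimately have "hnorm H (x - p) \<le> sqrt d" using LIMSEQ_le_const by fastforce
    then have "(hnorm H (x - p))\<^sup>2 \<le> (sqrt d)\<^sup>2" by (intro power_mono) (auto simp: mem)
    moreover have "d \<ge> 0" unfolding d_def D_def using S0 by (intro cInf_greatest) auto
    ultimately show ?thesis using d_le[OF that] by simp
  qed
  have "ip H (x - p) y = 0" if y: "y \<in> S" for y
  proof -
    note [simp] = SV[OF y]
    define a where "a = ip H (x - p) y"
    define N where "N = (hnorm H y)\<^sup>2"
    \<comment> \<open>Dividing by \<open>N + 1\<close> instead of \<open>N\<close> keeps
      \<open>t * N \<le> 1\<close> and also covers \<open>y = 0\<close>.\<close>
    define t where "t = 1 / (N + 1)"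
    have N: "N \<ge> 0" by (simp add: N_def)
    define c where "c = of_real t * a"
    have "(hnorm H (x - p))\<^sup>2 \<le> (hnorm H (x - (p + c *\<^sub>C y)))\<^sup>2"
      by (intro min Sadd pS Sscale y)
    also have "x - (p + c *\<^sub>C y) = (x - p) - c *\<^sub>C y" by simp
    also have "(hnorm H \<dots>)\<^sup>2 = (hnorm H (x - p))\<^sup>2 + (cmod c)\<^sup>2 * N - 2 * Re (cnj c * a)"
      using hnorm_diff_sq[of "x - p" "c *\<^sub>C y"]
      by (simp add: mem hnorm_scaleC power_mult_distrib N_def ip_scaleC_right a_def)
    finally have le: "2 * Re (cnj c * a) \<le> (cmod c)\<^sup>2 * N" by simp
    have "cnj c * a = of_real t * of_real ((cmod a)\<^sup>2)"
      unfolding c_def complex_norm_square by simp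
    then have r: "Re (cnj c * a) = t * (cmod a)\<^sup>2" by (metis Re_complex_of_real of_real_mult)
    have cc: "(cmod c)\<^sup>2 = t\<^sup>2 * (cmod a)\<^sup>2" by (simp add: c_def norm_mult power_mult_distrib)
    have t: "t > 0" "t * N \<le> 1" using N by (auto simp: t_def)
    have "2 * (t * (cmod a)\<^sup>2) \<le> t * (cmod a)\<^sup>2 * (t * N)" using le r cc by (simp add: power2_eq_square mult_ac)
    also have "\<dots> \<le> t * (cmod a)\<^sup>2 * 1" using t by (intro mult_left_mono) auto
    finally have "t * (cmod a)\<^sup>2 \<le> 0" by simp
    then have "a = 0" using t by (simp add: mult_le_0_iff)
    then show ?thesis by (simp add: a_def)
  qed
  then have "x - p \<in> perp H S" using x p by (auto simp: perp_def intro: diff_mem)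
  then show ?thesis using pS by blast
qed

text \<open>The bound makes the kernel closed. A vector \<open>z\<close> orthogonal to the kernel
  represents \<open>f\<close> up to a scalar, because the combination of \<open>x\<close> and
  \<open>z\<close> with coefficients \<open>f z\<close> and \<open>- f x\<close> always lies in the
  kernel.\<close>

lemma riesz:
  assumes add: "\<And>x y. \<lbrakk>x \<in> vecs H; y \<in> vecs H\<rbrakk> \<Longrightarrow> f (x + y) = f x + f y"
    and scale: "\<And>x c. x \<in> vecs H \<Longrightarrow> f (c *\<^sub>C x) = c * f x"
    and bound: "\<And>x. x \<in> vecs H \<Longrightarrow> cmod (f x) \<le> C * hnorm H x"
  shows "\<exists>w\<in>vecs H. \<forall>x\<in>vecs H. f x = ip H x w"
proof -
  have f0: "f 0 = 0" using scale[OF zero_mem, of 0] by simp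
  have diff: "f (x - y) = f x - f y" if "x \<in> vecs H" "y \<in> vecs H" for x y
    using add[of x "(-1) *\<^sub>C y"] scale[of y "-1"] that by (simp add: scaleC_minus1 mem)
  define S where "S = {x\<in>vecs H. f x = 0}"
  have "closed_sub H S"
    unfolding closed_sub_def
  proof (intro conjI)
    show "S \<subseteq> vecs H" "0 \<in> S" by (auto simp: S_def zero_mem f0)
    show "\<forall>x\<in>S. \<forall>y\<in>S. x + y \<in> S" by (simp add: S_def add_mem add)
    show "\<forall>x\<in>S. \<forall>c. c *\<^sub>C x \<in> S" by (simp add: S_def scaleC_mem scale)
    show "\<forall>s x. (\<forall>n. s n \<in> S) \<longrightarrow> x \<in> vecs H \<longrightarrow> (\<lambda>n. hnorm H (s n - x)) \<longlonglongrightarrow> 0 \<longrightarrow> x \<in> S"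
    proof (intro allI impI)
      fix s x assume s: "\<forall>n::nat. s n \<in> S" and x: "x \<in> vecs H" and l: "(\<lambda>n. hnorm H (s n - x)) \<longlonglongrightarrow> 0"
      have sv: "s n \<in> vecs H" "f (s n) = 0" for n using s by (auto simp: S_def)
      have "cmod (f x) \<le> C * hnorm H (s n - x)" for n
        using bound[of "s n - x"] diff[of "s n" x] x sv by (simp add: diff_mem)
      moreover have "(\<lambda>n. C * hnorm H (s n - x)) \<longlonglongrightarrow> 0" using tendsto_mult_right_zero[OF l] .
      ultimately have "cmod (f x) \<le> 0" by (intro LIMSEQ_le_const) auto
      then show "x \<in> S" using x by (simp add: S_def)
    qed
  qed
  show ?thesis
  proof (cases "S = vecs H")
    case True
    then show ?thesis using f0 zero_mem by (intro bexI[of _ 0]) (auto simp: S_def)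
  next
    case False
    then obtain x0 where x0: "x0 \<in> vecs H" "x0 \<notin> S" by (auto simp: S_def)
    obtain p where p: "p \<in> S" "x0 - p \<in> perp H S" using projection[OF \<open>closed_sub H S\<close> x0(1)] by blast
    define z where "z = x0 - p"
    have pv: "p \<in> vecs H" and fp: "f p = 0" using p by (auto simp: S_def)
    have z: "z \<in> vecs H" using x0 pv by (simp add: z_def mem)
    have fz: "f z \<noteq> 0" using x0 fp unfolding z_def diff[OF x0(1) pv] S_def by simp
    then have z0: "z \<noteq> 0" using f0 by metis
    have nz: "ip H z z \<noteq> 0" using ip_definite z z0 by blast
    define w where "w = cnj (f z / ip H z z) *\<^sub>C z"
    have "f x = ip H x w" if x: "x \<in> vecs H" for x
    proof -
      have m: "f z *\<^sub>C x \<in> vecs H" "f x *\<^sub>C z \<in> vecs H" using x z by (auto intro: scaleC_mem)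
      have "f z *\<^sub>C x - f x *\<^sub>C z \<in> S" unfolding S_def using m x z by (simp add: diff_mem diff scale)
      then have "ip H z (f z *\<^sub>C x - f x *\<^sub>C z) = 0" using p by (auto simp: perp_def z_def)
      then have "ip H (f z *\<^sub>C x - f x *\<^sub>C z) z = 0"
        using ip_commute[OF z diff_mem[OF m]] by simp
      then have "f z * ip H x z = f x * ip H z z"
        using m x z by (simp add: ip_diff_left ip_scaleC)
      then have "f x = f z / ip H z z * ip H x z" using nz by (simp add: field_simps)
      then show ?thesis unfolding w_def using x z by (simp add: ip_scaleC_right)
    qed
    moreover have "w \<in> vecs H" unfolding w_def using z by (rule scaleC_mem)
    ultimately show ?thesis by blast
  qed
qed

text \<open>Each diagonal value expands into four terms. After multiplication by the p-th power of
  \<i> and summation, three of them carry sums of nontrivial roots of unity and cancel; the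
  coefficient of \<open>B h k\<close> is a number of modulus one times its conjugate, hence
  1.\<close>

lemma polarization:
  assumes addl: "\<And>x y z. \<lbrakk>x \<in> vecs H; y \<in> vecs H; z \<in> vecs H\<rbrakk> \<Longrightarrow> B (x + y) z = B x z + B y z"
    and addr: "\<And>x y z. \<lbrakk>x \<in> vecs H; y \<in> vecs H; z \<in> vecs H\<rbrakk> \<Longrightarrow> B z (x + y) = B z x + B z y"
    and scl: "\<And>x y c. \<lbrakk>x \<in> vecs H; y \<in> vecs H\<rbrakk> \<Longrightarrow> B (c *\<^sub>C x) y = c * B x y"
    and scr: "\<And>x y c. \<lbrakk>x \<in> vecs H; y \<in> vecs H\<rbrakk> \<Longrightarrow> B x (c *\<^sub>C y) = cnj c * B x y"
    and hk: "h \<in> vecs H" "k \<in> vecs H"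
  shows "(\<Sum>p<4. \<i> ^ p * B (pol p h k) (pol p h k)) = B h k"
proof -
  have "B (pol p h k) (pol p h k) = (1/4) * (B h h + cnj (\<i> ^ p) * B h k + \<i> ^ p * B k h + \<i> ^ p * cnj (\<i> ^ p) * B k k)" for p
    using hk by (simp add: pol_def addl addr scl scr mem distrib_left mult_ac)
  then show ?thesis
    by (simp add: sum_lessThan_4 power3_eq_cube algebra_simps)
qed

text \<open>Turns a bound by c times the squared norm for each of the four diagonal measures into
  the quadratic hypothesis of \<open>sesquilinear_bound\<close>.\<close>

lemma pol_norm_sum:
  assumes "h \<in> vecs H" "k \<in> vecs H"
  shows "(\<Sum>p<4. (hnorm H (pol p h k))\<^sup>2) = (hnorm H h)\<^sup>2 + (hnorm H k)\<^sup>2"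
proof -
  have "complex_of_real (\<Sum>p<4. (hnorm H (pol p h k))\<^sup>2) = (\<Sum>p<4. ip H (pol p h k) (pol p h k))"
    using assms by (simp add: ip_self mem)
  also have "\<dots> = ip H h h + ip H k k"
    using assms
    by (simp add: sum_lessThan_4 pol_def ip_simps mem power3_eq_cube algebra_simps)
  also have "\<dots> = complex_of_real ((hnorm H h)\<^sup>2 + (hnorm H k)\<^sup>2)"
    using assms by (simp add: ip_self)
  finally show ?thesis by (simp only: of_real_eq_iff)
qed

subsection \<open>Orthonormal bases\<close>

text \<open>Pythagoras. Bessel's inequality and the contractivity and monotonicity in
  \<open>F\<close> of the remainder are all read off from it.\<close>

lemma orthonormal_sum_sq:
  assumes E: "orthonormal H F" "finite F" and x: "x \<in> vecs H"
  shows "(hnorm H (x - (\<Sum>e\<in>F. ip H x e *\<^sub>C e)))\<^sup>2 = (hnorm H x)\<^sup>2 - (\<Sum>e\<in>F. (cmod (ip H x e))\<^sup>2)"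
proof -
  have FV: "\<And>e. e \<in> F \<Longrightarrow> e \<in> vecs H" using E by (auto simp: orthonormal_def)
  define q where "q = (\<Sum>e\<in>F. ip H x e *\<^sub>C e)"
  have q: "q \<in> vecs H" unfolding q_def using FV by (intro mem) auto
  have xq: "ip H x q = (\<Sum>e\<in>F. of_real ((cmod (ip H x e))\<^sup>2))"
    unfolding q_def complex_norm_square using FV x by (simp add: ip_sum_right mem ip_scaleC_right mult.commute)
  have eq: "ip H e q = cnj (ip H x e)" if "e \<in> F" for e
  proof -
    have "ip H e q = (\<Sum>e'\<in>F. cnj (ip H x e') * ip H e e')"
      unfolding q_def using that FV by (simp add: ip_sum_right mem ip_scaleC_right)
    also have "\<dots> = (\<Sum>e'\<in>F. if e = e' then cnj (ip H x e') else 0)"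
      using E that by (intro sum.cong) (auto simp: orthonormal_def)
    finally show ?thesis using E that by simp
  qed
  have "ip H q q = (\<Sum>e\<in>F. ip H x e * ip H e q)"
    using FV q by (subst q_def) (simp add: ip_sum_left mem ip_scaleC)
  also have "\<dots> = (\<Sum>e\<in>F. of_real ((cmod (ip H x e))\<^sup>2))"
    unfolding complex_norm_square using eq by simp
  finally have qq: "ip H q q = (\<Sum>e\<in>F. of_real ((cmod (ip H x e))\<^sup>2))" .
  have "(hnorm H (x - q))\<^sup>2 = (hnorm H x)\<^sup>2 + (hnorm H q)\<^sup>2 - 2 * Re (ip H x q)"
    using hnorm_diff_sq[OF x q] .
  then show ?thesis unfolding q_def[symmetric] using q by (simp add: hnorm_sq[of q] xq qq)
qed

lemma bessel:
  assumes "orthonormal H F" "finite F" "x \<in> vecs H"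
  shows "(\<Sum>e\<in>F. (cmod (ip H x e))\<^sup>2) \<le> (hnorm H x)\<^sup>2"
  using orthonormal_sum_sq[OF assms] zero_le_power2[of "hnorm H (x - (\<Sum>e\<in>F. ip H x e *\<^sub>C e))"] by linarith

lemma orthonormal_sum_le:
  assumes "orthonormal H F" "finite F" "x \<in> vecs H"
  shows "hnorm H (x - (\<Sum>e\<in>F. ip H x e *\<^sub>C e)) \<le> hnorm H x"
proof (rule power2_le_imp_le)
  show "(hnorm H (x - (\<Sum>e\<in>F. ip H x e *\<^sub>C e)))\<^sup>2 \<le> (hnorm H x)\<^sup>2"
    using orthonormal_sum_sq[OF assms] sum_nonneg[of F "\<lambda>e. (cmod (ip H x e))\<^sup>2"] by simp
qed (use assms in simp)

lemma orthonormal_subset: "\<lbrakk>orthonormal H E; F \<subseteq> E\<rbrakk> \<Longrightarrow> orthonormal H F"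
  by (simp add: orthonormal_def subset_iff)

lemma orthonormal_sum_antimono:
  assumes "orthonormal H F'" "finite F'" "F \<subseteq> F'" "x \<in> vecs H"
  shows "hnorm H (x - (\<Sum>e\<in>F'. ip H x e *\<^sub>C e)) \<le> hnorm H (x - (\<Sum>e\<in>F. ip H x e *\<^sub>C e))"
proof (rule power2_le_imp_le)
  have F: "orthonormal H F" "finite F" using assms orthonormal_subset finite_subset by auto
  have "(\<Sum>e\<in>F. (cmod (ip H x e))\<^sup>2) \<le> (\<Sum>e\<in>F'. (cmod (ip H x e))\<^sup>2)"
    using assms by (intro sum_mono2) auto
  then show "(hnorm H (x - (\<Sum>e\<in>F'. ip H x e *\<^sub>C e)))\<^sup>2 \<le> (hnorm H (x - (\<Sum>e\<in>F. ip H x e *\<^sub>C e)))\<^sup>2"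
    using orthonormal_sum_sq F assms by simp
  show "0 \<le> hnorm H (x - (\<Sum>e\<in>F. ip H x e *\<^sub>C e))"
    using F assms by (intro hnorm_nonneg mem) (auto simp: orthonormal_def)
qed

text \<open>Zorn's lemma gives a maximal orthonormal set; a nonzero vector orthogonal to it could be
  normalized and added.\<close>

lemma ex_onb: "\<exists>E. onb H E"
proof -
  have "\<exists>M\<in>{E. orthonormal H E}. \<forall>X\<in>{E. orthonormal H E}. M \<subseteq> X \<longrightarrow> X = M"
  proof (rule subset_Zorn')
    fix C assume C: "subset.chain {E. orthonormal H E} C"
    then have sub: "C \<subseteq> {E. orthonormal H E}" and ch: "\<And>X Y. \<lbrakk>X \<in> C; Y \<in> C\<rbrakk> \<Longrightarrow> X \<subseteq> Y \<or> Y \<subseteq> X"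
      by (auto simp: subset.chain_def)
    show "\<Union>C \<in> {E. orthonormal H E}"
      unfolding orthonormal_def mem_Collect_eq
    proof (intro conjI ballI)
      show "\<Union> C \<subseteq> vecs H" using sub by (auto simp: orthonormal_def)
      fix e e' assume "e \<in> \<Union>C" "e' \<in> \<Union>C"
      then obtain X Y where X: "X \<in> C" "e \<in> X" "Y \<in> C" "e' \<in> Y" by blast
      then have "\<exists>Z\<in>C. e \<in> Z \<and> e' \<in> Z" using ch[of X Y] by blast
      then show "ip H e e' = (if e = e' then 1 else 0)" using sub by (auto simp: orthonormal_def)
    qed
  qed
  then obtain E where E: "orthonormal H E" and max: "\<And>X. \<lbrakk>orthonormal H X; E \<subseteq> X\<rbrakk> \<Longrightarrow> X = E" by blast
  have "x = 0" if x: "x \<in> vecs H" and perp: "\<And>e. e \<in> E \<Longrightarrow> ip H x e = 0" for x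
  proof (rule ccontr)
    assume "x \<noteq> 0"
    then have n: "hnorm H x > 0" using hnorm_eq_0[OF x] hnorm_nonneg[OF x] by simp
    define y where "y = complex_of_real (1 / hnorm H x) *\<^sub>C x"
    have y: "y \<in> vecs H" using x by (simp add: y_def mem)
    have "hnorm H y = 1" using n x by (simp add: y_def hnorm_scaleC norm_divide)
    then have yy: "ip H y y = 1" using ip_self[OF y] by simp
    have ye: "ip H y e = 0 \<and> ip H e y = 0" if "e \<in> E" for e
    proof -
      have e: "e \<in> vecs H" using E that by (auto simp: orthonormal_def)
      have "ip H y e = 0" using perp[OF that] x e by (simp add: y_def ip_scaleC)
      then show ?thesis using ip_commute[OF y e] by simp
    qed
    have "orthonormal H (insert y E)"
      using E y yy ye by (auto simp: orthonormal_def)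
    then have "y \<in> E" using max[of "insert y E"] by blast
    then show False using yy ye by force
  qed
  then show ?thesis using E by (auto simp: onb_def)
qed

text \<open>The vectors that can be approximated form a closed subspace \<open>S\<close> containing
  \<open>E\<close>. The component of \<open>x\<close> orthogonal to \<open>S\<close> is orthogonal
  to \<open>E\<close>, hence zero by the defining property of \<open>onb\<close>.\<close>

lemma onb_approx:
  assumes E: "onb H E" and x: "x \<in> vecs H" and e: "\<epsilon> > 0"
  shows "\<exists>F\<subseteq>E. finite F \<and> hnorm H (x - (\<Sum>e\<in>F. ip H x e *\<^sub>C e)) < \<epsilon>"
proof -
  have oE: "orthonormal H E" and EV: "\<And>e. e \<in> E \<Longrightarrow> e \<in> vecs H" using E by (auto simp: onb_def orthonormal_def)
  define r where "r F x = x - (\<Sum>e\<in>F. ip H x e *\<^sub>C e)" for F x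
  have rV: "r F x \<in> vecs H" if "F \<subseteq> E" "x \<in> vecs H" for F x
    using that EV by (auto simp: r_def intro!: mem)
  have radd: "r F (x + y) = r F x + r F y" if "F \<subseteq> E" "x \<in> vecs H" "y \<in> vecs H" for F x y
  proof -
    have "(\<Sum>e\<in>F. ip H (x + y) e *\<^sub>C e) = (\<Sum>e\<in>F. ip H x e *\<^sub>C e) + (\<Sum>e\<in>F. ip H y e *\<^sub>C e)"
      using that EV by (simp add: sum.distrib[symmetric]) (intro sum.cong, auto simp: ip_add scaleC_add_left subset_iff)
    then show ?thesis by (simp add: r_def)
  qed
  have rscale: "r F (c *\<^sub>C x) = c *\<^sub>C r F x" if "F \<subseteq> E" "x \<in> vecs H" for F x c
  proof -
    have "(\<Sum>e\<in>F. ip H (c *\<^sub>C x) e *\<^sub>C e) = c *\<^sub>C (\<Sum>e\<in>F. ip H x e *\<^sub>C e)"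
      using that EV unfolding scaleC_sum_right by (intro sum.cong) (auto simp: ip_scaleC scaleC_scaleC subset_iff)
    then show ?thesis by (simp add: r_def scaleC_diff_right)
  qed
  have mono: "hnorm H (r F' x) \<le> hnorm H (r F x)" if "F \<subseteq> F'" "F' \<subseteq> E" "finite F'" "x \<in> vecs H" for F F' x
    unfolding r_def using that orthonormal_subset[OF oE] by (intro orthonormal_sum_antimono) auto
  have contr: "hnorm H (r F x) \<le> hnorm H x" if "F \<subseteq> E" "finite F" "x \<in> vecs H" for F x
    unfolding r_def using that orthonormal_subset[OF oE] by (intro orthonormal_sum_le) auto
  define S where "S = {x\<in>vecs H. \<forall>\<epsilon>>0. \<exists>F\<subseteq>E. finite F \<and> hnorm H (r F x) < \<epsilon>}"
  have "closed_sub H S"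
    unfolding closed_sub_def
  proof (intro conjI allI impI ballI)
    show "0 \<in> S" by (auto simp: S_def mem r_def intro!: exI[of _ "{}"])
  next
    fix x y assume xy: "x \<in> S" "y \<in> S"
    then have v: "x \<in> vecs H" "y \<in> vecs H" by (auto simp: S_def)
    have "\<exists>F\<subseteq>E. finite F \<and> hnorm H (r F (x + y)) < \<epsilon>" if "\<epsilon> > 0" for \<epsilon>
    proof -
      have "\<epsilon> / 2 > 0" using that by simp
      then obtain F1 F2 where F: "F1 \<subseteq> E" "finite F1" "hnorm H (r F1 x) < \<epsilon> / 2"
        "F2 \<subseteq> E" "finite F2" "hnorm H (r F2 y) < \<epsilon> / 2"
        using xy unfolding S_def by blast
      have "hnorm H (r (F1 \<union> F2) (x + y)) \<le> hnorm H (r (F1 \<union> F2) x) + hnorm H (r (F1 \<union> F2) y)"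
        using radd[of "F1 \<union> F2" x y] F v by (simp add: hnorm_triangle rV)
      also have "\<dots> \<le> hnorm H (r F1 x) + hnorm H (r F2 y)"
        using F v by (intro add_mono mono) auto
      finally show ?thesis using F by (intro exI[of _ "F1 \<union> F2"]) auto
    qed
    then show "x + y \<in> S" using v by (auto simp: S_def mem)
  next
    fix x c assume xy: "x \<in> S"
    then have v: "x \<in> vecs H" by (auto simp: S_def)
    have "\<exists>F\<subseteq>E. finite F \<and> hnorm H (r F (c *\<^sub>C x)) < \<epsilon>" if "\<epsilon> > 0" for \<epsilon>
    proof -
      \<comment> \<open>Dividing by \<open>cmod c + 1\<close> rather than by \<open>cmod c\<close>
        covers \<open>c = 0\<close>.\<close>
      have p: "cmod c + 1 > 0" using norm_ge_zero[of c] by linarith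
      then have "\<epsilon> / (cmod c + 1) > 0" using that by simp
      then obtain F where F: "F \<subseteq> E" "finite F" "hnorm H (r F x) < \<epsilon> / (cmod c + 1)"
        using xy unfolding S_def by blast
      have "hnorm H (r F (c *\<^sub>C x)) = cmod c * hnorm H (r F x)"
        using F v rscale by (simp add: hnorm_scaleC rV)
      also have "\<dots> \<le> (cmod c + 1) * hnorm H (r F x)"
        using F v rV by (intro mult_right_mono) auto
      also have "\<dots> < \<epsilon>" using F(3) p by (simp add: field_simps)
      finally show ?thesis using F by blast
    qed
    then show "c *\<^sub>C x \<in> S" using v by (auto simp: S_def mem)
  next
    fix s x assume s: "\<forall>n::nat. s n \<in> S" and x: "x \<in> vecs H" and l: "(\<lambda>n. hnorm H (s n - x)) \<longlonglongrightarrow> 0"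
    have sv: "s n \<in> vecs H" for n using s by (auto simp: S_def)
    have "\<exists>F\<subseteq>E. finite F \<and> hnorm H (r F x) < \<epsilon>" if "\<epsilon> > 0" for \<epsilon>
    proof -
      have h: "\<epsilon> / 2 > 0" using that by simp
      obtain n where n: "hnorm H (s n - x) < \<epsilon> / 2"
        using order_tendstoD(2)[OF l h] unfolding eventually_sequentially by blast
      obtain F where F: "F \<subseteq> E" "finite F" "hnorm H (r F (s n)) < \<epsilon> / 2"
        using s h unfolding S_def by blast
      have "x = (x - s n) + s n" by simp
      then have "hnorm H (r F x) = hnorm H (r F (x - s n) + r F (s n))"
        using radd[of F "x - s n" "s n"] F x sv by (simp add: mem)
      also have "\<dots> \<le> hnorm H (r F (x - s n)) + hnorm H (r F (s n))"
        using F x sv by (intro hnorm_triangle rV mem)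
      also have "\<dots> \<le> hnorm H (x - s n) + hnorm H (r F (s n))"
        using F x sv by (intro add_mono contr mem) auto
      also have "\<dots> < \<epsilon>" using n F hnorm_commute[OF x sv] by simp
      finally show ?thesis using F by blast
    qed
    then show "x \<in> S" using x by (auto simp: S_def)
  qed (auto simp: S_def)
  then obtain p where p: "p \<in> S" "x - p \<in> perp H S" using projection x by blast
  have "E \<subseteq> S"
  proof
    fix e assume e: "e \<in> E"
    then have "r {e} e = 0" using oE by (simp add: r_def orthonormal_def scaleC_one)
    then show "e \<in> S" using e EV by (auto simp: S_def intro!: exI[of _ "{e}"])
  qed
  then have "ip H (x - p) e = 0" if "e \<in> E" for e using p that by (auto simp: perp_def)
  moreover have "x - p \<in> vecs H" using p by (auto simp: perp_def)
  ultimately have "x - p = 0" using E by (auto simp: onb_def)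
  then have "x \<in> S" using p by simp
  then show ?thesis using e unfolding S_def r_def by blast
qed

text \<open>Enlarging a finite set furnished by \<open>onb_approx\<close> can only shrink the
  remainder. This is convergence along the finite subsets of \<open>E\<close>, so no enumeration of
  \<open>E\<close> enters.\<close>

lemma parseval:
  assumes E: "onb H E" and x: "x \<in> vecs H" and y: "y \<in> vecs H"
  shows "((\<lambda>e. ip H x e * ip H e y) has_sum ip H x y) E"
  unfolding has_sum_def
proof (rule tendstoI)
  fix \<epsilon> :: real assume "\<epsilon> > 0"
  have oE: "orthonormal H E" and EV: "\<And>e. e \<in> E \<Longrightarrow> e \<in> vecs H" using E by (auto simp: onb_def orthonormal_def)
  define \<delta> where "\<delta> = \<epsilon> / (hnorm H y + 1)"
  have \<delta>: "\<delta> > 0" using \<open>\<epsilon> > 0\<close> hnorm_nonneg[OF y] by (simp add: \<delta>_def)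
  obtain F where F: "F \<subseteq> E" "finite F" "hnorm H (x - (\<Sum>e\<in>F. ip H x e *\<^sub>C e)) < \<delta>"
    using onb_approx[OF E x \<delta>] by blast
  have "dist (\<Sum>e\<in>F'. ip H x e * ip H e y) (ip H x y) < \<epsilon>" if F': "finite F'" "F \<subseteq> F'" "F' \<subseteq> E" for F'
  proof -
    define q where "q = (\<Sum>e\<in>F'. ip H x e *\<^sub>C e)"
    have q: "q \<in> vecs H" using F' EV by (auto simp: q_def intro!: mem)
    have "hnorm H (x - q) \<le> hnorm H (x - (\<Sum>e\<in>F. ip H x e *\<^sub>C e))"
      unfolding q_def using F' orthonormal_subset[OF oE] x by (intro orthonormal_sum_antimono) auto
    then have *: "hnorm H (x - q) < \<delta>" using F by simp
    have "(\<Sum>e\<in>F'. ip H x e * ip H e y) = ip H q y"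
      unfolding q_def using F' EV y by (subst ip_sum_left) (auto intro!: sum.cong mem simp: ip_scaleC subset_iff)
    then have "dist (\<Sum>e\<in>F'. ip H x e * ip H e y) (ip H x y) = cmod (ip H (x - q) y)"
      using x q y by (simp add: dist_norm ip_diff_left norm_minus_commute)
    also have "\<dots> \<le> hnorm H (x - q) * hnorm H y" using x q y by (intro cauchy_schwarz mem)
    also have "\<dots> \<le> hnorm H (x - q) * (hnorm H y + 1)" using x q by (intro mult_left_mono) (auto simp: mem)
    also have "\<dots> < \<delta> * (hnorm H y + 1)"
      using * hnorm_nonneg[OF y] by (intro mult_strict_right_mono) linarith+
    also have "\<dots> = \<epsilon>" using hnorm_nonneg[OF y] by (simp add: \<delta>_def)
    finally show ?thesis .
  qed
  then show "\<forall>\<^sub>F F in finite_subsets_at_top E. dist (\<Sum>e\<in>F. ip H x e * ip H e y) (ip H x y) < \<epsilon>"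
    using F unfolding eventually_finite_subsets_at_top by blast
qed

text \<open>The Parseval family of \<open>x\<close> with itself is absolutely summable, and a
  summable family has countable support, however large \<open>E\<close> is.\<close>

lemma onb_support_countable:
  assumes E: "onb H E" and x: "x \<in> vecs H"
  shows "countable {e\<in>E. ip H x e \<noteq> 0}"
proof -
  have EV: "\<And>e. e \<in> E \<Longrightarrow> e \<in> vecs H" using E by (auto simp: onb_def orthonormal_def)
  have "(\<lambda>e. ip H x e * ip H e x) summable_on E" using parseval[OF E x x] has_sum_imp_summable by blast
  then have "(\<lambda>e. norm (ip H x e * ip H e x)) summable_on E"
    by (subst summable_on_iff_abs_summable_on_complex[symmetric])
  then have "countable {e\<in>E. ip H x e * ip H e x \<noteq> 0}" by (rule abs_summable_countable)
  moreover have "ip H e x \<noteq> 0 \<longleftrightarrow> ip H x e \<noteq> 0" if "e \<in> E" for e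
    using ip_commute[OF x EV[OF that]] by simp
  then have "{e\<in>E. ip H x e \<noteq> 0} = {e\<in>E. ip H x e * ip H e x \<noteq> 0}" by auto
  ultimately show ?thesis by simp
qed

text \<open>Only countably many basis vectors, collected in \<open>E0\<close>, meet
  \<open>C\<close>. The others lie in \<open>perp H C\<close>, so a vector of the closed span of
  \<open>C\<close> has no coefficients outside \<open>E0\<close>, and an enumeration of
  \<open>E0\<close> gives the sets \<open>F n\<close>. They depend on \<open>C\<close> alone, not on
  the vector. The constant 2 comes from the triangle inequality through the remainder
  \<open>v - q\<close>, whose norm is at most that of \<open>v\<close>.\<close>

lemma separable_approx:
  assumes C: "countable C" "C \<subseteq> vecs H"
  shows "\<exists>F::nat \<Rightarrow> 'h set. (\<forall>n. finite (F n) \<and> F n \<subseteq> vecs H) \<and>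
    (\<forall>v\<in>perp H (perp H C). \<forall>y\<in>vecs H. (\<lambda>n. \<Sum>e\<in>F n. ip H v e * ip H e y) \<longlonglongrightarrow> ip H v y) \<and>
    (\<forall>v\<in>vecs H. \<forall>y\<in>vecs H. \<forall>n. cmod (\<Sum>e\<in>F n. ip H v e * ip H e y) \<le> 2 * hnorm H v * hnorm H y)"
proof -
  obtain E where E: "onb H E" using ex_onb by blast
  have oE: "orthonormal H E" and EV: "\<And>e. e \<in> E \<Longrightarrow> e \<in> vecs H" using E by (auto simp: onb_def orthonormal_def)
  define E0 where "E0 = (\<Union>c\<in>C. {e\<in>E. ip H c e \<noteq> 0})"
  have cE0: "countable E0" unfolding E0_def using C onb_support_countable[OF E] by (intro countable_UN) auto
  define F where "F n = {e\<in>E0. to_nat_on E0 e < n}" for n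
  have fin: "finite (F n)" for n
  proof (rule inj_on_finite[of "to_nat_on E0" _ "{..<n}"])
    show "inj_on (to_nat_on E0) (F n)" using inj_on_to_nat_on[OF cE0] by (rule inj_on_subset) (auto simp: F_def)
  qed (auto simp: F_def)
  have FE: "F n \<subseteq> E" for n by (auto simp: F_def E0_def)
  have lim: "filterlim F (finite_subsets_at_top E0) sequentially"
    unfolding filterlim_finite_subsets_at_top
  proof (intro allI impI)
    fix X assume X: "finite X \<and> X \<subseteq> E0"
    have "\<forall>\<^sub>F n in sequentially. \<forall>e\<in>X. to_nat_on E0 e < n"
      using X eventually_gt_at_top by (auto simp: eventually_ball_finite_distrib)
    then show "\<forall>\<^sub>F n in sequentially. finite (F n) \<and> X \<subseteq> F n \<and> F n \<subseteq> E0"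
      by eventually_elim (use X fin in \<open>auto simp: F_def\<close>)
  qed
  have "(\<lambda>n. \<Sum>e\<in>F n. ip H v e * ip H e y) \<longlonglongrightarrow> ip H v y" if v: "v \<in> perp H (perp H C)" and y: "y \<in> vecs H" for v y
  proof -
    have vV: "v \<in> vecs H" using v by (simp add: perp_def)
    have "ip H v e = 0" if e: "e \<in> E - E0" for e
    proof -
      have "e \<in> perp H C"
        using e C EV ip_commute[of _ e] by (force simp: E0_def perp_def subset_iff)
      then show ?thesis using v by (auto simp: perp_def)
    qed
    then have "((\<lambda>e. ip H v e * ip H e y) has_sum ip H v y) E0"
      using parseval[OF E vV y] by (subst has_sum_cong_neutral[where T=E and g="\<lambda>e. ip H v e * ip H e y"]) (auto simp: E0_def)
    then show ?thesis unfolding has_sum_def using lim by (rule filterlim_compose)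
  qed
  moreover have "cmod (\<Sum>e\<in>F n. ip H v e * ip H e y) \<le> 2 * hnorm H v * hnorm H y" if v: "v \<in> vecs H" and y: "y \<in> vecs H" for v y n
  proof -
    define q where "q = (\<Sum>e\<in>F n. ip H v e *\<^sub>C e)"
    have q: "q \<in> vecs H" using FE EV by (auto simp: q_def intro!: mem)
    have "(\<Sum>e\<in>F n. ip H v e * ip H e y) = ip H q y"
      unfolding q_def using FE EV y by (subst ip_sum_left) (auto intro!: sum.cong mem simp: ip_scaleC subset_iff)
    moreover have "cmod (ip H q y) \<le> hnorm H q * hnorm H y" using q y by (rule cauchy_schwarz)
    moreover have "hnorm H q \<le> 2 * hnorm H v"
    proof -
      have "hnorm H q = hnorm H (v - (v - q))" by simp
      also have "\<dots> \<le> hnorm H v + hnorm H (v - q)"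
        using hnorm_triangle[of v "- (v - q)"] hnorm_minus[of "v - q"] v q by (simp add: mem)
      also have "hnorm H (v - q) \<le> hnorm H v"
        unfolding q_def using fin FE orthonormal_subset[OF oE] v by (intro orthonormal_sum_le) auto
      finally show ?thesis by simp
    qed
    then have "hnorm H q * hnorm H y \<le> 2 * hnorm H v * hnorm H y" using y by (intro mult_right_mono) auto
    ultimately show ?thesis by simp
  qed
  ultimately show ?thesis using fin FE EV by (intro exI[of _ F]) (auto simp: subset_iff)
qed

text \<open>The double complement plays the part of the closed linear span.\<close>

lemma mem_perp_perp: "\<lbrakk>C \<subseteq> vecs H; c \<in> C\<rbrakk> \<Longrightarrow> c \<in> perp H (perp H C)"
  using ip_commute[of _ c] by (force simp: perp_def subset_iff)

end

subsection \<open>Bounded operators\<close>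

lemma bounded_op_mem: "\<lbrakk>bounded_op H K T; x \<in> vecs H\<rbrakk> \<Longrightarrow> T x \<in> vecs K"
  and bounded_op_add: "\<lbrakk>bounded_op H K T; x \<in> vecs H; y \<in> vecs H\<rbrakk> \<Longrightarrow> T (x + y) = T x + T y"
  and bounded_op_scaleC: "\<lbrakk>bounded_op H K T; x \<in> vecs H\<rbrakk> \<Longrightarrow> T (c *\<^sub>C x) = c *\<^sub>C T x"
  by (auto simp: bounded_op_def)

lemma bounded_op_bound:
  assumes "bounded_op H K T" "hilbert_space H"
  shows "\<exists>C\<ge>0. \<forall>x\<in>vecs H. hnorm K (T x) \<le> C * hnorm H x"
proof -
  interpret hilbert_space H by fact
  obtain C where C: "\<forall>x\<in>vecs H. hnorm K (T x) \<le> C * hnorm H x" using assms by (auto simp: bounded_op_def)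
  have "hnorm K (T x) \<le> max C 0 * hnorm H x" if "x \<in> vecs H" for x
  proof -
    have "C * hnorm H x \<le> max C 0 * hnorm H x" using that by (intro mult_right_mono) auto
    then show ?thesis using C that by force
  qed
  then show ?thesis by (intro exI[of _ "max C 0"]) auto
qed

lemma bounded_op_comp:
  assumes "bounded_op H K S" "bounded_op K L T" "hilbert_space H" "hilbert_space K"
  shows "bounded_op H L (\<lambda>x. T (S x))"
proof -
  obtain C D where C: "C \<ge> 0" "\<forall>x\<in>vecs H. hnorm K (S x) \<le> C * hnorm H x"
    and D: "D \<ge> 0" "\<forall>x\<in>vecs K. hnorm L (T x) \<le> D * hnorm K x"
    using bounded_op_bound assms by meson
  have "hnorm L (T (S x)) \<le> (D * C) * hnorm H x" if "x \<in> vecs H" for x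
  proof -
    have "hnorm L (T (S x)) \<le> D * hnorm K (S x)" using D that assms bounded_op_mem by blast
    also have "\<dots> \<le> D * (C * hnorm H x)" using C D that by (intro mult_left_mono) auto
    finally show ?thesis by simp
  qed
  then show ?thesis using assms unfolding bounded_op_def by auto
qed

text \<open>Gives the value of the adjoint at a single vector; this is all that is used of adjoints,
  so the adjoint as an operator is never formed.\<close>

lemma bounded_op_adjoint:
  assumes T: "bounded_op H K T" and H: "hilbert_space H" and K: "hilbert_space K" and k: "k \<in> vecs K"
  shows "\<exists>w\<in>vecs H. \<forall>x\<in>vecs H. ip K (T x) k = ip H x w"
proof -
  interpret H: hilbert_space H by fact
  interpret K: hilbert_space K by fact
  obtain C where C: "C \<ge> 0" "\<forall>x\<in>vecs H. hnorm K (T x) \<le> C * hnorm H x" using bounded_op_bound[OF T H] by auto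
  show ?thesis
  proof (rule H.riesz)
    fix x assume x: "x \<in> vecs H"
    have "cmod (ip K (T x) k) \<le> hnorm K (T x) * hnorm K k"
      using bounded_op_mem[OF T x] k by (rule K.cauchy_schwarz)
    also have "\<dots> \<le> (C * hnorm H x) * hnorm K k" using C x k by (intro mult_right_mono) auto
    finally show "cmod (ip K (T x) k) \<le> (C * hnorm K k) * hnorm H x" by (simp add: mult_ac)
  next
    fix x y assume x: "x \<in> vecs H" "y \<in> vecs H"
    show "ip K (T (x + y)) k = ip K (T x) k + ip K (T y) k"
      unfolding bounded_op_add[OF T x] by (intro K.ip_add bounded_op_mem[OF T] x k)
  next
    fix x c assume x: "x \<in> vecs H"
    show "ip K (T (c *\<^sub>C x)) k = c * ip K (T x) k"
      unfolding bounded_op_scaleC[OF T x] by (intro K.ip_scaleC bounded_op_mem[OF T] x k)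
  qed
qed

text \<open>Both sides of the conclusion are homogeneous, so it suffices to consider unit vectors,
  where the quadratic bound has the value 2 C.\<close>

lemma sesquilinear_bound:
  assumes H: "hilbert_space H" and K: "hilbert_space K"
    and scl: "\<And>x y c. \<lbrakk>x \<in> vecs H; y \<in> vecs K\<rbrakk> \<Longrightarrow> B (c *\<^sub>C x) y = c * B x y"
    and scr: "\<And>x y c. \<lbrakk>x \<in> vecs H; y \<in> vecs K\<rbrakk> \<Longrightarrow> B x (c *\<^sub>C y) = cnj c * B x y"
    and bnd: "\<And>x y. \<lbrakk>x \<in> vecs H; y \<in> vecs K\<rbrakk> \<Longrightarrow> cmod (B x y) \<le> C * ((hnorm H x)\<^sup>2 + (hnorm K y)\<^sup>2)"
    and x: "x \<in> vecs H" and y: "y \<in> vecs K"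
  shows "cmod (B x y) \<le> 2 * C * hnorm H x * hnorm K y"
proof -
  interpret H: hilbert_space H by fact
  interpret K: hilbert_space K by fact
  have "x = 0 \<or> hnorm H x > 0"
    using H.hnorm_eq_0[OF x] H.hnorm_nonneg[OF x] order_le_imp_less_or_eq by metis
  moreover have "y = 0 \<or> hnorm K y > 0"
    using K.hnorm_eq_0[OF y] K.hnorm_nonneg[OF y] order_le_imp_less_or_eq by metis
  ultimately consider "x = 0" | "y = 0" | "hnorm H x > 0" "hnorm K y > 0" by blast
  then show ?thesis
  proof cases
    case 1 then show ?thesis using scl[OF x y, of 0] by simp
  next
    case 2 then show ?thesis using scr[OF x y, of 0] by simp
  next
    case 3
    define a b where "a = complex_of_real (hnorm H x)" and "b = complex_of_real (hnorm K y)"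
    have ab: "a \<noteq> 0" "b \<noteq> 0" "cnj b = b" using 3 by (auto simp: a_def b_def)
    have sc: "(1/a) *\<^sub>C x \<in> vecs H" "(1/b) *\<^sub>C y \<in> vecs K" using x y by (auto simp: H.mem K.mem)
    have n: "hnorm H ((1/a) *\<^sub>C x) = 1" "hnorm K ((1/b) *\<^sub>C y) = 1"
      using x y 3 by (auto simp: H.hnorm_scaleC K.hnorm_scaleC a_def b_def norm_divide)
    have "B x y = a * b * B ((1/a) *\<^sub>C x) ((1/b) *\<^sub>C y)"
      using x y sc ab scl[OF x, of "(1/b) *\<^sub>C y" "1/a"] scr[OF x y, of "1/b"] by simp
    then have "cmod (B x y) = hnorm H x * hnorm K y * cmod (B ((1/a) *\<^sub>C x) ((1/b) *\<^sub>C y))"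
      using 3 by (simp add: norm_mult a_def b_def)
    also have "\<dots> \<le> hnorm H x * hnorm K y * (C * (1\<^sup>2 + 1\<^sup>2))"
      using bnd[OF sc] 3 unfolding n by (intro mult_left_mono) auto
    finally show ?thesis by (simp add: mult_ac)
  qed
qed

lemma sesquilinear_op:
  assumes H: "hilbert_space H" and K: "hilbert_space K"
    and addl: "\<And>x y z. \<lbrakk>x \<in> vecs H; y \<in> vecs H; z \<in> vecs K\<rbrakk> \<Longrightarrow> B (x + y) z = B x z + B y z"
    and addr: "\<And>x y z. \<lbrakk>x \<in> vecs K; y \<in> vecs K; z \<in> vecs H\<rbrakk> \<Longrightarrow> B z (x + y) = B z x + B z y"
    and scl: "\<And>x y c. \<lbrakk>x \<in> vecs H; y \<in> vecs K\<rbrakk> \<Longrightarrow> B (c *\<^sub>C x) y = c * B x y"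
    and scr: "\<And>x y c. \<lbrakk>x \<in> vecs H; y \<in> vecs K\<rbrakk> \<Longrightarrow> B x (c *\<^sub>C y) = cnj c * B x y"
    and bnd: "\<And>x y. \<lbrakk>x \<in> vecs H; y \<in> vecs K\<rbrakk> \<Longrightarrow> cmod (B x y) \<le> C * hnorm H x * hnorm K y"
  shows "\<exists>T. bounded_op H K T \<and> (\<forall>x\<in>vecs H. \<forall>y\<in>vecs K. ip K (T x) y = B x y)"
proof -
  interpret H: hilbert_space H by fact
  interpret K: hilbert_space K by fact
  \<comment> \<open>Conjugation makes the form linear in \<open>y\<close>, as \<open>riesz\<close>
    requires.\<close>
  have "\<exists>w\<in>vecs K. \<forall>y\<in>vecs K. cnj (B x y) = ip K y w" if x: "x \<in> vecs H" for x
  proof (rule K.riesz)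
    fix y assume "y \<in> vecs K"
    then show "cmod (cnj (B x y)) \<le> (C * hnorm H x) * hnorm K y" using bnd[OF x] by simp
  qed (use x in \<open>auto simp: addr scr\<close>)
  then obtain T where T: "\<And>x. x \<in> vecs H \<Longrightarrow> T x \<in> vecs K"
    and TB': "\<And>x y. \<lbrakk>x \<in> vecs H; y \<in> vecs K\<rbrakk> \<Longrightarrow> cnj (B x y) = ip K y (T x)" by metis
  have TB: "ip K (T x) y = B x y" if "x \<in> vecs H" "y \<in> vecs K" for x y
    using TB'[OF that] K.ip_commute[OF that(2) T[OF that(1)]] by (metis complex_cnj_cnj)
  have "T (x + y) = T x + T y" if "x \<in> vecs H" "y \<in> vecs H" for x y
    using that by (intro K.vec_eqI) (auto simp: T H.mem K.mem TB addl K.ip_add)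
  moreover have "T (c *\<^sub>C x) = c *\<^sub>C T x" if "x \<in> vecs H" for x c
    using that by (intro K.vec_eqI) (auto simp: T H.mem K.mem TB scl K.ip_scaleC)
  moreover have "hnorm K (T x) \<le> max C 0 * hnorm H x" if x: "x \<in> vecs H" for x
  proof (cases "hnorm K (T x) = 0")
    case False
    have "(hnorm K (T x))\<^sup>2 = cmod (ip K (T x) (T x))" by (simp add: K.ip_self T x norm_power)
    also have "\<dots> = cmod (B x (T x))" by (simp add: TB T x)
    also have "\<dots> \<le> C * hnorm H x * hnorm K (T x)" using bnd x T by blast
    finally have "hnorm K (T x) * hnorm K (T x) \<le> (C * hnorm H x) * hnorm K (T x)" by (simp add: power2_eq_square)
    then have "hnorm K (T x) \<le> C * hnorm H x" using False K.hnorm_nonneg[OF T[OF x]] by (simp add: mult_le_cancel_right)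
    also have "\<dots> \<le> max C 0 * hnorm H x" using x by (intro mult_right_mono) auto
    finally show ?thesis .
  qed (use x in auto)
  ultimately have "bounded_op H K T" using T unfolding bounded_op_def by blast
  then show ?thesis using TB by blast
qed

section \<open>Calculus of projection valued measures\<close>

text \<open>Complex measures are kept as bare set functions of which only the values on
  \<open>sets M\<close> count, so that matrix coefficients of projections qualify directly.\<close>

definition cmeas :: "'w measure \<Rightarrow> ('w set \<Rightarrow> complex) \<Rightarrow> bool" where
  "cmeas M \<nu> \<longleftrightarrow> (\<forall>A::nat \<Rightarrow> 'w set. range A \<subseteq> sets M \<longrightarrow> disjoint_family A \<longrightarrow>
     (\<lambda>n. \<nu> (A n)) sums \<nu> (\<Union>n. A n))"

lemma cmeasD: "\<lbrakk>cmeas M \<nu>; range A \<subseteq> sets M; disjoint_family A\<rbrakk> \<Longrightarrow> (\<lambda>n::nat. \<nu> (A n)) sums \<nu> (\<Union>n. A n)"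
  unfolding cmeas_def by blast

lemma cmeas_empty: assumes "cmeas M \<nu>" shows "\<nu> {} = 0"
proof -
  have "(\<lambda>n::nat. \<nu> {}) sums \<nu> {}"
    using cmeasD[OF assms, of "\<lambda>_. {}"] by (simp add: disjoint_family_on_def)
  then have "summable (\<lambda>n::nat. \<nu> {})" by (rule sums_summable)
  then show ?thesis by (simp add: summable_const_iff)
qed

lemma cmeas_Un:
  assumes "cmeas M \<nu>" "A \<in> sets M" "B \<in> sets M" "A \<inter> B = {}"
  shows "\<nu> (A \<union> B) = \<nu> A + \<nu> B"
proof -
  have "(\<lambda>n. \<nu> (binaryset A B n)) sums \<nu> (\<Union>n. binaryset A B n)"
    using assms by (intro cmeasD) (auto simp: range_binaryset_eq disjoint_family_on_def binaryset_def)
  moreover have "(\<lambda>n. \<nu> (binaryset A B n)) sums (\<nu> A + \<nu> B)"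
  proof -
    have "(\<lambda>n. \<nu> (binaryset A B n)) sums (\<Sum>n\<in>{0, 1}. \<nu> (binaryset A B n))"
      using cmeas_empty[OF assms(1)] by (intro sums_finite) (auto simp: binaryset_def)
    then show ?thesis by (simp add: binaryset_def)
  qed
  ultimately show ?thesis by (simp add: UN_binaryset_eq sums_iff)
qed

lemma cmeas_add: "\<lbrakk>cmeas M \<nu>; cmeas M \<nu>'\<rbrakk> \<Longrightarrow> cmeas M (\<lambda>A. \<nu> A + \<nu>' A)"
  unfolding cmeas_def by (auto intro!: sums_add)

lemma cmeas_cmult: "cmeas M \<nu> \<Longrightarrow> cmeas M (\<lambda>A. c * \<nu> A)"
  unfolding cmeas_def by (auto intro!: sums_mult)

lemma cmeas_sum: "(\<And>i. i \<in> I \<Longrightarrow> cmeas M (\<nu> i)) \<Longrightarrow> cmeas M (\<lambda>A. \<Sum>i\<in>I. \<nu> i A)"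
  unfolding cmeas_def by (auto intro!: sums_sum)

lemma cmeas_cnj: "cmeas M \<nu> \<Longrightarrow> cmeas M (\<lambda>A. cnj (\<nu> A))"
  unfolding cmeas_def by (auto simp: sums_cnj)

lemma cmeas_restrict:
  assumes "cmeas M \<nu>" "B \<in> sets M" shows "cmeas M (\<lambda>A. \<nu> (A \<inter> B))"
  unfolding cmeas_def
proof (intro allI impI)
  fix A :: "nat \<Rightarrow> _" assume A: "range A \<subseteq> sets M" "disjoint_family A"
  have "(\<lambda>n. \<nu> (A n \<inter> B)) sums \<nu> (\<Union>n. A n \<inter> B)"
    using A assms by (intro cmeasD) (auto simp: disjoint_family_on_def)
  then show "(\<lambda>n. \<nu> (A n \<inter> B)) sums \<nu> ((\<Union>n. A n) \<inter> B)" by simp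
qed

lemma cmeas_measure:
  assumes "finite_measure \<mu>" "sets \<mu> = sets M"
  shows "cmeas M (\<lambda>A. complex_of_real (measure \<mu> A))"
proof -
  interpret finite_measure \<mu> by fact
  show ?thesis unfolding cmeas_def using finite_measure_UNION assms(2) by (auto simp: sums_of_real_iff)
qed

text \<open>The Dynkin argument works for complex set functions because total masses are finite:
  complements are handled by subtraction from the mass of the whole space.\<close>

lemma cmeas_unique:
  assumes m: "cmeas M \<nu>" "cmeas M \<nu>'" and G: "sets M = sigma_sets (space M) G" "Int_stable G" "G \<subseteq> Pow (space M)"
    and eq: "\<And>A. A \<in> G \<Longrightarrow> \<nu> A = \<nu>' A" and top: "\<nu> (space M) = \<nu>' (space M)" and A: "A \<in> sets M"
  shows "\<nu> A = \<nu>' A"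
  using G(2,3) A[unfolded G(1)]
proof (induction rule: sigma_sets_induct_disjoint)
  case (compl A)
  then have A: "A \<in> sets M" by (simp add: G)
  then have "space M = A \<union> (space M - A)" using sets.sets_into_space by auto
  then have "\<nu> (space M) = \<nu> A + \<nu> (space M - A)" "\<nu>' (space M) = \<nu>' A + \<nu>' (space M - A)"
    using cmeas_Un[OF m(1) A, of "space M - A"] cmeas_Un[OF m(2) A, of "space M - A"] A by auto
  then show ?case using top compl by simp
next
  case (union A)
  then have "range A \<subseteq> sets M" by (simp add: G)
  then have "(\<lambda>n. \<nu> (A n)) sums \<nu> (\<Union>n. A n)" "(\<lambda>n. \<nu>' (A n)) sums \<nu>' (\<Union>n. A n)"
    using union(1) m by (auto intro: cmeasD)
  then show ?case using union(3) by (simp add: sums_iff)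
qed (simp_all add: eq cmeas_empty[OF m(1)] cmeas_empty[OF m(2)])

section \<open>Bounded measurable functions\<close>

lemma bdd_measI: "\<lbrakk>f \<in> borel_measurable M; \<And>\<omega>. \<omega> \<in> space M \<Longrightarrow> cmod (f \<omega>) \<le> C\<rbrakk> \<Longrightarrow> f \<in> bdd_meas M"
  by (auto simp: bdd_meas_def)

lemma bdd_meas_measurable [measurable_dest]: "f \<in> bdd_meas M \<Longrightarrow> f \<in> borel_measurable M"
  by (simp add: bdd_meas_def)

lemma bdd_meas_bound: "f \<in> bdd_meas M \<Longrightarrow> \<exists>C\<ge>0. \<forall>\<omega>\<in>space M. cmod (f \<omega>) \<le> C"
proof -
  assume "f \<in> bdd_meas M"
  then obtain C where "\<forall>\<omega>\<in>space M. cmod (f \<omega>) \<le> C" by (auto simp: bdd_meas_def)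
  then show ?thesis by (intro exI[of _ "max C 0"]) (auto simp: max.coboundedI1)
qed

lemma bdd_meas_indicator: "A \<in> sets M \<Longrightarrow> indicator A \<in> bdd_meas M"
  by (rule bdd_measI[where C=1]) (auto simp: indicator_def)

lemma bdd_meas_const: "(\<lambda>_. c) \<in> bdd_meas M"
  by (rule bdd_measI[where C="cmod c"]) auto

lemma bdd_meas_add: assumes "f \<in> bdd_meas M" "g \<in> bdd_meas M" shows "(\<lambda>\<omega>. f \<omega> + g \<omega>) \<in> bdd_meas M"
proof -
  obtain C D where "\<forall>\<omega>\<in>space M. cmod (f \<omega>) \<le> C" "\<forall>\<omega>\<in>space M. cmod (g \<omega>) \<le> D" using assms by (auto simp: bdd_meas_def)
  then show ?thesis using assms
    by (intro bdd_measI[where C="C + D"]) (auto intro: norm_triangle_mono simp: bdd_meas_def)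
qed

lemma bdd_meas_mult: assumes "f \<in> bdd_meas M" "g \<in> bdd_meas M" shows "(\<lambda>\<omega>. f \<omega> * g \<omega>) \<in> bdd_meas M"
proof -
  obtain C where C: "C \<ge> 0" "\<forall>\<omega>\<in>space M. cmod (f \<omega>) \<le> C" using bdd_meas_bound[OF assms(1)] by auto
  obtain D where D: "D \<ge> 0" "\<forall>\<omega>\<in>space M. cmod (g \<omega>) \<le> D" using bdd_meas_bound[OF assms(2)] by auto
  show ?thesis using assms C D
    by (intro bdd_measI[where C="C * D"]) (auto simp: norm_mult bdd_meas_def intro!: mult_mono)
qed

lemma bdd_meas_cmult: "f \<in> bdd_meas M \<Longrightarrow> (\<lambda>\<omega>. c * f \<omega>) \<in> bdd_meas M"
  using bdd_meas_mult[OF bdd_meas_const] .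

lemma bdd_meas_sum: "(\<And>i. i \<in> I \<Longrightarrow> f i \<in> bdd_meas M) \<Longrightarrow> (\<lambda>\<omega>. \<Sum>i\<in>I. f i \<omega>) \<in> bdd_meas M"
  by (induction I rule: infinite_finite_induct) (auto intro: bdd_meas_add bdd_meas_const)

lemma bdd_meas_sets_cong: "sets M = sets N \<Longrightarrow> bdd_meas M = bdd_meas N"
  unfolding bdd_meas_def using measurable_cong_sets[of M N borel borel] sets_eq_imp_space_eq[of M N] by auto

text \<open>Rounding real and imaginary parts down to a grid of mesh 1/(n+1) gives finitely many
  values on a bounded range and an error of at most 2/(n+1). Thus simple functions converge
  uniformly, which is more than the limit clause asks for.\<close>

lemma bdd_meas_induct [consumes 1, case_names indicator add cmult lim]:
  assumes g: "g \<in> bdd_meas M"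
    and ind: "\<And>A. A \<in> sets M \<Longrightarrow> Q (indicator A)"
    and add: "\<And>f g. \<lbrakk>f \<in> bdd_meas M; Q f; g \<in> bdd_meas M; Q g\<rbrakk> \<Longrightarrow> Q (\<lambda>\<omega>. f \<omega> + g \<omega>)"
    and cmult: "\<And>f c. \<lbrakk>f \<in> bdd_meas M; Q f\<rbrakk> \<Longrightarrow> Q (\<lambda>\<omega>. c * f \<omega>)"
    and lim: "\<And>s g C. \<lbrakk>\<And>n::nat. s n \<in> bdd_meas M; \<And>n. Q (s n); g \<in> bdd_meas M;
      \<And>n \<omega>. \<omega> \<in> space M \<Longrightarrow> cmod (s n \<omega>) \<le> C; \<And>\<omega>. \<omega> \<in> space M \<Longrightarrow> (\<lambda>n. s n \<omega>) \<longlonglongrightarrow> g \<omega>\<rbrakk> \<Longrightarrow> Q g"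
  shows "Q g"
proof -
  note [measurable] = bdd_meas_measurable[OF g]
  obtain C where C: "C \<ge> 0" "\<And>\<omega>. \<omega> \<in> space M \<Longrightarrow> cmod (g \<omega>) \<le> C" using bdd_meas_bound[OF g] by auto
  define u where "u n x = real_of_int \<lfloor>real (Suc n) * x\<rfloor> / real (Suc n)" for n x
  have u: "\<bar>u n x - x\<bar> \<le> 1 / real (Suc n)" for n x
  proof -
    have "u n x - x = (real_of_int \<lfloor>real (Suc n) * x\<rfloor> - real (Suc n) * x) / real (Suc n)"
      by (simp add: u_def field_simps)
    then have "\<bar>u n x - x\<bar> = \<bar>real_of_int \<lfloor>real (Suc n) * x\<rfloor> - real (Suc n) * x\<bar> / real (Suc n)"
      by (simp only: abs_divide abs_of_nat)
    moreover have "\<bar>real_of_int \<lfloor>real (Suc n) * x\<rfloor> - real (Suc n) * x\<bar> \<le> 1" by linarith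
    ultimately show ?thesis by (simp only:) (intro divide_right_mono, auto)
  qed
  define r where "r n \<omega> = Complex (u n (Re (g \<omega>))) (u n (Im (g \<omega>)))" for n \<omega>
  define Z where "Z n = r n ` space M" for n
  define A where "A n z = {\<omega>\<in>space M. r n \<omega> = z}" for n z
  define s where "s n \<omega> = (\<Sum>z\<in>Z n. z * indicator (A n z) \<omega>)" for n \<omega>
  have rm: "r n \<in> borel_measurable M" for n
    unfolding r_def u_def complex_eq Complex_eq by measurable
  have As: "A n z \<in> sets M" for n z
  proof -
    note [measurable] = rm
    show ?thesis unfolding A_def by measurable
  qed
  have fin: "finite (Z n)" for n
  proof (rule finite_subset)
    \<comment> \<open>A bound for the integer parts that can occur when
      \<open>\<bar>x\<bar> \<le> C\<close>; the extra 1 absorbs the rounding of negative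
      numbers.\<close>
    define N where "N = \<lceil>real (Suc n) * C\<rceil> + 1"
    let ?f = "\<lambda>(i::int, j::int). Complex (real_of_int i / real (Suc n)) (real_of_int j / real (Suc n))"
    show "Z n \<subseteq> ?f ` ({-N..N} \<times> {-N..N})"
    proof
      fix z assume "z \<in> Z n"
      then obtain \<omega> where w: "\<omega> \<in> space M" "z = r n \<omega>" by (auto simp: Z_def)
      have *: "\<lfloor>real (Suc n) * x\<rfloor> \<in> {-N..N}" if "\<bar>x\<bar> \<le> C" for x
      proof -
        have "\<bar>real (Suc n) * x\<bar> \<le> real (Suc n) * C" unfolding abs_mult using that by (simp add: mult_left_mono)
        then show ?thesis unfolding N_def by simp linarith
      qed
      have "\<bar>Re (g \<omega>)\<bar> \<le> C" "\<bar>Im (g \<omega>)\<bar> \<le> C"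
        using C(2)[OF w(1)] abs_Re_le_cmod[of "g \<omega>"] abs_Im_le_cmod[of "g \<omega>"] by linarith+
      then show "z \<in> ?f ` ({-N..N} \<times> {-N..N})"
        using * by (intro image_eqI[of _ _ "(\<lfloor>real (Suc n) * Re (g \<omega>)\<rfloor>, \<lfloor>real (Suc n) * Im (g \<omega>)\<rfloor>)"])
          (auto simp: w(2) r_def u_def)
    qed
  qed simp
  have Q0: "Q (\<lambda>\<omega>. 0)" using cmult[of "indicator {}" 0] ind[of "{}"] bdd_meas_indicator[of "{}" M] by simp
  have sQ: "Q (s n)" for n
  proof -
    have "Q (\<lambda>\<omega>. \<Sum>z\<in>Y. z * indicator (A n z) \<omega>)" if "finite Y" for Y
      using that
    proof induction
      case (insert z Y)
      show ?case
        unfolding sum.insert[OF insert(1,2)] using insert(3)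
        by (intro add cmult ind As bdd_meas_indicator bdd_meas_cmult bdd_meas_sum)
    qed (simp add: Q0)
    then show ?thesis unfolding s_def using fin .
  qed
  have sr: "s n \<omega> = r n \<omega>" if "\<omega> \<in> space M" for n \<omega>
  proof -
    have "s n \<omega> = (\<Sum>z\<in>Z n. if r n \<omega> = z then r n \<omega> else 0)"
      unfolding s_def using that by (intro sum.cong) (auto simp: A_def indicator_def)
    also have "\<dots> = r n \<omega>" using that fin by (auto simp: Z_def)
    finally show ?thesis .
  qed
  have d: "cmod (s n \<omega> - g \<omega>) \<le> 2 * (1 / real (Suc n))" if "\<omega> \<in> space M" for n \<omega>
    using cmod_le[of "s n \<omega> - g \<omega>"] u[of n "Re (g \<omega>)"] u[of n "Im (g \<omega>)"]
    unfolding sr[OF that] by (simp add: r_def)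
  show ?thesis
  proof (rule lim[of s g "C + 2"])
    show "s n \<in> bdd_meas M" for n
      unfolding s_def using As by (intro bdd_meas_sum bdd_meas_cmult bdd_meas_indicator)
    show "cmod (s n \<omega>) \<le> C + 2" if "\<omega> \<in> space M" for n \<omega>
    proof -
      have "2 * (1 / real (Suc n)) \<le> 2" by (simp add: divide_le_eq)
      then show ?thesis using d[OF that, of n] C(2)[OF that] norm_triangle_ineq2[of "s n \<omega>" "g \<omega>"] by linarith
    qed
    show "(\<lambda>n. s n \<omega>) \<longlonglongrightarrow> g \<omega>" if "\<omega> \<in> space M" for \<omega>
    proof -
      have "(\<lambda>n. s n \<omega> - g \<omega>) \<longlonglongrightarrow> 0"
      proof (rule Lim_null_comparison)
        show "\<forall>\<^sub>F n in sequentially. norm (s n \<omega> - g \<omega>) \<le> 2 * (1 / real (Suc n))" using d[OF that] by simp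
        show "(\<lambda>n. 2 * (1 / real (Suc n))) \<longlonglongrightarrow> 0"
          using tendsto_mult_right_zero[OF LIMSEQ_Suc[OF lim_1_over_n]] by simp
      qed
      then show ?thesis by (simp add: LIM_zero_iff)
    qed
  qed (use sQ g in auto)
qed

section \<open>Functionals continuous under bounded pointwise convergence\<close>

definition bfun :: "'w measure \<Rightarrow> (('w \<Rightarrow> complex) \<Rightarrow> complex) \<Rightarrow> bool" where
  "bfun M \<Phi> \<longleftrightarrow>
    (\<forall>f\<in>bdd_meas M. \<forall>g\<in>bdd_meas M. \<Phi> (\<lambda>\<omega>. f \<omega> + g \<omega>) = \<Phi> f + \<Phi> g) \<and>
    (\<forall>f\<in>bdd_meas M. \<forall>c. \<Phi> (\<lambda>\<omega>. c * f \<omega>) = c * \<Phi> f) \<and>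
    (\<forall>s g C. (\<forall>n::nat. s n \<in> bdd_meas M) \<longrightarrow> g \<in> bdd_meas M \<longrightarrow> (\<forall>n. \<forall>\<omega>\<in>space M. cmod (s n \<omega>) \<le> C) \<longrightarrow>
       (\<forall>\<omega>\<in>space M. (\<lambda>n. s n \<omega>) \<longlonglongrightarrow> g \<omega>) \<longrightarrow> (\<lambda>n. \<Phi> (s n)) \<longlonglongrightarrow> \<Phi> g)"

lemma bfunD:
  assumes "bfun M \<Phi>"
  shows "\<And>f g. \<lbrakk>f \<in> bdd_meas M; g \<in> bdd_meas M\<rbrakk> \<Longrightarrow> \<Phi> (\<lambda>\<omega>. f \<omega> + g \<omega>) = \<Phi> f + \<Phi> g"
    and "\<And>f c. f \<in> bdd_meas M \<Longrightarrow> \<Phi> (\<lambda>\<omega>. c * f \<omega>) = c * \<Phi> f"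
    and "\<And>s g C. \<lbrakk>\<And>n::nat. s n \<in> bdd_meas M; g \<in> bdd_meas M; \<And>n \<omega>. \<omega>\<in>space M \<Longrightarrow> cmod (s n \<omega>) \<le> C;
       \<And>\<omega>. \<omega>\<in>space M \<Longrightarrow> (\<lambda>n. s n \<omega>) \<longlonglongrightarrow> g \<omega>\<rbrakk> \<Longrightarrow> (\<lambda>n. \<Phi> (s n)) \<longlonglongrightarrow> \<Phi> g"
  using assms unfolding bfun_def by (blast, blast, meson)

text \<open>Such functionals are integrals against complex measures in disguise, and a measure is
  known from its values on sets. Every identity between spectral integrals below is checked on
  indicators and extended in this way.\<close>

lemma bfun_eqI:
  assumes \<Phi>: "bfun M \<Phi>" and \<Psi>: "bfun M \<Psi>" and eq: "\<And>A. A \<in> sets M \<Longrightarrow> \<Phi> (indicator A) = \<Psi> (indicator A)"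
    and g: "g \<in> bdd_meas M"
  shows "\<Phi> g = \<Psi> g"
  using g
proof (induction rule: bdd_meas_induct)
  case (lim s g C)
  have "(\<lambda>n. \<Phi> (s n)) \<longlonglongrightarrow> \<Phi> g" by (rule bfunD(3)[OF \<Phi>, of s g C]) (use lim in auto)
  moreover have "(\<lambda>n. \<Psi> (s n)) \<longlonglongrightarrow> \<Psi> g" by (rule bfunD(3)[OF \<Psi>, of s g C]) (use lim in auto)
  moreover have "(\<lambda>n. \<Phi> (s n)) = (\<lambda>n. \<Psi> (s n))" by (intro ext) (rule lim)
  ultimately show ?case using LIMSEQ_unique by metis
qed (simp_all add: eq bfunD[OF \<Phi>] bfunD[OF \<Psi>])

lemma bfunI:
  assumes "\<And>f g. \<lbrakk>f \<in> bdd_meas M; g \<in> bdd_meas M\<rbrakk> \<Longrightarrow> \<Phi> (\<lambda>\<omega>. f \<omega> + g \<omega>) = \<Phi> f + \<Phi> g"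
    and "\<And>f c. f \<in> bdd_meas M \<Longrightarrow> \<Phi> (\<lambda>\<omega>. c * f \<omega>) = c * \<Phi> f"
    and "\<And>s g C. \<lbrakk>\<And>n::nat. s n \<in> bdd_meas M; g \<in> bdd_meas M; \<And>n \<omega>. \<omega>\<in>space M \<Longrightarrow> cmod (s n \<omega>) \<le> C;
       \<And>\<omega>. \<omega>\<in>space M \<Longrightarrow> (\<lambda>n. s n \<omega>) \<longlonglongrightarrow> g \<omega>\<rbrakk> \<Longrightarrow> (\<lambda>n. \<Phi> (s n)) \<longlonglongrightarrow> \<Phi> g"
  shows "bfun M \<Phi>"
  unfolding bfun_def
proof (intro conjI ballI allI impI)
  fix s g C assume "\<forall>n::nat. s n \<in> bdd_meas M" "g \<in> bdd_meas M" "\<forall>n. \<forall>\<omega>\<in>space M. cmod (s n \<omega>) \<le> C"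
    "\<forall>\<omega>\<in>space M. (\<lambda>n. s n \<omega>) \<longlonglongrightarrow> g \<omega>"
  then show "(\<lambda>n. \<Phi> (s n)) \<longlonglongrightarrow> \<Phi> g" by (intro assms(3)[of s g C]) auto
next
  show "\<Phi> (\<lambda>\<omega>. f \<omega> + g \<omega>) = \<Phi> f + \<Phi> g" if "f \<in> bdd_meas M" "g \<in> bdd_meas M" for f g
    using that by (rule assms(1))
  show "\<Phi> (\<lambda>\<omega>. c * f \<omega>) = c * \<Phi> f" if "f \<in> bdd_meas M" for f c
    using that by (rule assms(2))
qed

lemma bfun_add: assumes \<Phi>: "bfun M \<Phi>" and \<Psi>: "bfun M \<Psi>" shows "bfun M (\<lambda>f. \<Phi> f + \<Psi> f)"
proof (rule bfunI)
  fix s g C assume "\<And>n::nat. s n \<in> bdd_meas M" "g \<in> bdd_meas M" "\<And>n \<omega>. \<omega>\<in>space M \<Longrightarrow> cmod (s n \<omega>) \<le> C"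
       "\<And>\<omega>. \<omega>\<in>space M \<Longrightarrow> (\<lambda>n. s n \<omega>) \<longlonglongrightarrow> g \<omega>"
  then show "(\<lambda>n. \<Phi> (s n) + \<Psi> (s n)) \<longlonglongrightarrow> \<Phi> g + \<Psi> g"
    by (intro tendsto_add bfunD(3)[OF \<Phi>, of s g C] bfunD(3)[OF \<Psi>, of s g C])
qed (simp_all add: bfunD(1,2)[OF \<Phi>] bfunD(1,2)[OF \<Psi>] distrib_left)

lemma bfun_cmult: assumes \<Phi>: "bfun M \<Phi>" shows "bfun M (\<lambda>f. c * \<Phi> f)"
proof (rule bfunI)
  fix s g C assume "\<And>n::nat. s n \<in> bdd_meas M" "g \<in> bdd_meas M" "\<And>n \<omega>. \<omega>\<in>space M \<Longrightarrow> cmod (s n \<omega>) \<le> C"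
       "\<And>\<omega>. \<omega>\<in>space M \<Longrightarrow> (\<lambda>n. s n \<omega>) \<longlonglongrightarrow> g \<omega>"
  then show "(\<lambda>n. c * \<Phi> (s n)) \<longlonglongrightarrow> c * \<Phi> g"
    by (intro tendsto_mult_left bfunD(3)[OF \<Phi>, of s g C])
qed (simp_all add: bfunD(1,2)[OF \<Phi>] distrib_left mult.left_commute)

lemma bfun_zero: "bfun M (\<lambda>f. 0)"
  unfolding bfun_def by auto

lemma bfun_sum: "(\<And>i. i \<in> I \<Longrightarrow> bfun M (\<Phi> i)) \<Longrightarrow> bfun M (\<lambda>f. \<Sum>i\<in>I. \<Phi> i f)"
  by (induction I rule: infinite_finite_induct) (auto intro: bfun_add bfun_zero)

text \<open>Passing to the measure with density \<open>g\<close>; this is what allows the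
  multiplicativity of the spectral integral to be tested one factor at a time.\<close>

lemma bfun_mult:
  assumes "bfun M \<Phi>" and g: "g \<in> bdd_meas M"
  shows "bfun M (\<lambda>f. \<Phi> (\<lambda>\<omega>. f \<omega> * g \<omega>))"
  unfolding bfun_def
proof (intro conjI allI ballI impI)
  obtain D where D: "D \<ge> 0" "\<And>\<omega>. \<omega> \<in> space M \<Longrightarrow> cmod (g \<omega>) \<le> D" using bdd_meas_bound[OF g] by auto
  fix s h C assume *: "\<forall>n::nat. s n \<in> bdd_meas M" "h \<in> bdd_meas M" "\<forall>n. \<forall>\<omega>\<in>space M. cmod (s n \<omega>) \<le> C"
     "\<forall>\<omega>\<in>space M. (\<lambda>n. s n \<omega>) \<longlonglongrightarrow> h \<omega>"
  show "(\<lambda>n. \<Phi> (\<lambda>\<omega>. s n \<omega> * g \<omega>)) \<longlonglongrightarrow> \<Phi> (\<lambda>\<omega>. h \<omega> * g \<omega>)"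
  proof (rule bfunD(3)[OF assms(1), where C="C * D"])
    fix n \<omega> assume w: "\<omega> \<in> space M"
    have c: "cmod (s n \<omega>) \<le> C" using * w by blast
    then have "0 \<le> C" using norm_ge_zero order_trans by blast
    then show "cmod (s n \<omega> * g \<omega>) \<le> C * D"
      using D(2)[OF w] c by (simp add: norm_mult mult_mono)
  qed (use * g in \<open>auto intro: bdd_meas_mult tendsto_mult_right\<close>)
next
  fix f h assume "f \<in> bdd_meas M" "h \<in> bdd_meas M"
  then show "\<Phi> (\<lambda>\<omega>. (f \<omega> + h \<omega>) * g \<omega>) = \<Phi> (\<lambda>\<omega>. f \<omega> * g \<omega>) + \<Phi> (\<lambda>\<omega>. h \<omega> * g \<omega>)"
    using bfunD(1)[OF assms(1), of "\<lambda>\<omega>. f \<omega> * g \<omega>" "\<lambda>\<omega>. h \<omega> * g \<omega>"] g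
    by (simp add: bdd_meas_mult distrib_right)
next
  fix f c assume "f \<in> bdd_meas M"
  then show "\<Phi> (\<lambda>\<omega>. c * f \<omega> * g \<omega>) = c * \<Phi> (\<lambda>\<omega>. f \<omega> * g \<omega>)"
    using bfunD(2)[OF assms(1), of "\<lambda>\<omega>. f \<omega> * g \<omega>" c] g
    by (simp add: bdd_meas_mult mult.assoc)
qed

lemma bdd_meas_integrable:
  assumes "finite_measure N" "sets N = sets M" "f \<in> bdd_meas M"
  shows "integrable N f"
proof -
  interpret finite_measure N by fact
  have f: "f \<in> bdd_meas N" using assms bdd_meas_sets_cong by blast
  then obtain C where "\<forall>\<omega>\<in>space N. cmod (f \<omega>) \<le> C" by (auto simp: bdd_meas_def)
  then have "AE \<omega> in N. norm (f \<omega>) \<le> C" by (intro AE_I2) blast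
  then show ?thesis using bdd_meas_measurable[OF f] by (rule integrable_const_bound)
qed

lemma bfun_integral:
  assumes N: "finite_measure N" "sets N = sets M"
  shows "bfun M (\<lambda>f. LINT \<omega>|N. f \<omega>)"
  unfolding bfun_def
proof (intro conjI allI ballI impI)
  interpret finite_measure N by fact
  have sp: "space N = space M" using N(2) by (rule sets_eq_imp_space_eq)
  note int = bdd_meas_integrable[OF N]
  show "(LINT \<omega>|N. f \<omega> + g \<omega>) = (LINT \<omega>|N. f \<omega>) + (LINT \<omega>|N. g \<omega>)" if "f \<in> bdd_meas M" "g \<in> bdd_meas M" for f g
    using that by (intro Bochner_Integration.integral_add int)
  show "(LINT \<omega>|N. c * f \<omega>) = c * (LINT \<omega>|N. f \<omega>)" for f :: "'a \<Rightarrow> complex" and c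
    by (rule integral_mult_right_zero)
  fix s g C assume *: "\<forall>n::nat. s n \<in> bdd_meas M" "g \<in> bdd_meas M" "\<forall>n. \<forall>\<omega>\<in>space M. cmod (s n \<omega>) \<le> C"
     "\<forall>\<omega>\<in>space M. (\<lambda>n. s n \<omega>) \<longlonglongrightarrow> g \<omega>"
  show "(\<lambda>n. LINT \<omega>|N. s n \<omega>) \<longlonglongrightarrow> (LINT \<omega>|N. g \<omega>)"
  proof (rule integral_dominated_convergence[where w="\<lambda>_. C"])
    show "g \<in> borel_measurable N" "\<And>i. s i \<in> borel_measurable N"
      using * int by (blast intro: borel_measurable_integrable)+
    show "AE \<omega> in N. (\<lambda>n. s n \<omega>) \<longlonglongrightarrow> g \<omega>" using *(4) sp by (intro AE_I2) blast
    show "AE \<omega> in N. norm (s n \<omega>) \<le> C" for n using *(3) sp by (intro AE_I2) blast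
  qed simp
qed

text \<open>The value that \<open>has_cmeasure_integral\<close> assigns to a complex measure written
  with the four positive measures \<open>\<mu> p\<close>.\<close>

definition cint :: "(nat \<Rightarrow> 'w measure) \<Rightarrow> ('w \<Rightarrow> complex) \<Rightarrow> complex" where
  "cint \<mu> f = (\<Sum>p<4. \<i> ^ p * (LINT \<omega>|\<mu> p. f \<omega>))"

lemma bfun_cint:
  assumes "\<And>p. p < 4 \<Longrightarrow> finite_measure (\<mu> p)" "\<And>p. p < 4 \<Longrightarrow> sets (\<mu> p) = sets M"
  shows "bfun M (cint \<mu>)"
  unfolding cint_def using assms by (intro bfun_sum bfun_cmult bfun_integral) auto

lemma integral_indicator_complex:
  assumes "finite_measure N" "A \<in> sets N"
  shows "(LINT \<omega>|N. indicator A \<omega>) = complex_of_real (measure N A)"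
proof -
  have "(LINT \<omega>|N. indicator A \<omega> :: complex) = (LINT \<omega>|N. complex_of_real (indicator A \<omega>))"
    by (intro Bochner_Integration.integral_cong) (auto simp: indicator_def)
  also have "\<dots> = complex_of_real (measure N A)"
    using assms sets.sets_into_space[OF assms(2)] by (simp add: integral_complex_of_real Int_absorb2)
  finally show ?thesis .
qed

lemma cint_indicator:
  assumes "\<And>p. p < 4 \<Longrightarrow> finite_measure (\<mu> p)" "\<And>p. p < 4 \<Longrightarrow> sets (\<mu> p) = sets M" "A \<in> sets M"
  shows "cint \<mu> (indicator A) = (\<Sum>p<4. \<i> ^ p * of_real (measure (\<mu> p) A))"
  unfolding cint_def using assms by (intro sum.cong refl) (auto simp: integral_indicator_complex)

section \<open>Spectral integrals\<close>

text \<open>The scalar spectral measure of \<open>h\<close>, whose value at \<open>G\<close> is the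
  inner product of \<open>prj X G h\<close> with \<open>h\<close>. The squared norm is the same
  number and is visibly nonnegative.\<close>

definition pmu :: "('w, 'h::complex_vector) pvms \<Rightarrow> 'h \<Rightarrow> 'w measure" where
  "pmu X h = measure_of (space (msp X)) (sets (msp X)) (\<lambda>G. ennreal ((hnorm (hsp X) (prj X G h))\<^sup>2))"

text \<open>The matrix coefficient of the spectral integral of \<open>f\<close> at \<open>h\<close>
  and \<open>k\<close>, recovered by polarization from scalar spectral measures.\<close>

definition pint :: "('w, 'h::complex_vector) pvms \<Rightarrow> ('w \<Rightarrow> complex) \<Rightarrow> 'h \<Rightarrow> 'h \<Rightarrow> complex" where
  "pint X f h k = cint (\<lambda>p. pmu X (pol p h k)) f"

lemma sets_pmu [simp, measurable_cong]: "sets (pmu X h) = sets (msp X)"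
  by (simp add: pmu_def)

lemma space_pmu [simp]: "space (pmu X h) = space (msp X)"
  by (simp add: pmu_def)

context pvm_space
begin

abbreviation (input) "HX \<equiv> hsp X"
abbreviation (input) "MX \<equiv> msp X"

lemma prj_mem: "\<lbrakk>G \<in> sets MX; h \<in> vecs HX\<rbrakk> \<Longrightarrow> prj X G h \<in> vecs HX"
  using bounded by (rule bounded_op_mem)

lemma cmeas_prj: "\<lbrakk>h \<in> vecs HX; k \<in> vecs HX\<rbrakk> \<Longrightarrow> cmeas MX (\<lambda>G. ip HX (prj X G h) k)"
  unfolding cmeas_def using weakly_additive by blast

lemma prj_ip_self:
  assumes "G \<in> sets MX" "h \<in> vecs HX"
  shows "ip HX (prj X G h) h = of_real ((hnorm HX (prj X G h))\<^sup>2)"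
  using selfadj[OF assms(1) prj_mem[OF assms] assms(2)] idem[OF assms] ip_self[OF prj_mem[OF assms]] by simp

lemma prj_norm_le:
  assumes "G \<in> sets MX" "h \<in> vecs HX"
  shows "hnorm HX (prj X G h) \<le> hnorm HX h"
proof (cases "hnorm HX (prj X G h) = 0")
  case False
  have "(hnorm HX (prj X G h))\<^sup>2 = cmod (ip HX (prj X G h) h)"
    unfolding prj_ip_self[OF assms] by (simp add: norm_power)
  also have "\<dots> \<le> hnorm HX (prj X G h) * hnorm HX h" using assms by (intro cauchy_schwarz prj_mem)
  finally have "hnorm HX (prj X G h) * hnorm HX (prj X G h) \<le> hnorm HX (prj X G h) * hnorm HX h"
    by (simp add: power2_eq_square)
  then show ?thesis using False hnorm_nonneg[OF prj_mem[OF assms]] by (simp add: mult_le_cancel_left)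
qed (use assms in simp)

lemma prj_empty: assumes "h \<in> vecs HX" shows "prj X {} h = 0"
  using cmeas_empty[OF cmeas_prj[OF assms]] assms
  by (intro vec_eqI) (auto intro!: prj_mem simp: zero_mem)

lemma prj_Un:
  assumes "A \<in> sets MX" "B \<in> sets MX" "A \<inter> B = {}" "h \<in> vecs HX"
  shows "prj X (A \<union> B) h = prj X A h + prj X B h"
  using cmeas_Un[OF cmeas_prj[OF assms(4)] assms(1-3)] assms
  by (intro vec_eqI) (auto intro!: prj_mem add_mem simp: ip_add prj_mem)

text \<open>Multiplicativity is not an axiom of \<open>pvm_space\<close>. With
  \<open>y = prj X B h\<close>, the projection of \<open>A \<union> B\<close> maps \<open>y\<close>
  to \<open>prj X A y + y\<close>, whose squared norm pairing adds up to that of both parts; since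
  projections contract, the part in \<open>A\<close> must vanish.\<close>

lemma prj_disjoint:
  assumes A: "A \<in> sets MX" and B: "B \<in> sets MX" and d: "A \<inter> B = {}" and h: "h \<in> vecs HX"
  shows "prj X A (prj X B h) = 0"
proof -
  define y where "y = prj X B h"
  have y: "y \<in> vecs HX" and By: "prj X B y = y" using prj_mem idem B h by (auto simp: y_def)
  have AB: "A \<union> B \<in> sets MX" using A B by blast
  have "(hnorm HX (prj X (A \<union> B) y))\<^sup>2 \<le> (hnorm HX y)\<^sup>2"
    using prj_norm_le[OF AB y] hnorm_nonneg prj_mem AB y by (intro power_mono) auto
  moreover have "(hnorm HX (prj X (A \<union> B) y))\<^sup>2 = (hnorm HX (prj X A y))\<^sup>2 + (hnorm HX y)\<^sup>2"
  proof -
    have "ip HX (prj X (A \<union> B) y) y = ip HX (prj X A y) y + ip HX y y"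
      unfolding prj_Un[OF A B d y] By using A y prj_mem by (simp add: ip_add)
    then show ?thesis
      unfolding prj_ip_self[OF AB y] prj_ip_self[OF A y] ip_self[OF y] of_real_add[symmetric] of_real_eq_iff .
  qed
  ultimately have "(hnorm HX (prj X A y))\<^sup>2 \<le> 0" by linarith
  then show ?thesis using hnorm_eq_0[OF prj_mem[OF A y]] by (simp add: y_def)
qed

lemma prj_Int:
  assumes A: "A \<in> sets MX" and B: "B \<in> sets MX" and h: "h \<in> vecs HX"
  shows "prj X A (prj X B h) = prj X (A \<inter> B) h"
proof -
  have s: "A \<inter> B \<in> sets MX" "B - A \<in> sets MX" "A - B \<in> sets MX" using A B by auto
  have "prj X B h = prj X (A \<inter> B) h + prj X (B - A) h"
  proof -
    have "B = (A \<inter> B) \<union> (B - A)" "(A \<inter> B) \<inter> (B - A) = {}" by auto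
    then show ?thesis using prj_Un[OF s(1,2) _ h] by metis
  qed
  then have "prj X A (prj X B h) = prj X A (prj X (A \<inter> B) h) + prj X A (prj X (B - A) h)"
    using bounded_op_add[OF bounded[OF A]] s prj_mem h by simp
  also have "prj X A (prj X (B - A) h) = 0" using A s h by (intro prj_disjoint) auto
  also have "prj X A (prj X (A \<inter> B) h) = prj X ((A \<inter> B) \<union> (A - B)) (prj X (A \<inter> B) h)"
    by (simp add: Int_Diff_Un)
  also have "\<dots> = prj X (A \<inter> B) (prj X (A \<inter> B) h) + prj X (A - B) (prj X (A \<inter> B) h)"
    using s h prj_mem by (intro prj_Un) auto
  also have "prj X (A - B) (prj X (A \<inter> B) h) = 0" using s h by (intro prj_disjoint) auto
  finally show ?thesis using idem s h by simp
qed

text \<open>Weak additivity with \<open>k = h\<close> is a statement about nonnegative numbers,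
  hence genuine countable additivity.\<close>

lemma emeasure_pmu:
  assumes "G \<in> sets MX" "h \<in> vecs HX"
  shows "emeasure (pmu X h) G = ennreal ((hnorm HX (prj X G h))\<^sup>2)"
proof (rule emeasure_measure_of[OF pmu_def])
  show "sets MX \<subseteq> Pow (space MX)" by (rule sets.space_closed)
  show "positive (sets (pmu X h)) (\<lambda>G. ennreal ((hnorm HX (prj X G h))\<^sup>2))"
    using assms by (simp add: positive_def prj_empty)
  show "countably_additive (sets (pmu X h)) (\<lambda>G. ennreal ((hnorm HX (prj X G h))\<^sup>2))"
    unfolding countably_additive_def
  proof (intro allI impI)
    fix A :: "nat \<Rightarrow> _" assume A: "range A \<subseteq> sets (pmu X h)" "disjoint_family A" "(\<Union>i. A i) \<in> sets (pmu X h)"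
    have "(\<lambda>n. ip HX (prj X (A n) h) h) sums ip HX (prj X (\<Union>n. A n) h) h"
      using A assms by (intro weakly_additive) auto
    then have "(\<lambda>n. complex_of_real ((hnorm HX (prj X (A n) h))\<^sup>2)) sums of_real ((hnorm HX (prj X (\<Union>n. A n) h))\<^sup>2)"
      using A assms by (subst (asm) (1 2) prj_ip_self) auto
    then have "(\<lambda>n. (hnorm HX (prj X (A n) h))\<^sup>2) sums (hnorm HX (prj X (\<Union>n. A n) h))\<^sup>2"
      unfolding sums_of_real_iff .
    then show "(\<Sum>i. ennreal ((hnorm HX (prj X (A i) h))\<^sup>2)) = ennreal ((hnorm HX (prj X (\<Union> (range A)) h))\<^sup>2)"
      by (intro suminf_ennreal_eq) auto
  qed
qed (use assms in simp)

lemma finite_measure_pmu: "h \<in> vecs HX \<Longrightarrow> finite_measure (pmu X h)"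
  by (intro finite_measureI) (simp add: emeasure_pmu)

lemma measure_pmu:
  "\<lbrakk>G \<in> sets MX; h \<in> vecs HX\<rbrakk> \<Longrightarrow> complex_of_real (measure (pmu X h) G) = ip HX (prj X G h) h"
  by (simp add: measure_def emeasure_pmu prj_ip_self)

lemma measure_pmu_space: "h \<in> vecs HX \<Longrightarrow> measure (pmu X h) (space MX) = (hnorm HX h)\<^sup>2"
  by (simp add: measure_def emeasure_pmu total)

lemma pol_measure:
  assumes "G \<in> sets MX" "h \<in> vecs HX" "k \<in> vecs HX"
  shows "(\<Sum>p<4. \<i> ^ p * of_real (measure (pmu X (pol p h k)) G)) = ip HX (prj X G h) k"
proof -
  note b = bounded[OF assms(1)]
  have "(\<Sum>p<4. \<i> ^ p * of_real (measure (pmu X (pol p h k)) G)) = (\<Sum>p<4. \<i> ^ p * ip HX (prj X G (pol p h k)) (pol p h k))"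
    using assms by (simp add: measure_pmu pol_mem)
  also have "\<dots> = ip HX (prj X G h) k"
    using assms
    by (intro polarization[where B="\<lambda>h k. ip HX (prj X G h) k"])
      (auto simp: bounded_op_add[OF b] bounded_op_scaleC[OF b] ip_add ip_add_right ip_scaleC ip_scaleC_right prj_mem)
  finally show ?thesis .
qed

lemma bfun_pint: "\<lbrakk>h \<in> vecs HX; k \<in> vecs HX\<rbrakk> \<Longrightarrow> bfun MX (\<lambda>f. pint X f h k)"
  unfolding pint_def by (intro bfun_cint finite_measure_pmu pol_mem sets_pmu)

lemma pint_indicator:
  "\<lbrakk>G \<in> sets MX; h \<in> vecs HX; k \<in> vecs HX\<rbrakk> \<Longrightarrow> pint X (indicator G) h k = ip HX (prj X G h) k"
  unfolding pint_def by (subst cint_indicator[where M=MX]) (auto intro: finite_measure_pmu pol_mem simp: pol_measure)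

text \<open>The four measures for \<open>x + y\<close> are not sums of those for \<open>x\<close>
  and \<open>y\<close>. Linearity is visible only on indicators, where the value is an inner
  product, and spreads from there by \<open>bfun_eqI\<close>; the three lemmas that follow use the
  same scheme.\<close>

lemma pint_add_left:
  assumes "f \<in> bdd_meas MX" "x \<in> vecs HX" "y \<in> vecs HX" "z \<in> vecs HX"
  shows "pint X f (x + y) z = pint X f x z + pint X f y z"
proof (rule bfun_eqI[OF _ _ _ assms(1)])
  show "bfun MX (\<lambda>f. pint X f (x + y) z)" using assms by (intro bfun_pint add_mem)
  show "bfun MX (\<lambda>f. pint X f x z + pint X f y z)" using assms by (intro bfun_add bfun_pint)
  show "pint X (indicator A) (x + y) z = pint X (indicator A) x z + pint X (indicator A) y z" if A: "A \<in> sets MX" for A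
    using assms A by (simp add: pint_indicator add_mem bounded_op_add[OF bounded[OF A]] ip_add prj_mem)
qed

lemma pint_add_right:
  assumes "f \<in> bdd_meas MX" "x \<in> vecs HX" "y \<in> vecs HX" "z \<in> vecs HX"
  shows "pint X f z (x + y) = pint X f z x + pint X f z y"
proof (rule bfun_eqI[OF _ _ _ assms(1)])
  show "bfun MX (\<lambda>f. pint X f z (x + y))" using assms by (intro bfun_pint add_mem)
  show "bfun MX (\<lambda>f. pint X f z x + pint X f z y)" using assms by (intro bfun_add bfun_pint)
  show "pint X (indicator A) z (x + y) = pint X (indicator A) z x + pint X (indicator A) z y" if A: "A \<in> sets MX" for A
    using assms A by (simp add: pint_indicator add_mem ip_add_right prj_mem)
qed

lemma pint_scaleC_left:
  assumes "f \<in> bdd_meas MX" "x \<in> vecs HX" "z \<in> vecs HX"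
  shows "pint X f (c *\<^sub>C x) z = c * pint X f x z"
proof (rule bfun_eqI[OF _ _ _ assms(1)])
  show "bfun MX (\<lambda>f. pint X f (c *\<^sub>C x) z)" using assms by (intro bfun_pint scaleC_mem)
  show "bfun MX (\<lambda>f. c * pint X f x z)" using assms by (intro bfun_cmult bfun_pint)
  show "pint X (indicator A) (c *\<^sub>C x) z = c * pint X (indicator A) x z" if A: "A \<in> sets MX" for A
    using assms A by (simp add: pint_indicator scaleC_mem bounded_op_scaleC[OF bounded[OF A]] ip_scaleC prj_mem)
qed

lemma pint_scaleC_right:
  assumes "f \<in> bdd_meas MX" "x \<in> vecs HX" "z \<in> vecs HX"
  shows "pint X f z (c *\<^sub>C x) = cnj c * pint X f z x"
proof (rule bfun_eqI[OF _ _ _ assms(1)])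
  show "bfun MX (\<lambda>f. pint X f z (c *\<^sub>C x))" using assms by (intro bfun_pint scaleC_mem)
  show "bfun MX (\<lambda>f. cnj c * pint X f z x)" using assms by (intro bfun_cmult bfun_pint)
  show "pint X (indicator A) z (c *\<^sub>C x) = cnj c * pint X (indicator A) z x" if A: "A \<in> sets MX" for A
    using assms A by (simp add: pint_indicator scaleC_mem ip_scaleC_right prj_mem)
qed

end

text \<open>\<open>Linf\<close> admits representatives that are only almost everywhere equal to
  measurable functions. \<open>Linf_norm\<close> looks at level sets of the representative itself,
  so its properties require a measurable one; sections of decompositions are of this kind.\<close>

definition Linf_meas :: "('w, 'h::complex_vector) pvms \<Rightarrow> ('w \<Rightarrow> complex) set" where
  "Linf_meas X = Linf X \<inter> borel_measurable (msp X)"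

context pvm_space
begin

text \<open>Reduces null sets of a projection valued measure to null sets of positive measures,
  whence countable unions and subsets.\<close>

lemma pvm_null_iff:
  assumes "N \<in> sets MX"
  shows "pvm_null X N \<longleftrightarrow> (\<forall>h\<in>vecs HX. N \<in> null_sets (pmu X h))"
proof -
  have "prj X N h = 0 \<longleftrightarrow> N \<in> null_sets (pmu X h)" if h: "h \<in> vecs HX" for h
    using assms h hnorm_eq_0[OF prj_mem[OF assms h]]
    by (simp add: null_sets_def emeasure_pmu ennreal_eq_0_iff)
  then show ?thesis by (auto simp: pvm_null_def)
qed

lemma pvm_null_UN:
  assumes "\<And>n::nat. N n \<in> sets MX" "\<And>n. pvm_null X (N n)"
  shows "pvm_null X (\<Union>n. N n)"
  using assms by (subst pvm_null_iff) (auto simp: pvm_null_iff)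

lemma pvm_null_subset:
  assumes "pvm_null X N" "N \<in> sets MX" "N' \<subseteq> N" "N' \<in> sets MX"
  shows "pvm_null X N'"
  using assms by (auto simp: pvm_null_iff intro: null_sets_subset)

lemma pvm_AE_pmu: assumes "pvm_AE X p" "h \<in> vecs HX" shows "AE \<omega> in pmu X h. p \<omega>"
proof -
  obtain N where "N \<in> sets MX" "pvm_null X N" "{\<omega>\<in>space MX. \<not> p \<omega>} \<subseteq> N" using assms(1) by (auto simp: pvm_AE_def)
  then show ?thesis using assms(2) by (intro AE_I'[of N]) (auto simp: pvm_null_iff)
qed

lemma pvm_AE_I: "(\<And>\<omega>. \<omega> \<in> space MX \<Longrightarrow> p \<omega>) \<Longrightarrow> pvm_AE X p"
  unfolding pvm_AE_def by (intro bexI[of _ "{}"]) (auto simp: pvm_null_def prj_empty)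

lemma pvm_AE_mp2:
  assumes "pvm_AE X p" "pvm_AE X q" "\<And>\<omega>. \<lbrakk>\<omega> \<in> space MX; p \<omega>; q \<omega>\<rbrakk> \<Longrightarrow> r \<omega>"
  shows "pvm_AE X r"
proof -
  obtain N N' where N: "N \<in> sets MX" "pvm_null X N" "{\<omega>\<in>space MX. \<not> p \<omega>} \<subseteq> N"
    "N' \<in> sets MX" "pvm_null X N'" "{\<omega>\<in>space MX. \<not> q \<omega>} \<subseteq> N'" using assms(1,2) by (auto simp: pvm_AE_def)
  have "pvm_null X (N \<union> N')" using N by (auto simp: pvm_null_iff)
  then show ?thesis unfolding pvm_AE_def using N assms(3) by (intro bexI[of _ "N \<union> N'"]) auto
qed

lemma pvm_AE_mp: "\<lbrakk>pvm_AE X p; \<And>\<omega>. \<lbrakk>\<omega> \<in> space MX; p \<omega>\<rbrakk> \<Longrightarrow> r \<omega>\<rbrakk> \<Longrightarrow> pvm_AE X r"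
  by (rule pvm_AE_mp2[of p p]) auto

lemma pint_cong_AE:
  assumes "f \<in> borel_measurable MX" "g \<in> borel_measurable MX" "pvm_AE X (\<lambda>\<omega>. f \<omega> = g \<omega>)" "h \<in> vecs HX" "k \<in> vecs HX"
  shows "pint X f h k = pint X g h k"
  unfolding pint_def cint_def using assms
  by (intro sum.cong refl arg_cong2[of _ _ _ _ "(*)"] integral_cong_AE pvm_AE_pmu pol_mem)
    (auto simp: measurable_cong_sets[OF sets_pmu refl])

text \<open>Each diagonal integral is bounded by \<open>c\<close> times a squared norm. Summing the
  four and rescaling by \<open>sesquilinear_bound\<close> produces the factor 2.\<close>

lemma pint_bound:
  assumes f: "f \<in> bdd_meas MX" and ae: "pvm_AE X (\<lambda>\<omega>. cmod (f \<omega>) \<le> c)" and c: "0 \<le> c"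
    and h: "h \<in> vecs HX" and k: "k \<in> vecs HX"
  shows "cmod (pint X f h k) \<le> 2 * c * hnorm HX h * hnorm HX k"
proof (rule sesquilinear_bound[OF hilbert_space_axioms hilbert_space_axioms _ _ _ h k])
  fix h k assume h: "h \<in> vecs HX" and k: "k \<in> vecs HX"
  have *: "cmod (LINT \<omega>|pmu X z. f \<omega>) \<le> c * (hnorm HX z)\<^sup>2" if z: "z \<in> vecs HX" for z
  proof -
    interpret finite_measure "pmu X z" using z by (rule finite_measure_pmu)
    have i: "integrable (pmu X z) f" using bdd_meas_integrable[OF finite_measure_pmu[OF z] sets_pmu f] .
    have "cmod (LINT \<omega>|pmu X z. f \<omega>) \<le> (LINT \<omega>|pmu X z. cmod (f \<omega>))" by (rule integral_norm_bound)
    also have "\<dots> \<le> (LINT \<omega>|pmu X z. c)"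
      using i pvm_AE_pmu[OF ae z] by (intro integral_mono_AE) auto
    also have "\<dots> = c * (hnorm HX z)\<^sup>2" using z by (simp add: measure_pmu_space)
    finally show ?thesis .
  qed
  have "cmod (pint X f h k) \<le> (\<Sum>p<4. cmod (\<i> ^ p * (LINT \<omega>|pmu X (pol p h k). f \<omega>)))"
    unfolding pint_def cint_def by (rule norm_sum)
  also have "\<dots> \<le> (\<Sum>p<4. c * (hnorm HX (pol p h k))\<^sup>2)"
    using * h k by (intro sum_mono) (simp add: norm_mult norm_power pol_mem)
  also have "\<dots> = c * ((hnorm HX h)\<^sup>2 + (hnorm HX k)\<^sup>2)"
    unfolding sum_distrib_left[symmetric] using pol_norm_sum[OF h k] by simp
  finally show "cmod (pint X f h k) \<le> c * ((hnorm HX h)\<^sup>2 + (hnorm HX k)\<^sup>2)" .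
qed (use f in \<open>simp_all add: pint_scaleC_left pint_scaleC_right\<close>)

lemma ex_pint_op:
  assumes f: "f \<in> bdd_meas MX"
  shows "\<exists>T. bounded_op HX HX T \<and> (\<forall>h\<in>vecs HX. \<forall>k\<in>vecs HX. ip HX (T h) k = pint X f h k)"
proof -
  obtain C where C: "C \<ge> 0" "\<forall>\<omega>\<in>space MX. cmod (f \<omega>) \<le> C" using bdd_meas_bound[OF f] by auto
  have ae: "pvm_AE X (\<lambda>\<omega>. cmod (f \<omega>) \<le> C)" using C by (intro pvm_AE_I) auto
  show ?thesis
    by (rule sesquilinear_op[OF hilbert_space_axioms hilbert_space_axioms, where C="2 * C"])
      (use f ae C(1) in \<open>simp_all add: pint_add_left pint_add_right pint_scaleC_left pint_scaleC_right pint_bound\<close>)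
qed

text \<open>The value does not depend on the four measures used to write the complex measure: any
  such choice gives a \<open>bfun\<close> with the same values on indicators.\<close>

lemma cmeasure_integral_pint:
  assumes "has_cmeasure_integral MX (\<lambda>G. ip HX (prj X G h) k) g z" and g: "g \<in> bdd_meas MX"
    and h: "h \<in> vecs HX" and k: "k \<in> vecs HX"
  shows "z = pint X g h k"
proof -
  obtain \<mu> where \<mu>: "\<And>p. p < (4::nat) \<Longrightarrow> finite_measure (\<mu> p)" "\<And>p. p < 4 \<Longrightarrow> sets (\<mu> p) = sets MX"
    "\<And>G. G \<in> sets MX \<Longrightarrow> ip HX (prj X G h) k = (\<Sum>p<4. \<i> ^ p * of_real (measure (\<mu> p) G))"
    and z: "z = cint \<mu> g"
    using assms(1) unfolding has_cmeasure_integral_def cint_def by blast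
  show ?thesis unfolding z
    by (rule bfun_eqI[OF bfun_cint[OF \<mu>(1,2)] bfun_pint[OF h k] _ g])
      (simp_all add: cint_indicator[OF \<mu>(1,2)] pint_indicator h k \<mu>(3))
qed

lemma has_cmeasure_integral_pint:
  assumes g: "g \<in> bdd_meas MX" and h: "h \<in> vecs HX" and k: "k \<in> vecs HX"
  shows "has_cmeasure_integral MX (\<lambda>G. ip HX (prj X G h) k) g (pint X g h k)"
  unfolding has_cmeasure_integral_def pint_def cint_def
proof (intro exI[of _ "\<lambda>p. pmu X (pol p h k)"] conjI allI impI ballI refl)
  fix p :: nat
  have z: "pol p h k \<in> vecs HX" using h k by (rule pol_mem)
  show "finite_measure (pmu X (pol p h k))" using z by (rule finite_measure_pmu)
  show "sets (pmu X (pol p h k)) = sets MX" by (rule sets_pmu)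
  show "integrable (pmu X (pol p h k)) g" using bdd_meas_integrable[OF finite_measure_pmu[OF z] sets_pmu g] .
next
  fix G assume "G \<in> sets MX"
  then show "ip HX (prj X G h) k = (\<Sum>p<4. \<i> ^ p * of_real (measure (pmu X (pol p h k)) G))"
    using pol_measure h k by simp
qed

text \<open>Opens the \<open>SOME\<close> of \<open>pvm_int\<close>. The bounded representative
  hidden in it is unknown, but it agrees almost everywhere with any given one, and
  \<open>pint\<close> cannot tell them apart.\<close>

lemma pvm_int_char:
  assumes "f \<in> Linf X"
  shows "bounded_op HX HX (pvm_int X f)"
    and "\<And>g h k. \<lbrakk>g \<in> bdd_meas MX; pvm_AE X (\<lambda>\<omega>. f \<omega> = g \<omega>); h \<in> vecs HX; k \<in> vecs HX\<rbrakk>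
      \<Longrightarrow> ip HX (pvm_int X f h) k = pint X g h k"
proof -
  let ?P = "\<lambda>T. bounded_op HX HX T \<and>
     (\<exists>g\<in>bdd_meas MX. pvm_AE X (\<lambda>\<omega>. f \<omega> = g \<omega>) \<and>
        (\<forall>h\<in>vecs HX. \<forall>k\<in>vecs HX. has_cmeasure_integral MX (\<lambda>G. ip HX (prj X G h) k) g (ip HX (T h) k)))"
  obtain g where g: "g \<in> bdd_meas MX" "pvm_AE X (\<lambda>\<omega>. f \<omega> = g \<omega>)" using assms by (auto simp: Linf_def)
  obtain T where T: "bounded_op HX HX T" "\<forall>h\<in>vecs HX. \<forall>k\<in>vecs HX. ip HX (T h) k = pint X g h k"
    using ex_pint_op[OF g(1)] by auto
  have "?P T" using T g has_cmeasure_integral_pint[OF g(1)] by auto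
  then have P: "?P (pvm_int X f)" unfolding pvm_int_def by (rule someI[where P="?P"])
  then show "bounded_op HX HX (pvm_int X f)" by blast
  obtain g' where g': "g' \<in> bdd_meas MX" "pvm_AE X (\<lambda>\<omega>. f \<omega> = g' \<omega>)"
    and int: "\<And>h k. \<lbrakk>h \<in> vecs HX; k \<in> vecs HX\<rbrakk> \<Longrightarrow> has_cmeasure_integral MX (\<lambda>G. ip HX (prj X G h) k) g' (ip HX (pvm_int X f h) k)"
    using P by blast
  fix g h k assume g: "g \<in> bdd_meas MX" "pvm_AE X (\<lambda>\<omega>. f \<omega> = g \<omega>)" and h: "h \<in> vecs HX" and k: "k \<in> vecs HX"
  have "ip HX (pvm_int X f h) k = pint X g' h k"
    using cmeasure_integral_pint[OF int[OF h k] g'(1) h k] .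
  also have "\<dots> = pint X g h k"
    using g g' h k by (intro pint_cong_AE bdd_meas_measurable) (auto elim: pvm_AE_mp2)
  finally show "ip HX (pvm_int X f h) k = pint X g h k" .
qed

lemma pvm_int_mem: "\<lbrakk>f \<in> Linf X; h \<in> vecs HX\<rbrakk> \<Longrightarrow> pvm_int X f h \<in> vecs HX"
  using pvm_int_char(1) bounded_op_mem by blast

lemma bdd_meas_Linf: "f \<in> bdd_meas MX \<Longrightarrow> f \<in> Linf X"
  unfolding Linf_def by (auto intro!: bexI[of _ f] pvm_AE_I)

text \<open>An \<open>Inf\<close> of reals says something only for a nonempty set. The second
  alternative confines the claim to measurable \<open>f\<close>, whose level sets belong to the
  sigma algebra.\<close>

lemma Linf_norm_set:
  assumes "f \<in> Linf X"
  shows "{c. 0 \<le> c \<and> pvm_null X {\<omega>\<in>space MX. c < cmod (f \<omega>)}} \<noteq> {} \<or> f \<notin> borel_measurable MX"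
proof (cases "f \<in> borel_measurable MX")
  case True
  note [measurable] = True
  obtain g where g: "g \<in> bdd_meas MX" "pvm_AE X (\<lambda>\<omega>. f \<omega> = g \<omega>)" using assms by (auto simp: Linf_def)
  obtain C where C: "C \<ge> 0" "\<forall>\<omega>\<in>space MX. cmod (g \<omega>) \<le> C" using bdd_meas_bound[OF g(1)] by auto
  obtain N where N: "N \<in> sets MX" "pvm_null X N" "{\<omega>\<in>space MX. \<not> f \<omega> = g \<omega>} \<subseteq> N" using g(2) by (auto simp: pvm_AE_def)
  have "{\<omega>\<in>space MX. C < cmod (f \<omega>)} \<subseteq> N" using N(3) C(2) by force
  then have "pvm_null X {\<omega>\<in>space MX. C < cmod (f \<omega>)}" using pvm_null_subset[OF N(2,1)] by auto
  then show ?thesis using C(1) by auto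
qed simp

lemma Linf_norm_nonneg:
  assumes "f \<in> Linf_meas X" shows "0 \<le> Linf_norm X f"
  unfolding Linf_norm_def using Linf_norm_set[of f] assms by (intro cInf_greatest) (auto simp: Linf_meas_def)

lemma Linf_norm_le:
  assumes "0 \<le> c" "pvm_AE X (\<lambda>\<omega>. cmod (f \<omega>) \<le> c)" "f \<in> borel_measurable MX"
  shows "Linf_norm X f \<le> c"
  unfolding Linf_norm_def
proof (rule cInf_lower)
  note [measurable] = assms(3)
  obtain N where N: "N \<in> sets MX" "pvm_null X N" "{\<omega>\<in>space MX. \<not> cmod (f \<omega>) \<le> c} \<subseteq> N" using assms(2) by (auto simp: pvm_AE_def)
  have "{\<omega>\<in>space MX. c < cmod (f \<omega>)} \<subseteq> N" using N(3) by force
  then have "pvm_null X {\<omega>\<in>space MX. c < cmod (f \<omega>)}" using pvm_null_subset[OF N(2,1)] by auto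
  then show "c \<in> {c. 0 \<le> c \<and> pvm_null X {\<omega>\<in>space MX. c < cmod (f \<omega>)}}" using assms(1) by simp
qed (auto intro!: bdd_belowI[of _ 0])

text \<open>The infimum is attained: the set where it is exceeded is the countable union of the null
  sets where it is exceeded by 1/(n+1).\<close>

lemma Linf_norm_AE:
  assumes "f \<in> Linf_meas X"
  shows "pvm_AE X (\<lambda>\<omega>. cmod (f \<omega>) \<le> Linf_norm X f)"
proof -
  have m [measurable]: "f \<in> borel_measurable MX" using assms by (simp add: Linf_meas_def)
  define D where "D = {c. 0 \<le> c \<and> pvm_null X {\<omega>\<in>space MX. c < cmod (f \<omega>)}}"
  have ne: "D \<noteq> {}" using Linf_norm_set[of f] assms by (simp add: Linf_meas_def D_def)
  have eq: "Linf_norm X f = Inf D" by (simp add: Linf_norm_def D_def)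
  define N where "N n = {\<omega>\<in>space MX. Linf_norm X f + 1 / real (Suc n) < cmod (f \<omega>)}" for n
  have N: "N n \<in> sets MX" for n unfolding N_def by measurable
  have "pvm_null X (N n)" for n
  proof -
    have "Inf D < Linf_norm X f + 1 / real (Suc n)" unfolding eq by simp
    then obtain c where c: "c \<in> D" "c < Linf_norm X f + 1 / real (Suc n)" using cInf_lessD[OF ne] by blast
    then have "N n \<subseteq> {\<omega>\<in>space MX. c < cmod (f \<omega>)}" by (auto simp: N_def)
    then show ?thesis using c(1) N pvm_null_subset[of "{\<omega>\<in>space MX. c < cmod (f \<omega>)}" "N n"] by (simp add: D_def)
  qed
  then have "pvm_null X (\<Union>n. N n)" using pvm_null_UN N by blast
  moreover have "{\<omega>\<in>space MX. \<not> cmod (f \<omega>) \<le> Linf_norm X f} \<subseteq> (\<Union>n. N n)"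
  proof
    fix \<omega> assume "\<omega> \<in> {\<omega>\<in>space MX. \<not> cmod (f \<omega>) \<le> Linf_norm X f}"
    then have w: "\<omega> \<in> space MX" "0 < cmod (f \<omega>) - Linf_norm X f" by auto
    obtain n where "1 / real (Suc n) < cmod (f \<omega>) - Linf_norm X f" using nat_approx_posE[OF w(2)] by blast
    then have "\<omega> \<in> N n" using w(1) by (simp add: N_def)
    then show "\<omega> \<in> (\<Union>n. N n)" by blast
  qed
  ultimately show ?thesis unfolding pvm_AE_def using N by (intro bexI[of _ "\<Union>n. N n"]) auto
qed

lemma Linf_trunc:
  assumes "f \<in> Linf_meas X"
  shows "\<exists>g\<in>bdd_meas MX. pvm_AE X (\<lambda>\<omega>. f \<omega> = g \<omega>) \<and> (\<forall>\<omega>\<in>space MX. cmod (g \<omega>) \<le> Linf_norm X f)"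
proof -
  have [measurable]: "f \<in> borel_measurable MX" using assms by (simp add: Linf_meas_def)
  define g where "g \<omega> = (if cmod (f \<omega>) \<le> Linf_norm X f then f \<omega> else 0)" for \<omega>
  have b: "cmod (g \<omega>) \<le> Linf_norm X f" for \<omega> using Linf_norm_nonneg[OF assms] by (simp add: g_def)
  have "g \<in> borel_measurable MX" unfolding g_def by measurable
  then have "g \<in> bdd_meas MX" using b by (rule bdd_measI)
  moreover have "pvm_AE X (\<lambda>\<omega>. f \<omega> = g \<omega>)" by (rule pvm_AE_mp[OF Linf_norm_AE[OF assms]]) (simp add: g_def)
  ultimately show ?thesis using b by blast
qed

lemma pvm_int_ip:
  assumes "f \<in> Linf_meas X" "h \<in> vecs HX" "k \<in> vecs HX"
  shows "ip HX (pvm_int X f h) k = pint X f h k"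
proof -
  have f: "f \<in> Linf X" "f \<in> borel_measurable MX" using assms by (auto simp: Linf_meas_def)
  obtain g where g: "g \<in> bdd_meas MX" "pvm_AE X (\<lambda>\<omega>. f \<omega> = g \<omega>)" using Linf_trunc[OF assms(1)] by auto
  have "ip HX (pvm_int X f h) k = pint X g h k" using pvm_int_char(2)[OF f(1) g assms(2,3)] .
  also have "\<dots> = pint X f h k"
    by (rule pint_cong_AE[symmetric]) (use f g assms bdd_meas_measurable in auto)
  finally show ?thesis .
qed

text \<open>Apply \<open>pint_bound\<close> with the image vector itself as second argument and
  cancel one factor. The truncated representative turns the essential bound into a pointwise
  one.\<close>

lemma pvm_int_norm:
  assumes f: "f \<in> Linf_meas X" and h: "h \<in> vecs HX"
  shows "hnorm HX (pvm_int X f h) \<le> 2 * Linf_norm X f * hnorm HX h"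
proof (cases "hnorm HX (pvm_int X f h) = 0")
  case True
  then show ?thesis using Linf_norm_nonneg[OF f] h by simp
next
  case False
  define y where "y = pvm_int X f h"
  have fL: "f \<in> Linf X" using f by (auto simp: Linf_meas_def)
  have y: "y \<in> vecs HX" unfolding y_def using fL h by (rule pvm_int_mem)
  obtain g where g: "g \<in> bdd_meas MX" "pvm_AE X (\<lambda>\<omega>. f \<omega> = g \<omega>)" "\<forall>\<omega>\<in>space MX. cmod (g \<omega>) \<le> Linf_norm X f"
    using Linf_trunc[OF f] by auto
  have "hnorm HX y * hnorm HX y = cmod (ip HX y y)" by (simp add: ip_self[OF y] norm_power power2_eq_square norm_mult)
  also have "ip HX y y = pint X g h y" unfolding y_def by (rule pvm_int_char(2)[OF fL g(1,2) h y[unfolded y_def]])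
  also have "cmod \<dots> \<le> (2 * Linf_norm X f * hnorm HX h) * hnorm HX y"
    using g Linf_norm_nonneg[OF f] h y by (intro pint_bound pvm_AE_I) auto
  finally show ?thesis using False hnorm_nonneg[OF y] unfolding y_def[symmetric] by (simp add: mult_le_cancel_right)
qed

lemma Linf_measI: "\<lbrakk>f \<in> borel_measurable MX; 0 \<le> c; pvm_AE X (\<lambda>\<omega>. cmod (f \<omega>) \<le> c)\<rbrakk> \<Longrightarrow> f \<in> Linf_meas X"
proof -
  assume [measurable]: "f \<in> borel_measurable MX" and c: "0 \<le> c" and ae: "pvm_AE X (\<lambda>\<omega>. cmod (f \<omega>) \<le> c)"
  define g where "g \<omega> = (if cmod (f \<omega>) \<le> c then f \<omega> else 0)" for \<omega>
  have "g \<in> borel_measurable MX" unfolding g_def by measurable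
  then have "g \<in> bdd_meas MX" by (rule bdd_measI[where C=c]) (simp add: g_def c)
  moreover have "pvm_AE X (\<lambda>\<omega>. f \<omega> = g \<omega>)" by (rule pvm_AE_mp[OF ae]) (simp add: g_def)
  ultimately show ?thesis by (auto simp: Linf_meas_def Linf_def)
qed

lemma Linf_mult_AE:
  assumes f: "f \<in> Linf_meas X" and g: "g \<in> Linf_meas X"
  shows "pvm_AE X (\<lambda>\<omega>. cmod (f \<omega> * g \<omega>) \<le> Linf_norm X f * Linf_norm X g)"
  by (rule pvm_AE_mp2[OF Linf_norm_AE[OF f] Linf_norm_AE[OF g]])
    (simp add: norm_mult mult_mono Linf_norm_nonneg[OF f])

lemma Linf_meas_mult:
  assumes f: "f \<in> Linf_meas X" and g: "g \<in> Linf_meas X"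
  shows "(\<lambda>\<omega>. f \<omega> * g \<omega>) \<in> Linf_meas X"
    and "Linf_norm X (\<lambda>\<omega>. f \<omega> * g \<omega>) \<le> Linf_norm X f * Linf_norm X g"
proof -
  have [measurable]: "f \<in> borel_measurable MX" "g \<in> borel_measurable MX" using assms by (auto simp: Linf_meas_def)
  show "(\<lambda>\<omega>. f \<omega> * g \<omega>) \<in> Linf_meas X"
    by (rule Linf_measI[OF _ _ Linf_mult_AE[OF f g]]) (auto simp: Linf_norm_nonneg f g)
  show "Linf_norm X (\<lambda>\<omega>. f \<omega> * g \<omega>) \<le> Linf_norm X f * Linf_norm X g"
    by (rule Linf_norm_le[OF _ Linf_mult_AE[OF f g]]) (auto simp: Linf_norm_nonneg f g)
qed

text \<open>Two applications of \<open>bfun_eqI\<close>, first in \<open>f\<close>, then in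
  \<open>g\<close>, reduce the claim to indicators of \<open>A\<close> and \<open>B\<close>, where
  it is \<open>prj_Int\<close>.\<close>

lemma pint_mult:
  assumes f: "f \<in> bdd_meas MX" and g: "g \<in> bdd_meas MX" and h: "h \<in> vecs HX" and k: "k \<in> vecs HX"
  shows "pint X f (pvm_int X g h) k = pint X (\<lambda>\<omega>. f \<omega> * g \<omega>) h k"
proof (rule bfun_eqI[OF _ _ _ f])
  have gL: "g \<in> Linf X" using g by (rule bdd_meas_Linf)
  have gh: "pvm_int X g h \<in> vecs HX" using gL h by (rule pvm_int_mem)
  show "bfun MX (\<lambda>f. pint X f (pvm_int X g h) k)" using gh k by (rule bfun_pint)
  show "bfun MX (\<lambda>f. pint X (\<lambda>\<omega>. f \<omega> * g \<omega>) h k)" using bfun_mult[OF bfun_pint[OF h k] g] .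
  fix A assume A: "A \<in> sets MX"
  have "pint X (indicator A) (pvm_int X g h) k = ip HX (pvm_int X g h) (prj X A k)"
    using A gh k by (simp add: pint_indicator selfadj)
  also have "\<dots> = pint X g h (prj X A k)"
    using g h prj_mem[OF A k] by (intro pvm_int_char(2)[OF gL]) (auto intro: pvm_AE_I)
  also have "\<dots> = pint X (\<lambda>\<omega>. g \<omega> * indicator A \<omega>) h k"
  proof (rule bfun_eqI[OF _ _ _ g])
    show "bfun MX (\<lambda>g. pint X g h (prj X A k))" using h prj_mem[OF A k] by (rule bfun_pint)
    show "bfun MX (\<lambda>g. pint X (\<lambda>\<omega>. g \<omega> * indicator A \<omega>) h k)"
      using bfun_mult[OF bfun_pint[OF h k] bdd_meas_indicator[OF A]] .
    fix B assume B: "B \<in> sets MX"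
    have AB: "A \<inter> B \<in> sets MX" using A B by blast
    have "pint X (indicator B) h (prj X A k) = ip HX (prj X A (prj X B h)) k"
      using A B h k by (simp add: pint_indicator prj_mem selfadj)
    also have "\<dots> = pint X (indicator (A \<inter> B)) h k"
      unfolding prj_Int[OF A B h] pint_indicator[OF AB h k] ..
    also have "indicator (A \<inter> B) = (\<lambda>\<omega>. indicator B \<omega> * indicator A \<omega> :: complex)"
      by (auto simp: indicator_def fun_eq_iff)
    finally show "pint X (indicator B) h (prj X A k) = pint X (\<lambda>\<omega>. indicator B \<omega> * indicator A \<omega>) h k" .
  qed
  finally show "pint X (indicator A) (pvm_int X g h) k = pint X (\<lambda>\<omega>. indicator A \<omega> * g \<omega>) h k"
    by (simp add: mult.commute)
qed

lemma pvm_int_cong: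
  assumes "f \<in> Linf X" "g \<in> Linf X" "pvm_AE X (\<lambda>\<omega>. f \<omega> = g \<omega>)" "h \<in> vecs HX"
  shows "pvm_int X f h = pvm_int X g h"
proof (rule vec_eqI)
  obtain g' where g': "g' \<in> bdd_meas MX" "pvm_AE X (\<lambda>\<omega>. g \<omega> = g' \<omega>)" using assms by (auto simp: Linf_def)
  have "pvm_AE X (\<lambda>\<omega>. f \<omega> = g' \<omega>)" by (rule pvm_AE_mp2[OF assms(3) g'(2)]) simp
  then show "ip HX (pvm_int X f h) k = ip HX (pvm_int X g h) k" if "k \<in> vecs HX" for k
    using pvm_int_char(2)[OF assms(1) g'(1)] pvm_int_char(2)[OF assms(2) g'] assms(4) that by simp
qed (use assms pvm_int_mem in auto)

lemma pvm_int_mult: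
  assumes f: "f \<in> Linf_meas X" and g: "g \<in> Linf_meas X" and h: "h \<in> vecs HX"
  shows "pvm_int X (\<lambda>\<omega>. f \<omega> * g \<omega>) h = pvm_int X f (pvm_int X g h)"
proof (rule vec_eqI)
  have fg: "f \<in> Linf X" "g \<in> Linf X" "(\<lambda>\<omega>. f \<omega> * g \<omega>) \<in> Linf X"
    using f g Linf_meas_mult(1)[OF f g] by (auto simp: Linf_meas_def)
  show "pvm_int X (\<lambda>\<omega>. f \<omega> * g \<omega>) h \<in> vecs HX" "pvm_int X f (pvm_int X g h) \<in> vecs HX"
    using fg h by (auto intro!: pvm_int_mem)
  fix k assume k: "k \<in> vecs HX"
  obtain f' where f': "f' \<in> bdd_meas MX" "pvm_AE X (\<lambda>\<omega>. f \<omega> = f' \<omega>)" using Linf_trunc[OF f] by auto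
  obtain g' where g': "g' \<in> bdd_meas MX" "pvm_AE X (\<lambda>\<omega>. g \<omega> = g' \<omega>)" using Linf_trunc[OF g] by auto
  have "ip HX (pvm_int X (\<lambda>\<omega>. f \<omega> * g \<omega>) h) k = pint X (\<lambda>\<omega>. f' \<omega> * g' \<omega>) h k"
    using f' g' h k by (intro pvm_int_char(2)[OF fg(3)] bdd_meas_mult) (auto elim: pvm_AE_mp2)
  also have "\<dots> = pint X f' (pvm_int X g' h) k" by (rule pint_mult[OF f'(1) g'(1) h k, symmetric])
  also have "pvm_int X g' h = pvm_int X g h"
    by (intro pvm_int_cong[symmetric] fg g' h bdd_meas_Linf[OF g'(1)])
  also have "pint X f' (pvm_int X g h) k = ip HX (pvm_int X f (pvm_int X g h)) k"
    using pvm_int_char(2)[OF fg(1) f' pvm_int_mem[OF fg(2) h] k] by simp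
  finally show "ip HX (pvm_int X (\<lambda>\<omega>. f \<omega> * g \<omega>) h) k = ip HX (pvm_int X f (pvm_int X g h)) k" .
qed

lemma Linf_meas_const: "(\<lambda>_. c) \<in> Linf_meas X"
  unfolding Linf_meas_def using bdd_meas_Linf[OF bdd_meas_const] by simp

lemma Linf_norm_const: "Linf_norm X (\<lambda>_. c) \<le> cmod c"
  by (rule Linf_norm_le) (auto intro: pvm_AE_I)

text \<open>A scalar is a constant function, so this is multiplicativity together with the fact that
  constants integrate to multiples of the identity.\<close>

lemma pvm_int_cmult:
  assumes f: "f \<in> Linf_meas X" and h: "h \<in> vecs HX"
  shows "pvm_int X (\<lambda>\<omega>. c * f \<omega>) h = c *\<^sub>C pvm_int X f h"
proof -
  have fL: "f \<in> Linf X" using f by (auto simp: Linf_meas_def)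
  have y: "pvm_int X f h \<in> vecs HX" using fL h by (rule pvm_int_mem)
  have "pvm_int X (\<lambda>_. c) y = c *\<^sub>C y" if y: "y \<in> vecs HX" for y
  proof (rule vec_eqI)
    show "pvm_int X (\<lambda>_. c) y \<in> vecs HX" using y bdd_meas_Linf[OF bdd_meas_const] by (intro pvm_int_mem)
    show "c *\<^sub>C y \<in> vecs HX" using y by (rule scaleC_mem)
    fix k assume k: "k \<in> vecs HX"
    have "pint X (\<lambda>_. c) y k = pint X (\<lambda>\<omega>. c * indicator (space MX) \<omega>) y k"
      using y k by (intro pint_cong_AE) (auto intro!: pvm_AE_I)
    also have "\<dots> = c * ip HX y k"
      using bfunD(2)[OF bfun_pint[OF y k] bdd_meas_indicator[OF sets.top], of c] y k by (simp add: pint_indicator total)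
    finally show "ip HX (pvm_int X (\<lambda>_. c) y) k = ip HX (c *\<^sub>C y) k"
      using y k by (simp add: pvm_int_ip Linf_meas_const ip_scaleC)
  qed
  then show ?thesis using pvm_int_mult[OF Linf_meas_const f h] y by simp
qed

end

section \<open>Tensor products of Hilbert spaces\<close>

lemma sum_fun_apply: "(\<Sum>i\<in>A. f i) x = (\<Sum>i\<in>A. f i x :: 'b::comm_monoid_add)"
  by (induction A rule: infinite_finite_induct) simp_all

lemma summable_on_norm_dominated:
  fixes f :: "'a \<Rightarrow> 'b::banach" and g :: "'a \<Rightarrow> real"
  assumes "g summable_on A" "\<And>x. x \<in> A \<Longrightarrow> norm (f x) \<le> g x"
  shows "(\<lambda>x. norm (f x)) summable_on A" "f summable_on A"
proof -
  have "norm (g x) = g x" if "x \<in> A" for x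
    using assms(2)[OF that] norm_ge_zero[of "f x"] by (simp add: order_trans[OF norm_ge_zero])
  then have "(\<lambda>x. norm (g x)) summable_on A \<longleftrightarrow> g summable_on A" by (intro summable_on_cong)
  then have "(\<lambda>x. norm (g x)) summable_on A" using assms(1) by simp
  moreover have "norm (f x) \<le> norm (g x)" if "x \<in> A" for x using assms(2)[OF that] by simp
  ultimately show 1: "(\<lambda>x. norm (f x)) summable_on A" by (rule Infinite_Sum.abs_summable_on_comparison_test)
  then show "f summable_on A" by (rule abs_summable_summable)
qed

text \<open>Square summable families on \<open>J\<close>. They are functions on the whole type and
  must vanish off \<open>J\<close>, since otherwise the inner product would not be definite.\<close>

definition l2 :: "'j set \<Rightarrow> ('j \<Rightarrow> complex) hspace" where
  "l2 J = \<lparr>vecs = {F. (\<forall>j. j \<notin> J \<longrightarrow> F j = 0) \<and> (\<lambda>j. (cmod (F j))\<^sup>2) summable_on J},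
     ip = \<lambda>F G. \<Sum>\<^sub>\<infinity>j\<in>J. F j * cnj (G j)\<rparr>"

lemma l2_mem: "F \<in> vecs (l2 J) \<longleftrightarrow> (\<forall>j. j \<notin> J \<longrightarrow> F j = 0) \<and> (\<lambda>j. (cmod (F j))\<^sup>2) summable_on J"
  and l2_ip: "ip (l2 J) F G = (\<Sum>\<^sub>\<infinity>j\<in>J. F j * cnj (G j))"
  by (simp_all add: l2_def)

lemma l2_memI:
  assumes "\<And>j. j \<notin> J \<Longrightarrow> F j = 0" "\<And>B. \<lbrakk>finite B; B \<subseteq> J\<rbrakk> \<Longrightarrow> (\<Sum>j\<in>B. (cmod (F j))\<^sup>2) \<le> C"
  shows "F \<in> vecs (l2 J)" "(\<Sum>\<^sub>\<infinity>j\<in>J. (cmod (F j))\<^sup>2) \<le> C"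
proof -
  have "(\<lambda>j. (cmod (F j))\<^sup>2) summable_on J"
    using assms(2) by (intro nonneg_bdd_above_summable_on) (auto intro!: bdd_aboveI[where M=C])
  then show "F \<in> vecs (l2 J)" "(\<Sum>\<^sub>\<infinity>j\<in>J. (cmod (F j))\<^sup>2) \<le> C"
    using assms by (auto simp: l2_mem intro!: infsum_le_finite_sums)
qed

lemma l2_mult_summable:
  assumes "F \<in> vecs (l2 J)" "G \<in> vecs (l2 J)"
  shows "(\<lambda>j. F j * cnj (G j)) summable_on J"
proof (rule summable_on_norm_dominated(2))
  show "(\<lambda>j. (cmod (F j))\<^sup>2 + (cmod (G j))\<^sup>2) summable_on J"
    using assms by (intro summable_on_add) (auto simp: l2_mem)
  fix j
  have "2 * (cmod (F j) * cmod (G j)) \<le> (cmod (F j))\<^sup>2 + (cmod (G j))\<^sup>2"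
    using zero_le_power2[of "cmod (F j) - cmod (G j)"] by (simp add: power2_diff)
  moreover have "0 \<le> cmod (F j) * cmod (G j)" by simp
  ultimately have "cmod (F j) * cmod (G j) \<le> (cmod (F j))\<^sup>2 + (cmod (G j))\<^sup>2" by linarith
  then show "cmod (F j * cnj (G j)) \<le> (cmod (F j))\<^sup>2 + (cmod (G j))\<^sup>2" by (simp add: norm_mult)
qed

lemma l2_add: assumes "F \<in> vecs (l2 J)" "G \<in> vecs (l2 J)" shows "F + G \<in> vecs (l2 J)"
proof -
  have "(\<lambda>j. (cmod (F j + G j))\<^sup>2) summable_on J"
  proof (rule summable_on_norm_dominated(2))
    show "(\<lambda>j. 2 * (cmod (F j))\<^sup>2 + 2 * (cmod (G j))\<^sup>2) summable_on J"
      using assms by (intro summable_on_add summable_on_cmult_right) (auto simp: l2_mem)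
    fix j
    have "(cmod (F j + G j))\<^sup>2 \<le> (cmod (F j) + cmod (G j))\<^sup>2"
      by (intro power_mono norm_triangle_ineq) auto
    also have "\<dots> \<le> 2 * (cmod (F j))\<^sup>2 + 2 * (cmod (G j))\<^sup>2"
      using zero_le_power2[of "cmod (F j) - cmod (G j)"] by (simp add: power2_diff power2_sum)
    finally show "norm ((cmod (F j + G j))\<^sup>2) \<le> 2 * (cmod (F j))\<^sup>2 + 2 * (cmod (G j))\<^sup>2" by simp
  qed
  then show ?thesis using assms by (simp add: l2_mem)
qed

lemma l2_ip_self:
  assumes "F \<in> vecs (l2 J)"
  shows "ip (l2 J) F F = of_real (\<Sum>\<^sub>\<infinity>j\<in>J. (cmod (F j))\<^sup>2)"
proof -
  have "((\<lambda>j. (cmod (F j))\<^sup>2) has_sum (\<Sum>\<^sub>\<infinity>j\<in>J. (cmod (F j))\<^sup>2)) J"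
    using assms by (intro has_sum_infsum) (simp add: l2_mem)
  then have "((\<lambda>j. complex_of_real ((cmod (F j))\<^sup>2)) has_sum of_real (\<Sum>\<^sub>\<infinity>j\<in>J. (cmod (F j))\<^sup>2)) J"
    by (rule has_sum_of_real)
  then show ?thesis unfolding l2_ip complex_norm_square[symmetric] by (rule infsumI)
qed

lemma l2_hnorm:
  assumes "F \<in> vecs (l2 J)"
  shows "hnorm (l2 J) F = sqrt (\<Sum>\<^sub>\<infinity>j\<in>J. (cmod (F j))\<^sup>2)"
  unfolding hnorm_def l2_ip_self[OF assms] by simp

lemma l2_finite_sum_le:
  assumes F: "F \<in> vecs (l2 J)" and B: "finite B" "B \<subseteq> J"
  shows "(\<Sum>j\<in>B. (cmod (F j))\<^sup>2) \<le> (hnorm (l2 J) F)\<^sup>2"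
proof -
  have "(\<Sum>j\<in>B. (cmod (F j))\<^sup>2) \<le> (\<Sum>\<^sub>\<infinity>j\<in>J. (cmod (F j))\<^sup>2)"
    using F B by (intro finite_sum_le_infsum) (auto simp: l2_mem)
  moreover have "(\<Sum>\<^sub>\<infinity>j\<in>J. (cmod (F j))\<^sup>2) \<ge> 0" by (intro infsum_nonneg) simp
  ultimately show ?thesis by (simp add: l2_hnorm[OF F])
qed

lemma hilbert_space_l2: "hilbert_space (l2 J)"
proof
  show "0 \<in> vecs (l2 J)" by (simp add: l2_mem zero_fun_def)
  show add: "x + y \<in> vecs (l2 J)" if "x \<in> vecs (l2 J)" "y \<in> vecs (l2 J)" for x y using that by (rule l2_add)
  show scale: "c *\<^sub>C x \<in> vecs (l2 J)" if "x \<in> vecs (l2 J)" for x c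
    using that by (auto simp: l2_mem scaleC_fun_def scaleC_complex_def norm_mult power_mult_distrib intro: summable_on_cmult_right)
  show "ip (l2 J) (x + y) z = ip (l2 J) x z + ip (l2 J) y z"
    if "x \<in> vecs (l2 J)" "y \<in> vecs (l2 J)" "z \<in> vecs (l2 J)" for x y z
    unfolding l2_ip using infsum_add[OF l2_mult_summable[OF that(1,3)] l2_mult_summable[OF that(2,3)]]
    by (simp add: distrib_right)
  show "ip (l2 J) (c *\<^sub>C x) y = c * ip (l2 J) x y" for x y c
    unfolding l2_ip by (simp add: scaleC_fun_def scaleC_complex_def mult.assoc infsum_cmult_right')
  show "ip (l2 J) y x = cnj (ip (l2 J) x y)" for x y
    unfolding l2_ip infsum_cnj[symmetric] by (simp add: mult.commute)
  show "0 \<le> Re (ip (l2 J) x x)" if "x \<in> vecs (l2 J)" for x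
    unfolding l2_ip_self[OF that] by (simp add: infsum_nonneg)
  show "x = 0" if x: "x \<in> vecs (l2 J)" and 0: "ip (l2 J) x x = 0" for x
  proof
    fix j show "x j = 0 j"
    proof (cases "j \<in> J")
      case True
      have "(cmod (x j))\<^sup>2 \<le> (hnorm (l2 J) x)\<^sup>2" using l2_finite_sum_le[OF x, of "{j}"] True by simp
      then show ?thesis using 0 by (simp add: hnorm_def)
    qed (use x in \<open>simp add: l2_mem\<close>)
  qed
  fix s :: "nat \<Rightarrow> 'a \<Rightarrow> complex"
  assume s: "\<And>n. s n \<in> vecs (l2 J)"
    and cau: "\<And>e. 0 < e \<Longrightarrow> \<exists>N. \<forall>m\<ge>N. \<forall>n\<ge>N. hnorm (l2 J) (s m - s n) < e"
  have diff: "s m - s n \<in> vecs (l2 J)" for m n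
  proof -
    have eq: "s m - s n = s m + (-1) *\<^sub>C s n" by (simp add: scaleC_minus1)
    show ?thesis unfolding eq by (intro add scale s)
  qed
  have "convergent (\<lambda>n. s n j)" if j: "j \<in> J" for j
  proof (rule Cauchy_convergent, rule metric_CauchyI)
    fix e :: real assume e: "0 < e"
    obtain N where N: "\<And>m n. \<lbrakk>m \<ge> N; n \<ge> N\<rbrakk> \<Longrightarrow> hnorm (l2 J) (s m - s n) < e" using cau[OF e] by blast
    have "dist (s m j) (s n j) < e" if "m \<ge> N" "n \<ge> N" for m n
    proof -
      have "(cmod ((s m - s n) j))\<^sup>2 \<le> (hnorm (l2 J) (s m - s n))\<^sup>2"
        using l2_finite_sum_le[OF diff[of m n], of "{j}"] j by simp
      moreover have "0 \<le> hnorm (l2 J) (s m - s n)" unfolding l2_hnorm[OF diff] by (simp add: infsum_nonneg)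
      ultimately have "cmod (s m j - s n j) \<le> hnorm (l2 J) (s m - s n)"
        using power2_le_imp_le by fastforce
      then show ?thesis using N[OF that] by (simp add: dist_norm)
    qed
    then show "\<exists>M. \<forall>m\<ge>M. \<forall>n\<ge>M. dist (s m j) (s n j) < e" by blast
  qed
  then have lim: "(\<lambda>n. s n j) \<longlonglongrightarrow> lim (\<lambda>n. s n j)" if "j \<in> J" for j
    using that convergent_LIMSEQ_iff by blast
  define F where "F j = (if j \<in> J then lim (\<lambda>n. s n j) else 0)" for j
  \<comment> \<open>The limit in \<open>m\<close> is taken inside finite partial sums, where it is
    termwise; only afterwards does the finite set grow.\<close>
  have key: "F - s n \<in> vecs (l2 J) \<and> (\<Sum>\<^sub>\<infinity>j\<in>J. (cmod ((F - s n) j))\<^sup>2) \<le> e\<^sup>2"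
    if e: "e > 0" and N: "\<And>m. m \<ge> N \<Longrightarrow> hnorm (l2 J) (s m - s n) < e" for e n N
  proof -
    have "(\<Sum>j\<in>B. (cmod ((F - s n) j))\<^sup>2) \<le> e\<^sup>2" if B: "finite B" "B \<subseteq> J" for B
    proof (rule LIMSEQ_le_const2)
      show "(\<lambda>m. \<Sum>j\<in>B. (cmod ((s m - s n) j))\<^sup>2) \<longlonglongrightarrow> (\<Sum>j\<in>B. (cmod ((F - s n) j))\<^sup>2)"
        using B lim by (intro tendsto_sum) (auto intro!: tendsto_intros simp: F_def)
      have "(\<Sum>j\<in>B. (cmod ((s m - s n) j))\<^sup>2) \<le> e\<^sup>2" if m: "m \<ge> N" for m
      proof -
        have "(\<Sum>j\<in>B. (cmod ((s m - s n) j))\<^sup>2) \<le> (hnorm (l2 J) (s m - s n))\<^sup>2"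
          using diff B by (rule l2_finite_sum_le)
        also have "\<dots> \<le> e\<^sup>2"
          using N[OF m] by (intro power_mono) (auto simp: l2_hnorm[OF diff] infsum_nonneg)
        finally show ?thesis .
      qed
      then show "\<exists>N. \<forall>m\<ge>N. (\<Sum>j\<in>B. (cmod ((s m - s n) j))\<^sup>2) \<le> e\<^sup>2" by blast
    qed
    moreover have "(F - s n) j = 0" if "j \<notin> J" for j using that s[of n] by (simp add: F_def l2_mem)
    ultimately show ?thesis using l2_memI[of J "F - s n" "e\<^sup>2"] by blast
  qed
  have minus: "s n - F \<in> vecs (l2 J) \<and> hnorm (l2 J) (s n - F) \<le> e"
    if e: "e > 0" and N: "\<And>m. m \<ge> N \<Longrightarrow> hnorm (l2 J) (s m - s n) < e" for e n N
  proof -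
    have k: "F - s n \<in> vecs (l2 J)" "(\<Sum>\<^sub>\<infinity>j\<in>J. (cmod ((F - s n) j))\<^sup>2) \<le> e\<^sup>2"
      using key[of e N n] e N by auto
    have m: "s n - F \<in> vecs (l2 J)" using scale[OF k(1), of "-1"] by (simp add: scaleC_minus1)
    have "(\<Sum>\<^sub>\<infinity>j\<in>J. (cmod ((s n - F) j))\<^sup>2) \<le> e\<^sup>2" using k(2) by (simp add: norm_minus_commute)
    then show ?thesis using m e by (simp add: l2_hnorm real_le_lsqrt)
  qed
  have "F \<in> vecs (l2 J)"
  proof -
    obtain N where N: "\<And>m. m \<ge> N \<Longrightarrow> hnorm (l2 J) (s m - s N) < 1" using cau[of 1] by auto
    have "F - s N \<in> vecs (l2 J)" using key[of 1 N N] N by auto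
    then show ?thesis using add[OF _ s[of N]] by fastforce
  qed
  moreover have "(\<lambda>n. hnorm (l2 J) (s n - F)) \<longlonglongrightarrow> 0"
  proof (rule LIMSEQ_I)
    fix r :: real assume "0 < r"
    then have r: "r / 2 > 0" by simp
    obtain N where N: "\<And>m n. \<lbrakk>m \<ge> N; n \<ge> N\<rbrakk> \<Longrightarrow> hnorm (l2 J) (s m - s n) < r / 2" using cau[OF r] by blast
    have "norm (hnorm (l2 J) (s n - F) - 0) < r" if n: "n \<ge> N" for n
    proof -
      have *: "s n - F \<in> vecs (l2 J)" "hnorm (l2 J) (s n - F) \<le> r / 2"
        using minus[OF r, of N n] N n by auto
      moreover have "0 \<le> hnorm (l2 J) (s n - F)" unfolding l2_hnorm[OF *(1)] by (simp add: infsum_nonneg)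
      ultimately show ?thesis using \<open>0 < r\<close> by simp
    qed
    then show "\<exists>N. \<forall>n\<ge>N. norm (hnorm (l2 J) (s n - F) - 0) < r" by blast
  qed
  ultimately show "\<exists>x\<in>vecs (l2 J). (\<lambda>n. hnorm (l2 J) (s n - x)) \<longlonglongrightarrow> 0" by blast
qed

text \<open>The coordinates of the elementary tensor of the \<open>x i\<close> with respect to the
  tensors of basis vectors, which are indexed by \<open>PiE I E\<close>.\<close>

definition tensor_vec :: "'i set \<Rightarrow> ('i \<Rightarrow> 'h hspace) \<Rightarrow> ('i \<Rightarrow> 'h set) \<Rightarrow> ('i \<Rightarrow> 'h) \<Rightarrow> ('i \<Rightarrow> 'h) \<Rightarrow> complex" where
  "tensor_vec I H E x = (\<lambda>e. if e \<in> PiE I E then \<Prod>i\<in>I. ip (H i) (x i) (e i) else 0)"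

text \<open>The inner product formula is Parseval in every factor combined with the expansion of a
  finite product of absolutely convergent sums. Density holds because the coordinate vectors of l2
  are themselves elementary tensors.\<close>

lemma hilbert_tensor_l2:
  fixes H :: "'i \<Rightarrow> 'h::complex_vector hspace"
  assumes fin: "finite I" and H: "\<And>i. i \<in> I \<Longrightarrow> hilbert_space (H i)" and E: "\<And>i. i \<in> I \<Longrightarrow> onb (H i) (E i)"
  shows "hilbert_tensor I H (l2 (PiE I E)) (tensor_vec I H E)"
proof -
  define J where "J = PiE I E"
  define \<iota> where "\<iota> = tensor_vec I H E"
  have EV: "e \<in> vecs (H i)" if "i \<in> I" "e \<in> E i" for i e using E[OF that(1)] that by (auto simp: onb_def orthonormal_def)
  have mem: "\<iota> x \<in> vecs (l2 J)" if x: "x \<in> (\<Pi>\<^sub>E i\<in>I. vecs (H i))" for x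
  proof (rule l2_memI)
    show "\<iota> x e = 0" if "e \<notin> J" for e using that by (simp add: \<iota>_def J_def tensor_vec_def)
    fix B assume B: "finite B" "B \<subseteq> J"
    define P where "P i = (\<lambda>e. e i) ` B" for i
    have PE: "P i \<subseteq> E i" if "i \<in> I" for i using B that by (auto simp: P_def J_def)
    have Pf: "finite (P i)" for i using B by (simp add: P_def)
    \<comment> \<open>The finite set \<open>B\<close> is enlarged to a finite box, over which the
      sum of products factorizes and Bessel's inequality applies in each factor.\<close>
    have "B \<subseteq> PiE I P" using B by (auto simp: P_def J_def PiE_iff)
    then have "(\<Sum>e\<in>B. (cmod (\<iota> x e))\<^sup>2) \<le> (\<Sum>e\<in>PiE I P. (cmod (\<iota> x e))\<^sup>2)"
      using fin Pf by (intro sum_mono2 finite_PiE) auto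
    also have "\<dots> = (\<Sum>e\<in>PiE I P. \<Prod>i\<in>I. (cmod (ip (H i) (x i) (e i)))\<^sup>2)"
    proof (rule sum.cong[OF refl])
      fix e assume "e \<in> PiE I P"
      then have "e \<in> PiE I E" using PE by (auto simp: PiE_iff)
      then show "(cmod (\<iota> x e))\<^sup>2 = (\<Prod>i\<in>I. (cmod (ip (H i) (x i) (e i)))\<^sup>2)"
        by (simp add: \<iota>_def tensor_vec_def prod_norm[symmetric] prod_power_distrib)
    qed
    also have "\<dots> = (\<Prod>i\<in>I. \<Sum>e\<in>P i. (cmod (ip (H i) (x i) e))\<^sup>2)"
      by (rule prod_sum_PiE[symmetric]) (use fin Pf in auto)
    also have "\<dots> \<le> (\<Prod>i\<in>I. (hnorm (H i) (x i))\<^sup>2)"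
    proof (rule prod_mono)
      fix i assume i: "i \<in> I"
      interpret hilbert_space "H i" using H i by simp
      have "orthonormal (H i) (P i)" using orthonormal_subset[OF _ PE[OF i]] E[OF i] by (simp add: onb_def)
      then have "(\<Sum>e\<in>P i. (cmod (ip (H i) (x i) e))\<^sup>2) \<le> (hnorm (H i) (x i))\<^sup>2"
        using Pf x i by (intro bessel) auto
      then show "0 \<le> (\<Sum>e\<in>P i. (cmod (ip (H i) (x i) e))\<^sup>2) \<and> (\<Sum>e\<in>P i. (cmod (ip (H i) (x i) e))\<^sup>2) \<le> (hnorm (H i) (x i))\<^sup>2"
        by (simp add: sum_nonneg)
    qed
    finally show "(\<Sum>e\<in>B. (cmod (\<iota> x e))\<^sup>2) \<le> (\<Prod>i\<in>I. (hnorm (H i) (x i))\<^sup>2)" .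
  qed
  have ips: "ip (l2 J) (\<iota> x) (\<iota> y) = (\<Prod>i\<in>I. ip (H i) (x i) (y i))"
    if x: "x \<in> (\<Pi>\<^sub>E i\<in>I. vecs (H i))" and y: "y \<in> (\<Pi>\<^sub>E i\<in>I. vecs (H i))" for x y
  proof -
    have hs: "((\<lambda>e. ip (H i) (x i) e * cnj (ip (H i) (y i) e)) has_sum ip (H i) (x i) (y i)) (E i)" if i: "i \<in> I" for i
    proof -
      interpret hilbert_space "H i" using H i by simp
      have xy: "x i \<in> vecs (H i)" "y i \<in> vecs (H i)" using x y i by auto
      have "cnj (ip (H i) (y i) e) = ip (H i) e (y i)" if "e \<in> E i" for e
        using ip_commute[OF xy(2) EV[OF i that]] by simp
      then show ?thesis using parseval[OF E[OF i] xy] by (subst has_sum_cong) auto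
    qed
    have "ip (l2 J) (\<iota> x) (\<iota> y) = (\<Sum>\<^sub>\<infinity>e\<in>PiE I E. \<Prod>i\<in>I. ip (H i) (x i) (e i) * cnj (ip (H i) (y i) (e i)))"
      unfolding l2_ip J_def by (rule infsum_cong) (simp add: \<iota>_def tensor_vec_def prod.distrib)
    also have "\<dots> = (\<Prod>i\<in>I. \<Sum>\<^sub>\<infinity>e\<in>E i. ip (H i) (x i) e * cnj (ip (H i) (y i) e))"
    proof (rule infsum_prod_PiE_abs[OF fin])
      fix i assume i: "i \<in> I"
      show "(\<lambda>e. norm (ip (H i) (x i) e * cnj (ip (H i) (y i) e))) summable_on E i"
        using has_sum_imp_summable[OF hs[OF i]] by (subst summable_on_iff_abs_summable_on_complex[symmetric])
    qed
    also have "\<dots> = (\<Prod>i\<in>I. ip (H i) (x i) (y i))"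
      using hs by (intro prod.cong refl infsumI) auto
    finally show ?thesis .
  qed
  have dense: "\<exists>(n::nat) c x. (\<forall>l<n. x l \<in> (\<Pi>\<^sub>E i\<in>I. vecs (H i))) \<and> hnorm (l2 J) (v - (\<Sum>l<n. c l *\<^sub>C \<iota> (x l))) < \<epsilon>"
    if v: "v \<in> vecs (l2 J)" and \<epsilon>: "\<epsilon> > 0" for v \<epsilon>
  proof -
    let ?s = "\<Sum>\<^sub>\<infinity>j\<in>J. (cmod (v j))\<^sup>2"
    have vs: "(\<lambda>j. (cmod (v j))\<^sup>2) summable_on J" using v by (simp add: l2_mem)
    then have "((\<lambda>j. (cmod (v j))\<^sup>2) has_sum ?s) J" by (rule has_sum_infsum)
    then have "\<forall>\<^sub>F B in finite_subsets_at_top J. dist (\<Sum>j\<in>B. (cmod (v j))\<^sup>2) ?s < \<epsilon>\<^sup>2"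
      unfolding has_sum_def using \<epsilon> by (intro tendstoD) auto
    then obtain B where B: "finite B" "B \<subseteq> J" "dist (\<Sum>j\<in>B. (cmod (v j))\<^sup>2) ?s < \<epsilon>\<^sup>2"
      unfolding eventually_finite_subsets_at_top by blast
    obtain x where x: "bij_betw x {..<card B} B"
      using ex_bij_betw_nat_finite[OF B(1)] by (auto simp: atLeast0LessThan)
    define q where "q = (\<Sum>l<card B. v (x l) *\<^sub>C \<iota> (x l))"
    \<comment> \<open>The tensor of basis vectors \<open>e\<close> is the coordinate vector at the
      index \<open>e\<close>.\<close>
    have \<delta>: "\<iota> e e' = (if e = e' then 1 else 0)" if e: "e \<in> J" for e e'
    proof (cases "e' \<in> J")
      case True
      have "\<iota> e e' = (\<Prod>i\<in>I. if e i = e' i then 1 else 0)"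
      proof -
        have "ip (H i) (e i) (e' i) = (if e i = e' i then 1 else 0)" if i: "i \<in> I" for i
        proof -
          have "e i \<in> E i" "e' i \<in> E i" using True e i by (auto simp: J_def)
          then show ?thesis using E[OF i] by (simp add: onb_def orthonormal_def)
        qed
        then show ?thesis using True by (simp add: \<iota>_def tensor_vec_def J_def cong: prod.cong)
      qed
      also have "\<dots> = (if \<forall>i\<in>I. e i = e' i then 1 else 0)" using fin by (induction I) auto
      also have "(\<forall>i\<in>I. e i = e' i) \<longleftrightarrow> e = e'" using True e unfolding J_def by (metis PiE_ext)
      finally show ?thesis .
    qed (use e in \<open>auto simp: \<iota>_def tensor_vec_def J_def\<close>)
    have q: "q e = (if e \<in> B then v e else 0)" for e
    proof -
      have "q e = (\<Sum>l<card B. v (x l) * \<iota> (x l) e)"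
        by (simp add: q_def sum_fun_apply scaleC_fun_def scaleC_complex_def)
      also have "\<dots> = (\<Sum>e'\<in>B. v e' * \<iota> e' e)"
        by (rule sum.reindex_bij_betw[OF x])
      also have "\<dots> = (\<Sum>e'\<in>B. if e' = e then v e' else 0)"
        using B by (intro sum.cong) (auto simp: \<delta>)
      finally show ?thesis using B(1) by simp
    qed
    have vq: "v - q \<in> vecs (l2 J)"
      unfolding l2_mem
    proof (intro conjI allI impI)
      show "(v - q) j = 0" if "j \<notin> J" for j using that v B by (auto simp: l2_mem q)
      show "(\<lambda>j. (cmod ((v - q) j))\<^sup>2) summable_on J"
        by (rule summable_on_norm_dominated(2)[OF vs]) (simp add: q)
    qed
    have "(\<Sum>\<^sub>\<infinity>j\<in>J. (cmod ((v - q) j))\<^sup>2) = (\<Sum>\<^sub>\<infinity>j\<in>J - B. (cmod (v j))\<^sup>2)"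
      using B by (intro infsum_cong_neutral) (auto simp: q)
    also have "\<dots> = ?s - (\<Sum>j\<in>B. (cmod (v j))\<^sup>2)"
      using B vs by (subst infsum_Diff) auto
    also have "\<dots> < \<epsilon>\<^sup>2" using B(3) by (simp add: dist_real_def abs_less_iff)
    finally have "hnorm (l2 J) (v - q) < \<epsilon>"
      unfolding l2_hnorm[OF vq] using \<epsilon> by (intro real_less_lsqrt) (auto intro: infsum_nonneg)
    moreover have "x l \<in> (\<Pi>\<^sub>E i\<in>I. vecs (H i))" if "l < card B" for l
    proof -
      have "x l \<in> J" using x that B by (auto simp: bij_betw_def)
      then show ?thesis using EV by (auto simp: J_def PiE_iff)
    qed
    ultimately show ?thesis unfolding q_def
      by (intro exI[of _ "card B"] exI[of _ "\<lambda>l. v (x l)"] exI[of _ x]) simp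
  qed
  show ?thesis
    unfolding hilbert_tensor_def J_def[symmetric] \<iota>_def[symmetric]
    by (intro conjI ballI allI impI hilbert_space_l2 mem ips dense)
qed

section \<open>Extension of projection valued measures from a semiring\<close>

text \<open>For each vector \<open>u\<close>, Caratheodory extends the squared norms of
  \<open>Q A u\<close> to a measure \<open>N u\<close>. Polarization turns these into complex
  measures, which for each set form a bounded sesquilinear form and hence an operator. All algebraic
  properties of the new operators follow from those on \<open>R\<close> by uniqueness of
  measures.\<close>

lemma pvm_extension:
  fixes K :: "'k::complex_vector hspace" and M :: "'w measure"
  assumes K: "hilbert_space K"
    and semi: "semiring_of_sets (space M) R" and setsM: "sets M = sigma_sets (space M) R" and top: "space M \<in> R"
    and bop: "\<And>A. A \<in> R \<Longrightarrow> bounded_op K K (Q A)"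
    and tot: "\<And>u. u \<in> vecs K \<Longrightarrow> Q (space M) u = u"
    and int: "\<And>A B u. \<lbrakk>A \<in> R; B \<in> R; u \<in> vecs K\<rbrakk> \<Longrightarrow> Q A (Q B u) = Q (A \<inter> B) u"
    and sa: "\<And>A u v. \<lbrakk>A \<in> R; u \<in> vecs K; v \<in> vecs K\<rbrakk> \<Longrightarrow> ip K (Q A u) v = ip K u (Q A v)"
    and cadd: "\<And>A u. \<lbrakk>range A \<subseteq> R; disjoint_family A; (\<Union>n. A n) \<in> R; u \<in> vecs K\<rbrakk>
      \<Longrightarrow> (\<lambda>n::nat. (hnorm K (Q (A n) u))\<^sup>2) sums (hnorm K (Q (\<Union>n. A n) u))\<^sup>2"
  shows "\<exists>T. pvm_space \<lparr>msp = M, hsp = K, prj = T\<rparr> \<and> (\<forall>A\<in>R. \<forall>u\<in>vecs K. T A u = Q A u)"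
proof -
  interpret K: hilbert_space K by fact
  interpret R: semiring_of_sets "space M" R by fact
  have Qmem: "Q A u \<in> vecs K" if "A \<in> R" "u \<in> vecs K" for A u using bounded_op_mem[OF bop] that .
  have RM: "A \<in> sets M" if "A \<in> R" for A using that by (simp add: setsM)
  have "\<exists>N. sets N = sets M \<and> (\<forall>A\<in>R. emeasure N A = ennreal ((hnorm K (Q A u))\<^sup>2))" if u: "u \<in> vecs K" for u
  proof (intro exI conjI ballI)
    let ?\<mu> = "\<lambda>A. ennreal ((hnorm K (Q A u))\<^sup>2)"
    let ?N = "extend_measure (space M) R (\<lambda>x. x) ?\<mu>"
    show "sets ?N = sets M" using R.space_closed by (subst sets_extend_measure) (auto simp: setsM)
    fix A assume A: "A \<in> R"
    show "emeasure ?N A = ?\<mu> A"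
    proof (rule extend_measure_caratheodory[OF refl A, where G="\<lambda>x. x"])
      show "semiring_of_sets (space M) ((\<lambda>x. x) ` R)" using semi by simp
      show "?\<mu> B = 0" if "B = {}" for B
      proof -
        have "(\<lambda>n::nat. (hnorm K (Q {} u))\<^sup>2) sums (hnorm K (Q (\<Union>n::nat. {}) u))\<^sup>2"
          using u by (intro cadd[of "\<lambda>_. {}"]) (auto simp: disjoint_family_on_def)
        then have "summable (\<lambda>n::nat. (hnorm K (Q {} u))\<^sup>2)" by (rule sums_summable)
        then show ?thesis using that by (simp add: summable_const_iff)
      qed
      fix B :: "nat \<Rightarrow> _" and C assume B: "B \<in> UNIV \<rightarrow> R" "C \<in> R" "disjoint_family ((\<lambda>x. x) \<circ> B)" "(\<Union>i. B i) = C"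
      then have "(\<lambda>n. (hnorm K (Q (B n) u))\<^sup>2) sums (hnorm K (Q (\<Union>n. B n) u))\<^sup>2"
        using u by (intro cadd) (auto simp: comp_def)
      then show "(\<Sum>n. ?\<mu> (B n)) = ?\<mu> C" unfolding B(4) by (intro suminf_ennreal_eq) auto
    qed auto
  qed
  then obtain N where N: "\<And>u. u \<in> vecs K \<Longrightarrow> sets (N u) = sets M"
    "\<And>u A. \<lbrakk>u \<in> vecs K; A \<in> R\<rbrakk> \<Longrightarrow> emeasure (N u) A = ennreal ((hnorm K (Q A u))\<^sup>2)" by metis
  have Nsp: "space (N u) = space M" if "u \<in> vecs K" for u using N(1)[OF that] by (rule sets_eq_imp_space_eq)
  have fin: "finite_measure (N u)" if "u \<in> vecs K" for u
    using N(2)[OF that top] by (intro finite_measureI) (simp add: Nsp that)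
  have mR: "complex_of_real (measure (N u) A) = ip K (Q A u) u" if u: "u \<in> vecs K" and A: "A \<in> R" for u A
  proof -
    have "complex_of_real (measure (N u) A) = ip K (Q A u) (Q A u)"
      unfolding measure_def N(2)[OF u A] K.ip_self[OF Qmem[OF A u]] by simp
    also have "\<dots> = ip K (Q A (Q A u)) u" using sa[OF A Qmem[OF A u] u] by simp
    also have "\<dots> = ip K (Q A u) u" using int[OF A A u] by simp
    finally show ?thesis .
  qed
  \<comment> \<open>On \<open>R\<close> this is the inner product of \<open>Q A u\<close> with
    \<open>v\<close>. Elsewhere it is only a combination of extended measures, so that even
    sesquilinearity has to be carried over by \<open>uniq\<close>.\<close>
  define \<nu> where "\<nu> u v G = (\<Sum>p<4. \<i> ^ p * complex_of_real (measure (N (pol p u v)) G))" for u v G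
  have cm: "cmeas M (\<nu> u v)" if "u \<in> vecs K" "v \<in> vecs K" for u v
    unfolding \<nu>_def using that by (intro cmeas_sum cmeas_cmult cmeas_measure fin N K.pol_mem)
  have \<nu>R: "\<nu> u v A = ip K (Q A u) v" if u: "u \<in> vecs K" and v: "v \<in> vecs K" and A: "A \<in> R" for u v A
  proof -
    have "\<nu> u v A = (\<Sum>p<4. \<i> ^ p * ip K (Q A (pol p u v)) (pol p u v))"
      unfolding \<nu>_def using u v A by (simp add: mR K.pol_mem)
    also have "\<dots> = ip K (Q A u) v"
      using u v A
      by (intro K.polarization[where B="\<lambda>u v. ip K (Q A u) v"])
        (auto simp: bounded_op_add[OF bop[OF A]] bounded_op_scaleC[OF bop[OF A]] K.ip_add K.ip_add_right K.ip_scaleC K.ip_scaleC_right Qmem)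
    finally show ?thesis .
  qed
  \<comment> \<open>Agreement on \<open>R\<close> includes agreement on the whole space, which
    belongs to \<open>R\<close>.\<close>
  have uniq: "\<mu> G = \<mu>' G" if "cmeas M \<mu>" "cmeas M \<mu>'" "\<And>A. A \<in> R \<Longrightarrow> \<mu> A = \<mu>' A" "G \<in> sets M" for \<mu> \<mu>' G
    using that(1,2) setsM _ R.space_closed that(3) that(3)[OF top] that(4)
    by (rule cmeas_unique) (auto simp: Int_stable_def)
  have addl: "\<nu> (x + y) z G = \<nu> x z G + \<nu> y z G" if "x \<in> vecs K" "y \<in> vecs K" "z \<in> vecs K" "G \<in> sets M" for x y z G
    by (rule uniq[of "\<nu> (x + y) z" "\<lambda>G. \<nu> x z G + \<nu> y z G"])
      (use that in \<open>simp_all add: cm cmeas_add K.add_mem \<nu>R bounded_op_add[OF bop] K.ip_add Qmem\<close>)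
  have addr: "\<nu> z (x + y) G = \<nu> z x G + \<nu> z y G" if "x \<in> vecs K" "y \<in> vecs K" "z \<in> vecs K" "G \<in> sets M" for x y z G
    by (rule uniq[of "\<nu> z (x + y)" "\<lambda>G. \<nu> z x G + \<nu> z y G"])
      (use that in \<open>simp_all add: cm cmeas_add K.add_mem \<nu>R K.ip_add_right Qmem\<close>)
  have scl: "\<nu> (c *\<^sub>C x) z G = c * \<nu> x z G" if "x \<in> vecs K" "z \<in> vecs K" "G \<in> sets M" for x c z G
    by (rule uniq[of "\<nu> (c *\<^sub>C x) z" "\<lambda>G. c * \<nu> x z G"])
      (use that in \<open>simp_all add: cm cmeas_cmult K.scaleC_mem \<nu>R bounded_op_scaleC[OF bop] K.ip_scaleC Qmem\<close>)
  have scr: "\<nu> z (c *\<^sub>C x) G = cnj c * \<nu> z x G" if "x \<in> vecs K" "z \<in> vecs K" "G \<in> sets M" for x c z G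
    by (rule uniq[of "\<nu> z (c *\<^sub>C x)" "\<lambda>G. cnj c * \<nu> z x G"])
      (use that in \<open>simp_all add: cm cmeas_cmult K.scaleC_mem \<nu>R K.ip_scaleC_right Qmem\<close>)
  have bnd: "cmod (\<nu> u v G) \<le> 1 * ((hnorm K u)\<^sup>2 + (hnorm K v)\<^sup>2)" if u: "u \<in> vecs K" and v: "v \<in> vecs K" for u v G
  proof -
    have le: "measure (N w) G \<le> (hnorm K w)\<^sup>2" if w: "w \<in> vecs K" for w
    proof -
      interpret finite_measure "N w" using fin[OF w] .
      have "measure (N w) G \<le> measure (N w) (space M)" using bounded_measure[of G] Nsp[OF w] by simp
      also have "\<dots> = (hnorm K w)\<^sup>2" unfolding measure_def N(2)[OF w top] tot[OF w] by simp
      finally show ?thesis .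
    qed
    have "cmod (\<nu> u v G) \<le> (\<Sum>p<4. cmod (\<i> ^ p * complex_of_real (measure (N (pol p u v)) G)))"
      unfolding \<nu>_def by (rule norm_sum)
    also have "\<dots> \<le> (\<Sum>p<4. (hnorm K (pol p u v))\<^sup>2)"
      using le u v by (intro sum_mono) (simp add: norm_mult norm_power K.pol_mem)
    also have "\<dots> = (hnorm K u)\<^sup>2 + (hnorm K v)\<^sup>2" using u v by (rule K.pol_norm_sum)
    finally show ?thesis by simp
  qed
  have "\<exists>T. bounded_op K K T \<and> (\<forall>u\<in>vecs K. \<forall>v\<in>vecs K. ip K (T u) v = \<nu> u v G)" if G: "G \<in> sets M" for G
  proof (rule sesquilinear_op[OF K K, where C=2])
    fix u v assume u: "u \<in> vecs K" and v: "v \<in> vecs K"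
    show "cmod (\<nu> u v G) \<le> 2 * hnorm K u * hnorm K v"
      using sesquilinear_bound[OF K K, of "\<lambda>u v. \<nu> u v G" 1, OF _ _ _ u v] scl[OF _ _ G] scr[OF _ _ G] bnd by simp
  qed (use G addl addr scl scr in auto)
  then obtain T where Tb: "\<And>G. G \<in> sets M \<Longrightarrow> bounded_op K K (T G)"
    and T: "\<And>G u v. \<lbrakk>G \<in> sets M; u \<in> vecs K; v \<in> vecs K\<rbrakk> \<Longrightarrow> ip K (T G u) v = \<nu> u v G" by metis
  have Tmem: "T G u \<in> vecs K" if "G \<in> sets M" "u \<in> vecs K" for G u using bounded_op_mem[OF Tb] that .
  have TQ: "T A u = Q A u" if "A \<in> R" "u \<in> vecs K" for A u
    using that by (intro K.vec_eqI) (auto simp: Tmem RM Qmem T \<nu>R)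
  have Tsa: "ip K (T G u) v = ip K u (T G v)" if G: "G \<in> sets M" and u: "u \<in> vecs K" and v: "v \<in> vecs K" for G u v
  proof -
    have "\<nu> u v G = cnj (\<nu> v u G)"
    proof (rule uniq[of "\<nu> u v" "\<lambda>G. cnj (\<nu> v u G)"])
      fix A assume A: "A \<in> R"
      show "\<nu> u v A = cnj (\<nu> v u A)"
        using A u v K.ip_commute[OF Qmem[OF A v] u] by (simp add: \<nu>R sa)
    qed (use G u v in \<open>auto intro: cm cmeas_cnj\<close>)
    then show ?thesis using G u v T K.ip_commute[OF Tmem[OF G v] u] by simp
  qed
  \<comment> \<open>Multiplicativity is extended from \<open>R\<close> one set at a time: here one
    of the two sets is still in \<open>R\<close>, in \<open>mult\<close> both are arbitrary.
    Idempotence is the case of two equal sets.\<close>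
  have restr: "\<nu> (Q A u) v G = \<nu> u v (G \<inter> A)" if A: "A \<in> R" and G: "G \<in> sets M" and u: "u \<in> vecs K" and v: "v \<in> vecs K" for A G u v
  proof (rule uniq[of "\<nu> (Q A u) v" "\<lambda>G. \<nu> u v (G \<inter> A)"])
    show "cmeas M (\<nu> (Q A u) v)" using Qmem[OF A u] v by (rule cm)
    show "cmeas M (\<lambda>G. \<nu> u v (G \<inter> A))" using cm[OF u v] RM[OF A] by (rule cmeas_restrict)
    fix B assume B: "B \<in> R"
    then have "B \<inter> A \<in> R" using A by blast
    then show "\<nu> (Q A u) v B = \<nu> u v (B \<inter> A)" using A B u v by (simp add: \<nu>R Qmem int)
  qed fact
  have mult: "\<nu> u (T G v) A = \<nu> u v (A \<inter> G)" if A: "A \<in> sets M" and G: "G \<in> sets M" and u: "u \<in> vecs K" and v: "v \<in> vecs K" for A G u v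
  proof (rule uniq[of "\<nu> u (T G v)" "\<lambda>A. \<nu> u v (A \<inter> G)"])
    show "cmeas M (\<nu> u (T G v))" using u Tmem[OF G v] by (rule cm)
    show "cmeas M (\<lambda>A. \<nu> u v (A \<inter> G))" using cm[OF u v] G by (rule cmeas_restrict)
    fix B assume B: "B \<in> R"
    have "\<nu> u (T G v) B = ip K (T G (Q B u)) v"
      using B G u v by (simp add: \<nu>R Tmem Qmem Tsa)
    also have "\<dots> = \<nu> u v (G \<inter> B)" using B G u v by (simp add: T Qmem restr)
    finally show "\<nu> u (T G v) B = \<nu> u v (B \<inter> G)" by (simp add: Int_commute)
  qed fact
  have idem: "T G (T G u) = T G u" if G: "G \<in> sets M" and u: "u \<in> vecs K" for G u
  proof (rule K.vec_eqI)
    fix v assume v: "v \<in> vecs K"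
    have "ip K (T G (T G u)) v = ip K (T G u) (T G v)" using G u v by (simp add: Tsa Tmem)
    also have "\<dots> = ip K (T G u) v" using G u v by (simp add: T Tmem mult)
    finally show "ip K (T G (T G u)) v = ip K (T G u) v" .
  qed (use G u Tmem in auto)
  have "pvm_space \<lparr>msp = M, hsp = K, prj = T\<rparr>"
  proof (rule pvm_space.intro)
    show "hilbert_space (hsp \<lparr>msp = M, hsp = K, prj = T\<rparr>)" using K by simp
    show "pvm_space_axioms \<lparr>msp = M, hsp = K, prj = T\<rparr>"
    proof
      fix A :: "nat \<Rightarrow> _" and h k
      assume "range A \<subseteq> sets (msp \<lparr>msp = M, hsp = K, prj = T\<rparr>)" and d: "disjoint_family A"
        and "h \<in> vecs (hsp \<lparr>msp = M, hsp = K, prj = T\<rparr>)" "k \<in> vecs (hsp \<lparr>msp = M, hsp = K, prj = T\<rparr>)"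
      then have *: "range A \<subseteq> sets M" "h \<in> vecs K" "k \<in> vecs K" by simp_all
      have "ip K (T (A n) h) k = \<nu> h k (A n)" for n using * by (intro T) auto
      moreover have "ip K (T (\<Union>n. A n) h) k = \<nu> h k (\<Union>n. A n)" using * by (intro T) auto
      moreover have "(\<lambda>n. \<nu> h k (A n)) sums \<nu> h k (\<Union>n. A n)" using cm[OF *(2,3)] *(1) d by (rule cmeasD)
      ultimately show "(\<lambda>n. ip (hsp \<lparr>msp = M, hsp = K, prj = T\<rparr>) (prj \<lparr>msp = M, hsp = K, prj = T\<rparr> (A n) h) k) sums
        ip (hsp \<lparr>msp = M, hsp = K, prj = T\<rparr>) (prj \<lparr>msp = M, hsp = K, prj = T\<rparr> (\<Union>n. A n) h) k" by simp
    qed (simp_all add: Tb Tsa idem TQ[OF top] tot)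
  qed
  then show ?thesis using TQ by blast
qed

text \<open>The point is to write the difference of two boxes as a finite disjoint union of boxes;
  the order of the indices is used to make it disjoint.\<close>

lemma semiring_prod_algebra:
  fixes I :: "nat set" and M :: "nat \<Rightarrow> 'w measure"
  assumes I: "finite I" "I \<noteq> {}"
  shows "semiring_of_sets (space (PiM I M)) (prod_algebra I M)"
proof
  show "prod_algebra I M \<subseteq> Pow (space (PiM I M))"
    using prod_algebra_sets_into_space[of I M] by (simp add: space_PiM)
  obtain i where "i \<in> I" using I by blast
  then have "PiE I (\<lambda>_. {} :: 'w set) = {}" by auto
  then show "{} \<in> prod_algebra I M"
    using prod_algebraI_finite[OF I(1), of "\<lambda>_. {}" M] by simp
  show "a \<inter> b \<in> prod_algebra I M" if "a \<in> prod_algebra I M" "b \<in> prod_algebra I M" for a b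
    using Int_stable_prod_algebra[of I M] that by (auto simp: Int_stable_def)
  have rect: "\<exists>G. a = PiE I G \<and> (\<forall>i\<in>I. G i \<in> sets (M i))" if "a \<in> prod_algebra I M" for a
    using that unfolding prod_algebra_eq_finite[OF I(1)] Pi_iff mem_Collect_eq by blast
  fix a b assume "a \<in> prod_algebra I M" "b \<in> prod_algebra I M"
  then obtain G H where G: "a = PiE I G" "\<And>i. i \<in> I \<Longrightarrow> G i \<in> sets (M i)"
    and H: "b = PiE I H" "\<And>i. i \<in> I \<Longrightarrow> H i \<in> sets (M i)"
    using rect[of a] rect[of b] by metis
  \<comment> \<open>Points of \<open>a\<close> are sorted by the first coordinate at which they
    leave \<open>b\<close>: before \<open>i\<close> they stay in \<open>H j\<close>, at
    \<open>i\<close> they leave it, and later coordinates are free in \<open>G j\<close>.\<close>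
  define S where "S i = PiE I (\<lambda>j. if j < i then G j \<inter> H j else if j = i then G j - H j else G j)" for i
  have "S ` I \<subseteq> prod_algebra I M"
    unfolding S_def using G H by (auto intro!: prod_algebraI_finite[OF I(1)])
  moreover have "disjoint (S ` I)"
  proof (rule disjointI)
    fix s t assume st: "s \<in> S ` I" "t \<in> S ` I" "s \<noteq> t"
    then obtain i j where ij: "i \<in> I" "j \<in> I" "s = S i" "t = S j" "i \<noteq> j" by blast
    have *: "S i \<inter> S j = {}" if "i \<in> I" "i < j" for i j
    proof (rule ccontr)
      assume "S i \<inter> S j \<noteq> {}"
      then obtain \<omega> where w: "\<omega> \<in> S i" "\<omega> \<in> S j" by blast
      then have "\<omega> i \<in> G i - H i" "\<omega> i \<in> G i \<inter> H i" using that unfolding S_def by (auto simp: PiE_iff)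
      then show False by blast
    qed
    show "s \<inter> t = {}" using *[of i j] *[of j i] ij by (cases "i < j") auto
  qed
  moreover have "a - b = \<Union>(S ` I)"
  proof (intro equalityI subsetI)
    fix \<omega> assume w: "\<omega> \<in> a - b"
    then have "\<exists>i\<in>I. \<omega> i \<notin> H i" by (auto simp: G H PiE_iff)
    define i where "i = Min {i\<in>I. \<omega> i \<notin> H i}"
    have fin: "finite {i\<in>I. \<omega> i \<notin> H i}" "{i\<in>I. \<omega> i \<notin> H i} \<noteq> {}" using I \<open>\<exists>i\<in>I. \<omega> i \<notin> H i\<close> by auto
    have "i \<in> {i\<in>I. \<omega> i \<notin> H i}" unfolding i_def using fin by (rule Min_in)
    moreover have "\<omega> j \<in> H j" if "j \<in> I" "j < i" for j
      using Min_le[OF fin(1), of j] that by (auto simp: i_def)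
    ultimately have "\<omega> \<in> S i" using w unfolding S_def G(1) by (auto simp: PiE_iff)
    then show "\<omega> \<in> \<Union>(S ` I)" using \<open>i \<in> {i\<in>I. \<omega> i \<notin> H i}\<close> by blast
  next
    fix \<omega> assume "\<omega> \<in> \<Union>(S ` I)"
    then obtain i where i: "i \<in> I" "\<omega> \<in> S i" by blast
    have "\<omega> j \<in> G j" if "j \<in> I" for j using i(2) that unfolding S_def by (auto simp: PiE_iff split: if_splits)
    moreover have "\<omega> i \<notin> H i" using i unfolding S_def by (auto simp: PiE_iff)
    moreover have "\<omega> \<in> extensional I" using i(2) unfolding S_def by (auto simp: PiE_iff)
    ultimately show "\<omega> \<in> a - b" using i(1) by (auto simp: G H PiE_iff)
  qed
  ultimately show "\<exists>C\<subseteq>prod_algebra I M. finite C \<and> disjoint C \<and> a - b = \<Union>C"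
    using I(1) by (intro exI[of _ "S ` I"]) auto
qed

section \<open>Tensor products of projection valued measures\<close>

context hilbert_space
begin

lemma projection_unique:
  assumes S: "closed_sub H S" and u: "u \<in> vecs H" and "p \<in> S" "u - p \<in> perp H S" "q \<in> S" "u - q \<in> perp H S"
  shows "p = q"
proof -
  have SV: "S \<subseteq> vecs H" using S by (simp add: closed_sub_def)
  have pq: "p \<in> vecs H" "q \<in> vecs H" using SV assms by auto
  have mq: "p + (- 1) *\<^sub>C q \<in> S" using S assms unfolding closed_sub_def by meson
  then have s: "p - q \<in> S" by (simp add: scaleC_minus1)
  have "ip H (u - p) (p - q) = 0" "ip H (u - q) (p - q) = 0" using assms s by (auto simp: perp_def)
  moreover have "ip H (u - q) (p - q) - ip H (u - p) (p - q) = ip H (p - q) (p - q)"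
    using u pq by (simp add: ip_diff_left[symmetric] diff_mem)
  ultimately have "ip H (p - q) (p - q) = 0" by simp
  then have "p - q = 0" using ip_definite diff_mem[OF pq] by blast
  then show ?thesis by simp
qed

lemma perp_add: "\<lbrakk>C \<subseteq> vecs H; x \<in> perp H C; y \<in> perp H C\<rbrakk> \<Longrightarrow> x + y \<in> perp H C"
  and perp_scaleC: "\<lbrakk>C \<subseteq> vecs H; x \<in> perp H C\<rbrakk> \<Longrightarrow> c *\<^sub>C x \<in> perp H C"
  using closed_sub_perp[of C] by (simp_all add: closed_sub_def)

text \<open>Linearity comes from uniqueness of the orthogonal decomposition, self-adjointness from
  the orthogonality of the two remainders to \<open>S\<close>.\<close>

lemma ex_projection_op:
  assumes S: "closed_sub H S"
  shows "\<exists>Q. bounded_op H H Q \<and> (\<forall>u\<in>vecs H. Q u \<in> S \<and> u - Q u \<in> perp H S) \<and>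
    (\<forall>u\<in>vecs H. \<forall>v\<in>vecs H. ip H (Q u) v = ip H u (Q v)) \<and> (\<forall>u\<in>vecs H. hnorm H (Q u) \<le> hnorm H u)"
proof -
  have SV: "S \<subseteq> vecs H" and Sadd: "\<And>x y. \<lbrakk>x \<in> S; y \<in> S\<rbrakk> \<Longrightarrow> x + y \<in> S" and Sscale: "\<And>x c. x \<in> S \<Longrightarrow> c *\<^sub>C x \<in> S"
    using S by (auto simp: closed_sub_def)
  obtain Q where Q: "\<And>u. u \<in> vecs H \<Longrightarrow> Q u \<in> S" "\<And>u. u \<in> vecs H \<Longrightarrow> u - Q u \<in> perp H S"
    using projection[OF S] by metis
  have QV: "Q u \<in> vecs H" if "u \<in> vecs H" for u using Q(1)[OF that] SV by blast
  have orth: "ip H (u - Q u) s = 0" if "u \<in> vecs H" "s \<in> S" for u s using Q(2)[OF that(1)] that(2) by (auto simp: perp_def)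
  have add: "Q (x + y) = Q x + Q y" if "x \<in> vecs H" "y \<in> vecs H" for x y
  proof (rule projection_unique[OF S, of "x + y"])
    have eq: "(x + y) - (Q x + Q y) = (x - Q x) + (y - Q y)" by simp
    show "x + y - (Q x + Q y) \<in> perp H S" unfolding eq using Q(2) that by (intro perp_add[OF SV])
  qed (use that Q Sadd add_mem in auto)
  have scale: "Q (c *\<^sub>C x) = c *\<^sub>C Q x" if "x \<in> vecs H" for x c
  proof (rule projection_unique[OF S, of "c *\<^sub>C x"])
    show "c *\<^sub>C x - c *\<^sub>C Q x \<in> perp H S" using perp_scaleC[OF SV] Q that by (simp add: scaleC_diff_right[symmetric])
  qed (use that Q Sscale scaleC_mem in auto)
  have left: "ip H (Q u) s = ip H u s" if "u \<in> vecs H" "s \<in> S" for u s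
    using orth[OF that] that SV QV by (auto simp: ip_diff_left subset_iff)
  have sa: "ip H (Q u) v = ip H u (Q v)" if "u \<in> vecs H" "v \<in> vecs H" for u v
  proof -
    have "ip H (Q u) v = cnj (ip H v (Q u))" using ip_commute[OF that(2) QV[OF that(1)]] .
    also have "\<dots> = cnj (ip H (Q v) (Q u))" using left[OF that(2) Q(1)[OF that(1)]] by simp
    also have "\<dots> = ip H (Q u) (Q v)" using ip_commute[OF QV[OF that(2)] QV[OF that(1)]] by simp
    also have "\<dots> = ip H u (Q v)" using left[OF that(1) Q(1)[OF that(2)]] .
    finally show ?thesis .
  qed
  have bnd: "hnorm H (Q u) \<le> hnorm H u" if u: "u \<in> vecs H" for u
  proof (cases "hnorm H (Q u) = 0")
    case False
    have "hnorm H (Q u) * hnorm H (Q u) = cmod (ip H (Q u) (Q u))"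
      by (simp add: ip_self[OF QV[OF u]] norm_power power2_eq_square norm_mult)
    also have "\<dots> = cmod (ip H u (Q u))" using left[OF u Q(1)[OF u]] by simp
    also have "\<dots> \<le> hnorm H u * hnorm H (Q u)" using u QV by (intro cauchy_schwarz)
    finally show ?thesis using False hnorm_nonneg[OF QV[OF u]] by (simp add: mult_le_cancel_right)
  qed (use u in simp)
  have "bounded_op H H Q"
    unfolding bounded_op_def using QV add scale bnd by (intro conjI ballI allI exI[of _ 1]) auto
  then show ?thesis using Q sa bnd by blast
qed

lemma total_closed_sub:
  assumes W: "closed_sub H W" and "D \<subseteq> W" and tot: "\<And>w. \<lbrakk>w \<in> vecs H; \<And>d. d \<in> D \<Longrightarrow> ip H w d = 0\<rbrakk> \<Longrightarrow> w = 0"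
    and u: "u \<in> vecs H"
  shows "u \<in> W"
proof -
  obtain p where p: "p \<in> W" "u - p \<in> perp H W" using projection[OF W u] by blast
  then have "u - p = 0" using assms(2) by (intro tot) (auto simp: perp_def)
  then show ?thesis using p by simp
qed

text \<open>For each \<open>k\<close>, the Riesz vectors of the two functionals have the same inner
  products with \<open>D\<close> and hence coincide by totality. The linear span of \<open>D\<close>
  is never formed.\<close>

lemma bounded_op_eqI:
  assumes S: "bounded_op H H S" and T: "bounded_op H H T" and D: "D \<subseteq> vecs H"
    and tot: "\<And>w. \<lbrakk>w \<in> vecs H; \<And>d. d \<in> D \<Longrightarrow> ip H w d = 0\<rbrakk> \<Longrightarrow> w = 0"
    and eq: "\<And>d. d \<in> D \<Longrightarrow> S d = T d" and u: "u \<in> vecs H"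
  shows "S u = T u"
proof (rule vec_eqI)
  show "S u \<in> vecs H" "T u \<in> vecs H" using bounded_op_mem S T u by blast+
  fix k assume k: "k \<in> vecs H"
  obtain s where s: "s \<in> vecs H" "\<forall>x\<in>vecs H. ip H (S x) k = ip H x s"
    using bounded_op_adjoint[OF S hilbert_space_axioms hilbert_space_axioms k] by blast
  obtain t where t: "t \<in> vecs H" "\<forall>x\<in>vecs H. ip H (T x) k = ip H x t"
    using bounded_op_adjoint[OF T hilbert_space_axioms hilbert_space_axioms k] by blast
  have "s - t = 0"
  proof (rule tot)
    fix d assume d: "d \<in> D"
    then have dV: "d \<in> vecs H" using D by blast
    have "ip H d s = ip H d t" using s(2) t(2) dV eq[OF d] by metis
    then have "ip H d (s - t) = 0" using dV s t by (simp add: ip_diff_right)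
    then show "ip H (s - t) d = 0" using ip_commute[OF dV diff_mem[OF s(1) t(1)]] by simp
  qed (use s t diff_mem in auto)
  then show "ip H (S u) k = ip H (T u) k" using s t u by simp
qed

end

text \<open>Approximating \<open>w\<close> by combinations orthogonal to it is possible only if
  \<open>w = 0\<close>, since by Pythagoras every such approximation is at least at distance
  \<open>hnorm K w\<close>.\<close>

lemma hilbert_tensor_total:
  assumes T: "hilbert_tensor I H K \<iota>" and w: "w \<in> vecs K"
    and orth: "\<And>x. x \<in> (\<Pi>\<^sub>E i\<in>I. vecs (H i)) \<Longrightarrow> ip K w (\<iota> x) = 0"
  shows "w = 0"
proof -
  interpret K: hilbert_space K using T by (simp add: hilbert_tensor_def)
  have \<iota>: "\<iota> x \<in> vecs K" if "x \<in> (\<Pi>\<^sub>E i\<in>I. vecs (H i))" for x using T that by (simp add: hilbert_tensor_def)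
  have "hnorm K w \<le> e" if e: "e > 0" for e
  proof -
    obtain n :: nat and c x where x: "\<forall>l<n. x l \<in> (\<Pi>\<^sub>E i\<in>I. vecs (H i))"
      and lt: "hnorm K (w - (\<Sum>l<n. c l *\<^sub>C \<iota> (x l))) < e"
      using T w e unfolding hilbert_tensor_def by meson
    define s where "s = (\<Sum>l<n. c l *\<^sub>C \<iota> (x l))"
    have s: "s \<in> vecs K" unfolding s_def using x \<iota> by (intro K.sum_mem K.scaleC_mem) auto
    have "ip K w s = 0"
      unfolding s_def using x \<iota> orth w by (subst K.ip_sum_right) (auto intro!: K.scaleC_mem simp: K.ip_scaleC_right)
    then have "(hnorm K (w - s))\<^sup>2 = (hnorm K w)\<^sup>2 + (hnorm K s)\<^sup>2" using w s by (simp add: K.hnorm_diff_sq)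
    then have "(hnorm K w)\<^sup>2 \<le> (hnorm K (w - s))\<^sup>2" by simp
    then have "hnorm K w \<le> hnorm K (w - s)" using K.hnorm_nonneg[OF K.diff_mem[OF w s]] by (rule power2_le_imp_le)
    then show ?thesis using lt by (simp add: s_def)
  qed
  then have "hnorm K w \<le> 0" by (rule field_le_epsilon[of _ 0, simplified])
  then show ?thesis using K.hnorm_eq_0[OF w] K.hnorm_nonneg[OF w] by simp
qed

text \<open>The product of the scalar spectral measures. The measure \<open>count_space {}\<close>
  off \<open>I\<close> is a default that makes the family sigma-finite at every index, as
  \<open>product_sigma_finite\<close> demands.\<close>

definition tmu :: "nat set \<Rightarrow> (nat \<Rightarrow> ('w, 'h::complex_vector) pvms) \<Rightarrow> (nat \<Rightarrow> 'h) \<Rightarrow> (nat \<Rightarrow> 'w) measure" where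
  "tmu I X z = PiM I (\<lambda>i. if i \<in> I then pmu (X i) (z i) else count_space {})"

lemma sets_tmu: "sets (tmu I X z) = sets (\<Pi>\<^sub>M i\<in>I. msp (X i))"
  unfolding tmu_def by (rule sets_PiM_cong) auto

lemma space_tmu: "space (tmu I X z) = space (\<Pi>\<^sub>M i\<in>I. msp (X i))"
  using sets_tmu by (rule sets_eq_imp_space_eq)

lemma product_sigma_finite_pmu:
  assumes "\<And>i. i \<in> I \<Longrightarrow> pvm_space (X i)" "\<And>i. i \<in> I \<Longrightarrow> z i \<in> vecs (hsp (X i))"
  shows "product_sigma_finite (\<lambda>i. if i \<in> I then pmu (X i) (z i) else count_space {})"
  unfolding product_sigma_finite_def
proof
  fix i
  show "sigma_finite_measure (if i \<in> I then pmu (X i) (z i) else count_space {})"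
  proof (cases "i \<in> I")
    case True
    then have "finite_measure (pmu (X i) (z i))" using assms by (intro pvm_space.finite_measure_pmu)
    then show ?thesis using True finite_measure.axioms(1) by auto
  next
    case False
    then show ?thesis by (simp add: sigma_finite_measure_count_space_finite)
  qed
qed

lemma emeasure_tmu:
  assumes "finite I" "\<And>i. i \<in> I \<Longrightarrow> pvm_space (X i)" "\<And>i. i \<in> I \<Longrightarrow> z i \<in> vecs (hsp (X i))"
    "\<And>i. i \<in> I \<Longrightarrow> G i \<in> sets (msp (X i))"
  shows "emeasure (tmu I X z) (PiE I G) = ennreal (\<Prod>i\<in>I. (hnorm (hsp (X i)) (prj (X i) (G i) (z i)))\<^sup>2)"
proof -
  interpret product_sigma_finite "\<lambda>i. if i \<in> I then pmu (X i) (z i) else count_space {}"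
    using assms by (intro product_sigma_finite_pmu)
  have "emeasure (tmu I X z) (PiE I G) = (\<Prod>i\<in>I. emeasure (if i \<in> I then pmu (X i) (z i) else count_space {}) (G i))"
    unfolding tmu_def by (rule emeasure_PiM) (use assms in auto)
  also have "\<dots> = (\<Prod>i\<in>I. ennreal ((hnorm (hsp (X i)) (prj (X i) (G i) (z i)))\<^sup>2))"
    using assms by (intro prod.cong) (auto simp: pvm_space.emeasure_pmu)
  finally show ?thesis by (simp add: prod_ennreal)
qed

lemma finite_measure_tmu:
  assumes "finite I" "\<And>i. i \<in> I \<Longrightarrow> pvm_space (X i)" "\<And>i. i \<in> I \<Longrightarrow> z i \<in> vecs (hsp (X i))"
  shows "finite_measure (tmu I X z)"
  using emeasure_tmu[OF assms, where G="\<lambda>i. space (msp (X i))"]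
  by (intro finite_measureI) (simp add: space_tmu space_PiM)

text \<open>The tensor product of projections is obtained as the orthogonal projection on the closed
  span of the tensors \<open>\<iota> (r x)\<close>, which avoids tensor products of operators.
  Self-adjointness and idempotence in each factor show that \<open>\<iota> x - \<iota> (r x)\<close>
  is orthogonal to that span.\<close>

lemma ex_rectangle_projection:
  fixes X :: "nat \<Rightarrow> ('w, 'h::complex_vector) pvms"
  assumes pvm: "\<And>i. i \<in> I \<Longrightarrow> pvm_space (X i)" and T: "hilbert_tensor I (\<lambda>i. hsp (X i)) K \<iota>"
    and G: "\<And>i. i \<in> I \<Longrightarrow> G i \<in> sets (msp (X i))"
  shows "\<exists>Q. bounded_op K K Q \<and> (\<forall>u\<in>vecs K. \<forall>v\<in>vecs K. ip K (Q u) v = ip K u (Q v)) \<and>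
    (\<forall>u\<in>vecs K. hnorm K (Q u) \<le> hnorm K u) \<and>
    (\<forall>x \<in> (\<Pi>\<^sub>E i\<in>I. vecs (hsp (X i))). Q (\<iota> x) = \<iota> (\<lambda>i\<in>I. prj (X i) (G i) (x i)))"
proof -
  interpret K: hilbert_space K using T by (simp add: hilbert_tensor_def)
  define D where "D = (\<Pi>\<^sub>E i\<in>I. vecs (hsp (X i)))"
  define r where "r x = (\<lambda>i\<in>I. prj (X i) (G i) (x i))" for x
  have \<iota>: "\<iota> x \<in> vecs K" if "x \<in> D" for x using T that by (simp add: hilbert_tensor_def D_def)
  have ips: "ip K (\<iota> x) (\<iota> y) = (\<Prod>i\<in>I. ip (hsp (X i)) (x i) (y i))" if "x \<in> D" "y \<in> D" for x y
    using T that by (simp add: hilbert_tensor_def D_def)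
  have r: "r x \<in> D" if "x \<in> D" for x
    using that pvm G by (auto simp: r_def D_def pvm_space.prj_mem PiE_iff)
  define C where "C = (\<lambda>x. \<iota> (r x)) ` D"
  have CV: "C \<subseteq> vecs K" using \<iota> r by (auto simp: C_def)
  define S where "S = perp K (perp K C)"
  have pV: "perp K A \<subseteq> vecs K" for A by (auto simp: perp_def)
  have S: "closed_sub K S" unfolding S_def by (rule K.closed_sub_perp[OF pV])
  obtain Q where Q: "bounded_op K K Q" "\<And>u. u \<in> vecs K \<Longrightarrow> Q u \<in> S" "\<And>u. u \<in> vecs K \<Longrightarrow> u - Q u \<in> perp K S"
    "\<forall>u\<in>vecs K. \<forall>v\<in>vecs K. ip K (Q u) v = ip K u (Q v)" "\<forall>u\<in>vecs K. hnorm K (Q u) \<le> hnorm K u"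
    using K.ex_projection_op[OF S] by blast
  have "Q (\<iota> x) = \<iota> (r x)" if x: "x \<in> D" for x
  proof (rule K.projection_unique[OF S, of "\<iota> x"])
    show "\<iota> (r x) \<in> S" unfolding S_def using x by (intro K.mem_perp_perp[OF CV]) (auto simp: C_def)
    have "ip K (\<iota> x - \<iota> (r x)) (\<iota> (r y)) = 0" if y: "y \<in> D" for y
    proof -
      have "ip (hsp (X i)) (x i) (r y i) = ip (hsp (X i)) (r x i) (r y i)" if i: "i \<in> I" for i
      proof -
        interpret pvm_space "X i" using pvm i by simp
        have "x i \<in> vecs (hsp (X i))" "y i \<in> vecs (hsp (X i))" using x y i by (auto simp: D_def)
        then show ?thesis using i G[OF i] by (simp add: r_def selfadj prj_mem idem)
      qed
      then have "ip K (\<iota> x) (\<iota> (r y)) = ip K (\<iota> (r x)) (\<iota> (r y))"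
        using x y r by (simp add: ips cong: prod.cong)
      then show ?thesis using x y r \<iota> by (simp add: K.ip_diff_left)
    qed
    then have "\<iota> x - \<iota> (r x) \<in> perp K C" using x r \<iota> by (auto simp: perp_def C_def intro: K.diff_mem)
    then show "\<iota> x - \<iota> (r x) \<in> perp K S" unfolding S_def by (intro K.mem_perp_perp[OF pV])
  qed (use x Q \<iota> in auto)
  then show ?thesis using Q(1,4,5) unfolding D_def r_def by blast
qed

text \<open>The input for \<open>pvm_extension\<close> is checked on elementary tensors and passed
  to all vectors by totality. For products and total mass this is an identity of bounded operators;
  countable additivity is a limit and needs the closed subspace \<open>W\<close> below.\<close>

lemma ex_tensor_pvms_hilbert:
  fixes X :: "nat \<Rightarrow> ('w, 'h::complex_vector) pvms" and K :: "'k::complex_vector hspace"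
  assumes I: "finite I" "I \<noteq> {}" and pvm: "\<And>i. i \<in> I \<Longrightarrow> pvm_space (X i)"
    and T: "hilbert_tensor I (\<lambda>i. hsp (X i)) K \<iota>"
  shows "\<exists>Y :: (nat \<Rightarrow> 'w, 'k) pvms. is_tensor_pvms I X Y"
proof -
  interpret K: hilbert_space K using T by (simp add: hilbert_tensor_def)
  let ?M = "\<Pi>\<^sub>M i\<in>I. msp (X i)"
  define R where "R = prod_algebra I (\<lambda>i. msp (X i))"
  define D where "D = (\<Pi>\<^sub>E i\<in>I. vecs (hsp (X i)))"
  define r where "r G x = (\<lambda>i\<in>I. prj (X i) (G i) (x i))" for G x
  have D: "x i \<in> vecs (hsp (X i))" if "x \<in> D" "i \<in> I" for x i using that by (auto simp: D_def)
  have \<iota>: "\<iota> x \<in> vecs K" if "x \<in> D" for x using T that by (simp add: hilbert_tensor_def D_def)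
  have ips: "ip K (\<iota> x) (\<iota> y) = (\<Prod>i\<in>I. ip (hsp (X i)) (x i) (y i))" if "x \<in> D" "y \<in> D" for x y
    using T that by (simp add: hilbert_tensor_def D_def)
  have r: "r G x \<in> D" if "x \<in> D" "\<And>i. i \<in> I \<Longrightarrow> G i \<in> sets (msp (X i))" for G x
    using that pvm by (auto simp: r_def D_def pvm_space.prj_mem PiE_iff)
  have \<iota>norm: "(hnorm K (\<iota> x))\<^sup>2 = (\<Prod>i\<in>I. (hnorm (hsp (X i)) (x i))\<^sup>2)" if x: "x \<in> D" for x
  proof -
    have "complex_of_real ((hnorm K (\<iota> x))\<^sup>2) = (\<Prod>i\<in>I. complex_of_real ((hnorm (hsp (X i)) (x i))\<^sup>2))"
      unfolding K.ip_self[OF \<iota>[OF x], symmetric] ips[OF x x]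
    proof (rule prod.cong[OF refl])
      fix i assume i: "i \<in> I"
      interpret pvm_space "X i" using pvm i by simp
      show "ip (hsp (X i)) (x i) (x i) = complex_of_real ((hnorm (hsp (X i)) (x i))\<^sup>2)" using D[OF x i] by (rule ip_self)
    qed
    then show ?thesis by (simp only: of_real_prod[symmetric] of_real_eq_iff)
  qed
  have rect: "\<exists>G. A = PiE I G \<and> (\<forall>i\<in>I. G i \<in> sets (msp (X i)))" if "A \<in> R" for A
    using that unfolding R_def prod_algebra_eq_finite[OF I(1)] Pi_iff mem_Collect_eq by blast
  have RI: "PiE I G \<in> R" if "\<And>i. i \<in> I \<Longrightarrow> G i \<in> sets (msp (X i))" for G
    unfolding R_def using that I by (intro prod_algebraI_finite) auto
  \<comment> \<open>A nonempty rectangle determines its sides. An empty one does not, but then each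
    description has an empty side and both tensors vanish, so the operator of a rectangle is well
    defined.\<close>
  have rcong: "\<iota> (r G x) = \<iota> (r G' x)"
    if G: "\<And>i. i \<in> I \<Longrightarrow> G i \<in> sets (msp (X i))" "\<And>i. i \<in> I \<Longrightarrow> G' i \<in> sets (msp (X i))"
      and eq: "PiE I G = PiE I G'" and x: "x \<in> D" for G G' x
  proof -
    have z: "\<iota> (r G x) = 0" if G: "\<And>i. i \<in> I \<Longrightarrow> G i \<in> sets (msp (X i))" and e: "\<exists>i\<in>I. G i = {}" for G
    proof -
      obtain i where i: "i \<in> I" "G i = {}" using e by blast
      interpret pvm_space "X i" using pvm i by simp
      have "r G x i = 0" using i D[OF x i(1)] by (simp add: r_def prj_empty)
      then have "(hnorm (hsp (X i)) (r G x i))\<^sup>2 = 0" by simp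
      then have "(\<Prod>i\<in>I. (hnorm (hsp (X i)) (r G x i))\<^sup>2) = 0" using I(1) i(1) by (intro prod_zero) auto
      then have "(hnorm K (\<iota> (r G x)))\<^sup>2 = 0" using \<iota>norm[OF r[OF x G]] by simp
      then show ?thesis using K.hnorm_eq_0[OF \<iota>[OF r[OF x G]]] by simp
    qed
    show ?thesis
    proof (cases "\<forall>i\<in>I. G i = G' i")
      case True
      then have "r G x = r G' x" by (auto simp: r_def)
      then show ?thesis by simp
    next
      case False
      then have "\<exists>i\<in>I. G i = {}" "\<exists>i\<in>I. G' i = {}" using eq unfolding PiE_eq_iff by blast+
      then show ?thesis using z G by metis
    qed
  qed
  have "\<exists>Q. bounded_op K K Q \<and> (\<forall>u\<in>vecs K. \<forall>v\<in>vecs K. ip K (Q u) v = ip K u (Q v)) \<and>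
    (\<forall>u\<in>vecs K. hnorm K (Q u) \<le> hnorm K u) \<and>
    (\<forall>G. (\<forall>i\<in>I. G i \<in> sets (msp (X i))) \<longrightarrow> A = PiE I G \<longrightarrow> (\<forall>x\<in>D. Q (\<iota> x) = \<iota> (r G x)))" if A: "A \<in> R" for A
  proof -
    obtain G where G: "A = PiE I G" "\<And>i. i \<in> I \<Longrightarrow> G i \<in> sets (msp (X i))" using rect[OF A] by auto
    obtain Q where Q: "bounded_op K K Q" "\<forall>u\<in>vecs K. \<forall>v\<in>vecs K. ip K (Q u) v = ip K u (Q v)"
      "\<forall>u\<in>vecs K. hnorm K (Q u) \<le> hnorm K u" "\<forall>x\<in>D. Q (\<iota> x) = \<iota> (r G x)"
      using ex_rectangle_projection[OF pvm T G(2)] unfolding D_def r_def by blast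
    have "Q (\<iota> x) = \<iota> (r G' x)" if G': "\<forall>i\<in>I. G' i \<in> sets (msp (X i))" "A = PiE I G'" and x: "x \<in> D" for G' x
    proof -
      have "Q (\<iota> x) = \<iota> (r G x)" using Q(4) x by blast
      also have "\<dots> = \<iota> (r G' x)" using G' G(1) by (intro rcong[OF G(2) _ _ x]) simp_all
      finally show ?thesis .
    qed
    then show ?thesis by (intro exI[of _ Q] conjI Q(1-3) allI impI ballI) simp
  qed
  then have "\<exists>Q. \<forall>A\<in>R. bounded_op K K (Q A) \<and> (\<forall>u\<in>vecs K. \<forall>v\<in>vecs K. ip K (Q A u) v = ip K u (Q A v)) \<and>
    (\<forall>u\<in>vecs K. hnorm K (Q A u) \<le> hnorm K u) \<and>
    (\<forall>G. (\<forall>i\<in>I. G i \<in> sets (msp (X i))) \<longrightarrow> A = PiE I G \<longrightarrow> (\<forall>x\<in>D. Q A (\<iota> x) = \<iota> (r G x)))"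
    by (intro bchoice ballI)
  then obtain Q where Q: "\<forall>A\<in>R. bounded_op K K (Q A) \<and> (\<forall>u\<in>vecs K. \<forall>v\<in>vecs K. ip K (Q A u) v = ip K u (Q A v)) \<and>
    (\<forall>u\<in>vecs K. hnorm K (Q A u) \<le> hnorm K u) \<and>
    (\<forall>G. (\<forall>i\<in>I. G i \<in> sets (msp (X i))) \<longrightarrow> A = PiE I G \<longrightarrow> (\<forall>x\<in>D. Q A (\<iota> x) = \<iota> (r G x)))" ..
  have Qb: "bounded_op K K (Q A)" if "A \<in> R" for A using bspec[OF Q that] by simp
  have Qsa: "ip K (Q A u) v = ip K u (Q A v)" if "A \<in> R" "u \<in> vecs K" "v \<in> vecs K" for A u v
    using bspec[OF Q that(1)] that(2,3) by simp
  have Qn: "hnorm K (Q A u) \<le> hnorm K u" if "A \<in> R" "u \<in> vecs K" for A u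
    using bspec[OF Q that(1)] that(2) by simp
  have Q\<iota>': "Q A (\<iota> x) = \<iota> (r G x)" if "A \<in> R" "\<forall>i\<in>I. G i \<in> sets (msp (X i))" "A = PiE I G" "x \<in> D" for A G x
    using bspec[OF Q that(1)] that(2-4) by blast
  have Q\<iota>: "Q (PiE I G) (\<iota> x) = \<iota> (r G x)" if "\<And>i. i \<in> I \<Longrightarrow> G i \<in> sets (msp (X i))" "x \<in> D" for G x
    using Q\<iota>'[OF RI[OF that(1)]] that by blast
  have QV: "Q A u \<in> vecs K" if "A \<in> R" "u \<in> vecs K" for A u using bounded_op_mem[OF Qb] that .
  have \<iota>D: "\<iota> ` D \<subseteq> vecs K" using \<iota> by auto
  have tot: "w = 0" if "w \<in> vecs K" "\<And>d. d \<in> \<iota> ` D \<Longrightarrow> ip K w d = 0" for w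
    using hilbert_tensor_total[OF T that(1)] that(2) by (auto simp: D_def)
  have int: "Q A (Q B u) = Q (A \<inter> B) u" if A: "A \<in> R" and B: "B \<in> R" and u: "u \<in> vecs K" for A B u
  proof -
    obtain G where G: "A = PiE I G" "\<And>i. i \<in> I \<Longrightarrow> G i \<in> sets (msp (X i))" using rect[OF A] by auto
    obtain G' where G': "B = PiE I G'" "\<And>i. i \<in> I \<Longrightarrow> G' i \<in> sets (msp (X i))" using rect[OF B] by auto
    have AB: "A \<inter> B = PiE I (\<lambda>i. G i \<inter> G' i)" unfolding G(1) G'(1) by (rule PiE_Int)
    have ABR: "A \<inter> B \<in> R" unfolding AB using G G' by (intro RI) auto
    show ?thesis
    proof (rule K.bounded_op_eqI[OF bounded_op_comp[OF Qb[OF B] Qb[OF A] K.hilbert_space_axioms K.hilbert_space_axioms] Qb[OF ABR] \<iota>D tot _ u])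
      fix d assume "d \<in> \<iota> ` D"
      then obtain x where x: "x \<in> D" "d = \<iota> x" by blast
      have "r G (r G' x) = r (\<lambda>i. G i \<inter> G' i) x"
        unfolding r_def
      proof (rule restrict_ext)
        fix i assume i: "i \<in> I"
        interpret pvm_space "X i" using pvm i by simp
        show "prj (X i) (G i) ((\<lambda>i\<in>I. prj (X i) (G' i) (x i)) i) = prj (X i) (G i \<inter> G' i) (x i)"
          using i G G' D[OF x(1) i] by (simp add: prj_Int)
      qed
      then show "Q A (Q B d) = Q (A \<inter> B) d"
        unfolding x(2) AB unfolding G(1) G'(1) using G(2) G'(2) x(1) r by (simp add: Q\<iota>)
    qed
  qed
  have top: "space ?M \<in> R" unfolding space_PiM by (rule RI) auto
  have Qtot: "Q (space ?M) u = u" if u: "u \<in> vecs K" for u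
  proof (rule K.bounded_op_eqI[OF Qb[OF top] _ \<iota>D tot _ u])
    show "bounded_op K K (\<lambda>u. u)" unfolding bounded_op_def by (auto intro: exI[of _ 1])
    fix d assume "d \<in> \<iota> ` D"
    then obtain x where x: "x \<in> D" "d = \<iota> x" by blast
    have "r (\<lambda>i. space (msp (X i))) x = x"
    proof
      fix i
      show "r (\<lambda>i. space (msp (X i))) x i = x i"
        using x(1) D[OF x(1)] pvm pvm_space.total[of "X i"] by (cases "i \<in> I") (auto simp: r_def D_def PiE_iff extensional_def)
    qed
    then show "Q (space ?M) d = d" unfolding x(2) space_PiM using x(1) by (simp add: Q\<iota>)
  qed
  have semi: "semiring_of_sets (space ?M) R" unfolding R_def using I by (rule semiring_prod_algebra)
  interpret R: semiring_of_sets "space ?M" R by (rule semi)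
  have Q0: "Q {} u = 0" if u: "u \<in> vecs K" for u
  proof -
    obtain G where G: "{} = PiE I G" "\<And>i. i \<in> I \<Longrightarrow> G i \<in> sets (msp (X i))" using rect[OF R.empty_sets] by auto
    show ?thesis
    proof (rule K.bounded_op_eqI[OF Qb[OF R.empty_sets] _ \<iota>D tot _ u])
      show "bounded_op K K (\<lambda>u. 0)" unfolding bounded_op_def by (auto intro: exI[of _ 1] K.zero_mem)
      fix d assume "d \<in> \<iota> ` D"
      then obtain x where x: "x \<in> D" "d = \<iota> x" by blast
      obtain i where i: "i \<in> I" "G i = {}" using G(1) PiE_eq_empty_iff[of I G] by metis
      interpret pvm_space "X i" using pvm i by simp
      have "r G x i = 0" using i D[OF x(1) i(1)] by (simp add: r_def prj_empty)
      then have "(hnorm (hsp (X i)) (r G x i))\<^sup>2 = 0" by simp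
      then have "(\<Prod>i\<in>I. (hnorm (hsp (X i)) (r G x i))\<^sup>2) = 0" using I(1) i(1) by (intro prod_zero) auto
      then have "(hnorm K (\<iota> (r G x)))\<^sup>2 = 0" using \<iota>norm[OF r[OF x(1) G(2)]] by simp
      then have "\<iota> (r G x) = 0" using K.hnorm_eq_0[OF \<iota>[OF r[OF x(1) G(2)]]] by simp
      then show "Q {} d = 0" unfolding x(2) using Q\<iota>'[OF R.empty_sets, of G x] G x(1) by simp
    qed
  qed
  have cadd: "(\<lambda>n. (hnorm K (Q (A n) u))\<^sup>2) sums (hnorm K (Q (\<Union>n. A n) u))\<^sup>2"
    if A: "range A \<subseteq> R" and d: "disjoint_family A" and U: "(\<Union>n. A n) \<in> R" and u: "u \<in> vecs K"
    for A :: "nat \<Rightarrow> _" and u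
  proof -
    define B where "B = (\<Union>n. A n)"
    have B: "B \<in> R" using U by (simp add: B_def)
    have AR: "A n \<in> R" for n using A by blast
    have AB: "A n \<inter> B = A n" for n by (auto simp: B_def)
    have AA: "A m \<inter> A n = {}" if "m \<noteq> n" for m n using d that by (auto simp: disjoint_family_on_def)
    \<comment> \<open>The remainder after \<open>N\<close> pieces. By Pythagoras its squared norm is
      the defect of the series, so additivity at \<open>u\<close> means that it tends to 0.\<close>
    define S where "S N u = Q B u - (\<Sum>n<N. Q (A n) u)" for N :: nat and u
    have sumV: "(\<Sum>n<N. Q (A n) u) \<in> vecs K" if "u \<in> vecs K" for N :: nat and u
      using that AR by (intro K.sum_mem QV) auto
    have SV: "S N u \<in> vecs K" if "u \<in> vecs K" for N u
      unfolding S_def using that B sumV by (intro K.diff_mem QV) auto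
    have Ssq: "(hnorm K (S N u))\<^sup>2 = (hnorm K (Q B u))\<^sup>2 - (\<Sum>n<N. (hnorm K (Q (A n) u))\<^sup>2)" if u: "u \<in> vecs K" for N u
    proof -
      define t where "t = (\<Sum>n<N. Q (A n) u)"
      have t: "t \<in> vecs K" unfolding t_def using u by (rule sumV)
      have nn: "ip K (Q (A n) u) u = of_real ((hnorm K (Q (A n) u))\<^sup>2)" for n
        using Qsa[OF AR QV[OF AR u] u, of n n] int[OF AR AR u, of n n] K.ip_self[OF QV[OF AR u], of n] by simp
      have 1: "ip K (Q B u) (Q (A n) u) = of_real ((hnorm K (Q (A n) u))\<^sup>2)" for n
        using Qsa[OF AR QV[OF B u] u, of n] int[OF AR B u, of n] nn[of n] by (simp add: AB)
      have 2: "ip K (Q (A m) u) (Q (A n) u) = (if m = n then of_real ((hnorm K (Q (A n) u))\<^sup>2) else 0)" for m n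
        using Qsa[OF AR QV[OF AR u] u, of n m] int[OF AR AR u, of n m] nn[of n] AA[of n m] Q0[OF u] u by auto
      have "ip K (Q B u) t = (\<Sum>n<N. of_real ((hnorm K (Q (A n) u))\<^sup>2))"
        unfolding t_def using u B AR by (subst K.ip_sum_right) (auto simp: 1 QV)
      moreover have "ip K t t = (\<Sum>n<N. of_real ((hnorm K (Q (A n) u))\<^sup>2))"
      proof -
        have "ip K t t = (\<Sum>m<N. ip K (Q (A m) u) t)"
          using t by (subst t_def) (auto intro!: K.ip_sum_left QV AR u)
        also have "\<dots> = (\<Sum>m<N. \<Sum>n<N. if m = n then of_real ((hnorm K (Q (A n) u))\<^sup>2) else 0)"
          unfolding t_def using u AR by (intro sum.cong refl) (subst K.ip_sum_right, auto simp: 2 QV)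
        finally show ?thesis by simp
      qed
      ultimately show ?thesis
        unfolding S_def t_def[symmetric] using K.hnorm_diff_sq[OF QV[OF B u] t] K.hnorm_sq[OF t] by simp
    qed
    have Sle: "hnorm K (S N u) \<le> hnorm K u" if u: "u \<in> vecs K" for N u
    proof (rule power2_le_imp_le)
      have "(\<Sum>n<N. (hnorm K (Q (A n) u))\<^sup>2) \<ge> 0" by (intro sum_nonneg) simp
      moreover have "(hnorm K (Q B u))\<^sup>2 \<le> (hnorm K u)\<^sup>2" using Qn[OF B u] QV[OF B u] by (intro power_mono) auto
      ultimately show "(hnorm K (S N u))\<^sup>2 \<le> (hnorm K u)\<^sup>2" using Ssq[OF u, of N] by linarith
    qed (use u in simp)
    have Sadd: "S N (x + y) = S N x + S N y" if "x \<in> vecs K" "y \<in> vecs K" for N x y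
      unfolding S_def using that by (simp add: bounded_op_add[OF Qb[OF B]] bounded_op_add[OF Qb[OF AR]] sum.distrib)
    have Ssc: "S N (c *\<^sub>C x) = c *\<^sub>C S N x" if "x \<in> vecs K" for N x c
      unfolding S_def using that
      by (simp add: bounded_op_scaleC[OF Qb[OF B]] bounded_op_scaleC[OF Qb[OF AR]] scaleC_sum_right scaleC_diff_right)
    \<comment> \<open>The remainders are linear and contractive uniformly in \<open>N\<close>, so
      \<open>W\<close> is a closed subspace; it is the whole space as soon as it contains the
      elementary tensors.\<close>
    define W where "W = {u\<in>vecs K. (\<lambda>N. hnorm K (S N u)) \<longlonglongrightarrow> 0}"
    have "closed_sub K W"
      unfolding closed_sub_def
    proof (intro conjI)
      show "W \<subseteq> vecs K" by (auto simp: W_def)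
      have "S N 0 = 0" for N
        using Ssc[OF K.zero_mem, of N 0] by simp
      then show "0 \<in> W" using K.zero_mem by (simp add: W_def)
      show "\<forall>x\<in>W. \<forall>y\<in>W. x + y \<in> W"
      proof (intro ballI)
        fix x y assume xy: "x \<in> W" "y \<in> W"
        then have v: "x \<in> vecs K" "y \<in> vecs K" by (auto simp: W_def)
        have "(\<lambda>N. hnorm K (S N (x + y))) \<longlonglongrightarrow> 0"
        proof (rule tendsto_sandwich[OF _ _ tendsto_const])
          show "\<forall>\<^sub>F N in sequentially. 0 \<le> hnorm K (S N (x + y))" using SV v K.add_mem by simp
          show "\<forall>\<^sub>F N in sequentially. hnorm K (S N (x + y)) \<le> hnorm K (S N x) + hnorm K (S N y)"
            using Sadd SV v by (simp add: K.hnorm_triangle)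
          show "(\<lambda>N. hnorm K (S N x) + hnorm K (S N y)) \<longlonglongrightarrow> 0"
            using tendsto_add[of "\<lambda>N. hnorm K (S N x)" 0 sequentially "\<lambda>N. hnorm K (S N y)" 0] xy by (simp add: W_def)
        qed
        then show "x + y \<in> W" using v K.add_mem by (simp add: W_def)
      qed
      show "\<forall>x\<in>W. \<forall>c. c *\<^sub>C x \<in> W"
        using tendsto_mult_right_zero[where F=sequentially] by (auto simp: W_def Ssc SV K.hnorm_scaleC K.scaleC_mem)
      show "\<forall>s x. (\<forall>n. s n \<in> W) \<longrightarrow> x \<in> vecs K \<longrightarrow> (\<lambda>n. hnorm K (s n - x)) \<longlonglongrightarrow> 0 \<longrightarrow> x \<in> W"
      proof (intro allI impI)
        fix s x assume s: "\<forall>n::nat. s n \<in> W" and x: "x \<in> vecs K" and l: "(\<lambda>n. hnorm K (s n - x)) \<longlonglongrightarrow> 0"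
        have sv: "s n \<in> vecs K" for n using s by (auto simp: W_def)
        have "(\<lambda>N. hnorm K (S N x)) \<longlonglongrightarrow> 0"
        proof (rule LIMSEQ_I)
          fix e :: real assume "0 < e"
          then have e: "e / 2 > 0" by simp
          obtain n where n: "hnorm K (s n - x) < e / 2"
            using order_tendstoD(2)[OF l e] unfolding eventually_sequentially by blast
          have "(\<lambda>N. hnorm K (S N (s n))) \<longlonglongrightarrow> 0" using s by (simp add: W_def)
          from order_tendstoD(2)[OF this e]
          obtain N0 where N0: "\<And>N. N \<ge> N0 \<Longrightarrow> hnorm K (S N (s n)) < e / 2"
            unfolding eventually_sequentially by blast
          have "norm (hnorm K (S N x) - 0) < e" if N: "N \<ge> N0" for N
          proof -
            have "S N x = S N (x - s n) + S N (s n)" using Sadd[of "x - s n" "s n" N] x sv by (simp add: K.diff_mem)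
            then have "hnorm K (S N x) \<le> hnorm K (S N (x - s n)) + hnorm K (S N (s n))"
              using K.hnorm_triangle[OF SV SV, of "x - s n" "s n" N N] x sv by (simp add: K.diff_mem)
            also have "\<dots> \<le> hnorm K (x - s n) + hnorm K (S N (s n))"
              using Sle[of "x - s n" N] x sv by (simp add: K.diff_mem)
            also have "\<dots> < e" using n N0[OF N] K.hnorm_commute[OF x sv] by simp
            finally show ?thesis using K.hnorm_nonneg[OF SV[OF x]] by simp
          qed
          then show "\<exists>N0. \<forall>N\<ge>N0. norm (hnorm K (S N x) - 0) < e" by blast
        qed
        then show "x \<in> W" using x by (simp add: W_def)
      qed
    qed
    moreover have "\<iota> ` D \<subseteq> W"
    proof
      fix d assume "d \<in> \<iota> ` D"
      then obtain x where x: "x \<in> D" "d = \<iota> x" by blast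
      have dV: "d \<in> vecs K" using x \<iota> by simp
      \<comment> \<open>At an elementary tensor the squared norms are the values of a product
        measure on rectangles, and its countable additivity is known.\<close>
      interpret \<mu>: finite_measure "tmu I X x" using I(1) pvm D[OF x(1)] by (rule finite_measure_tmu)
      have meas: "measure (tmu I X x) C = (hnorm K (Q C d))\<^sup>2" if C: "C \<in> R" for C
      proof -
        obtain G where G: "C = PiE I G" "\<And>i. i \<in> I \<Longrightarrow> G i \<in> sets (msp (X i))" using rect[OF C] by auto
        have "measure (tmu I X x) C = (\<Prod>i\<in>I. (hnorm (hsp (X i)) (prj (X i) (G i) (x i)))\<^sup>2)"
          unfolding measure_def G(1) using emeasure_tmu[OF I(1) pvm D[OF x(1)] G(2)] by (simp add: prod_nonneg)
        also have "\<dots> = (hnorm K (\<iota> (r G x)))\<^sup>2"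
        proof -
          have "r G x \<in> D" using x(1) G(2) by (rule r)
          then show ?thesis by (simp add: \<iota>norm) (simp add: r_def)
        qed
        also have "\<iota> (r G x) = Q C d" unfolding G(1) x(2) using Q\<iota> G(2) x(1) by simp
        finally show ?thesis .
      qed
      have Rs: "C \<in> sets (tmu I X x)" if "C \<in> R" for C
        using rect[OF that] I(1) by (auto simp: sets_tmu intro!: sets_PiM_I_finite)
      have "(\<lambda>n. measure (tmu I X x) (A n)) sums measure (tmu I X x) (\<Union>n. A n)"
        using AR Rs d by (intro \<mu>.finite_measure_UNION) auto
      then have "(\<lambda>n. (hnorm K (Q (A n) d))\<^sup>2) sums (hnorm K (Q B d))\<^sup>2"
        using meas AR U by (simp add: B_def)
      then have "(\<lambda>N. (hnorm K (Q B d))\<^sup>2 - (\<Sum>n<N. (hnorm K (Q (A n) d))\<^sup>2)) \<longlonglongrightarrow> (hnorm K (Q B d))\<^sup>2 - (hnorm K (Q B d))\<^sup>2"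
        unfolding sums_def by (intro tendsto_diff tendsto_const)
      then have "(\<lambda>N. (hnorm K (S N d))\<^sup>2) \<longlonglongrightarrow> 0" by (simp add: Ssq[OF dV])
      then have "(\<lambda>N. sqrt ((hnorm K (S N d))\<^sup>2)) \<longlonglongrightarrow> sqrt 0" by (rule tendsto_real_sqrt)
      then have "(\<lambda>N. hnorm K (S N d)) \<longlonglongrightarrow> 0" using SV[OF dV] by simp
      then show "d \<in> W" using dV by (simp add: W_def)
    qed
    ultimately have "u \<in> W" using tot u by (rule K.total_closed_sub)
    then have "(\<lambda>N. (hnorm K (S N u))\<^sup>2) \<longlonglongrightarrow> 0\<^sup>2" by (intro tendsto_power) (simp add: W_def)
    then have "(\<lambda>N. (hnorm K (Q B u))\<^sup>2 - (hnorm K (S N u))\<^sup>2) \<longlonglongrightarrow> (hnorm K (Q B u))\<^sup>2 - 0\<^sup>2"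
      by (intro tendsto_diff tendsto_const)
    then show ?thesis unfolding sums_def B_def[symmetric] by (simp add: Ssq[OF u])
  qed
  have setsM: "sets ?M = sigma_sets (space ?M) R" unfolding R_def space_PiM by (rule sets_PiM)
  obtain T where T1: "pvm_space \<lparr>msp = ?M, hsp = K, prj = T\<rparr>" and T2: "\<forall>A\<in>R. \<forall>u\<in>vecs K. T A u = Q A u"
    using pvm_extension[OF K.hilbert_space_axioms semi setsM top Qb Qtot int Qsa cadd] by blast
  have "is_tensor_pvms I X \<lparr>msp = ?M, hsp = K, prj = T\<rparr>"
    unfolding is_tensor_pvms_def
  proof (intro conjI exI[of _ \<iota>] allI impI)
    fix G x assume "\<forall>i\<in>I. G i \<in> sets (msp (X i))" "x \<in> (\<Pi>\<^sub>E i\<in>I. vecs (hsp (X i)))"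
    then have "\<And>i. i \<in> I \<Longrightarrow> G i \<in> sets (msp (X i))" "x \<in> D" by (auto simp: D_def)
    then show "prj \<lparr>msp = ?M, hsp = K, prj = T\<rparr> (Pi\<^sub>E I G) (\<iota> x) = \<iota> (\<lambda>i\<in>I. prj (X i) (G i) (x i))"
      using T2 RI[of G] \<iota>[of x] Q\<iota>[of G x] by (simp add: r_def)
  qed (use T T1 in simp_all)
  then show ?thesis by blast
qed

text \<open>The existence behind the \<open>SOME\<close> of \<open>tensor_pvms\<close>: the l2 model
  fits into the type reserved for it, since tuples of basis vectors are functions from indices to
  vectors.\<close>

lemma is_tensor_pvms_tensor_pvms:
  fixes X :: "nat \<Rightarrow> ('w, 'h::complex_vector) pvms"
  assumes I: "finite I" "I \<noteq> {}" and pvm: "\<And>i. i \<in> I \<Longrightarrow> pvm_space (X i)"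
  shows "is_tensor_pvms I X (tensor_pvms I X)"
proof -
  have H: "hilbert_space (hsp (X i))" if "i \<in> I" for i using pvm[OF that] by (simp add: pvm_space_def)
  then have "\<exists>E. \<forall>i\<in>I. onb (hsp (X i)) (E i)" using hilbert_space.ex_onb by (intro bchoice) blast
  then obtain E where E: "\<And>i. i \<in> I \<Longrightarrow> onb (hsp (X i)) (E i)" by blast
  have T: "hilbert_tensor I (\<lambda>i. hsp (X i)) (l2 (PiE I E)) (tensor_vec I (\<lambda>i. hsp (X i)) E)"
    by (rule hilbert_tensor_l2[OF I(1) H E])
  obtain Y :: "(nat \<Rightarrow> 'w, (nat \<Rightarrow> 'h) \<Rightarrow> complex) pvms" where "is_tensor_pvms I X Y"
    using ex_tensor_pvms_hilbert[OF I pvm T] by blast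
  then show ?thesis unfolding tensor_pvms_def by (rule someI)
qed

text \<open>The scalar spectral measure of an elementary tensor is a product measure, because both
  agree on rectangles; and a projection vanishes as soon as it kills the total set of elementary
  tensors. This is the bridge from operators to Fubini.\<close>

lemma tensor_pvm_null_iff:
  fixes X :: "nat \<Rightarrow> ('w, 'h::complex_vector) pvms"
  assumes I: "finite I" and pvm: "\<And>i. i \<in> I \<Longrightarrow> pvm_space (X i)"
    and Y: "is_tensor_pvms I X Y" and N: "N \<in> sets (\<Pi>\<^sub>M i\<in>I. msp (X i))"
  shows "pvm_null Y N \<longleftrightarrow> (\<forall>z \<in> (\<Pi>\<^sub>E i\<in>I. vecs (hsp (X i))). emeasure (tmu I X z) N = 0)"
proof -
  define D where "D = (\<Pi>\<^sub>E i\<in>I. vecs (hsp (X i)))"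
  have M: "msp Y = (\<Pi>\<^sub>M i\<in>I. msp (X i))" and pY: "pvm_space Y"
    using Y by (simp_all add: is_tensor_pvms_def)
  obtain \<iota> where T: "hilbert_tensor I (\<lambda>i. hsp (X i)) (hsp Y) \<iota>"
    and P': "\<forall>G x. (\<forall>i\<in>I. G i \<in> sets (msp (X i))) \<longrightarrow> x \<in> D \<longrightarrow> prj Y (PiE I G) (\<iota> x) = \<iota> (\<lambda>i\<in>I. prj (X i) (G i) (x i))"
    using Y unfolding is_tensor_pvms_def D_def by (elim conjE exE)
  have P: "prj Y (PiE I G) (\<iota> x) = \<iota> (\<lambda>i\<in>I. prj (X i) (G i) (x i))"
    if "\<And>i. i \<in> I \<Longrightarrow> G i \<in> sets (msp (X i))" "x \<in> D" for G x
    using P' that by simp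
  interpret Y: pvm_space Y by fact
  have D: "x i \<in> vecs (hsp (X i))" if "x \<in> D" "i \<in> I" for x i using that by (auto simp: D_def)
  have \<iota>: "\<iota> x \<in> vecs (hsp Y)" if "x \<in> D" for x using T that by (simp add: hilbert_tensor_def D_def)
  have ips: "ip (hsp Y) (\<iota> x) (\<iota> y) = (\<Prod>i\<in>I. ip (hsp (X i)) (x i) (y i))" if "x \<in> D" "y \<in> D" for x y
    using T that by (simp add: hilbert_tensor_def D_def)
  have \<iota>norm: "(hnorm (hsp Y) (\<iota> x))\<^sup>2 = (\<Prod>i\<in>I. (hnorm (hsp (X i)) (x i))\<^sup>2)" if x: "x \<in> D" for x
  proof -
    have "complex_of_real ((hnorm (hsp Y) (\<iota> x))\<^sup>2) = (\<Prod>i\<in>I. complex_of_real ((hnorm (hsp (X i)) (x i))\<^sup>2))"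
      unfolding Y.ip_self[OF \<iota>[OF x], symmetric] ips[OF x x]
    proof (rule prod.cong[OF refl])
      fix i assume i: "i \<in> I"
      interpret pvm_space "X i" using pvm i by simp
      show "ip (hsp (X i)) (x i) (x i) = complex_of_real ((hnorm (hsp (X i)) (x i))\<^sup>2)" using D[OF x i] by (rule ip_self)
    qed
    then show ?thesis by (simp only: of_real_prod[symmetric] of_real_eq_iff)
  qed
  have eq: "pmu Y (\<iota> z) = tmu I X z" if z: "z \<in> D" for z
  proof (rule measure_eqI_PiM_finite[OF I, where M="\<lambda>i. msp (X i)" and A="\<lambda>_. space (\<Pi>\<^sub>M i\<in>I. msp (X i))"])
    fix G assume G: "\<And>i. i \<in> I \<Longrightarrow> G i \<in> sets (msp (X i))"
    have rD: "(\<lambda>i\<in>I. prj (X i) (G i) (z i)) \<in> D"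
      unfolding D_def using pvm_space.prj_mem[OF pvm G D[OF z]] by (intro restrict_PiE_iff[THEN iffD2] ballI)
    have "PiE I G \<in> sets (msp Y)" unfolding M using I G by (intro sets_PiM_I_finite)
    then have "emeasure (pmu Y (\<iota> z)) (PiE I G) = ennreal ((hnorm (hsp Y) (\<iota> (\<lambda>i\<in>I. prj (X i) (G i) (z i))))\<^sup>2)"
      using \<iota>[OF z] P[OF G z] by (simp add: Y.emeasure_pmu)
    also have "\<dots> = emeasure (tmu I X z) (PiE I G)"
    proof -
      have "emeasure (tmu I X z) (PiE I G) = ennreal (\<Prod>i\<in>I. (hnorm (hsp (X i)) (prj (X i) (G i) (z i)))\<^sup>2)"
        using D[OF z] pvm G by (intro emeasure_tmu[OF I])
      then show ?thesis unfolding \<iota>norm[OF rD] by simp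
    qed
    finally show "emeasure (pmu Y (\<iota> z)) (PiE I G) = emeasure (tmu I X z) (PiE I G)" .
  next
    show "range (\<lambda>_::nat. space (\<Pi>\<^sub>M i\<in>I. msp (X i))) \<subseteq> prod_algebra I (\<lambda>i. msp (X i))"
      using I by (auto simp: space_PiM intro!: prod_algebraI_finite)
    show "emeasure (pmu Y (\<iota> z)) (space (\<Pi>\<^sub>M i\<in>I. msp (X i))) \<noteq> \<infinity>"
      using Y.emeasure_pmu[OF sets.top \<iota>[OF z]] by (simp add: M)
  qed (auto simp: sets_tmu M)
  have NY: "N \<in> sets (msp Y)" using N M by simp
  have iff: "emeasure (tmu I X z) N = 0 \<longleftrightarrow> prj Y N (\<iota> z) = 0" if z: "z \<in> D" for z
    unfolding eq[OF z, symmetric] Y.emeasure_pmu[OF NY \<iota>[OF z]]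
    using Y.hnorm_eq_0[OF Y.prj_mem[OF NY \<iota>[OF z]]] by (simp add: ennreal_eq_0_iff)
  show ?thesis
    unfolding D_def[symmetric]
  proof
    assume "pvm_null Y N"
    then show "\<forall>z\<in>D. emeasure (tmu I X z) N = 0" using iff \<iota> by (auto simp: pvm_null_def)
  next
    assume *: "\<forall>z\<in>D. emeasure (tmu I X z) N = 0"
    show "pvm_null Y N"
      unfolding pvm_null_def
    proof
      fix u assume u: "u \<in> vecs (hsp Y)"
      show "prj Y N u = 0"
      proof (rule Y.bounded_op_eqI[OF Y.bounded[OF NY] _ _ _ _ u, where D="\<iota> ` D"])
        show "bounded_op (hsp Y) (hsp Y) (\<lambda>u. 0)" unfolding bounded_op_def by (auto intro: exI[of _ 1] Y.zero_mem)
        show "\<iota> ` D \<subseteq> vecs (hsp Y)" using \<iota> by auto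
        show "w = 0" if "w \<in> vecs (hsp Y)" "\<And>d. d \<in> \<iota> ` D \<Longrightarrow> ip (hsp Y) w d = 0" for w
          using hilbert_tensor_total[OF T that(1)] that(2) by (auto simp: D_def)
        show "prj Y N d = 0" if "d \<in> \<iota> ` D" for d using that * iff by auto
      qed
    qed
  qed
qed

lemma tensor_pvm_AE_iff:
  fixes X :: "nat \<Rightarrow> ('w, 'h::complex_vector) pvms"
  assumes I: "finite I" "I \<noteq> {}" and pvm: "\<And>i. i \<in> I \<Longrightarrow> pvm_space (X i)"
  shows "pvm_AE (tensor_pvms I X) p \<longleftrightarrow> (\<exists>N\<in>sets (\<Pi>\<^sub>M i\<in>I. msp (X i)).
    (\<forall>z \<in> (\<Pi>\<^sub>E i\<in>I. vecs (hsp (X i))). emeasure (tmu I X z) N = 0) \<and>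
    {\<omega>\<in>space (\<Pi>\<^sub>M i\<in>I. msp (X i)). \<not> p \<omega>} \<subseteq> N)"
proof -
  have T: "is_tensor_pvms I X (tensor_pvms I X)" using I pvm by (rule is_tensor_pvms_tensor_pvms)
  then have M: "msp (tensor_pvms I X) = (\<Pi>\<^sub>M i\<in>I. msp (X i))" by (simp add: is_tensor_pvms_def)
  show ?thesis
    unfolding pvm_AE_def M using tensor_pvm_null_iff[OF I(1) pvm T] by (intro bex_cong) auto
qed

lemma pvm_space_tensor:
  fixes X :: "nat \<Rightarrow> ('w, 'h::complex_vector) pvms"
  assumes "finite I" "I \<noteq> {}" "\<And>i. i \<in> I \<Longrightarrow> pvm_space (X i)"
  shows "pvm_space (tensor_pvms I X)" "msp (tensor_pvms I X) = (\<Pi>\<^sub>M i\<in>I. msp (X i))"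
  using is_tensor_pvms_tensor_pvms[OF assms] by (simp_all add: is_tensor_pvms_def)

text \<open>The exceptional set becomes a cylinder, and a product measure of a cylinder is the
  measure of its base, here 0, times the mass of the remaining factors. It lets decompositions in
  fewer variables be used on the full product.\<close>

lemma tensor_pvm_AE_restrict:
  fixes X :: "nat \<Rightarrow> ('w, 'h::complex_vector) pvms"
  assumes I: "finite I" "J \<subseteq> I" "J \<noteq> {}" and pvm: "\<And>i. i \<in> I \<Longrightarrow> pvm_space (X i)"
    and ae: "pvm_AE (tensor_pvms J X) p"
  shows "pvm_AE (tensor_pvms I X) (\<lambda>\<omega>. p (restrict \<omega> J))"
proof -
  have J: "finite J" "I \<noteq> {}" using I finite_subset by auto
  have pJ: "pvm_space (X i)" if "i \<in> J" for i using pvm I that by auto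
  obtain N where N: "N \<in> sets (\<Pi>\<^sub>M i\<in>J. msp (X i))"
    "\<And>z. z \<in> (\<Pi>\<^sub>E i\<in>J. vecs (hsp (X i))) \<Longrightarrow> emeasure (tmu J X z) N = 0"
    "{\<omega>\<in>space (\<Pi>\<^sub>M i\<in>J. msp (X i)). \<not> p \<omega>} \<subseteq> N"
    using ae tensor_pvm_AE_iff[OF J(1) I(3) pJ] by auto
  define N' where "N' = (\<lambda>\<omega>. restrict \<omega> J) -` N \<inter> space (\<Pi>\<^sub>M i\<in>I. msp (X i))"
  have rm: "(\<lambda>\<omega>. restrict \<omega> J) \<in> measurable (\<Pi>\<^sub>M i\<in>I. msp (X i)) (\<Pi>\<^sub>M i\<in>J. msp (X i))"
    using I(2) by (rule measurable_restrict_subset)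
  have N'm: "N' \<in> sets (\<Pi>\<^sub>M i\<in>I. msp (X i))" unfolding N'_def using rm N(1) by (rule measurable_sets)
  have "emeasure (tmu I X z) N' = 0" if z: "z \<in> (\<Pi>\<^sub>E i\<in>I. vecs (hsp (X i)))" for z
  proof -
    define M where "M i = (if i \<in> I then pmu (X i) (z i) else count_space {})" for i
    interpret product_sigma_finite M
      unfolding M_def using pvm z by (intro product_sigma_finite_pmu) auto
    have eqI: "tmu I X z = PiM (J \<union> (I - J)) M" unfolding tmu_def M_def using I(2) by (simp add: Un_absorb1)
    have eqJ: "PiM J M = tmu J X (restrict z J)" unfolding tmu_def M_def using I(2) by (intro PiM_cong) auto
    interpret J: sigma_finite_measure "PiM J M" using J(1) by (rule sigma_finite)
    interpret J': sigma_finite_measure "PiM (I - J) M" using I(1) by (intro sigma_finite) simp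
    have sJ: "sets (PiM J M) = sets (\<Pi>\<^sub>M i\<in>J. msp (X i))" unfolding eqJ by (rule sets_tmu)
    have NJ: "N \<in> sets (PiM J M)" using N(1) sJ by simp
    have N'I: "N' \<in> sets (PiM (J \<union> (I - J)) M)" unfolding eqI[symmetric] sets_tmu by (rule N'm)
    have "emeasure (tmu I X z) N' = emeasure (distr (PiM J M \<Otimes>\<^sub>M PiM (I - J) M) (PiM (J \<union> (I - J)) M) (merge J (I - J))) N'"
      unfolding eqI using I(1) J(1) by (subst distr_merge) auto
    also have "\<dots> = emeasure (PiM J M \<Otimes>\<^sub>M PiM (I - J) M) (merge J (I - J) -` N' \<inter> space (PiM J M \<Otimes>\<^sub>M PiM (I - J) M))"
      using N'I by (intro emeasure_distr) measurable
    also have "\<dots> \<le> emeasure (PiM J M \<Otimes>\<^sub>M PiM (I - J) M) (N \<times> space (PiM (I - J) M))"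
    proof (rule emeasure_mono)
      show "merge J (I - J) -` N' \<inter> space (PiM J M \<Otimes>\<^sub>M PiM (I - J) M) \<subseteq> N \<times> space (PiM (I - J) M)"
      proof
        fix t assume t: "t \<in> merge J (I - J) -` N' \<inter> space (PiM J M \<Otimes>\<^sub>M PiM (I - J) M)"
        obtain x y where xy: "t = (x, y)" by (cases t)
        have x: "x \<in> space (PiM J M)" "y \<in> space (PiM (I - J) M)" using t xy by (auto simp: space_pair_measure)
        have "restrict (merge J (I - J) (x, y)) J = restrict x J" by (rule restrict_merge) auto
        also have "\<dots> = x" using x(1) by (auto simp: space_PiM PiE_iff extensional_restrict)
        finally show "t \<in> N \<times> space (PiM (I - J) M)" using t xy x by (auto simp: N'_def)
      qed
    qed (use NJ in auto)
    also have "\<dots> = emeasure (PiM J M) N * emeasure (PiM (I - J) M) (space (PiM (I - J) M))"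
      using NJ by (intro J'.emeasure_pair_measure_Times) auto
    also have "emeasure (PiM J M) N = 0" unfolding eqJ using z I(2) by (intro N(2)) auto
    finally show ?thesis by simp
  qed
  moreover have "{\<omega>\<in>space (\<Pi>\<^sub>M i\<in>I. msp (X i)). \<not> p (restrict \<omega> J)} \<subseteq> N'"
    using N(3) measurable_space[OF rm] unfolding N'_def by blast
  ultimately show ?thesis
    using N'm pvm by (subst tensor_pvm_AE_iff[OF I(1) J(2)]) auto
qed

text \<open>Connects the space of one-entry tuples with \<open>X a\<close> itself, for the case of a
  single projection valued measure.\<close>

lemma tensor_pvm_AE_singleton:
  fixes X :: "nat \<Rightarrow> ('w, 'h::complex_vector) pvms"
  assumes pvm: "pvm_space (X a)" and ae: "pvm_AE (X a) p"
  shows "pvm_AE (tensor_pvms {a} X) (\<lambda>\<omega>. p (\<omega> a))"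
proof -
  interpret pvm_space "X a" by fact
  obtain N where N: "N \<in> sets (msp (X a))" "pvm_null (X a) N" "{\<omega>\<in>space (msp (X a)). \<not> p \<omega>} \<subseteq> N"
    using ae by (auto simp: pvm_AE_def)
  have "PiE {a} (\<lambda>_. N) \<in> sets (\<Pi>\<^sub>M i\<in>{a}. msp (X i))" using N(1) by (intro sets_PiM_I_finite) auto
  moreover have "emeasure (tmu {a} X z) (PiE {a} (\<lambda>_. N)) = 0" if z: "z \<in> (\<Pi>\<^sub>E i\<in>{a}. vecs (hsp (X i)))" for z
  proof -
    have "emeasure (tmu {a} X z) (PiE {a} (\<lambda>_. N)) = ennreal (\<Prod>i\<in>{a}. (hnorm (hsp (X i)) (prj (X i) N (z i)))\<^sup>2)"
      by (rule emeasure_tmu) (use pvm z N(1) in auto)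
    moreover have "z a \<in> vecs (hsp (X a))" using PiE_mem[OF z] by simp
    ultimately show ?thesis using N(2) by (simp add: pvm_null_def)
  qed
  moreover have "{\<omega>\<in>space (\<Pi>\<^sub>M i\<in>{a}. msp (X i)). \<not> p (\<omega> a)} \<subseteq> PiE {a} (\<lambda>_. N)"
    using N(3) by (auto simp: space_PiM PiE_iff extensional_def)
  ultimately show ?thesis using pvm by (subst tensor_pvm_AE_iff) auto
qed

section \<open>Measurable vector fields\<close>

text \<open>
  Values in the closed span \<open>perp H (perp H C)\<close> of a countable set \<open>C\<close> replace separability of \<open>H\<close>.
\<close>

definition vfield :: "'h::complex_vector hspace \<Rightarrow> 's measure \<Rightarrow> ('s \<Rightarrow> 'h) \<Rightarrow> bool" where
  "vfield H \<rho> v \<longleftrightarrow> (\<forall>\<sigma>\<in>space \<rho>. v \<sigma> \<in> vecs H) \<and>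
     (\<forall>y\<in>vecs H. (\<lambda>\<sigma>. ip H (v \<sigma>) y) \<in> borel_measurable \<rho>) \<and>
     (\<exists>C. countable C \<and> C \<subseteq> vecs H \<and> (\<forall>\<sigma>\<in>space \<rho>. v \<sigma> \<in> perp H (perp H C)))"

lemma vfield_const: assumes "hilbert_space H" "h \<in> vecs H" shows "vfield H \<rho> (\<lambda>_. h)"
proof -
  interpret hilbert_space H by fact
  have "h \<in> perp H (perp H {h})" using assms(2) by (intro mem_perp_perp) auto
  then show ?thesis using assms(2) unfolding vfield_def by (intro conjI exI[of _ "{h}"]) auto
qed

text \<open>The norm of the representing vector is tracked because it enters a majorant that has to
  be uniform in \<sigma>.\<close>

lemma bounded_op_adjoint_norm:
  assumes T: "bounded_op H K T" and H: "hilbert_space H" and K: "hilbert_space K" and D: "0 \<le> D"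
    "\<And>x. x \<in> vecs H \<Longrightarrow> hnorm K (T x) \<le> D * hnorm H x" and y: "y \<in> vecs K"
  shows "\<exists>w\<in>vecs H. (\<forall>x\<in>vecs H. ip K (T x) y = ip H x w) \<and> hnorm H w \<le> D * hnorm K y"
proof -
  interpret H: hilbert_space H by fact
  interpret K: hilbert_space K by fact
  obtain w where w: "w \<in> vecs H" "\<And>x. x \<in> vecs H \<Longrightarrow> ip K (T x) y = ip H x w"
    using bounded_op_adjoint[OF T H K y] by blast
  have "hnorm H w \<le> D * hnorm K y"
  proof (cases "hnorm H w = 0")
    case False
    have "hnorm H w * hnorm H w = cmod (ip H w w)" by (simp add: H.ip_self[OF w(1)] norm_power power2_eq_square norm_mult)
    also have "\<dots> = cmod (ip K (T w) y)" using w by simp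
    also have "\<dots> \<le> hnorm K (T w) * hnorm K y" using bounded_op_mem[OF T w(1)] y by (rule K.cauchy_schwarz)
    also have "\<dots> \<le> (D * hnorm H w) * hnorm K y" using D w(1) y by (intro mult_right_mono) auto
    finally have "hnorm H w * hnorm H w \<le> (D * hnorm K y) * hnorm H w" by (simp add: mult_ac)
    then show ?thesis using False H.hnorm_nonneg[OF w(1)] by (simp add: mult_le_cancel_right)
  qed (use D y in simp)
  then show ?thesis using w by blast
qed

text \<open>One sequence of finite sets serves all \<sigma> at once, since it depends only on the
  countable set that spans the values of the field.\<close>

lemma vfield_approx:
  assumes H: "hilbert_space H" and v: "vfield H \<rho> v"
  obtains F :: "nat \<Rightarrow> 'h::complex_vector set"
  where "\<And>n. finite (F n)" "\<And>n. F n \<subseteq> vecs H"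
    "\<And>\<sigma> w. \<lbrakk>\<sigma> \<in> space \<rho>; w \<in> vecs H\<rbrakk> \<Longrightarrow> (\<lambda>n. \<Sum>e\<in>F n. ip H (v \<sigma>) e * ip H e w) \<longlonglongrightarrow> ip H (v \<sigma>) w"
    "\<And>\<sigma> w n. \<lbrakk>\<sigma> \<in> space \<rho>; w \<in> vecs H\<rbrakk>
      \<Longrightarrow> cmod (\<Sum>e\<in>F n. ip H (v \<sigma>) e * ip H e w) \<le> 2 * hnorm H (v \<sigma>) * hnorm H w"
proof -
  interpret H: hilbert_space H by fact
  obtain C where C: "countable C" "C \<subseteq> vecs H" "\<And>\<sigma>. \<sigma> \<in> space \<rho> \<Longrightarrow> v \<sigma> \<in> perp H (perp H C)"
    using v by (auto simp: vfield_def)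
  have vV: "v \<sigma> \<in> vecs H" if "\<sigma> \<in> space \<rho>" for \<sigma> using v that by (auto simp: vfield_def)
  obtain F :: "nat \<Rightarrow> 'h set" where F: "\<forall>n. finite (F n) \<and> F n \<subseteq> vecs H"
    "\<forall>v\<in>perp H (perp H C). \<forall>y\<in>vecs H. (\<lambda>n. \<Sum>e\<in>F n. ip H v e * ip H e y) \<longlonglongrightarrow> ip H v y"
    "\<forall>v\<in>vecs H. \<forall>y\<in>vecs H. \<forall>n. cmod (\<Sum>e\<in>F n. ip H v e * ip H e y) \<le> 2 * hnorm H v * hnorm H y"
    using H.separable_approx[OF C(1,2)] by (elim exE conjE)
  show ?thesis
    by (rule that[of F]) (use F(1) bspec[OF F(2) C(3)] bspec[OF F(3) vV] in auto)
qed

text \<open>The image of the countable set spans the new values: a vector orthogonal to it pulls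
  back, through the adjoint, to a vector orthogonal to \<open>C\<close>.\<close>

lemma vfield_bounded_op:
  assumes H: "hilbert_space H" and K: "hilbert_space K" and v: "vfield H \<rho> v" and b: "bounded_op H K b"
  shows "vfield K \<rho> (\<lambda>\<sigma>. b (v \<sigma>))"
proof -
  interpret H: hilbert_space H by fact
  interpret K: hilbert_space K by fact
  obtain C where C: "countable C" "C \<subseteq> vecs H" "\<And>\<sigma>. \<sigma> \<in> space \<rho> \<Longrightarrow> v \<sigma> \<in> perp H (perp H C)"
    using v by (auto simp: vfield_def)
  have vV: "v \<sigma> \<in> vecs H" if "\<sigma> \<in> space \<rho>" for \<sigma> using v that by (auto simp: vfield_def)
  have adj: "\<exists>w\<in>vecs H. \<forall>x\<in>vecs H. ip K (b x) y = ip H x w" if "y \<in> vecs K" for y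
    using b H K that by (rule bounded_op_adjoint)
  have bC: "b ` C \<subseteq> vecs K" using bounded_op_mem[OF b] C(2) by auto
  show ?thesis
    unfolding vfield_def
  proof (intro conjI ballI exI[of _ "b ` C"])
    show "b (v \<sigma>) \<in> vecs K" if "\<sigma> \<in> space \<rho>" for \<sigma> using bounded_op_mem[OF b vV[OF that]] .
    show "(\<lambda>\<sigma>. ip K (b (v \<sigma>)) y) \<in> borel_measurable \<rho>" if y: "y \<in> vecs K" for y
    proof -
      obtain w where w: "w \<in> vecs H" "\<And>x. x \<in> vecs H \<Longrightarrow> ip K (b x) y = ip H x w" using adj[OF y] by blast
      have "(\<lambda>\<sigma>. ip H (v \<sigma>) w) \<in> borel_measurable \<rho>" using v w(1) by (simp add: vfield_def)
      then show ?thesis using w(2) vV by (subst measurable_cong[where g="\<lambda>\<sigma>. ip H (v \<sigma>) w"]) auto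
    qed
    show "b (v \<sigma>) \<in> perp K (perp K (b ` C))" if s: "\<sigma> \<in> space \<rho>" for \<sigma>
      unfolding perp_def[of K "perp K (b ` C)"] mem_Collect_eq
    proof (intro conjI ballI)
      show "b (v \<sigma>) \<in> vecs K" using bounded_op_mem[OF b vV[OF s]] .
      fix y assume y: "y \<in> perp K (b ` C)"
      then have yV: "y \<in> vecs K" by (simp add: perp_def)
      obtain w where w: "w \<in> vecs H" "\<And>x. x \<in> vecs H \<Longrightarrow> ip K (b x) y = ip H x w" using adj[OF yV] by blast
      have "ip H w c = 0" if c: "c \<in> C" for c
      proof -
        have cV: "c \<in> vecs H" "b c \<in> vecs K" using c C(2) bC by auto
        have "ip K y (b c) = 0" using y c by (simp add: perp_def)
        then have "ip H c w = 0" using w(2)[OF cV(1)] K.ip_commute[OF yV cV(2)] by simp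
        then show ?thesis using H.ip_commute[OF cV(1) w(1)] by simp
      qed
      then have "w \<in> perp H C" using w(1) by (simp add: perp_def)
      then have "ip H (v \<sigma>) w = 0" using C(3)[OF s] by (simp add: perp_def)
      then show "ip K (b (v \<sigma>)) y = 0" using w(2)[OF vV[OF s]] by simp
    qed
  qed (use C bC in auto)
qed

section \<open>Spectral integrals of sections as measurable vector fields\<close>

lemma bdd_meas_section:
  assumes "f \<in> bdd_meas (M \<Otimes>\<^sub>M \<rho>)" "\<sigma> \<in> space \<rho>"
  shows "(\<lambda>\<omega>. f (\<omega>, \<sigma>)) \<in> bdd_meas M"
proof -
  obtain C where C: "\<forall>t\<in>space (M \<Otimes>\<^sub>M \<rho>). cmod (f t) \<le> C" using assms(1) by (auto simp: bdd_meas_def)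
  have "(\<lambda>\<omega>. f (\<omega>, \<sigma>)) \<in> borel_measurable M"
    using measurable_compose[OF measurable_Pair2'[OF assms(2)] bdd_meas_measurable[OF assms(1)]] .
  then show ?thesis using C assms(2) by (intro bdd_measI[where C=C]) (auto simp: space_pair_measure)
qed

context pvm_space
begin

lemma pint_section_measurable:
  assumes f: "f \<in> borel_measurable (MX \<Otimes>\<^sub>M \<rho>)" and h: "h \<in> vecs HX" and k: "k \<in> vecs HX"
  shows "(\<lambda>\<sigma>. pint X (\<lambda>\<omega>. f (\<omega>, \<sigma>)) h k) \<in> borel_measurable \<rho>"
proof -
  have lm: "(\<lambda>\<sigma>. LINT \<omega>|pmu X z. f (\<omega>, \<sigma>)) \<in> borel_measurable \<rho>" if z: "z \<in> vecs HX" for z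
  proof -
    interpret finite_measure "pmu X z" using z by (rule finite_measure_pmu)
    have "(\<lambda>(\<sigma>, \<omega>). f (\<omega>, \<sigma>)) \<in> borel_measurable (\<rho> \<Otimes>\<^sub>M MX)"
      using measurable_compose[OF measurable_pair_swap' f] by (simp add: case_prod_beta')
    then have "(\<lambda>(\<sigma>, \<omega>). f (\<omega>, \<sigma>)) \<in> borel_measurable (\<rho> \<Otimes>\<^sub>M pmu X z)"
      by (simp add: measurable_cong_sets[OF sets_pair_measure_cong[OF refl sets_pmu] refl])
    then show ?thesis by (rule borel_measurable_lebesgue_integral)
  qed
  then show ?thesis unfolding pint_def cint_def using h k
    by (intro borel_measurable_sum borel_measurable_times borel_measurable_const lm pol_mem)
qed

text \<open>All the vectors obtained from \<open>h\<close> by integrating sections lie in the closed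
  span of one countable set. A rectangle \<open>G \<times> S\<close> contributes the single vector
  \<open>prj X G h\<close>, and each operation of the monotone class argument unites at most
  countably many countable sets.\<close>

lemma pint_section_support_bounded:
  assumes f: "f \<in> bdd_meas (MX \<Otimes>\<^sub>M \<rho>)" and h: "h \<in> vecs HX"
  shows "\<exists>C. countable C \<and> C \<subseteq> vecs HX \<and>
    (\<forall>y\<in>perp HX C. \<forall>\<sigma>\<in>space \<rho>. pint X (\<lambda>\<omega>. f (\<omega>, \<sigma>)) h y = 0)"
  using f
proof (induction rule: bdd_meas_induct)
  case (indicator A)
  have sec: "(\<lambda>\<omega>. indicator A (\<omega>, \<sigma>)) = (indicator ((\<lambda>\<omega>. (\<omega>, \<sigma>)) -` A) :: _ \<Rightarrow> complex)" for A \<sigma>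
    by (auto simp: indicator_def fun_eq_iff)
  have sm: "(\<lambda>\<omega>. (\<omega>, \<sigma>)) -` A \<in> sets MX" if "A \<in> sets (MX \<Otimes>\<^sub>M \<rho>)" for A \<sigma> using that by (rule sets_Pair2)
  have sgn: "sets (MX \<Otimes>\<^sub>M \<rho>) = sigma_sets (space MX \<times> space \<rho>) {a \<times> b |a b. a \<in> sets MX \<and> b \<in> sets \<rho>}"
    by (rule sets_pair_measure)
  have "\<exists>C. countable C \<and> C \<subseteq> vecs HX \<and> (\<forall>y\<in>perp HX C. \<forall>\<sigma>\<in>space \<rho>. ip HX (prj X ((\<lambda>\<omega>. (\<omega>, \<sigma>)) -` A) h) y = 0)"
    using Int_stable_pair_measure_generator[of MX \<rho>] pair_measure_closed[of MX \<rho>] indicator[unfolded sgn]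
  proof (induction rule: sigma_sets_induct_disjoint)
    case (basic A)
    then obtain G S where GS: "A = G \<times> S" "G \<in> sets MX" "S \<in> sets \<rho>" by blast
    have "ip HX (prj X ((\<lambda>\<omega>. (\<omega>, \<sigma>)) -` A) h) y = 0" if y: "y \<in> perp HX {prj X G h}" for y \<sigma>
    proof -
      have yV: "y \<in> vecs HX" "ip HX y (prj X G h) = 0" using y by (auto simp: perp_def)
      have "(\<lambda>\<omega>. (\<omega>, \<sigma>)) -` A = (if \<sigma> \<in> S then G else {})" using GS(1) by auto
      then show ?thesis using yV ip_commute[OF yV(1) prj_mem[OF GS(2) h]] prj_empty[OF h] by simp
    qed
    then show ?case using prj_mem[OF GS(2) h] by (intro exI[of _ "{prj X G h}"]) auto
  next
    case empty
    then show ?case using prj_empty[OF h] by (intro exI[of _ "{}"]) (auto simp: perp_def)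
  next
    case (compl A)
    then have A: "A \<in> sets (MX \<Otimes>\<^sub>M \<rho>)" by (simp add: sgn)
    obtain C where C: "countable C" "C \<subseteq> vecs HX"
      "\<And>y \<sigma>. \<lbrakk>y \<in> perp HX C; \<sigma> \<in> space \<rho>\<rbrakk> \<Longrightarrow> ip HX (prj X ((\<lambda>\<omega>. (\<omega>, \<sigma>)) -` A) h) y = 0"
      using compl.IH by blast
    \<comment> \<open>Sections of the complement are complements of sections, so their projections
      of \<open>h\<close> are differences of \<open>h\<close> and the earlier ones; hence
      \<open>h\<close> joins the countable set.\<close>
    have "ip HX (prj X ((\<lambda>\<omega>. (\<omega>, \<sigma>)) -` (space MX \<times> space \<rho> - A)) h) y = 0"
      if y: "y \<in> perp HX (insert h C)" and s: "\<sigma> \<in> space \<rho>" for y \<sigma>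
    proof -
      have yV: "y \<in> vecs HX" "ip HX y h = 0" "y \<in> perp HX C" using y by (auto simp: perp_def)
      let ?A = "(\<lambda>\<omega>. (\<omega>, \<sigma>)) -` A" and ?B = "(\<lambda>\<omega>. (\<omega>, \<sigma>)) -` (space MX \<times> space \<rho> - A)"
      have "?A \<in> sets MX" "?B \<in> sets MX" using A by (auto intro!: sm)
      moreover have "?A \<union> ?B = space MX" "?A \<inter> ?B = {}" using sets.sets_into_space[OF A] s by (auto simp: space_pair_measure)
      ultimately have "ip HX (prj X (space MX) h) y = ip HX (prj X ?A h) y + ip HX (prj X ?B h) y"
        using cmeas_Un[OF cmeas_prj[OF h yV(1)], of ?A ?B] by simp
      moreover have "ip HX h y = 0" using ip_commute[OF yV(1) h] yV(2) by simp
      ultimately show ?thesis using C(3)[OF yV(3) s] total[OF h] by simp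
    qed
    then show ?case using C h by (intro exI[of _ "insert h C"]) auto
  next
    case (union A)
    then have A: "A n \<in> sets (MX \<Otimes>\<^sub>M \<rho>)" for n by (auto simp: sgn)
    have "\<exists>C. \<forall>n. countable (C n) \<and> C n \<subseteq> vecs HX \<and>
      (\<forall>y\<in>perp HX (C n). \<forall>\<sigma>\<in>space \<rho>. ip HX (prj X ((\<lambda>\<omega>. (\<omega>, \<sigma>)) -` A n) h) y = 0)"
      using union.IH by (intro choice allI)
    then obtain C where C': "\<forall>n. countable (C n) \<and> C n \<subseteq> vecs HX \<and>
      (\<forall>y\<in>perp HX (C n). \<forall>\<sigma>\<in>space \<rho>. ip HX (prj X ((\<lambda>\<omega>. (\<omega>, \<sigma>)) -` A n) h) y = 0)" ..
    have C: "countable (C n)" "C n \<subseteq> vecs HX"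
      "\<lbrakk>y \<in> perp HX (C n); \<sigma> \<in> space \<rho>\<rbrakk> \<Longrightarrow> ip HX (prj X ((\<lambda>\<omega>. (\<omega>, \<sigma>)) -` A n) h) y = 0" for n y \<sigma>
      using spec[OF C', of n] by simp_all
    have "ip HX (prj X ((\<lambda>\<omega>. (\<omega>, \<sigma>)) -` (\<Union>n. A n)) h) y = 0"
      if y: "y \<in> perp HX (\<Union>n. C n)" and s: "\<sigma> \<in> space \<rho>" for y \<sigma>
    proof -
      have yV: "y \<in> vecs HX" "\<And>n. y \<in> perp HX (C n)" using y by (auto simp: perp_def)
      have "disjoint_family (\<lambda>n. (\<lambda>\<omega>. (\<omega>, \<sigma>)) -` A n)"
        using union.hyps by (simp add: disjoint_family_on_def flip: vimage_Int)
      then have "(\<lambda>n. ip HX (prj X ((\<lambda>\<omega>. (\<omega>, \<sigma>)) -` A n) h) y) sums ip HX (prj X (\<Union>n. (\<lambda>\<omega>. (\<omega>, \<sigma>)) -` A n) h) y"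
        using sm[OF A] h yV(1) by (intro weakly_additive) auto
      then show ?thesis using C(3)[OF yV(2) s] by (simp add: vimage_UN sums_iff)
    qed
    then show ?case using C(1,2) by (intro exI[of _ "\<Union>n. C n"] conjI countable_UN UN_least ballI) auto
  qed
  then obtain C where C: "countable C" "C \<subseteq> vecs HX"
    "\<And>y \<sigma>. \<lbrakk>y \<in> perp HX C; \<sigma> \<in> space \<rho>\<rbrakk> \<Longrightarrow> ip HX (prj X ((\<lambda>\<omega>. (\<omega>, \<sigma>)) -` A) h) y = 0" by blast
  have "pint X (\<lambda>\<omega>. indicator A (\<omega>, \<sigma>)) h y = 0" if "y \<in> perp HX C" "\<sigma> \<in> space \<rho>" for y \<sigma>
    unfolding sec using C(3)[OF that] pint_indicator[OF sm[OF indicator] h, of y] that by (simp add: perp_def)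
  then show ?case using C(1,2) by blast
next
  case (add f g)
  obtain C D where C: "countable C" "C \<subseteq> vecs HX" "\<forall>y\<in>perp HX C. \<forall>\<sigma>\<in>space \<rho>. pint X (\<lambda>\<omega>. f (\<omega>, \<sigma>)) h y = 0"
    and D: "countable D" "D \<subseteq> vecs HX" "\<forall>y\<in>perp HX D. \<forall>\<sigma>\<in>space \<rho>. pint X (\<lambda>\<omega>. g (\<omega>, \<sigma>)) h y = 0"
    using add.IH by blast
  have "pint X (\<lambda>\<omega>. f (\<omega>, \<sigma>) + g (\<omega>, \<sigma>)) h y = 0" if y: "y \<in> perp HX (C \<union> D)" and s: "\<sigma> \<in> space \<rho>" for y \<sigma>
  proof -
    have yV: "y \<in> vecs HX" "y \<in> perp HX C" "y \<in> perp HX D" using y by (auto simp: perp_def)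
    then show ?thesis
      using C(3) D(3) s bfunD(1)[OF bfun_pint[OF h yV(1)] bdd_meas_section[OF add.hyps(1) s] bdd_meas_section[OF add.hyps(2) s]]
      by simp
  qed
  then show ?case using C D by (intro exI[of _ "C \<union> D"]) auto
next
  case (cmult f c)
  obtain C where C: "countable C" "C \<subseteq> vecs HX" "\<forall>y\<in>perp HX C. \<forall>\<sigma>\<in>space \<rho>. pint X (\<lambda>\<omega>. f (\<omega>, \<sigma>)) h y = 0"
    using cmult.IH by blast
  have "pint X (\<lambda>\<omega>. c * f (\<omega>, \<sigma>)) h y = 0" if y: "y \<in> perp HX C" and s: "\<sigma> \<in> space \<rho>" for y \<sigma>
  proof -
    have yV: "y \<in> vecs HX" using y by (auto simp: perp_def)
    then show ?thesis using C(3) y s bfunD(2)[OF bfun_pint[OF h yV] bdd_meas_section[OF cmult.hyps s]] by simp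
  qed
  then show ?case using C by blast
next
  case (lim f g c)
  have "\<exists>C. \<forall>n. countable (C n) \<and> C n \<subseteq> vecs HX \<and>
      (\<forall>y\<in>perp HX (C n). \<forall>\<sigma>\<in>space \<rho>. pint X (\<lambda>\<omega>. f n (\<omega>, \<sigma>)) h y = 0)"
    using lim.IH by (intro choice allI)
  then obtain C where C': "\<forall>n. countable (C n) \<and> C n \<subseteq> vecs HX \<and>
      (\<forall>y\<in>perp HX (C n). \<forall>\<sigma>\<in>space \<rho>. pint X (\<lambda>\<omega>. f n (\<omega>, \<sigma>)) h y = 0)" ..
  have C: "countable (C n)" "C n \<subseteq> vecs HX"
    "\<lbrakk>y \<in> perp HX (C n); \<sigma> \<in> space \<rho>\<rbrakk> \<Longrightarrow> pint X (\<lambda>\<omega>. f n (\<omega>, \<sigma>)) h y = 0" for n y \<sigma>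
    using spec[OF C', of n] by simp_all
  have "pint X (\<lambda>\<omega>. g (\<omega>, \<sigma>)) h y = 0" if y: "y \<in> perp HX (\<Union>n. C n)" and s: "\<sigma> \<in> space \<rho>" for y \<sigma>
  proof -
    have yV: "y \<in> vecs HX" "\<And>n. y \<in> perp HX (C n)" using y by (auto simp: perp_def)
    have "(\<lambda>n. pint X (\<lambda>\<omega>. f n (\<omega>, \<sigma>)) h y) \<longlonglongrightarrow> pint X (\<lambda>\<omega>. g (\<omega>, \<sigma>)) h y"
    proof (rule bfunD(3)[OF bfun_pint[OF h yV(1)], where C=c])
      show "cmod (f n (\<omega>, \<sigma>)) \<le> c" if "\<omega> \<in> space MX" for n \<omega>
        using lim.hyps(3)[of "(\<omega>, \<sigma>)" n] that s by (simp add: space_pair_measure)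
      show "(\<lambda>n. f n (\<omega>, \<sigma>)) \<longlonglongrightarrow> g (\<omega>, \<sigma>)" if "\<omega> \<in> space MX" for \<omega>
        using lim.hyps(4)[of "(\<omega>, \<sigma>)"] that s by (simp add: space_pair_measure)
      show "(\<lambda>\<omega>. f n (\<omega>, \<sigma>)) \<in> bdd_meas MX" for n using lim.hyps(1) s by (rule bdd_meas_section)
      show "(\<lambda>\<omega>. g (\<omega>, \<sigma>)) \<in> bdd_meas MX" using lim.hyps(2) s by (rule bdd_meas_section)
    qed
    then show ?thesis using C(3)[OF yV(2) s] by (simp add: LIMSEQ_const_iff)
  qed
  then show ?case using C(1,2) by (intro exI[of _ "\<Union>n. C n"] conjI countable_UN UN_least ballI) auto
qed

text \<open>A decomposition need not be bounded as a function of both variables. Each section,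
  however, is essentially bounded and agrees almost everywhere with its truncation at some integer
  level, so the union over all levels suffices.\<close>

lemma pint_section_support:
  assumes f: "f \<in> borel_measurable (MX \<Otimes>\<^sub>M \<rho>)" and L: "\<And>\<sigma>. \<sigma> \<in> space \<rho> \<Longrightarrow> (\<lambda>\<omega>. f (\<omega>, \<sigma>)) \<in> Linf X" and h: "h \<in> vecs HX"
  shows "\<exists>C. countable C \<and> C \<subseteq> vecs HX \<and> (\<forall>y\<in>perp HX C. \<forall>\<sigma>\<in>space \<rho>. pint X (\<lambda>\<omega>. f (\<omega>, \<sigma>)) h y = 0)"
proof -
  define g where "g n t = (if cmod (f t) \<le> real n then f t else 0)" for n t
  have gm: "g n \<in> bdd_meas (MX \<Otimes>\<^sub>M \<rho>)" for n
  proof (rule bdd_measI)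
    note [measurable] = f
    show "g n \<in> borel_measurable (MX \<Otimes>\<^sub>M \<rho>)" unfolding g_def by measurable
    show "cmod (g n t) \<le> real n" for t by (simp add: g_def)
  qed
  have "\<exists>C. \<forall>n. countable (C n) \<and> C n \<subseteq> vecs HX \<and>
      (\<forall>y\<in>perp HX (C n). \<forall>\<sigma>\<in>space \<rho>. pint X (\<lambda>\<omega>. g n (\<omega>, \<sigma>)) h y = 0)"
    using pint_section_support_bounded[OF gm h] by (intro choice allI)
  then obtain C where C': "\<forall>n. countable (C n) \<and> C n \<subseteq> vecs HX \<and>
      (\<forall>y\<in>perp HX (C n). \<forall>\<sigma>\<in>space \<rho>. pint X (\<lambda>\<omega>. g n (\<omega>, \<sigma>)) h y = 0)" ..
  have C: "countable (C n)" "C n \<subseteq> vecs HX"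
    "\<lbrakk>y \<in> perp HX (C n); \<sigma> \<in> space \<rho>\<rbrakk> \<Longrightarrow> pint X (\<lambda>\<omega>. g n (\<omega>, \<sigma>)) h y = 0" for n y \<sigma>
    using spec[OF C', of n] by simp_all
  have "pint X (\<lambda>\<omega>. f (\<omega>, \<sigma>)) h y = 0" if y: "y \<in> perp HX (\<Union>n. C n)" and s: "\<sigma> \<in> space \<rho>" for y \<sigma>
  proof -
    have yV: "y \<in> vecs HX" "\<And>n. y \<in> perp HX (C n)" using y by (auto simp: perp_def)
    have fs: "(\<lambda>\<omega>. f (\<omega>, \<sigma>)) \<in> borel_measurable MX"
      using measurable_compose[OF measurable_Pair2'[OF s] f] .
    then have Lm: "(\<lambda>\<omega>. f (\<omega>, \<sigma>)) \<in> Linf_meas X" using L[OF s] by (simp add: Linf_meas_def)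
    obtain n :: nat where n: "Linf_norm X (\<lambda>\<omega>. f (\<omega>, \<sigma>)) \<le> real n" using real_arch_simple by blast
    have "pvm_AE X (\<lambda>\<omega>. f (\<omega>, \<sigma>) = g n (\<omega>, \<sigma>))"
      by (rule pvm_AE_mp[OF Linf_norm_AE[OF Lm]]) (use n in \<open>simp add: g_def\<close>)
    then have "pint X (\<lambda>\<omega>. f (\<omega>, \<sigma>)) h y = pint X (\<lambda>\<omega>. g n (\<omega>, \<sigma>)) h y"
      using bdd_meas_measurable[OF bdd_meas_section[OF gm s]] fs h yV(1) by (intro pint_cong_AE)
    then show ?thesis using C(3)[OF yV(2) s] by simp
  qed
  then show ?thesis using C(1,2) by (intro exI[of _ "\<Union>n. C n"] conjI countable_UN UN_least ballI) auto
qed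

text \<open>Operator and vector both vary with \<sigma>. Expanding the vector along the finite sets
  of \<open>vfield_approx\<close> leaves sums of products of two measurable scalar functions, in
  which the operator acts on fixed vectors; measurability passes to the pointwise limit.\<close>

lemma vfield_pvm_int:
  assumes f: "f \<in> borel_measurable (MX \<Otimes>\<^sub>M \<rho>)" and L: "\<And>\<sigma>. \<sigma> \<in> space \<rho> \<Longrightarrow> (\<lambda>\<omega>. f (\<omega>, \<sigma>)) \<in> Linf X"
    and v: "vfield HX \<rho> v"
  shows "vfield HX \<rho> (\<lambda>\<sigma>. pvm_int X (\<lambda>\<omega>. f (\<omega>, \<sigma>)) (v \<sigma>))"
proof -
  define P where "P \<sigma> = pvm_int X (\<lambda>\<omega>. f (\<omega>, \<sigma>))" for \<sigma>
  have Pb: "bounded_op HX HX (P \<sigma>)" if "\<sigma> \<in> space \<rho>" for \<sigma> unfolding P_def using L[OF that] by (rule pvm_int_char(1))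
  have Pip: "ip HX (P \<sigma> h) y = pint X (\<lambda>\<omega>. f (\<omega>, \<sigma>)) h y" if s: "\<sigma> \<in> space \<rho>" and "h \<in> vecs HX" "y \<in> vecs HX" for \<sigma> h y
  proof -
    have "(\<lambda>\<omega>. f (\<omega>, \<sigma>)) \<in> Linf_meas X"
      using L[OF s] measurable_compose[OF measurable_Pair2'[OF s] f] by (simp add: Linf_meas_def)
    then show ?thesis unfolding P_def using that(2,3) by (rule pvm_int_ip)
  qed
  have vV: "v \<sigma> \<in> vecs HX" if "\<sigma> \<in> space \<rho>" for \<sigma> using v that by (auto simp: vfield_def)
  obtain C where C: "countable C" "C \<subseteq> vecs HX" "\<And>\<sigma>. \<sigma> \<in> space \<rho> \<Longrightarrow> v \<sigma> \<in> perp HX (perp HX C)"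
    using v by (auto simp: vfield_def)
  obtain F where F: "\<And>n. finite (F n)" "\<And>n. F n \<subseteq> vecs HX"
    and F_lim: "\<And>\<sigma> w. \<lbrakk>\<sigma> \<in> space \<rho>; w \<in> vecs HX\<rbrakk> \<Longrightarrow> (\<lambda>n. \<Sum>e\<in>F n. ip HX (v \<sigma>) e * ip HX e w) \<longlonglongrightarrow> ip HX (v \<sigma>) w"
    using vfield_approx[OF hilbert_space_axioms v] by metis
  have lim: "(\<lambda>n. \<Sum>e\<in>F n. ip HX (v \<sigma>) e * ip HX (P \<sigma> e) y) \<longlonglongrightarrow> ip HX (P \<sigma> (v \<sigma>)) y"
    if s: "\<sigma> \<in> space \<rho>" and y: "y \<in> vecs HX" for \<sigma> y
  proof -
    \<comment> \<open>The adjoint vector \<open>w\<close> depends on \<sigma>, which does no harm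
      because convergence is wanted for each \<sigma> separately.\<close>
    obtain w where w: "w \<in> vecs HX" "\<And>x. x \<in> vecs HX \<Longrightarrow> ip HX (P \<sigma> x) y = ip HX x w"
      using bounded_op_adjoint[OF Pb[OF s] hilbert_space_axioms hilbert_space_axioms y] by blast
    have "(\<Sum>e\<in>F n. ip HX (v \<sigma>) e * ip HX (P \<sigma> e) y) = (\<Sum>e\<in>F n. ip HX (v \<sigma>) e * ip HX e w)" for n
      using F(2) w(2) by (intro sum.cong) (auto simp: subset_iff)
    then show ?thesis using F_lim[OF s w(1)] w(2)[OF vV[OF s]] by simp
  qed
  have "\<exists>S. \<forall>c\<in>C. countable (S c) \<and> S c \<subseteq> vecs HX \<and> (\<forall>y\<in>perp HX (S c). \<forall>\<sigma>\<in>space \<rho>. pint X (\<lambda>\<omega>. f (\<omega>, \<sigma>)) c y = 0)"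
    using C(2) pint_section_support[OF f L] by (intro bchoice ballI) blast
  then obtain S where S': "\<forall>c\<in>C. countable (S c) \<and> S c \<subseteq> vecs HX \<and>
    (\<forall>y\<in>perp HX (S c). \<forall>\<sigma>\<in>space \<rho>. pint X (\<lambda>\<omega>. f (\<omega>, \<sigma>)) c y = 0)" ..
  have S: "countable (S c)" "S c \<subseteq> vecs HX"
    "\<lbrakk>y \<in> perp HX (S c); \<sigma> \<in> space \<rho>\<rbrakk> \<Longrightarrow> pint X (\<lambda>\<omega>. f (\<omega>, \<sigma>)) c y = 0" if "c \<in> C" for c y \<sigma>
    using bspec[OF S' that] by simp_all
  show ?thesis
    unfolding vfield_def P_def[symmetric]
  proof (intro conjI ballI exI[of _ "\<Union>c\<in>C. S c"])
    show PV: "P \<sigma> (v \<sigma>) \<in> vecs HX" if "\<sigma> \<in> space \<rho>" for \<sigma> using bounded_op_mem[OF Pb vV] that by blast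
    show "(\<lambda>\<sigma>. ip HX (P \<sigma> (v \<sigma>)) y) \<in> borel_measurable \<rho>" if y: "y \<in> vecs HX" for y
    proof (rule borel_measurable_LIMSEQ_metric[where f="\<lambda>n \<sigma>. \<Sum>e\<in>F n. ip HX (v \<sigma>) e * ip HX (P \<sigma> e) y"])
      show "(\<lambda>\<sigma>. \<Sum>e\<in>F n. ip HX (v \<sigma>) e * ip HX (P \<sigma> e) y) \<in> borel_measurable \<rho>" for n
      proof (intro borel_measurable_sum borel_measurable_times)
        fix e assume "e \<in> F n"
        then have e: "e \<in> vecs HX" using F(2) by blast
        show "(\<lambda>\<sigma>. ip HX (v \<sigma>) e) \<in> borel_measurable \<rho>" using v e by (simp add: vfield_def)
        show "(\<lambda>\<sigma>. ip HX (P \<sigma> e) y) \<in> borel_measurable \<rho>"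
          using pint_section_measurable[OF f e y] Pip[OF _ e y]
          by (subst measurable_cong[where g="\<lambda>\<sigma>. pint X (\<lambda>\<omega>. f (\<omega>, \<sigma>)) e y"]) auto
      qed
    qed (use lim[OF _ y] in blast)
    show "P \<sigma> (v \<sigma>) \<in> perp HX (perp HX (\<Union>c\<in>C. S c))" if s: "\<sigma> \<in> space \<rho>" for \<sigma>
      unfolding perp_def[of HX "perp HX (\<Union>c\<in>C. S c)"] mem_Collect_eq
    proof (intro conjI ballI)
      show "P \<sigma> (v \<sigma>) \<in> vecs HX" using PV[OF s] .
      fix y assume y: "y \<in> perp HX (\<Union>c\<in>C. S c)"
      then have yV: "y \<in> vecs HX" "\<And>c. c \<in> C \<Longrightarrow> y \<in> perp HX (S c)" by (auto simp: perp_def)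
      obtain w where w: "w \<in> vecs HX" "\<And>x. x \<in> vecs HX \<Longrightarrow> ip HX (P \<sigma> x) y = ip HX x w"
        using bounded_op_adjoint[OF Pb[OF s] hilbert_space_axioms hilbert_space_axioms yV(1)] by blast
      have "ip HX w c = 0" if c: "c \<in> C" for c
      proof -
        have cV: "c \<in> vecs HX" using c C(2) by auto
        have "ip HX c w = 0" using S(3)[OF c yV(2)[OF c] s] Pip[OF s cV yV(1)] w(2)[OF cV] by simp
        then show ?thesis using ip_commute[OF cV w(1)] by simp
      qed
      then have "w \<in> perp HX C" using w(1) by (simp add: perp_def)
      then have "ip HX (v \<sigma>) w = 0" using C(3)[OF s] by (simp add: perp_def)
      then show "ip HX (P \<sigma> (v \<sigma>)) y = 0" using w(2)[OF vV[OF s]] by simp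
    qed
  qed (use C(1) S in auto)
qed

end

section \<open>Multiple operator integrals of decompositions\<close>

text \<open>The recursion of \<open>op_chain\<close> grows at the right end; the inductions below
  peel off the leftmost, that is last applied, operator.\<close>

lemma op_chain_Suc_left: "op_chain A B a (Suc n) x = A a (B a (op_chain A B (Suc a) n x))"
  by (induction n arbitrary: x) simp_all

text \<open>On the diagonal the four polarized measures combine to the single positive measure
  \<open>pmu X z\<close>, to which absolute values and Fubini apply.\<close>

lemma (in pvm_space) pint_self:
  assumes f: "f \<in> Linf_meas X" and z: "z \<in> vecs HX"
  shows "integrable (pmu X z) f" "pint X f z z = (LINT \<omega>|pmu X z. f \<omega>)"
    "(LINT \<omega>|pmu X z. cmod (f \<omega>)) \<le> Linf_norm X f * (hnorm HX z)\<^sup>2"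
proof -
  interpret finite_measure "pmu X z" using z by (rule finite_measure_pmu)
  have fm: "f \<in> borel_measurable MX" using f by (simp add: Linf_meas_def)
  then have fm': "f \<in> borel_measurable (pmu X z)" by (simp add: measurable_cong_sets[OF sets_pmu refl])
  have ae: "AE \<omega> in pmu X z. cmod (f \<omega>) \<le> Linf_norm X f" using pvm_AE_pmu[OF Linf_norm_AE[OF f] z] .
  show i: "integrable (pmu X z) f" using ae fm' by (rule integrable_const_bound)
  have "(LINT \<omega>|pmu X z. cmod (f \<omega>)) \<le> (LINT \<omega>|pmu X z. Linf_norm X f)"
    using i ae by (intro integral_mono_AE) auto
  then show "(LINT \<omega>|pmu X z. cmod (f \<omega>)) \<le> Linf_norm X f * (hnorm HX z)\<^sup>2"
    using z by (simp add: measure_pmu_space mult.commute)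
  obtain g where g: "g \<in> bdd_meas MX" "pvm_AE X (\<lambda>\<omega>. f \<omega> = g \<omega>)" using Linf_trunc[OF f] by auto
  have gm: "g \<in> borel_measurable MX" using g(1) by (rule bdd_meas_measurable)
  have "pint X f z z = pint X g z z" using fm gm g(2) z z by (rule pint_cong_AE)
  also have "\<dots> = (LINT \<omega>|pmu X z. g \<omega>)"
  proof (rule bfun_eqI[OF bfun_pint[OF z z] bfun_integral[OF finite_measure_pmu[OF z] sets_pmu] _ g(1)])
    fix A assume "A \<in> sets MX"
    then show "pint X (indicator A) z z = (LINT \<omega>|pmu X z. indicator A \<omega>)"
      using z by (simp add: pint_indicator integral_indicator_complex finite_measure_pmu measure_pmu)
  qed
  also have "\<dots> = (LINT \<omega>|pmu X z. f \<omega>)"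
    using fm' gm pvm_AE_pmu[OF g(2) z]
    by (intro integral_cong_AE) (auto simp: measurable_cong_sets[OF sets_pmu refl])
  finally show "pint X f z z = (LINT \<omega>|pmu X z. f \<omega>)" .
qed

text \<open>A decomposition together with its operator arguments. The real function \<open>g\<close>
  is the integrable majorant extracted from the upper integral, because the product of the norms may
  fail to be measurable in \<sigma>.\<close>

locale ipd_ops =
  fixes a b :: nat and X :: "nat \<Rightarrow> ('w, 'h::complex_vector) pvms" and \<rho> :: "'s measure"
    and f :: "nat \<Rightarrow> 'w \<times> 's \<Rightarrow> complex" and B :: "nat \<Rightarrow> 'h \<Rightarrow> 'h" and g :: "'s \<Rightarrow> real"
  assumes ab: "a \<le> b" and pvm: "\<And>j. \<lbrakk>a \<le> j; j \<le> b\<rbrakk> \<Longrightarrow> pvm_space (X j)"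
    and sf: "sigma_finite_measure \<rho>"
    and fm: "\<And>j. \<lbrakk>a \<le> j; j \<le> b\<rbrakk> \<Longrightarrow> f j \<in> borel_measurable (msp (X j) \<Otimes>\<^sub>M \<rho>)"
    and fL: "\<And>j \<sigma>. \<lbrakk>a \<le> j; j \<le> b; \<sigma> \<in> space \<rho>\<rbrakk> \<Longrightarrow> (\<lambda>\<omega>. f j (\<omega>, \<sigma>)) \<in> Linf (X j)"
    and gi: "integrable \<rho> g" and gdom: "AE \<sigma> in \<rho>. (\<Prod>j=a..b. Linf_norm (X j) (\<lambda>\<omega>. f j (\<omega>, \<sigma>))) \<le> g \<sigma>"
    and Bop: "\<And>j. \<lbrakk>a \<le> j; j < b\<rbrakk> \<Longrightarrow> bounded_op (hsp (X (Suc j))) (hsp (X j)) (B j)"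
begin

abbreviation (input) "V j \<equiv> vecs (hsp (X j))"

definition P :: "nat \<Rightarrow> 's \<Rightarrow> 'h \<Rightarrow> 'h" where
  "P j \<sigma> = pvm_int (X j) (\<lambda>\<omega>. f j (\<omega>, \<sigma>))"

definition nrm :: "nat \<Rightarrow> 's \<Rightarrow> real" where
  "nrm j \<sigma> = Linf_norm (X j) (\<lambda>\<omega>. f j (\<omega>, \<sigma>))"

text \<open>The tail of the integrand from slot \<open>r\<close> on, applied to \<open>h\<close>; at
  \<open>r = a\<close> it is the whole integrand.\<close>

definition chain :: "nat \<Rightarrow> 'h \<Rightarrow> 's \<Rightarrow> 'h" where
  "chain r h \<sigma> = op_chain (\<lambda>j. P j \<sigma>) B r (b - r) h"

lemma hs: "\<lbrakk>a \<le> j; j \<le> b\<rbrakk> \<Longrightarrow> hilbert_space (hsp (X j))"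
  using pvm by (simp add: pvm_space_def)

lemma sec: "\<lbrakk>a \<le> j; j \<le> b; \<sigma> \<in> space \<rho>\<rbrakk> \<Longrightarrow> (\<lambda>\<omega>. f j (\<omega>, \<sigma>)) \<in> Linf_meas (X j)"
  using fL measurable_compose[OF measurable_Pair2' fm] by (simp add: Linf_meas_def)

lemma nrm_nonneg: "\<lbrakk>a \<le> j; j \<le> b; \<sigma> \<in> space \<rho>\<rbrakk> \<Longrightarrow> 0 \<le> nrm j \<sigma>"
  unfolding nrm_def using pvm_space.Linf_norm_nonneg[OF pvm sec] .

lemma P_bounded: "\<lbrakk>a \<le> j; j \<le> b; \<sigma> \<in> space \<rho>\<rbrakk> \<Longrightarrow> bounded_op (hsp (X j)) (hsp (X j)) (P j \<sigma>)"
  unfolding P_def using pvm_space.pvm_int_char(1)[OF pvm fL] .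

lemma P_mem: "\<lbrakk>a \<le> j; j \<le> b; \<sigma> \<in> space \<rho>; h \<in> V j\<rbrakk> \<Longrightarrow> P j \<sigma> h \<in> V j"
  using bounded_op_mem[OF P_bounded] .

lemma P_norm: "\<lbrakk>a \<le> j; j \<le> b; \<sigma> \<in> space \<rho>; h \<in> V j\<rbrakk> \<Longrightarrow> hnorm (hsp (X j)) (P j \<sigma> h) \<le> 2 * nrm j \<sigma> * hnorm (hsp (X j)) h"
  unfolding P_def nrm_def using pvm_space.pvm_int_norm[OF pvm sec] .

lemma vfield_P: "\<lbrakk>a \<le> j; j \<le> b; vfield (hsp (X j)) \<rho> v\<rbrakk> \<Longrightarrow> vfield (hsp (X j)) \<rho> (\<lambda>\<sigma>. P j \<sigma> (v \<sigma>))"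
  unfolding P_def using pvm_space.vfield_pvm_int[OF pvm fm fL] by blast

lemma P_ip_measurable: "\<lbrakk>a \<le> j; j \<le> b; x \<in> V j; y \<in> V j\<rbrakk> \<Longrightarrow> (\<lambda>\<sigma>. ip (hsp (X j)) (P j \<sigma> x) y) \<in> borel_measurable \<rho>"
  using vfield_P[OF _ _ vfield_const[OF hs]] unfolding vfield_def by blast

lemma P_ip_bound:
  assumes "a \<le> j" "j \<le> b" "\<sigma> \<in> space \<rho>" "x \<in> V j" "y \<in> V j"
  shows "cmod (ip (hsp (X j)) (P j \<sigma> x) y) \<le> 2 * hnorm (hsp (X j)) x * hnorm (hsp (X j)) y * nrm j \<sigma>"
proof -
  interpret hilbert_space "hsp (X j)" using hs assms by simp
  have "cmod (ip (hsp (X j)) (P j \<sigma> x) y) \<le> hnorm (hsp (X j)) (P j \<sigma> x) * hnorm (hsp (X j)) y"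
    using assms by (intro cauchy_schwarz P_mem)
  also have "\<dots> \<le> (2 * nrm j \<sigma> * hnorm (hsp (X j)) x) * hnorm (hsp (X j)) y"
    using assms by (intro mult_right_mono P_norm) auto
  finally show ?thesis by (simp add: mult_ac)
qed

lemma chain_last: "chain b h \<sigma> = P b \<sigma> h"
  by (simp add: chain_def)

lemma chain_rec: "r < b \<Longrightarrow> chain r h \<sigma> = P r \<sigma> (B r (chain (Suc r) h \<sigma>))"
proof -
  assume "r < b"
  then have "b - r = Suc (b - Suc r)" by simp
  then show ?thesis unfolding chain_def by (simp only: op_chain_Suc_left)
qed

lemma chain_bounded_op:
  assumes "a \<le> r" "r \<le> b" "\<sigma> \<in> space \<rho>"
  shows "bounded_op (hsp (X b)) (hsp (X r)) (\<lambda>h. chain r h \<sigma>)"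
  using assms(2,1)
proof (induction rule: inc_induct)
  case base
  then show ?case using P_bounded[of b \<sigma>] assms ab by (simp add: chain_last)
next
  case (step r)
  have 1: "bounded_op (hsp (X b)) (hsp (X (Suc r))) (\<lambda>h. chain (Suc r) h \<sigma>)" using step by simp
  have 2: "bounded_op (hsp (X b)) (hsp (X r)) (\<lambda>h. B r (chain (Suc r) h \<sigma>))"
    using bounded_op_comp[OF 1 Bop] hs ab step by simp
  show ?case
    using bounded_op_comp[OF 2 P_bounded[of r \<sigma>]] hs ab step assms(3) by (simp add: chain_rec)
qed

lemma chain_mem: "\<lbrakk>a \<le> r; r \<le> b; \<sigma> \<in> space \<rho>; h \<in> V b\<rbrakk> \<Longrightarrow> chain r h \<sigma> \<in> V r"
  using bounded_op_mem[OF chain_bounded_op] .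

lemma chain_vfield:
  assumes "a \<le> r" "r \<le> b" and h: "h \<in> V b"
  shows "vfield (hsp (X r)) \<rho> (chain r h)"
  using assms(2,1)
proof (induction rule: inc_induct)
  case base
  have "vfield (hsp (X b)) \<rho> (\<lambda>\<sigma>. P b \<sigma> h)" using vfield_P[OF ab order_refl vfield_const[OF hs h]] ab by simp
  then show ?case by (simp add: chain_last[abs_def])
next
  case (step r)
  have "vfield (hsp (X r)) \<rho> (\<lambda>\<sigma>. P r \<sigma> (B r (chain (Suc r) h \<sigma>)))"
    using step hs Bop by (intro vfield_P vfield_bounded_op[of "hsp (X (Suc r))" "hsp (X r)" \<rho> "chain (Suc r) h" "B r"]) auto
  moreover have "chain r h = (\<lambda>\<sigma>. P r \<sigma> (B r (chain (Suc r) h \<sigma>)))" using chain_rec step by auto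
  ultimately show ?case by simp
qed

text \<open>Each slot contributes the 2 of \<open>pvm_int_norm\<close> and each argument
  \<open>B r\<close> a bound of its own. What matters is that \<open>c\<close> depends neither on
  \<sigma> nor on \<open>h\<close>.\<close>

lemma chain_norm:
  assumes "a \<le> r" "r \<le> b"
  shows "\<exists>c\<ge>0. \<forall>\<sigma>\<in>space \<rho>. \<forall>h\<in>V b. hnorm (hsp (X r)) (chain r h \<sigma>) \<le> c * (\<Prod>j=r..b. nrm j \<sigma>) * hnorm (hsp (X b)) h"
  using assms(2,1)
proof (induction rule: inc_induct)
  case base
  show ?case using P_norm[of b] ab by (intro exI[of _ 2]) (auto simp: chain_last)
next
  case (step r)
  then obtain c where c: "c \<ge> 0" "\<forall>\<sigma>\<in>space \<rho>. \<forall>h\<in>V b. hnorm (hsp (X (Suc r))) (chain (Suc r) h \<sigma>) \<le> c * (\<Prod>j=Suc r..b. nrm j \<sigma>) * hnorm (hsp (X b)) h"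
    by auto
  have ar: "a \<le> r" "r < b" using step by auto
  obtain d where d: "d \<ge> 0" "\<forall>x\<in>V (Suc r). hnorm (hsp (X r)) (B r x) \<le> d * hnorm (hsp (X (Suc r))) x"
    using bounded_op_bound[OF Bop[OF ar] hs] ar by auto
  have "hnorm (hsp (X r)) (chain r h \<sigma>) \<le> (2 * d * c) * (\<Prod>j=r..b. nrm j \<sigma>) * hnorm (hsp (X b)) h"
    if s: "\<sigma> \<in> space \<rho>" and h: "h \<in> V b" for \<sigma> h
  proof -
    have v: "chain (Suc r) h \<sigma> \<in> V (Suc r)" using ar s h by (intro chain_mem) auto
    have Bv: "B r (chain (Suc r) h \<sigma>) \<in> V r" using bounded_op_mem[OF Bop[OF ar] v] .
    have n: "0 \<le> nrm r \<sigma>" using ar s by (intro nrm_nonneg) auto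
    have "hnorm (hsp (X r)) (chain r h \<sigma>) \<le> 2 * nrm r \<sigma> * hnorm (hsp (X r)) (B r (chain (Suc r) h \<sigma>))"
      unfolding chain_rec[OF ar(2)] using ar s Bv by (intro P_norm) auto
    also have "\<dots> \<le> 2 * nrm r \<sigma> * (d * hnorm (hsp (X (Suc r))) (chain (Suc r) h \<sigma>))"
      using d v n by (intro mult_left_mono) auto
    also have "\<dots> \<le> 2 * nrm r \<sigma> * (d * (c * (\<Prod>j=Suc r..b. nrm j \<sigma>) * hnorm (hsp (X b)) h))"
      using c d n s h by (intro mult_left_mono) auto
    also have "\<dots> = (2 * d * c) * (nrm r \<sigma> * (\<Prod>j=Suc r..b. nrm j \<sigma>)) * hnorm (hsp (X b)) h" by (simp add: mult_ac)
    also have "nrm r \<sigma> * (\<Prod>j=Suc r..b. nrm j \<sigma>) = (\<Prod>j=r..b. nrm j \<sigma>)" using ar by (simp add: prod.atLeast_Suc_atMost)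
    finally show ?thesis .
  qed
  then show ?case using c(1) d(1) by (intro exI[of _ "2 * d * c"]) auto
qed

text \<open>The natural bound, a multiple of the product of the \<open>nrm j\<close>, is replaced
  almost everywhere by the same multiple of \<open>g\<close>.\<close>

lemma dominated_integrable:
  fixes F :: "'s \<Rightarrow> 'v::{banach, second_countable_topology}"
  assumes F: "F \<in> borel_measurable \<rho>" and c: "0 \<le> c" and bnd: "\<And>\<sigma>. \<sigma> \<in> space \<rho> \<Longrightarrow> norm (F \<sigma>) \<le> c * (\<Prod>j=a..b. nrm j \<sigma>)"
  shows "integrable \<rho> F" "AE \<sigma> in \<rho>. norm (F \<sigma>) \<le> c * g \<sigma>"
proof -
  show ae: "AE \<sigma> in \<rho>. norm (F \<sigma>) \<le> c * g \<sigma>"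
    using gdom AE_space
  proof eventually_elim
    case (elim \<sigma>)
    have "c * (\<Prod>j=a..b. nrm j \<sigma>) \<le> c * g \<sigma>" using elim c by (intro mult_left_mono) (auto simp: nrm_def)
    then show ?case using bnd[OF elim(2)] by linarith
  qed
  show "integrable \<rho> F"
  proof (rule Bochner_Integration.integrable_bound)
    show "integrable \<rho> (\<lambda>\<sigma>. c * g \<sigma>)" using gi by simp
    show "AE \<sigma> in \<rho>. norm (F \<sigma>) \<le> norm (c * g \<sigma>)" using ae by eventually_elim auto
  qed fact
qed

lemma chain_ip_integrable:
  assumes h: "h \<in> V b" and k: "k \<in> V a"
  shows "integrable \<rho> (\<lambda>\<sigma>. ip (hsp (X a)) (chain a h \<sigma>) k)"
proof -
  interpret hilbert_space "hsp (X a)" using hs ab by simp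
  obtain c where c: "c \<ge> 0" "\<forall>\<sigma>\<in>space \<rho>. \<forall>h\<in>V b. hnorm (hsp (X a)) (chain a h \<sigma>) \<le> c * (\<Prod>j=a..b. nrm j \<sigma>) * hnorm (hsp (X b)) h"
    using chain_norm[OF order_refl ab] by auto
  have hb: "0 \<le> hnorm (hsp (X b)) h" using hilbert_space.hnorm_nonneg[OF hs h] ab by simp
  show ?thesis
  proof (rule dominated_integrable(1)[where c="c * hnorm (hsp (X b)) h * hnorm (hsp (X a)) k"])
    show "(\<lambda>\<sigma>. ip (hsp (X a)) (chain a h \<sigma>) k) \<in> borel_measurable \<rho>"
      using chain_vfield[OF order_refl ab h] k by (simp add: vfield_def)
    show "0 \<le> c * hnorm (hsp (X b)) h * hnorm (hsp (X a)) k" using c hb k by simp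
    fix \<sigma> assume s: "\<sigma> \<in> space \<rho>"
    have "cmod (ip (hsp (X a)) (chain a h \<sigma>) k) \<le> hnorm (hsp (X a)) (chain a h \<sigma>) * hnorm (hsp (X a)) k"
      using chain_mem[OF order_refl ab s h] k by (rule cauchy_schwarz)
    also have "\<dots> \<le> (c * (\<Prod>j=a..b. nrm j \<sigma>) * hnorm (hsp (X b)) h) * hnorm (hsp (X a)) k"
      using c s h k by (intro mult_right_mono) auto
    finally show "norm (ip (hsp (X a)) (chain a h \<sigma>) k) \<le> c * hnorm (hsp (X b)) h * hnorm (hsp (X a)) k * (\<Prod>j=a..b. nrm j \<sigma>)"
      by (simp add: mult_ac)
  qed
qed

text \<open>The weak integral is a sesquilinear form in \<open>h\<close> and \<open>k\<close>,
  bounded by the constant of \<open>chain_norm\<close> times the integral of \<open>g\<close>, so it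
  comes from an operator.\<close>

lemma ex_pettis:
  "\<exists>T. is_pettis_integral (hsp (X b)) (hsp (X a)) \<rho> (\<lambda>\<sigma>. op_chain (\<lambda>j. P j \<sigma>) B a (b - a)) T"
proof -
  interpret A: hilbert_space "hsp (X a)" using hs ab by simp
  interpret Bb: hilbert_space "hsp (X b)" using hs ab by simp
  define I where "I h k = (LINT \<sigma>|\<rho>. ip (hsp (X a)) (chain a h \<sigma>) k)" for h k
  note cb = chain_bounded_op[OF order_refl ab]
  note cm = chain_mem[OF order_refl ab]
  note ci = chain_ip_integrable
  obtain c where c: "c \<ge> 0" "\<forall>\<sigma>\<in>space \<rho>. \<forall>h\<in>V b. hnorm (hsp (X a)) (chain a h \<sigma>) \<le> c * (\<Prod>j=a..b. nrm j \<sigma>) * hnorm (hsp (X b)) h"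
    using chain_norm[OF order_refl ab] by auto
  have "\<exists>T. bounded_op (hsp (X b)) (hsp (X a)) T \<and> (\<forall>h\<in>V b. \<forall>k\<in>V a. ip (hsp (X a)) (T h) k = I h k)"
  proof (rule sesquilinear_op[OF Bb.hilbert_space_axioms A.hilbert_space_axioms])
    fix x y z assume v: "x \<in> V b" "y \<in> V b" "z \<in> V a"
    have "I (x + y) z = (LINT \<sigma>|\<rho>. ip (hsp (X a)) (chain a x \<sigma>) z + ip (hsp (X a)) (chain a y \<sigma>) z)"
      unfolding I_def using v
      by (intro Bochner_Integration.integral_cong refl) (simp add: bounded_op_add[OF cb] A.ip_add cm)
    then show "I (x + y) z = I x z + I y z" unfolding I_def using v by (simp add: ci)
  next
    fix x y z assume v: "x \<in> V a" "y \<in> V a" "z \<in> V b"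
    have "I z (x + y) = (LINT \<sigma>|\<rho>. ip (hsp (X a)) (chain a z \<sigma>) x + ip (hsp (X a)) (chain a z \<sigma>) y)"
      unfolding I_def using v
      by (intro Bochner_Integration.integral_cong refl) (simp add: A.ip_add_right cm)
    then show "I z (x + y) = I z x + I z y" unfolding I_def using v by (simp add: ci)
  next
    fix x y d assume v: "x \<in> V b" "y \<in> V a"
    have "I (d *\<^sub>C x) y = (LINT \<sigma>|\<rho>. d * ip (hsp (X a)) (chain a x \<sigma>) y)"
      unfolding I_def using v
      by (intro Bochner_Integration.integral_cong refl) (simp add: bounded_op_scaleC[OF cb] A.ip_scaleC cm)
    then show "I (d *\<^sub>C x) y = d * I x y" unfolding I_def by simp
  next
    fix x y d assume v: "x \<in> V b" "y \<in> V a"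
    have "I x (d *\<^sub>C y) = (LINT \<sigma>|\<rho>. cnj d * ip (hsp (X a)) (chain a x \<sigma>) y)"
      unfolding I_def using v
      by (intro Bochner_Integration.integral_cong refl) (simp add: A.ip_scaleC_right cm)
    then show "I x (d *\<^sub>C y) = cnj d * I x y" unfolding I_def by simp
  next
    fix h k assume v: "h \<in> V b" "k \<in> V a"
    have "cmod (I h k) \<le> (LINT \<sigma>|\<rho>. cmod (ip (hsp (X a)) (chain a h \<sigma>) k))"
      unfolding I_def by (rule integral_norm_bound)
    also have "\<dots> \<le> (LINT \<sigma>|\<rho>. c * hnorm (hsp (X b)) h * hnorm (hsp (X a)) k * g \<sigma>)"
    proof (rule integral_mono_AE)
      show "AE \<sigma> in \<rho>. cmod (ip (hsp (X a)) (chain a h \<sigma>) k) \<le> c * hnorm (hsp (X b)) h * hnorm (hsp (X a)) k * g \<sigma>"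
      proof (rule dominated_integrable(2))
        show "(\<lambda>\<sigma>. ip (hsp (X a)) (chain a h \<sigma>) k) \<in> borel_measurable \<rho>"
          using chain_vfield[OF order_refl ab v(1)] v(2) by (simp add: vfield_def)
        show "0 \<le> c * hnorm (hsp (X b)) h * hnorm (hsp (X a)) k" using c v by simp
        fix \<sigma> assume s: "\<sigma> \<in> space \<rho>"
        have "cmod (ip (hsp (X a)) (chain a h \<sigma>) k) \<le> hnorm (hsp (X a)) (chain a h \<sigma>) * hnorm (hsp (X a)) k"
          using cm[OF s v(1)] v(2) by (rule A.cauchy_schwarz)
        also have "\<dots> \<le> (c * (\<Prod>j=a..b. nrm j \<sigma>) * hnorm (hsp (X b)) h) * hnorm (hsp (X a)) k"
          using c s v by (intro mult_right_mono) auto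
        finally show "norm (ip (hsp (X a)) (chain a h \<sigma>) k) \<le> c * hnorm (hsp (X b)) h * hnorm (hsp (X a)) k * (\<Prod>j=a..b. nrm j \<sigma>)"
          by (simp add: mult_ac)
      qed
    qed (use gi ci[OF v] in auto)
    also have "\<dots> = (c * (LINT \<sigma>|\<rho>. g \<sigma>)) * hnorm (hsp (X b)) h * hnorm (hsp (X a)) k" by (simp add: mult_ac)
    finally show "cmod (I h k) \<le> (c * (LINT \<sigma>|\<rho>. g \<sigma>)) * hnorm (hsp (X b)) h * hnorm (hsp (X a)) k" .
  qed
  then obtain T where T: "bounded_op (hsp (X b)) (hsp (X a)) T" "\<forall>h\<in>V b. \<forall>k\<in>V a. ip (hsp (X a)) (T h) k = I h k" by blast
  then have "is_pettis_integral (hsp (X b)) (hsp (X a)) \<rho> (\<lambda>\<sigma>. op_chain (\<lambda>j. P j \<sigma>) B a (b - a)) T"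
    unfolding is_pettis_integral_def chain_def[symmetric]
    using ci by (simp add: I_def has_bochner_integral_iff)
  then show ?thesis by blast
qed

end

section \<open>Vanishing of the integral for decompositions of zero\<close>

context ipd_ops
begin

lemma P_ip_prod_integrable:
  assumes "\<And>j. \<lbrakk>a \<le> j; j \<le> b\<rbrakk> \<Longrightarrow> x j \<in> V j" "\<And>j. \<lbrakk>a \<le> j; j \<le> b\<rbrakk> \<Longrightarrow> y j \<in> V j"
  shows "integrable \<rho> (\<lambda>\<sigma>. \<Prod>j=a..b. ip (hsp (X j)) (P j \<sigma> (x j)) (y j))"
proof (rule dominated_integrable(1))
  show "(\<lambda>\<sigma>. \<Prod>j=a..b. ip (hsp (X j)) (P j \<sigma> (x j)) (y j)) \<in> borel_measurable \<rho>"
    using assms P_ip_measurable by (intro borel_measurable_prod) auto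
  have hn: "0 \<le> hnorm (hsp (X j)) (x j)" "0 \<le> hnorm (hsp (X j)) (y j)" if "a \<le> j" "j \<le> b" for j
    using hilbert_space.hnorm_nonneg[OF hs] assms that by auto
  then show "0 \<le> (\<Prod>j=a..b. 2 * hnorm (hsp (X j)) (x j) * hnorm (hsp (X j)) (y j))"
    by (intro prod_nonneg) auto
  fix \<sigma> assume s: "\<sigma> \<in> space \<rho>"
  have "norm (\<Prod>j=a..b. ip (hsp (X j)) (P j \<sigma> (x j)) (y j))
      \<le> (\<Prod>j=a..b. 2 * hnorm (hsp (X j)) (x j) * hnorm (hsp (X j)) (y j) * nrm j \<sigma>)"
    unfolding prod_norm[symmetric] using P_ip_bound[OF _ _ s] assms by (intro prod_mono) auto
  then show "norm (\<Prod>j=a..b. ip (hsp (X j)) (P j \<sigma> (x j)) (y j))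
      \<le> (\<Prod>j=a..b. 2 * hnorm (hsp (X j)) (x j) * hnorm (hsp (X j)) (y j)) * (\<Prod>j=a..b. nrm j \<sigma>)"
    by (simp add: prod.distrib)
qed

text \<open>With equal vectors on both sides, every factor is an integral against a positive
  measure, and their product is one integral over the product measure. After exchanging it with the
  integral over \<rho>, the inner integral vanishes outside a set that is null for that product
  measure.\<close>

lemma diagonal_integral_zero:
  assumes ae: "pvm_AE (tensor_pvms {a..b} X) (\<lambda>\<omega>. has_bochner_integral \<rho> (\<lambda>\<sigma>. \<Prod>j=a..b. f j (\<omega> j, \<sigma>)) 0)"
    and z: "\<And>j. \<lbrakk>a \<le> j; j \<le> b\<rbrakk> \<Longrightarrow> z j \<in> V j"
  shows "(LINT \<sigma>|\<rho>. (\<Prod>j=a..b. ip (hsp (X j)) (P j \<sigma> (z j)) (z j))) = 0"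
proof -
  define I where "I = {a..b}"
  have I: "finite I" "I \<noteq> {}" using ab by (auto simp: I_def)
  have pI: "pvm_space (X j)" if "j \<in> I" for j using that pvm by (simp add: I_def)
  define M where "M i = (if i \<in> I then pmu (X i) (z i) else count_space {})" for i
  have tmu: "PiM I M = tmu I X z" by (simp add: tmu_def M_def[abs_def])
  interpret product_sigma_finite M
    unfolding M_def using pI z by (intro product_sigma_finite_pmu) (auto simp: I_def)
  interpret \<rho>: sigma_finite_measure \<rho> by (rule sf)
  interpret \<nu>: sigma_finite_measure "PiM I M" using I(1) by (rule sigma_finite)
  interpret pair_sigma_finite \<rho> "PiM I M" ..
  have Mi: "M i = pmu (X i) (z i)" if "i \<in> I" for i using that by (simp add: M_def)
  have secI: "(\<lambda>\<omega>. f j (\<omega>, \<sigma>)) \<in> Linf_meas (X j)" if "j \<in> I" "\<sigma> \<in> space \<rho>" for j \<sigma> using that sec by (simp add: I_def)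
  have zI: "z j \<in> V j" if "j \<in> I" for j using that z by (simp add: I_def)
  have int: "integrable (M j) (\<lambda>\<omega>. f j (\<omega>, \<sigma>))" if "j \<in> I" "\<sigma> \<in> space \<rho>" for j \<sigma>
    unfolding Mi[OF that(1)] using pvm_space.pint_self(1)[OF pI secI zI] that by blast
  have ip: "ip (hsp (X j)) (P j \<sigma> (z j)) (z j) = (LINT \<omega>|M j. f j (\<omega>, \<sigma>))" if "j \<in> I" "\<sigma> \<in> space \<rho>" for j \<sigma>
    unfolding Mi[OF that(1)] P_def
    using pvm_space.pvm_int_ip[OF pI secI zI zI] pvm_space.pint_self(2)[OF pI secI zI] that by metis
  let ?\<Phi> = "\<lambda>(\<sigma>, \<omega>). \<Prod>j\<in>I. f j (\<omega> j, \<sigma>)"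
  have fmI: "f j \<in> borel_measurable (M j \<Otimes>\<^sub>M \<rho>)" if "j \<in> I" for j
  proof -
    have eq: "sets (M j \<Otimes>\<^sub>M \<rho>) = sets (msp (X j) \<Otimes>\<^sub>M \<rho>)" unfolding Mi[OF that] by (rule sets_pair_measure_cong) auto
    have "a \<le> j" "j \<le> b" using that by (auto simp: I_def)
    then show ?thesis unfolding measurable_cong_sets[OF eq refl] by (rule fm)
  qed
  have \<Phi>m: "?\<Phi> \<in> borel_measurable (\<rho> \<Otimes>\<^sub>M PiM I M)"
    unfolding case_prod_beta'
  proof (intro borel_measurable_prod)
    fix j assume j: "j \<in> I"
    have "(\<lambda>t. (snd t j, fst t)) \<in> measurable (\<rho> \<Otimes>\<^sub>M PiM I M) (M j \<Otimes>\<^sub>M \<rho>)"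
      using j by (intro measurable_Pair measurable_fst measurable_compose[OF measurable_snd measurable_component_singleton])
    from measurable_compose[OF this fmI[OF j]]
    show "(\<lambda>t. f j (snd t j, fst t)) \<in> borel_measurable (\<rho> \<Otimes>\<^sub>M PiM I M)" .
  qed
  \<comment> \<open>For fixed \<sigma> the L1 norm over the product factorizes and is at most a
    constant times the product of essential norms, hence a multiple of \<open>g\<close> almost
    everywhere.\<close>
  have \<Phi>i: "integrable (\<rho> \<Otimes>\<^sub>M PiM I M) ?\<Phi>"
  proof (rule Fubini_integrable[OF \<Phi>m])
    show "AE \<sigma> in \<rho>. integrable (PiM I M) (\<lambda>\<omega>. ?\<Phi> (\<sigma>, \<omega>))"
    proof (rule AE_I2)
      fix \<sigma> assume "\<sigma> \<in> space \<rho>"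
      then show "integrable (PiM I M) (\<lambda>\<omega>. ?\<Phi> (\<sigma>, \<omega>))"
        using product_integrable_prod[OF I(1), of "\<lambda>j x. f j (x, \<sigma>)"] int by simp
    qed
    show "integrable \<rho> (\<lambda>\<sigma>. LINT \<omega>|PiM I M. norm (?\<Phi> (\<sigma>, \<omega>)))"
    proof (rule dominated_integrable(1)[where c="\<Prod>j\<in>I. (hnorm (hsp (X j)) (z j))\<^sup>2"])
      show "(\<lambda>\<sigma>. LINT \<omega>|PiM I M. norm (?\<Phi> (\<sigma>, \<omega>))) \<in> borel_measurable \<rho>"
        using \<Phi>m by (intro \<nu>.borel_measurable_lebesgue_integral) simp
      show "0 \<le> (\<Prod>j\<in>I. (hnorm (hsp (X j)) (z j))\<^sup>2)" by (intro prod_nonneg) simp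
      fix \<sigma> assume s: "\<sigma> \<in> space \<rho>"
      have "(LINT \<omega>|PiM I M. norm (?\<Phi> (\<sigma>, \<omega>))) = (LINT \<omega>|PiM I M. (\<Prod>j\<in>I. norm (f j (\<omega> j, \<sigma>))))"
        by (simp add: prod_norm)
      also have "\<dots> = (\<Prod>j\<in>I. LINT \<omega>|M j. norm (f j (\<omega>, \<sigma>)))"
        using int[OF _ s] by (intro product_integral_prod[OF I(1)]) auto
      also have "\<dots> \<le> (\<Prod>j\<in>I. nrm j \<sigma> * (hnorm (hsp (X j)) (z j))\<^sup>2)"
      proof (rule prod_mono)
        fix j assume j: "j \<in> I"
        show "0 \<le> (LINT \<omega>|M j. norm (f j (\<omega>, \<sigma>))) \<and> (LINT \<omega>|M j. norm (f j (\<omega>, \<sigma>))) \<le> nrm j \<sigma> * (hnorm (hsp (X j)) (z j))\<^sup>2"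
          using pvm_space.pint_self(3)[OF pI[OF j] secI[OF j s] zI[OF j]] by (simp add: Mi[OF j] nrm_def)
      qed
      also have "\<dots> = (\<Prod>j\<in>I. (hnorm (hsp (X j)) (z j))\<^sup>2) * (\<Prod>j=a..b. nrm j \<sigma>)"
        by (simp add: prod.distrib I_def mult.commute)
      finally have le: "(LINT \<omega>|PiM I M. norm (?\<Phi> (\<sigma>, \<omega>))) \<le> (\<Prod>j\<in>I. (hnorm (hsp (X j)) (z j))\<^sup>2) * (\<Prod>j=a..b. nrm j \<sigma>)" .
      have "0 \<le> (LINT \<omega>|PiM I M. norm (?\<Phi> (\<sigma>, \<omega>)))" by (rule Bochner_Integration.integral_nonneg) simp
      then show "norm (LINT \<omega>|PiM I M. norm (?\<Phi> (\<sigma>, \<omega>))) \<le> (\<Prod>j\<in>I. (hnorm (hsp (X j)) (z j))\<^sup>2) * (\<Prod>j=a..b. nrm j \<sigma>)"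
        using le by simp
    qed
  qed
  have "(LINT \<sigma>|\<rho>. (\<Prod>j=a..b. ip (hsp (X j)) (P j \<sigma> (z j)) (z j))) = (LINT \<sigma>|\<rho>. LINT \<omega>|PiM I M. (\<Prod>j\<in>I. f j (\<omega> j, \<sigma>)))"
  proof (rule Bochner_Integration.integral_cong[OF refl])
    fix \<sigma> assume s: "\<sigma> \<in> space \<rho>"
    have "(\<Prod>j=a..b. ip (hsp (X j)) (P j \<sigma> (z j)) (z j)) = (\<Prod>j\<in>I. LINT \<omega>|M j. f j (\<omega>, \<sigma>))"
      unfolding I_def[symmetric] using ip s by (intro prod.cong) auto
    also have "\<dots> = (LINT \<omega>|PiM I M. (\<Prod>j\<in>I. f j (\<omega> j, \<sigma>)))"
      using int[OF _ s] by (intro product_integral_prod[OF I(1), symmetric]) auto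
    finally show "(\<Prod>j=a..b. ip (hsp (X j)) (P j \<sigma> (z j)) (z j)) = (LINT \<omega>|PiM I M. (\<Prod>j\<in>I. f j (\<omega> j, \<sigma>)))" .
  qed
  also have "\<dots> = (LINT \<omega>|PiM I M. LINT \<sigma>|\<rho>. (\<Prod>j\<in>I. f j (\<omega> j, \<sigma>)))"
    using Fubini_integral[OF \<Phi>i] by simp
  also have "\<dots> = 0"
  proof -
    have iff: "pvm_AE (tensor_pvms I X) Q \<longleftrightarrow> (\<exists>N\<in>sets (\<Pi>\<^sub>M i\<in>I. msp (X i)).
        (\<forall>z \<in> (\<Pi>\<^sub>E i\<in>I. vecs (hsp (X i))). emeasure (tmu I X z) N = 0) \<and>
        {\<omega>\<in>space (\<Pi>\<^sub>M i\<in>I. msp (X i)). \<not> Q \<omega>} \<subseteq> N)" for Q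
      using I pI by (rule tensor_pvm_AE_iff)
    obtain N where N: "N \<in> sets (\<Pi>\<^sub>M i\<in>I. msp (X i))"
      "\<forall>z \<in> (\<Pi>\<^sub>E i\<in>I. vecs (hsp (X i))). emeasure (tmu I X z) N = 0"
      "{\<omega>\<in>space (\<Pi>\<^sub>M i\<in>I. msp (X i)). \<not> has_bochner_integral \<rho> (\<lambda>\<sigma>. \<Prod>j\<in>I. f j (\<omega> j, \<sigma>)) 0} \<subseteq> N"
      using ae unfolding I_def[symmetric] iff by (elim bexE conjE)
    \<comment> \<open>The criterion for null sets ranges over extensional families, while the
      measure reads \<open>z\<close> only at indices in \<open>I\<close>.\<close>
    have "tmu I X z = tmu I X (restrict z I)" unfolding tmu_def by (intro PiM_cong) auto
    moreover have "restrict z I \<in> (\<Pi>\<^sub>E i\<in>I. vecs (hsp (X i)))" using zI by auto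
    ultimately have "emeasure (tmu I X z) N = 0" using N(2) by simp
    then have "N \<in> null_sets (PiM I M)" using N(1) by (simp add: tmu null_sets_def sets_tmu)
    moreover have "{\<omega>\<in>space (PiM I M). (LINT \<sigma>|\<rho>. (\<Prod>j\<in>I. f j (\<omega> j, \<sigma>))) \<noteq> 0} \<subseteq> N"
    proof
      fix \<omega> assume w: "\<omega> \<in> {\<omega>\<in>space (PiM I M). (LINT \<sigma>|\<rho>. (\<Prod>j\<in>I. f j (\<omega> j, \<sigma>))) \<noteq> 0}"
      then have "\<not> has_bochner_integral \<rho> (\<lambda>\<sigma>. \<Prod>j\<in>I. f j (\<omega> j, \<sigma>)) 0"
        using has_bochner_integral_integral_eq by blast
      then show "\<omega> \<in> N" using w N(3) by (auto simp: tmu space_tmu)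
    qed
    ultimately have "AE \<omega> in PiM I M. (LINT \<sigma>|\<rho>. (\<Prod>j\<in>I. f j (\<omega> j, \<sigma>))) = 0" by (intro AE_I') auto
    then show ?thesis by (rule integral_eq_zero_AE)
  qed
  finally show ?thesis .
qed

text \<open>\<open>J\<close> contains the slots at which \<open>x\<close> and \<open>y\<close> may
  differ. Polarizing one slot writes the integral as a combination of four integrals in which that
  slot is diagonal, so the induction shrinks \<open>J\<close>.\<close>

lemma offdiagonal_integral_zero:
  assumes ae: "pvm_AE (tensor_pvms {a..b} X) (\<lambda>\<omega>. has_bochner_integral \<rho> (\<lambda>\<sigma>. \<Prod>j=a..b. f j (\<omega> j, \<sigma>)) 0)"
    and J: "finite J" "J \<subseteq> {a..b}"
    and "\<And>j. \<lbrakk>a \<le> j; j \<le> b\<rbrakk> \<Longrightarrow> x j \<in> V j" "\<And>j. \<lbrakk>a \<le> j; j \<le> b\<rbrakk> \<Longrightarrow> y j \<in> V j"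
    and "\<And>j. \<lbrakk>a \<le> j; j \<le> b; j \<notin> J\<rbrakk> \<Longrightarrow> x j = y j"
  shows "(LINT \<sigma>|\<rho>. (\<Prod>j=a..b. ip (hsp (X j)) (P j \<sigma> (x j)) (y j))) = 0"
  using J assms(4-6)
proof (induction J arbitrary: x y rule: finite_induct)
  case empty
  have "(LINT \<sigma>|\<rho>. (\<Prod>j=a..b. ip (hsp (X j)) (P j \<sigma> (x j)) (y j))) = (LINT \<sigma>|\<rho>. (\<Prod>j=a..b. ip (hsp (X j)) (P j \<sigma> (x j)) (x j)))"
    using empty by (intro Bochner_Integration.integral_cong prod.cong) auto
  then show ?case using diagonal_integral_zero[OF ae, of x] empty by simp
next
  case (insert i J)
  have i: "a \<le> i" "i \<le> b" using insert.prems(1) by auto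
  interpret hilbert_space "hsp (X i)" using hs i by simp
  define u where "u p = pol p (x i) (y i)" for p
  have u: "u p \<in> V i" for p unfolding u_def using insert.prems(2,3) i by (intro pol_mem) auto
  define x' y' where "x' p = x(i := u p)" and "y' p = y(i := u p)" for p
  have mem: "a \<le> j \<Longrightarrow> j \<le> b \<Longrightarrow> x' p j \<in> V j" "a \<le> j \<Longrightarrow> j \<le> b \<Longrightarrow> y' p j \<in> V j" for p j
    using insert.prems(2,3) u by (auto simp: x'_def y'_def)
  have "(\<Prod>j=a..b. ip (hsp (X j)) (P j \<sigma> (x j)) (y j)) = (\<Sum>p<4. \<i> ^ p * (\<Prod>j=a..b. ip (hsp (X j)) (P j \<sigma> (x' p j)) (y' p j)))"
    if s: "\<sigma> \<in> space \<rho>" for \<sigma>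
  proof -
    note Pb = P_bounded[OF i s]
    have "ip (hsp (X i)) (P i \<sigma> (x i)) (y i) = (\<Sum>p<4. \<i> ^ p * ip (hsp (X i)) (P i \<sigma> (u p)) (u p))"
      unfolding u_def using insert.prems(2,3) i
      by (intro polarization[symmetric, where B="\<lambda>h k. ip (hsp (X i)) (P i \<sigma> h) k"])
        (auto simp: bounded_op_add[OF Pb] bounded_op_scaleC[OF Pb] bounded_op_mem[OF Pb] ip_add ip_add_right ip_scaleC ip_scaleC_right)
    moreover have "(\<Prod>j=a..b. F j) = F i * (\<Prod>j\<in>{a..b} - {i}. F j)" for F :: "nat \<Rightarrow> complex"
      using i by (intro prod.remove) auto
    moreover have "(\<Prod>j\<in>{a..b} - {i}. ip (hsp (X j)) (P j \<sigma> (x' p j)) (y' p j)) = (\<Prod>j\<in>{a..b} - {i}. ip (hsp (X j)) (P j \<sigma> (x j)) (y j))" for p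
      by (intro prod.cong) (auto simp: x'_def y'_def)
    ultimately show ?thesis by (simp add: x'_def y'_def sum_distrib_right mult.assoc)
  qed
  then have "(LINT \<sigma>|\<rho>. (\<Prod>j=a..b. ip (hsp (X j)) (P j \<sigma> (x j)) (y j)))
      = (LINT \<sigma>|\<rho>. (\<Sum>p<4. \<i> ^ p * (\<Prod>j=a..b. ip (hsp (X j)) (P j \<sigma> (x' p j)) (y' p j))))"
    by (intro Bochner_Integration.integral_cong refl)
  also have "\<dots> = (\<Sum>p<4. \<i> ^ p * (LINT \<sigma>|\<rho>. (\<Prod>j=a..b. ip (hsp (X j)) (P j \<sigma> (x' p j)) (y' p j))))"
    using P_ip_prod_integrable[of "x' _" "y' _"] mem by (subst Bochner_Integration.integral_sum) auto
  also have "\<dots> = 0"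
  proof -
    have "(LINT \<sigma>|\<rho>. (\<Prod>j=a..b. ip (hsp (X j)) (P j \<sigma> (x' p j)) (y' p j))) = 0" for p
    proof (rule insert.IH)
      show "x' p j = y' p j" if "a \<le> j" "j \<le> b" "j \<notin> J" for j
        using that insert.prems(4)[of j] by (cases "j = i") (auto simp: x'_def y'_def)
      show "J \<subseteq> {a..b}" using insert.prems(1) by blast
      show "x' p j \<in> V j" if "a \<le> j" "j \<le> b" for j using that by (rule mem(1))
      show "y' p j \<in> V j" if "a \<le> j" "j \<le> b" for j using that by (rule mem(2))
    qed
    then show ?thesis by simp
  qed
  finally show ?case .
qed

lemma prod_split_at:
  fixes F :: "nat \<Rightarrow> 'c::comm_monoid_mult"
  assumes "a \<le> r" "r \<le> b"
  shows "(\<Prod>j=a..b. F j) = (\<Prod>j\<in>{a..<r}. F j) * (\<Prod>j=r..b. F j)"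
proof -
  have eq: "{a..b} = {a..<r} \<union> {r..b}" using assms by auto
  show ?thesis unfolding eq by (rule prod.union_disjoint) auto
qed

text \<open>
  Operators to the left of slot \<open>r\<close> are replaced by rank one operators; the remaining ones are
  approximated by finite rank operators, one slot at a time.
\<close>

lemma partial_chain_integral_zero:
  assumes ae: "pvm_AE (tensor_pvms {a..b} X) (\<lambda>\<omega>. has_bochner_integral \<rho> (\<lambda>\<sigma>. \<Prod>j=a..b. f j (\<omega> j, \<sigma>)) 0)"
    and h: "h \<in> V b" and "a \<le> r" "r \<le> b"
    and "\<And>j. \<lbrakk>a \<le> j; j < r\<rbrakk> \<Longrightarrow> x j \<in> V j" "\<And>j. \<lbrakk>a \<le> j; j \<le> r\<rbrakk> \<Longrightarrow> y j \<in> V j"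
  shows "integrable \<rho> (\<lambda>\<sigma>. (\<Prod>j\<in>{a..<r}. ip (hsp (X j)) (P j \<sigma> (x j)) (y j)) * ip (hsp (X r)) (chain r h \<sigma>) (y r)) \<and>
    (LINT \<sigma>|\<rho>. (\<Prod>j\<in>{a..<r}. ip (hsp (X j)) (P j \<sigma> (x j)) (y j)) * ip (hsp (X r)) (chain r h \<sigma>) (y r)) = 0"
  using assms(4,3,5,6)
proof (induction arbitrary: x y rule: inc_induct)
  case base
  \<comment> \<open>At the last slot the chain is just \<open>P b \<sigma> h\<close>; taking
    \<open>h\<close> as the missing vector turns the integrand into a pure product.\<close>
  define x' where "x' = x(b := h)"
  have x': "x' j \<in> V j" if "a \<le> j" "j \<le> b" for j using base(2)[of j] h that by (auto simp: x'_def)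
  have eq: "(\<Prod>j\<in>{a..<b}. ip (hsp (X j)) (P j \<sigma> (x j)) (y j)) * ip (hsp (X b)) (chain b h \<sigma>) (y b) = (\<Prod>j=a..b. ip (hsp (X j)) (P j \<sigma> (x' j)) (y j))" for \<sigma>
    unfolding prod_split_at[OF ab order_refl] by (simp add: chain_last x'_def)
  show ?case unfolding eq
    using P_ip_prod_integrable[of x' y] offdiagonal_integral_zero[OF ae _ order_refl, of x' y] x' base(3) by auto
next
  case (step r)
  have r: "a \<le> r" "r < b" "r \<le> b" "a \<le> Suc r" "Suc r \<le> b" using step by auto
  interpret H: hilbert_space "hsp (X r)" using hs r by simp
  interpret H': hilbert_space "hsp (X (Suc r))" using hs r by simp
  interpret Hb: hilbert_space "hsp (X b)" using hs ab by simp
  define v where "v = chain (Suc r) h"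
  have vf: "vfield (hsp (X (Suc r))) \<rho> v" unfolding v_def using r h by (intro chain_vfield) auto
  have vV: "v \<sigma> \<in> V (Suc r)" if "\<sigma> \<in> space \<rho>" for \<sigma> using vf that by (auto simp: vfield_def)
  obtain F where F: "\<And>n. finite (F n)" "\<And>n. F n \<subseteq> V (Suc r)"
    "\<And>\<sigma> w. \<lbrakk>\<sigma> \<in> space \<rho>; w \<in> V (Suc r)\<rbrakk> \<Longrightarrow> (\<lambda>n. \<Sum>e\<in>F n. ip (hsp (X (Suc r))) (v \<sigma>) e * ip (hsp (X (Suc r))) e w) \<longlonglongrightarrow> ip (hsp (X (Suc r))) (v \<sigma>) w"
    "\<And>\<sigma> w n. \<lbrakk>\<sigma> \<in> space \<rho>; w \<in> V (Suc r)\<rbrakk>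
      \<Longrightarrow> cmod (\<Sum>e\<in>F n. ip (hsp (X (Suc r))) (v \<sigma>) e * ip (hsp (X (Suc r))) e w) \<le> 2 * hnorm (hsp (X (Suc r))) (v \<sigma>) * hnorm (hsp (X (Suc r))) w"
  proof (rule vfield_approx[OF H'.hilbert_space_axioms vf], goal_cases)
    case (1 F)
    show ?case by (rule that[of F]; fact 1)
  qed
  define L where "L \<sigma> = (\<Prod>j\<in>{a..<r}. ip (hsp (X j)) (P j \<sigma> (x j)) (y j))" for \<sigma>
  define G where "G \<sigma> = L \<sigma> * ip (hsp (X r)) (chain r h \<sigma>) (y r)" for \<sigma>
  \<comment> \<open>\<open>G\<close> with the vector \<open>v \<sigma>\<close> replaced by its n-th
    finite expansion.\<close>
  define S where "S n \<sigma> = (\<Sum>e\<in>F n. L \<sigma> * ip (hsp (X r)) (P r \<sigma> (B r e)) (y r) * ip (hsp (X (Suc r))) (v \<sigma>) e)" for n \<sigma>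
  have yr: "y r \<in> V r" using step.prems(3)[of r] r by simp
  have BV: "B r e \<in> V r" if "e \<in> V (Suc r)" for e using bounded_op_mem[OF Bop[OF r(1,2)] that] .
  have IH: "integrable \<rho> (\<lambda>\<sigma>. L \<sigma> * ip (hsp (X r)) (P r \<sigma> (B r e)) (y r) * ip (hsp (X (Suc r))) (v \<sigma>) e) \<and>
     (LINT \<sigma>|\<rho>. L \<sigma> * ip (hsp (X r)) (P r \<sigma> (B r e)) (y r) * ip (hsp (X (Suc r))) (v \<sigma>) e) = 0" if e: "e \<in> V (Suc r)" for e
  proof -
    \<comment> \<open>A summand with basis vector \<open>e\<close> is the claim at slot
      \<open>r + 1\<close> for the rank one operator that sends a vector to its inner product with
      \<open>e\<close> times \<open>B r e\<close>.\<close>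
    define x' y' where "x' = x(r := B r e)" and "y' = y(Suc r := e)"
    have "integrable \<rho> (\<lambda>\<sigma>. (\<Prod>j\<in>{a..<Suc r}. ip (hsp (X j)) (P j \<sigma> (x' j)) (y' j)) * ip (hsp (X (Suc r))) (chain (Suc r) h \<sigma>) (y' (Suc r))) \<and>
      (LINT \<sigma>|\<rho>. (\<Prod>j\<in>{a..<Suc r}. ip (hsp (X j)) (P j \<sigma> (x' j)) (y' j)) * ip (hsp (X (Suc r))) (chain (Suc r) h \<sigma>) (y' (Suc r))) = 0"
    proof (rule step.IH)
      show "x' j \<in> V j" if "a \<le> j" "j < Suc r" for j
        using that step.prems(2)[of j] BV[OF e] by (cases "j = r") (auto simp: x'_def)
      show "y' j \<in> V j" if "a \<le> j" "j \<le> Suc r" for j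
        using that step.prems(3)[of j] e by (cases "j = Suc r") (auto simp: y'_def)
    qed (use r in auto)
    moreover have "(\<Prod>j\<in>{a..<Suc r}. ip (hsp (X j)) (P j \<sigma> (x' j)) (y' j)) = L \<sigma> * ip (hsp (X r)) (P r \<sigma> (B r e)) (y r)" for \<sigma>
      using r by (simp add: L_def x'_def y'_def)
    ultimately show ?thesis by (simp add: v_def y'_def)
  qed
  obtain c where c: "c \<ge> 0" "\<forall>\<sigma>\<in>space \<rho>. \<forall>h\<in>V b. hnorm (hsp (X (Suc r))) (chain (Suc r) h \<sigma>) \<le> c * (\<Prod>j=Suc r..b. nrm j \<sigma>) * hnorm (hsp (X b)) h"
    using chain_norm[OF r(4,5)] by auto
  obtain d where d: "d \<ge> 0" "\<forall>x\<in>V (Suc r). hnorm (hsp (X r)) (B r x) \<le> d * hnorm (hsp (X (Suc r))) x"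
    using bounded_op_bound[OF Bop[OF r(1,2)] H'.hilbert_space_axioms] by auto
  define l where "l = (\<Prod>j\<in>{a..<r}. 2 * hnorm (hsp (X j)) (x j) * hnorm (hsp (X j)) (y j))"
  \<comment> \<open>A majorant constant independent of \<open>n\<close> and \<sigma>:
    \<open>l\<close> from the slots to the left, \<open>c\<close> from the tail of the chain, one 2
    from the bound in \<open>vfield_approx\<close>, and \<open>2 * d\<close> from
    \<open>P r \<sigma>\<close> after \<open>B r\<close>.\<close>
  define D where "D = l * (2 * (c * hnorm (hsp (X b)) h) * (2 * d * hnorm (hsp (X r)) (y r)))"
  have xyn: "0 \<le> hnorm (hsp (X j)) (x j)" "0 \<le> hnorm (hsp (X j)) (y j)" if "a \<le> j" "j < r" for j
    using hilbert_space.hnorm_nonneg[OF hs] step.prems(2,3)[of j] that r by auto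
  have l: "0 \<le> l" unfolding l_def using xyn by (intro prod_nonneg) auto
  have D: "0 \<le> D" unfolding D_def using l c(1) d(1) h yr by simp
  have Lb: "cmod (L \<sigma>) \<le> l * (\<Prod>j\<in>{a..<r}. nrm j \<sigma>)" if s: "\<sigma> \<in> space \<rho>" for \<sigma>
  proof -
    have "cmod (L \<sigma>) \<le> (\<Prod>j\<in>{a..<r}. 2 * hnorm (hsp (X j)) (x j) * hnorm (hsp (X j)) (y j) * nrm j \<sigma>)"
      unfolding L_def prod_norm[symmetric] using P_ip_bound[OF _ _ s] step.prems r by (intro prod_mono) auto
    then show ?thesis by (simp add: l_def prod.distrib)
  qed
  have key: "(\<lambda>n. S n \<sigma>) \<longlonglongrightarrow> G \<sigma> \<and> (\<forall>n. cmod (S n \<sigma>) \<le> D * (\<Prod>j=a..b. nrm j \<sigma>))" if s: "\<sigma> \<in> space \<rho>" for \<sigma>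
  proof -
    have n0: "0 \<le> nrm r \<sigma>" using r s by (intro nrm_nonneg) auto
    have Tb: "bounded_op (hsp (X (Suc r))) (hsp (X r)) (\<lambda>e. P r \<sigma> (B r e))"
      using bounded_op_comp[OF Bop[OF r(1,2)] P_bounded[OF r(1,3) s] H'.hilbert_space_axioms H.hilbert_space_axioms] .
    have Tn: "hnorm (hsp (X r)) (P r \<sigma> (B r e)) \<le> (2 * nrm r \<sigma> * d) * hnorm (hsp (X (Suc r))) e" if e: "e \<in> V (Suc r)" for e
    proof -
      have "hnorm (hsp (X r)) (P r \<sigma> (B r e)) \<le> 2 * nrm r \<sigma> * hnorm (hsp (X r)) (B r e)"
        using P_norm[OF r(1,3) s BV[OF e]] .
      also have "\<dots> \<le> 2 * nrm r \<sigma> * (d * hnorm (hsp (X (Suc r))) e)" using d e n0 by (intro mult_left_mono) auto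
      finally show ?thesis by (simp add: mult_ac)
    qed
    \<comment> \<open>The vector \<open>w\<close> represents pairing the image of \<open>e\<close>
      with \<open>y r\<close>, which brings the finite sums into the form controlled by
      \<open>vfield_approx\<close>.\<close>
    obtain w where w: "w \<in> V (Suc r)" "\<forall>e\<in>V (Suc r). ip (hsp (X r)) (P r \<sigma> (B r e)) (y r) = ip (hsp (X (Suc r))) e w"
      "hnorm (hsp (X (Suc r))) w \<le> (2 * nrm r \<sigma> * d) * hnorm (hsp (X r)) (y r)"
      using bounded_op_adjoint_norm[OF Tb H'.hilbert_space_axioms H.hilbert_space_axioms _ Tn yr] n0 d(1) by auto
    have Seq: "S n \<sigma> = L \<sigma> * (\<Sum>e\<in>F n. ip (hsp (X (Suc r))) (v \<sigma>) e * ip (hsp (X (Suc r))) e w)" for n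
      unfolding S_def sum_distrib_left using F(2) w(2) by (intro sum.cong) (auto simp: subset_iff mult_ac)
    have Geq: "G \<sigma> = L \<sigma> * ip (hsp (X (Suc r))) (v \<sigma>) w"
      unfolding G_def chain_rec[OF r(2)] using w(2) vV[OF s] by (simp add: v_def)
    have lim: "(\<lambda>n. S n \<sigma>) \<longlonglongrightarrow> G \<sigma>" unfolding Seq Geq using F(3)[OF s w(1)] by (rule tendsto_mult_left)
    have "cmod (S n \<sigma>) \<le> D * (\<Prod>j=a..b. nrm j \<sigma>)" for n
    proof -
      have vn: "hnorm (hsp (X (Suc r))) (v \<sigma>) \<le> c * (\<Prod>j=Suc r..b. nrm j \<sigma>) * hnorm (hsp (X b)) h"
        using c(2) s h by (simp add: v_def)
      have p1: "0 \<le> (\<Prod>j\<in>{a..<r}. nrm j \<sigma>)" "0 \<le> (\<Prod>j=Suc r..b. nrm j \<sigma>)"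
        using nrm_nonneg[OF _ _ s] r by (auto intro!: prod_nonneg)
      have "cmod (S n \<sigma>) \<le> (l * (\<Prod>j\<in>{a..<r}. nrm j \<sigma>)) * (2 * hnorm (hsp (X (Suc r))) (v \<sigma>) * hnorm (hsp (X (Suc r))) w)"
        unfolding Seq norm_mult using Lb[OF s] F(4)[OF s w(1)] l p1 by (intro mult_mono) auto
      also have "\<dots> \<le> (l * (\<Prod>j\<in>{a..<r}. nrm j \<sigma>)) *
          (2 * (c * (\<Prod>j=Suc r..b. nrm j \<sigma>) * hnorm (hsp (X b)) h) * ((2 * nrm r \<sigma> * d) * hnorm (hsp (X r)) (y r)))"
        using vn w(1,3) vV[OF s] l p1 c(1) h by (intro mult_left_mono mult_mono) auto
      also have "\<dots> = D * ((\<Prod>j\<in>{a..<r}. nrm j \<sigma>) * (nrm r \<sigma> * (\<Prod>j=Suc r..b. nrm j \<sigma>)))"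
        by (simp add: D_def mult_ac)
      also have "nrm r \<sigma> * (\<Prod>j=Suc r..b. nrm j \<sigma>) = (\<Prod>j=r..b. nrm j \<sigma>)" using r by (simp add: prod.atLeast_Suc_atMost)
      finally show ?thesis unfolding prod_split_at[OF r(1,3), symmetric] .
    qed
    then show ?thesis using lim by blast
  qed
  have Sm: "S n \<in> borel_measurable \<rho>" for n
    unfolding S_def[abs_def] using IH F(2) by (intro borel_measurable_sum borel_measurable_integrable) blast
  have Gm: "G \<in> borel_measurable \<rho>"
    by (rule borel_measurable_LIMSEQ_metric[where f=S]) (use Sm key in auto)
  have Dg: "integrable \<rho> (\<lambda>\<sigma>. D * g \<sigma>)" using gi by simp
  have S0: "(LINT \<sigma>|\<rho>. S n \<sigma>) = 0" for n
    unfolding S_def using IH F(2) by (subst Bochner_Integration.integral_sum) (auto simp: subset_iff)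
  have aeS: "AE \<sigma> in \<rho>. norm (S n \<sigma>) \<le> D * g \<sigma>" for n
    using Sm D key by (intro dominated_integrable(2)) auto
  have aeL: "AE \<sigma> in \<rho>. (\<lambda>n. S n \<sigma>) \<longlonglongrightarrow> G \<sigma>" using key by (intro AE_I2) blast
  have "integrable \<rho> G" using Gm Sm Dg aeL aeS by (rule integrable_dominated_convergence)
  moreover have "(\<lambda>n. LINT \<sigma>|\<rho>. S n \<sigma>) \<longlonglongrightarrow> (LINT \<sigma>|\<rho>. G \<sigma>)" using Gm Sm Dg aeL aeS by (rule integral_dominated_convergence)
  then have "(LINT \<sigma>|\<rho>. G \<sigma>) = 0" by (simp add: S0 LIMSEQ_const_iff)
  ultimately show ?case by (simp add: G_def[abs_def] L_def[abs_def])
qed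

lemma chain_integral_zero:
  assumes "pvm_AE (tensor_pvms {a..b} X) (\<lambda>\<omega>. has_bochner_integral \<rho> (\<lambda>\<sigma>. \<Prod>j=a..b. f j (\<omega> j, \<sigma>)) 0)"
    and "h \<in> V b" "k \<in> V a"
  shows "(LINT \<sigma>|\<rho>. ip (hsp (X a)) (chain a h \<sigma>) k) = 0"
  \<comment> \<open>At \<open>r = a\<close> the product over slots to the left is empty, so any
    vectors can be supplied for \<open>x\<close>.\<close>
  using partial_chain_integral_zero[OF assms(1,2) order_refl ab, of "\<lambda>_. 0" "\<lambda>_. k"] assms(3) by simp

end

section \<open>Sums, products and transport of decompositions\<close>

text \<open>Some measurable majorant in the infimum has finite integral; it is finite almost
  everywhere and can therefore be made real valued.\<close>

lemma upper_integral_dominated: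
  assumes "upper_integral \<rho> (\<lambda>\<sigma>. ennreal (h \<sigma>)) < \<infinity>"
  shows "\<exists>g::'s \<Rightarrow> real. integrable \<rho> g \<and> (AE \<sigma> in \<rho>. h \<sigma> \<le> g \<sigma>)"
proof -
  obtain G where G: "G \<in> borel_measurable \<rho>" "AE \<sigma> in \<rho>. ennreal (h \<sigma>) \<le> G \<sigma>" "(\<integral>\<^sup>+\<sigma>. G \<sigma> \<partial>\<rho>) < \<infinity>"
    using assms unfolding upper_integral_def Inf_less_iff by auto
  have fin: "AE \<sigma> in \<rho>. G \<sigma> \<noteq> \<infinity>" using G by (intro nn_integral_noteq_infinite) auto
  have "integrable \<rho> (\<lambda>\<sigma>. enn2real (G \<sigma>))"
  proof (rule integrableI_bounded)
    show "(\<lambda>\<sigma>. enn2real (G \<sigma>)) \<in> borel_measurable \<rho>" using G(1) by simp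
    have "(\<integral>\<^sup>+\<sigma>. ennreal (norm (enn2real (G \<sigma>))) \<partial>\<rho>) = (\<integral>\<^sup>+\<sigma>. G \<sigma> \<partial>\<rho>)"
      using fin by (intro nn_integral_cong_AE) (auto simp: ennreal_enn2real less_top)
    then show "(\<integral>\<^sup>+\<sigma>. ennreal (norm (enn2real (G \<sigma>))) \<partial>\<rho>) < \<infinity>" using G(3) by simp
  qed
  moreover have "AE \<sigma> in \<rho>. h \<sigma> \<le> enn2real (G \<sigma>)"
    using G(2) fin
  proof eventually_elim
    case (elim \<sigma>)
    then have "ennreal (h \<sigma>) \<le> ennreal (enn2real (G \<sigma>))" by (simp add: ennreal_enn2real less_top)
    then show ?case by (simp add: ennreal_le_iff)
  qed
  ultimately show ?thesis by blast
qed

lemma upper_integral_finite: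
  assumes "integrable \<rho> g" "AE \<sigma> in \<rho>. h \<sigma> \<le> g \<sigma>"
  shows "upper_integral \<rho> (\<lambda>\<sigma>. ennreal (h \<sigma>)) < \<infinity>"
proof -
  have "(\<lambda>\<sigma>. ennreal (g \<sigma>)) \<in> borel_measurable \<rho>" using assms(1) by (simp add: borel_measurable_integrable)
  moreover have "AE \<sigma> in \<rho>. ennreal (h \<sigma>) \<le> ennreal (g \<sigma>)" using assms(2) by eventually_elim (rule ennreal_leI)
  ultimately have "upper_integral \<rho> (\<lambda>\<sigma>. ennreal (h \<sigma>)) \<le> (\<integral>\<^sup>+\<sigma>. ennreal (g \<sigma>) \<partial>\<rho>)"
    unfolding upper_integral_def by (intro Inf_lower CollectI exI[of _ "\<lambda>\<sigma>. ennreal (g \<sigma>)"] conjI) simp_all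
  \<comment> \<open>The majorant may take negative values, while integrability speaks of its
    absolute value.\<close>
  also have "\<dots> \<le> (\<integral>\<^sup>+\<sigma>. ennreal (norm (g \<sigma>)) \<partial>\<rho>)" by (intro nn_integral_mono ennreal_leI) simp
  also have "\<dots> < \<infinity>" using assms(1) unfolding integrable_iff_bounded by simp
  finally show ?thesis .
qed

section \<open>Decompositions and their Pettis integrals\<close>

lemma is_ipdI:
  assumes "sigma_finite_measure \<rho>" "\<And>j. \<lbrakk>a \<le> j; j \<le> b\<rbrakk> \<Longrightarrow> f j \<in> borel_measurable (msp (X j) \<Otimes>\<^sub>M \<rho>)"
    "\<And>j \<sigma>. \<lbrakk>a \<le> j; j \<le> b; \<sigma> \<in> space \<rho>\<rbrakk> \<Longrightarrow> (\<lambda>\<omega>. f j (\<omega>, \<sigma>)) \<in> Linf (X j)"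
    "integrable \<rho> g" "AE \<sigma> in \<rho>. (\<Prod>j=a..b. Linf_norm (X j) (\<lambda>\<omega>. f j (\<omega>, \<sigma>))) \<le> g \<sigma>"
    "pvm_AE (tensor_pvms {a..b} X) (\<lambda>\<omega>. has_bochner_integral \<rho> (\<lambda>\<sigma>. \<Prod>j=a..b. f j (\<omega> j, \<sigma>)) (\<phi> \<omega>))"
  shows "is_ipd a b X \<phi> \<rho> f"
  unfolding is_ipd_def using assms(1,2,3,6) upper_integral_finite[OF assms(4,5)] by simp

lemma is_ipd_dominated:
  assumes "is_ipd a b X \<phi> \<rho> f"
  obtains g where "integrable \<rho> g" "AE \<sigma> in \<rho>. (\<Prod>j=a..b. Linf_norm (X j) (\<lambda>\<omega>. f j (\<omega>, \<sigma>))) \<le> g \<sigma>"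
proof -
  have "upper_integral \<rho> (\<lambda>\<sigma>. ennreal (\<Prod>j=a..b. Linf_norm (X j) (\<lambda>\<omega>. f j (\<omega>, \<sigma>)))) < \<infinity>"
    using assms by (simp add: is_ipd_def)
  from upper_integral_dominated[OF this] show ?thesis using that by blast
qed

lemma is_ipd_ops:
  assumes d: "is_ipd a b X \<phi> \<rho> f" and "a \<le> b" and "\<And>j. \<lbrakk>a \<le> j; j \<le> b\<rbrakk> \<Longrightarrow> pvm_space (X j)" and B: "B \<in> op_args a b X"
  shows "\<exists>g. ipd_ops a b X \<rho> f B g"
proof -
  obtain g where g: "integrable \<rho> g" "AE \<sigma> in \<rho>. (\<Prod>j=a..b. Linf_norm (X j) (\<lambda>\<omega>. f j (\<omega>, \<sigma>))) \<le> g \<sigma>"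
    by (rule is_ipd_dominated[OF d])
  have "ipd_ops a b X \<rho> f B g"
  proof (rule ipd_ops.intro)
    show "sigma_finite_measure \<rho>" using d by (simp add: is_ipd_def)
    show "f j \<in> borel_measurable (msp (X j) \<Otimes>\<^sub>M \<rho>)" if "a \<le> j" "j \<le> b" for j using d that by (simp add: is_ipd_def)
    show "(\<lambda>\<omega>. f j (\<omega>, \<sigma>)) \<in> Linf (X j)" if "a \<le> j" "j \<le> b" "\<sigma> \<in> space \<rho>" for j \<sigma> using d that by (simp add: is_ipd_def)
    show "bounded_op (hsp (X (Suc j))) (hsp (X j)) (B j)" if "a \<le> j" "j < b" for j using B that by (simp add: op_args_def)
  qed (fact assms(2,3) g)+
  then show ?thesis by blast
qed

lemma is_ipd_AE:
  "is_ipd a b X \<phi> \<rho> f \<Longrightarrow>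
    pvm_AE (tensor_pvms {a..b} X) (\<lambda>\<omega>. has_bochner_integral \<rho> (\<lambda>\<sigma>. \<Prod>j=a..b. f j (\<omega> j, \<sigma>)) (\<phi> \<omega>))"
  by (simp add: is_ipd_def)

definition chain_op where
  "chain_op a b X f B \<sigma> = op_chain (\<lambda>j. pvm_int (X j) (\<lambda>\<omega>. f j (\<omega>, \<sigma>))) B a (b - a)"

definition ipd_pettis where
  "ipd_pettis a b X \<rho> f B T \<longleftrightarrow> is_pettis_integral (hsp (X b)) (hsp (X a)) \<rho> (chain_op a b X f B) T"

lemma chain_op_chain: "ipd_ops a b X \<rho> f B g \<Longrightarrow> ipd_ops.chain b X f B a h \<sigma> = chain_op a b X f B \<sigma> h"
  by (simp add: ipd_ops.chain_def ipd_ops.P_def chain_op_def)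

lemma ex_ipd_pettis:
  assumes d: "is_ipd a b X \<phi> \<rho> f" and "a \<le> b" and "\<And>j. \<lbrakk>a \<le> j; j \<le> b\<rbrakk> \<Longrightarrow> pvm_space (X j)" and B: "B \<in> op_args a b X"
  shows "\<exists>T. ipd_pettis a b X \<rho> f B T"
proof -
  obtain g where "ipd_ops a b X \<rho> f B g" using is_ipd_ops[OF assms] by blast
  then interpret ipd_ops a b X \<rho> f B g .
  show ?thesis using ex_pettis unfolding ipd_pettis_def chain_op_def P_def[abs_def] .
qed

text \<open>All inner products of \<open>T h\<close> vanish by \<open>chain_integral_zero\<close>.
  The parameter type is arbitrary here, which is essential for comparing decompositions over
  different types.\<close>

lemma ipd_pettis_zero:
  assumes d: "is_ipd a b X (\<lambda>_. 0) \<rho> f" and ab: "a \<le> b" and pvm: "\<And>j. \<lbrakk>a \<le> j; j \<le> b\<rbrakk> \<Longrightarrow> pvm_space (X j)"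
    and B: "B \<in> op_args a b X" and T: "ipd_pettis a b X \<rho> f B T" and h: "h \<in> vecs (hsp (X b))"
  shows "T h = 0"
proof -
  obtain g where g: "ipd_ops a b X \<rho> f B g" using is_ipd_ops[OF d ab pvm B] by blast
  then interpret ipd_ops a b X \<rho> f B g .
  interpret A: hilbert_space "hsp (X a)" using hs ab by simp
  have Tb: "bounded_op (hsp (X b)) (hsp (X a)) T"
    and int: "\<And>k. k \<in> V a \<Longrightarrow> has_bochner_integral \<rho> (\<lambda>\<sigma>. ip (hsp (X a)) (chain_op a b X f B \<sigma> h) k) (ip (hsp (X a)) (T h) k)"
    using T h by (auto simp: ipd_pettis_def is_pettis_integral_def)
  show ?thesis
  proof (rule A.vec_eqI)
    show "T h \<in> V a" using bounded_op_mem[OF Tb h] .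
    fix k assume k: "k \<in> V a"
    have "ip (hsp (X a)) (T h) k = (LINT \<sigma>|\<rho>. ip (hsp (X a)) (chain a h \<sigma>) k)"
      using has_bochner_integral_integral_eq[OF int[OF k]] by (simp add: chain_op_chain[OF g])
    then show "ip (hsp (X a)) (T h) k = ip (hsp (X a)) 0 k"
      using chain_integral_zero[OF is_ipd_AE[OF d] h k] k by simp
  qed (rule A.zero_mem)
qed

section \<open>Transport of a decomposition along an injection\<close>

lemma has_bochner_integral_embed_measure:
  fixes F :: "'t \<Rightarrow> 'v::{banach, second_countable_topology}"
  assumes u: "inj u" and F: "has_bochner_integral \<rho> F z"
  shows "has_bochner_integral (embed_measure \<rho> u) (\<lambda>s. F (inv u s)) z"
proof -
  have m: "(\<lambda>s. F (inv u s)) \<in> borel_measurable (embed_measure \<rho> u)"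
    using F u by (intro measurable_embed_measure1) (auto simp: has_bochner_integral_iff borel_measurable_integrable)
  have um: "u \<in> measurable \<rho> (embed_measure \<rho> u)" using u by (rule measurable_embed_measure2)
  have "has_bochner_integral (distr \<rho> (embed_measure \<rho> u) u) (\<lambda>s. F (inv u s)) z"
    unfolding has_bochner_integral_iff using F u
    by (simp add: integrable_distr_eq[OF um m] integral_distr[OF um m] has_bochner_integral_iff)
  then show ?thesis using embed_measure_eq_distr[OF u, of \<rho>] by simp
qed

text \<open>Off the range of \<open>u\<close> the inverse is unspecified, but the embedded measure
  lives on the image of the old space.\<close>

definition embed_ipd :: "('t \<Rightarrow> 's) \<Rightarrow> (nat \<Rightarrow> 'w \<times> 't \<Rightarrow> complex) \<Rightarrow> nat \<Rightarrow> 'w \<times> 's \<Rightarrow> complex" where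
  "embed_ipd u f j = (\<lambda>(\<omega>, s). f j (\<omega>, inv u s))"

lemma is_ipd_embed:
  fixes X :: "nat \<Rightarrow> ('w, 'h::complex_vector) pvms"
  assumes u: "inj u" and d: "is_ipd a b X \<phi> \<rho> f" and ab: "a \<le> b" and pvm: "\<And>j. \<lbrakk>a \<le> j; j \<le> b\<rbrakk> \<Longrightarrow> pvm_space (X j)"
  shows "is_ipd a b X \<phi> (embed_measure \<rho> u) (embed_ipd u f)"
proof -
  have sf: "sigma_finite_measure \<rho>" and fm: "\<And>j. \<lbrakk>a \<le> j; j \<le> b\<rbrakk> \<Longrightarrow> f j \<in> borel_measurable (msp (X j) \<Otimes>\<^sub>M \<rho>)"
    and fL: "\<And>j \<sigma>. \<lbrakk>a \<le> j; j \<le> b; \<sigma> \<in> space \<rho>\<rbrakk> \<Longrightarrow> (\<lambda>\<omega>. f j (\<omega>, \<sigma>)) \<in> Linf (X j)"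
    using d by (auto simp: is_ipd_def)
  obtain g where g: "integrable \<rho> g" "AE \<sigma> in \<rho>. (\<Prod>j=a..b. Linf_norm (X j) (\<lambda>\<omega>. f j (\<omega>, \<sigma>))) \<le> g \<sigma>"
    by (rule is_ipd_dominated[OF d])
  show ?thesis
  proof (rule is_ipdI)
    show "sigma_finite_measure (embed_measure \<rho> u)" using sf u by (rule sigma_finite_embed_measure)
    have iu: "inv u \<in> measurable (embed_measure \<rho> u) \<rho>"
      using u by (intro measurable_embed_measure1) simp
    show "embed_ipd u f j \<in> borel_measurable (msp (X j) \<Otimes>\<^sub>M embed_measure \<rho> u)" if "a \<le> j" "j \<le> b" for j
    proof -
      have "(\<lambda>t. (fst t, inv u (snd t))) \<in> measurable (msp (X j) \<Otimes>\<^sub>M embed_measure \<rho> u) (msp (X j) \<Otimes>\<^sub>M \<rho>)"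
        by (intro measurable_Pair measurable_fst measurable_compose[OF measurable_snd iu])
      from measurable_compose[OF this fm[OF that]] show ?thesis by (simp add: embed_ipd_def case_prod_beta')
    qed
    show "(\<lambda>\<omega>. embed_ipd u f j (\<omega>, s)) \<in> Linf (X j)" if "a \<le> j" "j \<le> b" "s \<in> space (embed_measure \<rho> u)" for j s
      using that fL u by (auto simp: space_embed_measure embed_ipd_def)
    show "integrable (embed_measure \<rho> u) (\<lambda>s. g (inv u s))"
      using has_bochner_integral_embed_measure[OF u has_bochner_integral_integrable[OF g(1)]]
      by (rule integrable.intros)
    show "AE s in embed_measure \<rho> u. (\<Prod>j=a..b. Linf_norm (X j) (\<lambda>\<omega>. embed_ipd u f j (\<omega>, s))) \<le> g (inv u s)"
      unfolding AE_embed_measure[OF u] using g(2) u by (simp add: embed_ipd_def)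
    interpret T: pvm_space "tensor_pvms {a..b} X" using ab pvm by (intro pvm_space_tensor(1)) auto
    show "pvm_AE (tensor_pvms {a..b} X) (\<lambda>\<omega>. has_bochner_integral (embed_measure \<rho> u) (\<lambda>s. \<Prod>j=a..b. embed_ipd u f j (\<omega> j, s)) (\<phi> \<omega>))"
      by (rule T.pvm_AE_mp[OF is_ipd_AE[OF d]]) (use has_bochner_integral_embed_measure[OF u] in \<open>simp add: embed_ipd_def\<close>)
  qed
qed

subsection \<open>Disjoint sums of measures\<close>

text \<open>Carries two decompositions side by side. Integrals over it add, so adding functions
  amounts to joining their parameter spaces.\<close>

definition sum_measure :: "'s measure \<Rightarrow> 't measure \<Rightarrow> ('s + 't) measure" where
  "sum_measure M N = measure_of (space M <+> space N)
     {A. A \<subseteq> space M <+> space N \<and> Inl -` A \<in> sets M \<and> Inr -` A \<in> sets N}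
     (\<lambda>A. emeasure M (Inl -` A) + emeasure N (Inr -` A))"

lemma sum_measure_sigma_algebra:
  "sigma_algebra (space M <+> space N) {A. A \<subseteq> space M <+> space N \<and> Inl -` A \<in> sets M \<and> Inr -` A \<in> sets N}"
proof -
  have v: "Inl -` (A <+> B) = A" "Inr -` (A <+> B) = B" for A :: "'a set" and B :: "'b set" by auto
  show ?thesis
    unfolding sigma_algebra_iff2 by (auto simp: vimage_Diff vimage_UN v)
qed

lemma space_sum_measure: "space (sum_measure M N) = space M <+> space N"
  unfolding sum_measure_def by (intro space_measure_of) auto

lemma sets_sum_measure:
  "sets (sum_measure M N) = {A. A \<subseteq> space M <+> space N \<and> Inl -` A \<in> sets M \<and> Inr -` A \<in> sets N}"
  unfolding sum_measure_def using sigma_algebra.sets_measure_of_eq[OF sum_measure_sigma_algebra] .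

lemma emeasure_sum_measure:
  assumes "A \<in> sets (sum_measure M N)"
  shows "emeasure (sum_measure M N) A = emeasure M (Inl -` A) + emeasure N (Inr -` A)"
  unfolding sum_measure_def
proof (rule emeasure_measure_of_sigma[OF sum_measure_sigma_algebra])
  let ?S = "{A. A \<subseteq> space M <+> space N \<and> Inl -` A \<in> sets M \<and> Inr -` A \<in> sets N}"
  show "positive ?S (\<lambda>A. emeasure M (Inl -` A) + emeasure N (Inr -` A))" by (simp add: positive_def)
  show "countably_additive ?S (\<lambda>A. emeasure M (Inl -` A) + emeasure N (Inr -` A))"
    unfolding countably_additive_def
  proof (intro allI impI)
    fix A :: "nat \<Rightarrow> _" assume A: "range A \<subseteq> ?S" "disjoint_family A"
    have "disjoint_family (\<lambda>n. Inl -` A n)" "disjoint_family (\<lambda>n. Inr -` A n)"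
      using A(2) by (auto simp: disjoint_family_on_def simp flip: vimage_Int)
    then have "(\<Sum>n. emeasure M (Inl -` A n)) = emeasure M (\<Union>n. Inl -` A n)"
      "(\<Sum>n. emeasure N (Inr -` A n)) = emeasure N (\<Union>n. Inr -` A n)"
      using A(1) by (auto intro!: suminf_emeasure)
    then show "(\<Sum>n. emeasure M (Inl -` A n) + emeasure N (Inr -` A n)) = emeasure M (Inl -` (\<Union>n. A n)) + emeasure N (Inr -` (\<Union>n. A n))"
      by (subst suminf_add[symmetric]) (auto simp: vimage_UN)
  qed
  show "A \<in> ?S" using assms by (simp add: sets_sum_measure)
qed

lemma Plus_vimage: "Inl -` (A <+> B) = A" "Inr -` (A <+> B) = B"
  by auto

lemma Plus_in_sum_measure: "\<lbrakk>A \<in> sets M; B \<in> sets N\<rbrakk> \<Longrightarrow> A <+> B \<in> sets (sum_measure M N)"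
  using sets.sets_into_space[of A M] sets.sets_into_space[of B N] by (auto simp: sets_sum_measure Plus_vimage)

lemma emeasure_Plus: "\<lbrakk>A \<in> sets M; B \<in> sets N\<rbrakk> \<Longrightarrow> emeasure (sum_measure M N) (A <+> B) = emeasure M A + emeasure N B"
  by (simp add: emeasure_sum_measure Plus_in_sum_measure Plus_vimage)

lemma measurable_Inl: "Inl \<in> measurable M (sum_measure M N)"
  by (rule measurableI) (auto simp: space_sum_measure sets_sum_measure)

lemma measurable_Inr: "Inr \<in> measurable N (sum_measure M N)"
  by (rule measurableI) (auto simp: space_sum_measure sets_sum_measure)

lemma measurable_case_sum:
  assumes "F \<in> measurable M K" "G \<in> measurable N K"
  shows "case_sum F G \<in> measurable (sum_measure M N) K"
proof (rule measurableI)
  show "case_sum F G t \<in> space K" if "t \<in> space (sum_measure M N)" for t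
    using that measurable_space[OF assms(1)] measurable_space[OF assms(2)] by (auto simp: space_sum_measure)
  fix A assume A: "A \<in> sets K"
  have "case_sum F G -` A \<inter> space (sum_measure M N) = (F -` A \<inter> space M) <+> (G -` A \<inter> space N)"
    by (auto simp: space_sum_measure)
  then show "case_sum F G -` A \<inter> space (sum_measure M N) \<in> sets (sum_measure M N)"
    using A assms by (auto intro!: Plus_in_sum_measure measurable_sets)
qed

lemma sigma_finite_sum_measure:
  assumes "sigma_finite_measure M" "sigma_finite_measure N"
  shows "sigma_finite_measure (sum_measure M N)"
proof -
  obtain A where A: "countable A" "A \<subseteq> sets M" "\<Union>A = space M" "\<forall>a\<in>A. emeasure M a \<noteq> \<infinity>"
    using sigma_finite_measure.sigma_finite_countable[OF assms(1)] by metis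
  obtain B where B: "countable B" "B \<subseteq> sets N" "\<Union>B = space N" "\<forall>a\<in>B. emeasure N a \<noteq> \<infinity>"
    using sigma_finite_measure.sigma_finite_countable[OF assms(2)] by metis
  let ?C = "(\<lambda>a. a <+> {}) ` A \<union> (\<lambda>b. {} <+> b) ` B"
  show ?thesis
  proof (rule sigma_finite_measure.intro, intro exI[of _ ?C] conjI ballI)
    show "countable ?C" using A(1) B(1) by auto
    show "?C \<subseteq> sets (sum_measure M N)" using A(2) B(2) by (auto intro!: Plus_in_sum_measure)
    show "\<Union>?C = space (sum_measure M N)" unfolding space_sum_measure A(3)[symmetric] B(3)[symmetric] by auto
    show "emeasure (sum_measure M N) c \<noteq> \<infinity>" if "c \<in> ?C" for c
      using that A(2,4) B(2,4) by (auto simp: emeasure_Plus subset_iff)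
  qed
qed

lemma AE_sum_measure:
  assumes "AE s in M. p (Inl s)" "AE t in N. p (Inr t)"
  shows "AE x in sum_measure M N. p x"
proof -
  obtain A where A: "{s\<in>space M. \<not> p (Inl s)} \<subseteq> A" "A \<in> sets M" "emeasure M A = 0" using assms(1) by (rule AE_E)
  obtain B where B: "{s\<in>space N. \<not> p (Inr s)} \<subseteq> B" "B \<in> sets N" "emeasure N B = 0" using assms(2) by (rule AE_E)
  have "A <+> B \<in> null_sets (sum_measure M N)"
    using A B by (simp add: null_sets_def emeasure_Plus Plus_in_sum_measure)
  then show ?thesis using A(1) B(1) by (intro AE_I'[of "A <+> B"]) (auto simp: space_sum_measure)
qed

text \<open>Serves both summands: by \<open>e\<close>, the restriction of \<open>S\<close> to
  \<open>L\<close> is the image of \<open>M\<close> under \<open>T\<close>, so the integral is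
  computed once as a density and once as an image measure.\<close>

lemma has_bochner_integral_part:
  fixes F :: "'s \<Rightarrow> 'v::{banach, second_countable_topology}"
  assumes T: "T \<in> measurable M S" and L: "L \<in> sets S"
    and e: "\<And>A. A \<in> sets S \<Longrightarrow> emeasure S (L \<inter> A) = emeasure M (T -` A \<inter> space M)"
    and F: "F \<in> borel_measurable S" "has_bochner_integral M (\<lambda>s. F (T s)) z"
  shows "has_bochner_integral S (\<lambda>x. indicator L x *\<^sub>R F x) z"
proof -
  have il: "(\<lambda>x. indicator L x :: real) \<in> borel_measurable S" using L by simp
  have eq: "density S (\<lambda>x. ennreal (indicator L x)) = distr M S T"
  proof (rule measure_eqI)
    fix A assume "A \<in> sets (density S (\<lambda>x. ennreal (indicator L x)))"
    then have A: "A \<in> sets S" by simp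
    have "emeasure (density S (\<lambda>x. ennreal (indicator L x))) A = (\<integral>\<^sup>+x. ennreal (indicator L x) * indicator A x \<partial>S)"
      using A L by (intro emeasure_density) auto
    also have "\<dots> = (\<integral>\<^sup>+x. indicator (L \<inter> A) x \<partial>S)" by (intro nn_integral_cong) (auto simp: indicator_def)
    also have "\<dots> = emeasure S (L \<inter> A)" using A L by (intro nn_integral_indicator) auto
    finally show "emeasure (density S (\<lambda>x. ennreal (indicator L x))) A = emeasure (distr M S T) A"
      using A T by (simp add: e emeasure_distr)
  qed simp
  have nn: "AE x in S. 0 \<le> (indicator L x :: real)" by simp
  have "integrable S (\<lambda>x. indicator L x *\<^sub>R F x)"
    using integrable_density[OF F(1) il nn] integrable_distr_eq[OF T F(1)] F(2) unfolding eq has_bochner_integral_iff by simp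
  moreover have "(LINT x|S. indicator L x *\<^sub>R F x) = z"
    using integral_density[OF F(1) il nn] integral_distr[OF T F(1)] F(2) unfolding eq has_bochner_integral_iff by simp
  ultimately show ?thesis by (simp add: has_bochner_integral_iff)
qed

lemma has_bochner_integral_sum_measure:
  fixes F :: "'s \<Rightarrow> 'v::{banach, second_countable_topology}" and G :: "'t \<Rightarrow> 'v"
  assumes F: "has_bochner_integral M F y" and G: "has_bochner_integral N G z"
  shows "has_bochner_integral (sum_measure M N) (case_sum F G) (y + z)"
proof -
  let ?S = "sum_measure M N"
  have Fm: "F \<in> borel_measurable M" "G \<in> borel_measurable N"
    using F G by (auto simp: has_bochner_integral_iff borel_measurable_integrable)
  have m: "case_sum F G \<in> borel_measurable ?S" using Fm by (rule measurable_case_sum)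
  have L: "space M <+> {} \<in> sets ?S" "{} <+> space N \<in> sets ?S" by (auto intro!: Plus_in_sum_measure)
  have 1: "has_bochner_integral ?S (\<lambda>x. indicator (space M <+> {}) x *\<^sub>R case_sum F G x) y"
  proof (rule has_bochner_integral_part[OF measurable_Inl L(1) _ m])
    fix A assume A: "A \<in> sets ?S"
    then have "(space M <+> {}) \<inter> A \<in> sets ?S" using L by blast
    moreover have "Inl -` ((space M <+> {}) \<inter> A) = Inl -` A \<inter> space M" "Inr -` ((space M <+> ({} :: 't set)) \<inter> A) = {}" by auto
    ultimately show "emeasure ?S ((space M <+> {}) \<inter> A) = emeasure M (Inl -` A \<inter> space M)"
      by (simp add: emeasure_sum_measure)
  qed (use F in simp)
  have 2: "has_bochner_integral ?S (\<lambda>x. indicator ({} <+> space N) x *\<^sub>R case_sum F G x) z"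
  proof (rule has_bochner_integral_part[OF measurable_Inr L(2) _ m])
    fix A assume A: "A \<in> sets ?S"
    then have "({} <+> space N) \<inter> A \<in> sets ?S" using L by blast
    moreover have "Inr -` (({} <+> space N) \<inter> A) = Inr -` A \<inter> space N" "Inl -` ((({} :: 's set) <+> space N) \<inter> A) = {}" by auto
    ultimately show "emeasure ?S (({} <+> space N) \<inter> A) = emeasure N (Inr -` A \<inter> space N)"
      by (simp add: emeasure_sum_measure)
  qed (use G in simp)
  have "has_bochner_integral ?S (\<lambda>x. indicator (space M <+> {}) x *\<^sub>R case_sum F G x + indicator ({} <+> space N) x *\<^sub>R case_sum F G x) (y + z)"
    using 1 2 by (rule has_bochner_integral_add)
  then show ?thesis
    by (rule has_bochner_integral_cong[THEN iffD1, rotated -1]) (auto simp: space_sum_measure indicator_def)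
qed

text \<open>The projection is meaningful only on left summands, hence the restricted source.\<close>

lemma measurable_projl_part:
  "(\<lambda>x. (fst x, projl (snd x))) \<in> measurable (restrict_space (K \<Otimes>\<^sub>M sum_measure M N) {x. isl (snd x)}) (K \<Otimes>\<^sub>M M)"
proof (rule measurable_Pair)
  let ?R = "restrict_space (K \<Otimes>\<^sub>M sum_measure M N) {x. isl (snd x)}"
  show "fst \<in> measurable ?R K" by (rule measurable_restrict_space1[OF measurable_fst])
  show "(\<lambda>x. projl (snd x)) \<in> measurable ?R M"
  proof (rule measurableI)
    show "projl (snd x) \<in> space M" if "x \<in> space ?R" for x
      using that by (auto simp: space_restrict_space space_pair_measure space_sum_measure)
    fix A assume A: "A \<in> sets M"
    have "(\<lambda>x. projl (snd x)) -` A \<inter> space ?R = {x. isl (snd x)} \<inter> (space K \<times> (A <+> {}))"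
      using sets.sets_into_space[OF A] by (auto simp: space_restrict_space space_pair_measure space_sum_measure)
    moreover have "space K \<times> (A <+> {}) \<in> sets (K \<Otimes>\<^sub>M sum_measure M N)"
      using A by (intro pair_measureI Plus_in_sum_measure) auto
    ultimately show "(\<lambda>x. projl (snd x)) -` A \<inter> space ?R \<in> sets ?R" by (auto simp: sets_restrict_space)
  qed
qed

lemma measurable_projr_part:
  "(\<lambda>x. (fst x, projr (snd x))) \<in> measurable (restrict_space (K \<Otimes>\<^sub>M sum_measure M N) {x. \<not> isl (snd x)}) (K \<Otimes>\<^sub>M N)"
proof (rule measurable_Pair)
  let ?R = "restrict_space (K \<Otimes>\<^sub>M sum_measure M N) {x. \<not> isl (snd x)}"
  show "fst \<in> measurable ?R K" by (rule measurable_restrict_space1[OF measurable_fst])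
  show "(\<lambda>x. projr (snd x)) \<in> measurable ?R N"
  proof (rule measurableI)
    show "projr (snd x) \<in> space N" if "x \<in> space ?R" for x
      using that by (auto simp: space_restrict_space space_pair_measure space_sum_measure)
    fix A assume A: "A \<in> sets N"
    have "(\<lambda>x. projr (snd x)) -` A \<inter> space ?R = {x. \<not> isl (snd x)} \<inter> (space K \<times> ({} <+> A))"
      using sets.sets_into_space[OF A] by (auto simp: space_restrict_space space_pair_measure space_sum_measure)
    moreover have "space K \<times> ({} <+> A) \<in> sets (K \<Otimes>\<^sub>M sum_measure M N)"
      using A by (intro pair_measureI Plus_in_sum_measure) auto
    ultimately show "(\<lambda>x. projr (snd x)) -` A \<inter> space ?R \<in> sets ?R" by (auto simp: sets_restrict_space)
  qed
qed

text \<open>The product with a disjoint sum is split into its two measurable parts, and on each part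
  the function is a composition with one of the two projections.\<close>

lemma measurable_pair_case_sum:
  assumes F: "F \<in> measurable (K \<Otimes>\<^sub>M M) L" and G: "G \<in> measurable (K \<Otimes>\<^sub>M N) L"
  shows "(\<lambda>(\<omega>, t). case t of Inl s \<Rightarrow> F (\<omega>, s) | Inr s \<Rightarrow> G (\<omega>, s)) \<in> measurable (K \<Otimes>\<^sub>M sum_measure M N) L"
proof -
  have eq: "(\<lambda>(\<omega>, t). case t of Inl s \<Rightarrow> F (\<omega>, s) | Inr s \<Rightarrow> G (\<omega>, s)) =
      (\<lambda>x. if isl (snd x) then F (fst x, projl (snd x)) else G (fst x, projr (snd x)))"
    by (auto simp: fun_eq_iff split: sum.splits)
  have "{x \<in> space (K \<Otimes>\<^sub>M sum_measure M N). isl (snd x)} = space K \<times> (space M <+> {})"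
    by (auto simp: space_pair_measure space_sum_measure)
  then have "{x \<in> space (K \<Otimes>\<^sub>M sum_measure M N). isl (snd x)} \<in> sets (K \<Otimes>\<^sub>M sum_measure M N)"
    by (simp add: pair_measureI Plus_in_sum_measure)
  then show ?thesis
    unfolding eq measurable_If_restrict_space_iff[OF \<open>_ \<in> sets _\<close>]
    using measurable_compose[OF measurable_projl_part F] measurable_compose[OF measurable_projr_part G] by blast
qed

definition sum_ipd :: "(nat \<Rightarrow> 'w \<times> 's \<Rightarrow> complex) \<Rightarrow> (nat \<Rightarrow> 'w \<times> 't \<Rightarrow> complex) \<Rightarrow> nat \<Rightarrow> 'w \<times> ('s + 't) \<Rightarrow> complex" where
  "sum_ipd f g j = (\<lambda>(\<omega>, t). case t of Inl s \<Rightarrow> f j (\<omega>, s) | Inr s \<Rightarrow> g j (\<omega>, s))"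

lemma is_ipd_sum:
  fixes X :: "nat \<Rightarrow> ('w, 'h::complex_vector) pvms"
  assumes d1: "is_ipd a b X \<phi> \<rho> f" and d2: "is_ipd a b X \<psi> \<rho>' f'"
    and ab: "a \<le> b" and pvm: "\<And>j. \<lbrakk>a \<le> j; j \<le> b\<rbrakk> \<Longrightarrow> pvm_space (X j)"
  shows "is_ipd a b X (\<lambda>\<omega>. \<phi> \<omega> + \<psi> \<omega>) (sum_measure \<rho> \<rho>') (sum_ipd f f')"
proof -
  obtain g where g: "integrable \<rho> g" "AE \<sigma> in \<rho>. (\<Prod>j=a..b. Linf_norm (X j) (\<lambda>\<omega>. f j (\<omega>, \<sigma>))) \<le> g \<sigma>"
    by (rule is_ipd_dominated[OF d1])
  obtain g' where g': "integrable \<rho>' g'" "AE \<sigma> in \<rho>'. (\<Prod>j=a..b. Linf_norm (X j) (\<lambda>\<omega>. f' j (\<omega>, \<sigma>))) \<le> g' \<sigma>"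
    by (rule is_ipd_dominated[OF d2])
  interpret T: pvm_space "tensor_pvms {a..b} X" using ab pvm by (intro pvm_space_tensor(1)) auto
  show ?thesis
  proof (rule is_ipdI)
    show "sigma_finite_measure (sum_measure \<rho> \<rho>')" using d1 d2 by (intro sigma_finite_sum_measure) (auto simp: is_ipd_def)
    show "sum_ipd f f' j \<in> borel_measurable (msp (X j) \<Otimes>\<^sub>M sum_measure \<rho> \<rho>')" if "a \<le> j" "j \<le> b" for j
      unfolding sum_ipd_def using d1 d2 that by (intro measurable_pair_case_sum) (auto simp: is_ipd_def)
    show "(\<lambda>\<omega>. sum_ipd f f' j (\<omega>, \<sigma>)) \<in> Linf (X j)" if "a \<le> j" "j \<le> b" "\<sigma> \<in> space (sum_measure \<rho> \<rho>')" for j \<sigma>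
      using d1 d2 that by (auto simp: sum_ipd_def is_ipd_def space_sum_measure)
    show "integrable (sum_measure \<rho> \<rho>') (case_sum g g')"
      using has_bochner_integral_sum_measure[OF has_bochner_integral_integrable[OF g(1)] has_bochner_integral_integrable[OF g'(1)]]
      by (rule integrable.intros)
    show "AE \<sigma> in sum_measure \<rho> \<rho>'. (\<Prod>j=a..b. Linf_norm (X j) (\<lambda>\<omega>. sum_ipd f f' j (\<omega>, \<sigma>))) \<le> case_sum g g' \<sigma>"
      by (rule AE_sum_measure) (use g(2) g'(2) in \<open>simp_all add: sum_ipd_def\<close>)
    show "pvm_AE (tensor_pvms {a..b} X) (\<lambda>\<omega>. has_bochner_integral (sum_measure \<rho> \<rho>') (\<lambda>\<sigma>. \<Prod>j=a..b. sum_ipd f f' j (\<omega> j, \<sigma>)) (\<phi> \<omega> + \<psi> \<omega>))"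
    proof (rule T.pvm_AE_mp2[OF is_ipd_AE[OF d1] is_ipd_AE[OF d2]])
      fix \<omega> assume "has_bochner_integral \<rho> (\<lambda>\<sigma>. \<Prod>j=a..b. f j (\<omega> j, \<sigma>)) (\<phi> \<omega>)" "has_bochner_integral \<rho>' (\<lambda>\<sigma>. \<Prod>j=a..b. f' j (\<omega> j, \<sigma>)) (\<psi> \<omega>)"
      from has_bochner_integral_sum_measure[OF this]
      show "has_bochner_integral (sum_measure \<rho> \<rho>') (\<lambda>\<sigma>. \<Prod>j=a..b. sum_ipd f f' j (\<omega> j, \<sigma>)) (\<phi> \<omega> + \<psi> \<omega>)"
        by (rule has_bochner_integral_cong[THEN iffD1, rotated -1]) (auto simp: sum_ipd_def split: sum.splits)
    qed
  qed
qed

lemma ipd_pettis_sum: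
  assumes A: "hilbert_space (hsp (X a))"
    and T: "ipd_pettis a b X \<rho> f B T" and T': "ipd_pettis a b X \<rho>' f' B T'" and Hb: "hilbert_space (hsp (X b))"
  shows "ipd_pettis a b X (sum_measure \<rho> \<rho>') (sum_ipd f f') B (\<lambda>h. T h + T' h)"
proof -
  interpret A: hilbert_space "hsp (X a)" by fact
  interpret Hb: hilbert_space "hsp (X b)" by fact
  have Tb: "bounded_op (hsp (X b)) (hsp (X a)) T" "bounded_op (hsp (X b)) (hsp (X a)) T'"
    and i1: "\<And>h k. \<lbrakk>h \<in> vecs (hsp (X b)); k \<in> vecs (hsp (X a))\<rbrakk> \<Longrightarrow> has_bochner_integral \<rho> (\<lambda>\<sigma>. ip (hsp (X a)) (chain_op a b X f B \<sigma> h) k) (ip (hsp (X a)) (T h) k)"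
    and i2: "\<And>h k. \<lbrakk>h \<in> vecs (hsp (X b)); k \<in> vecs (hsp (X a))\<rbrakk> \<Longrightarrow> has_bochner_integral \<rho>' (\<lambda>\<sigma>. ip (hsp (X a)) (chain_op a b X f' B \<sigma> h) k) (ip (hsp (X a)) (T' h) k)"
    using T T' by (auto simp: ipd_pettis_def is_pettis_integral_def)
  obtain C D where C: "\<forall>x\<in>vecs (hsp (X b)). hnorm (hsp (X a)) (T x) \<le> C * hnorm (hsp (X b)) x"
    and D: "\<forall>x\<in>vecs (hsp (X b)). hnorm (hsp (X a)) (T' x) \<le> D * hnorm (hsp (X b)) x"
    using Tb by (auto simp: bounded_op_def)
  have "bounded_op (hsp (X b)) (hsp (X a)) (\<lambda>h. T h + T' h)"
    unfolding bounded_op_def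
  proof (intro conjI ballI allI exI[of _ "C + D"])
    fix x assume x: "x \<in> vecs (hsp (X b))"
    note m = bounded_op_mem[OF Tb(1) x] bounded_op_mem[OF Tb(2) x]
    show "T x + T' x \<in> vecs (hsp (X a))" using m by (rule A.add_mem)
    show "T (x + y) + T' (x + y) = T x + T' x + (T y + T' y)" if "y \<in> vecs (hsp (X b))" for y
      using bounded_op_add[OF Tb(1) x that] bounded_op_add[OF Tb(2) x that] by simp
    show "T (c *\<^sub>C x) + T' (c *\<^sub>C x) = c *\<^sub>C (T x + T' x)" for c
      using bounded_op_scaleC[OF Tb(1) x] bounded_op_scaleC[OF Tb(2) x] by (simp add: scaleC_add_right)
    show "hnorm (hsp (X a)) (T x + T' x) \<le> (C + D) * hnorm (hsp (X b)) x"
      using A.hnorm_triangle[OF m] bspec[OF C x] bspec[OF D x] by (simp add: distrib_right)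
  qed
  moreover have "has_bochner_integral (sum_measure \<rho> \<rho>') (\<lambda>\<sigma>. ip (hsp (X a)) (chain_op a b X (sum_ipd f f') B \<sigma> h) k) (ip (hsp (X a)) (T h + T' h) k)"
    if h: "h \<in> vecs (hsp (X b))" and k: "k \<in> vecs (hsp (X a))" for h k
  proof -
    have eq: "ip (hsp (X a)) (T h + T' h) k = ip (hsp (X a)) (T h) k + ip (hsp (X a)) (T' h) k"
      using bounded_op_mem[OF Tb(1) h] bounded_op_mem[OF Tb(2) h] k by (rule A.ip_add)
    show ?thesis unfolding eq using has_bochner_integral_sum_measure[OF i1[OF h k] i2[OF h k]]
      by (rule has_bochner_integral_cong[THEN iffD1, rotated -1]) (auto simp: chain_op_def sum_ipd_def split: sum.splits)
  qed
  ultimately show ?thesis by (simp add: ipd_pettis_def is_pettis_integral_def)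
qed

text \<open>Only the factor of index \<open>a\<close> is scaled, so that the product picks up
  \<open>c\<close> exactly once.\<close>

definition scale_ipd :: "nat \<Rightarrow> complex \<Rightarrow> (nat \<Rightarrow> 'w \<times> 's \<Rightarrow> complex) \<Rightarrow> nat \<Rightarrow> 'w \<times> 's \<Rightarrow> complex" where
  "scale_ipd a c f j t = (if j = a then c * f j t else f j t)"

lemma prod_scale_first:
  fixes F :: "nat \<Rightarrow> 'c::comm_monoid_mult"
  assumes "a \<le> b"
  shows "(\<Prod>j=a..b. if j = a then c * F j else F j) = c * (\<Prod>j=a..b. F j)"
proof -
  have "(\<Prod>j=Suc a..b. if j = a then c * F j else F j) = (\<Prod>j=Suc a..b. F j)" by (intro prod.cong) auto
  then show ?thesis using assms by (simp add: prod.atLeast_Suc_atMost mult.assoc)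
qed

lemma is_ipd_scale:
  fixes X :: "nat \<Rightarrow> ('w, 'h::complex_vector) pvms"
  assumes d: "is_ipd a b X \<phi> \<rho> f"
    and ab: "a \<le> b" and pvm: "\<And>j. \<lbrakk>a \<le> j; j \<le> b\<rbrakk> \<Longrightarrow> pvm_space (X j)"
  shows "is_ipd a b X (\<lambda>\<omega>. c * \<phi> \<omega>) \<rho> (scale_ipd a c f)"
proof -
  obtain g where g: "integrable \<rho> g" "AE \<sigma> in \<rho>. (\<Prod>j=a..b. Linf_norm (X j) (\<lambda>\<omega>. f j (\<omega>, \<sigma>))) \<le> g \<sigma>"
    by (rule is_ipd_dominated[OF d])
  have fm: "f j \<in> borel_measurable (msp (X j) \<Otimes>\<^sub>M \<rho>)" if "a \<le> j" "j \<le> b" for j using d that by (simp add: is_ipd_def)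
  have sec: "(\<lambda>\<omega>. f j (\<omega>, \<sigma>)) \<in> Linf_meas (X j)" if "a \<le> j" "j \<le> b" "\<sigma> \<in> space \<rho>" for j \<sigma>
    using d that measurable_compose[OF measurable_Pair2' fm] by (simp add: Linf_meas_def is_ipd_def)
  interpret T: pvm_space "tensor_pvms {a..b} X" using ab pvm by (intro pvm_space_tensor(1)) auto
  show ?thesis
  proof (rule is_ipdI)
    show "sigma_finite_measure \<rho>" using d by (simp add: is_ipd_def)
    show "scale_ipd a c f j \<in> borel_measurable (msp (X j) \<Otimes>\<^sub>M \<rho>)" if "a \<le> j" "j \<le> b" for j
      using fm[OF that] by (cases "j = a") (auto simp: scale_ipd_def[abs_def])
    show "(\<lambda>\<omega>. scale_ipd a c f j (\<omega>, \<sigma>)) \<in> Linf (X j)" if "a \<le> j" "j \<le> b" "\<sigma> \<in> space \<rho>" for j \<sigma>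
    proof (cases "j = a")
      case True
      have "(\<lambda>\<omega>. c * f j (\<omega>, \<sigma>)) \<in> Linf_meas (X j)"
        using pvm_space.Linf_meas_mult(1)[OF pvm pvm_space.Linf_meas_const[OF pvm] sec] that by blast
      then show ?thesis using True by (simp add: scale_ipd_def Linf_meas_def)
    qed (use sec[OF that] in \<open>simp add: scale_ipd_def Linf_meas_def\<close>)
    show "integrable \<rho> (\<lambda>\<sigma>. cmod c * g \<sigma>)" using g(1) by simp
    show "AE \<sigma> in \<rho>. (\<Prod>j=a..b. Linf_norm (X j) (\<lambda>\<omega>. scale_ipd a c f j (\<omega>, \<sigma>))) \<le> cmod c * g \<sigma>"
      using g(2) AE_space
    proof eventually_elim
      case (elim \<sigma>)
      have "(\<Prod>j=a..b. Linf_norm (X j) (\<lambda>\<omega>. scale_ipd a c f j (\<omega>, \<sigma>)))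
          \<le> (\<Prod>j=a..b. if j = a then cmod c * Linf_norm (X j) (\<lambda>\<omega>. f j (\<omega>, \<sigma>)) else Linf_norm (X j) (\<lambda>\<omega>. f j (\<omega>, \<sigma>)))"
      proof (rule prod_mono)
        fix j assume "j \<in> {a..b}"
        then have j: "a \<le> j" "j \<le> b" by auto
        interpret pvm_space "X j" using pvm j by simp
        note s = sec[OF j elim(2)]
        have "Linf_norm (X j) (\<lambda>\<omega>. c * f j (\<omega>, \<sigma>)) \<le> Linf_norm (X j) (\<lambda>_. c) * Linf_norm (X j) (\<lambda>\<omega>. f j (\<omega>, \<sigma>))"
          using Linf_meas_mult(2)[OF Linf_meas_const s] .
        also have "\<dots> \<le> cmod c * Linf_norm (X j) (\<lambda>\<omega>. f j (\<omega>, \<sigma>))"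
          using Linf_norm_const Linf_norm_nonneg[OF s] by (rule mult_right_mono)
        finally show "0 \<le> Linf_norm (X j) (\<lambda>\<omega>. scale_ipd a c f j (\<omega>, \<sigma>)) \<and> Linf_norm (X j) (\<lambda>\<omega>. scale_ipd a c f j (\<omega>, \<sigma>))
          \<le> (if j = a then cmod c * Linf_norm (X j) (\<lambda>\<omega>. f j (\<omega>, \<sigma>)) else Linf_norm (X j) (\<lambda>\<omega>. f j (\<omega>, \<sigma>)))"
          using Linf_norm_nonneg[OF s] Linf_norm_nonneg[OF Linf_meas_mult(1)[OF Linf_meas_const s, of c]]
          by (cases "j = a") (simp_all add: scale_ipd_def)
      qed
      also have "\<dots> = cmod c * (\<Prod>j=a..b. Linf_norm (X j) (\<lambda>\<omega>. f j (\<omega>, \<sigma>)))" using ab by (rule prod_scale_first)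
      also have "\<dots> \<le> cmod c * g \<sigma>" using elim(1) by (intro mult_left_mono) auto
      finally show ?case .
    qed
    show "pvm_AE (tensor_pvms {a..b} X) (\<lambda>\<omega>. has_bochner_integral \<rho> (\<lambda>\<sigma>. \<Prod>j=a..b. scale_ipd a c f j (\<omega> j, \<sigma>)) (c * \<phi> \<omega>))"
      by (rule T.pvm_AE_mp[OF is_ipd_AE[OF d]])
        (simp add: scale_ipd_def prod_scale_first[OF ab] has_bochner_integral_mult_right)
  qed
qed

lemma op_chain_bounded:
  assumes "\<And>j. \<lbrakk>a \<le> j; j \<le> a + n\<rbrakk> \<Longrightarrow> bounded_op (H j) (H j) (A j)"
    "\<And>j. \<lbrakk>a \<le> j; j < a + n\<rbrakk> \<Longrightarrow> bounded_op (H (Suc j)) (H j) (B j)"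
    "\<And>j. \<lbrakk>a \<le> j; j \<le> a + n\<rbrakk> \<Longrightarrow> hilbert_space (H j)"
  shows "bounded_op (H (a + n)) (H a) (op_chain A B a n)"
  using assms
proof (induction n)
  case (Suc n)
  have 1: "bounded_op (H (a + n)) (H a) (op_chain A B a n)" using Suc.prems by (intro Suc.IH) auto
  have A: "bounded_op (H (Suc (a + n))) (H (Suc (a + n))) (A (Suc (a + n)))"
    and B: "bounded_op (H (Suc (a + n))) (H (a + n)) (B (a + n))"
    and H: "hilbert_space (H (a + n))" "hilbert_space (H (Suc (a + n)))" using Suc.prems by auto
  have "bounded_op (H (Suc (a + n))) (H (a + n)) (\<lambda>x. B (a + n) (A (Suc (a + n)) x))"
    using A B H(2,2) by (rule bounded_op_comp)
  from bounded_op_comp[OF this 1 H(2,1)] show ?case by (simp add: comp_def)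
qed simp

lemma op_chain_cong:
  assumes "\<And>j. \<lbrakk>a \<le> j; j \<le> a + n\<rbrakk> \<Longrightarrow> A j = A' j" "\<And>j. \<lbrakk>a \<le> j; j < a + n\<rbrakk> \<Longrightarrow> B j = B' j"
  shows "op_chain A B a n = op_chain A' B' a n"
  using assms by (induction n) simp_all

lemma chain_op_cong:
  assumes "a \<le> b" "\<And>j \<omega>. \<lbrakk>a \<le> j; j \<le> b\<rbrakk> \<Longrightarrow> f j (\<omega>, \<sigma>) = f' j (\<omega>, \<sigma>')" "\<And>j. \<lbrakk>a \<le> j; j < b\<rbrakk> \<Longrightarrow> B j = B' j"
  shows "chain_op a b X f B \<sigma> = chain_op a b X f' B' \<sigma>'"
  unfolding chain_op_def using assms by (intro op_chain_cong) auto

text \<open>The scalar sits in the leftmost operator of the chain and comes out by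
  \<open>pvm_int_cmult\<close>. A chain with one slot has no tail and is treated apart.\<close>

lemma ipd_pettis_scale:
  fixes X :: "nat \<Rightarrow> ('w, 'h::complex_vector) pvms"
  assumes d: "is_ipd a b X \<phi> \<rho> f"
    and ab: "a \<le> b" and pvm: "\<And>j. \<lbrakk>a \<le> j; j \<le> b\<rbrakk> \<Longrightarrow> pvm_space (X j)" and B: "B \<in> op_args a b X"
    and T: "ipd_pettis a b X \<rho> f B T"
  shows "ipd_pettis a b X \<rho> (scale_ipd a c f) B (\<lambda>h. c *\<^sub>C T h)"
proof -
  have hs: "hilbert_space (hsp (X j))" if "a \<le> j" "j \<le> b" for j using pvm[OF that] by (simp add: pvm_space_def)
  interpret A: hilbert_space "hsp (X a)" using hs ab by simp
  interpret Xa: pvm_space "X a" using pvm ab by simp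
  have fm: "f j \<in> borel_measurable (msp (X j) \<Otimes>\<^sub>M \<rho>)" if "a \<le> j" "j \<le> b" for j using d that by (simp add: is_ipd_def)
  have sec: "(\<lambda>\<omega>. f j (\<omega>, \<sigma>)) \<in> Linf_meas (X j)" if "a \<le> j" "j \<le> b" "\<sigma> \<in> space \<rho>" for j \<sigma>
    using d that measurable_compose[OF measurable_Pair2' fm] by (simp add: Linf_meas_def is_ipd_def)
  have Pb: "bounded_op (hsp (X j)) (hsp (X j)) (pvm_int (X j) (\<lambda>\<omega>. f j (\<omega>, \<sigma>)))" if "a \<le> j" "j \<le> b" "\<sigma> \<in> space \<rho>" for j \<sigma>
    using pvm_space.pvm_int_char(1)[OF pvm] sec that by (auto simp: Linf_meas_def)
  have Bb: "bounded_op (hsp (X (Suc j))) (hsp (X j)) (B j)" if "a \<le> j" "j < b" for j using B that by (simp add: op_args_def)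
  have sc: "pvm_int (X a) (\<lambda>\<omega>. scale_ipd a c f a (\<omega>, \<sigma>)) y = c *\<^sub>C pvm_int (X a) (\<lambda>\<omega>. f a (\<omega>, \<sigma>)) y"
    if "y \<in> vecs (hsp (X a))" "\<sigma> \<in> space \<rho>" for y \<sigma>
    unfolding scale_ipd_def using Xa.pvm_int_cmult[OF sec[OF order_refl ab that(2)] that(1), of c] by simp
  have ch: "chain_op a b X (scale_ipd a c f) B \<sigma> h = c *\<^sub>C chain_op a b X f B \<sigma> h"
    if h: "h \<in> vecs (hsp (X b))" and s: "\<sigma> \<in> space \<rho>" for h \<sigma>
  proof (cases "b - a")
    case 0
    then have "b = a" using ab by simp
    then show ?thesis using sc h s by (simp add: chain_op_def)
  next
    case (Suc n)
    then have b: "b = Suc a + n" by simp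
    let ?A = "\<lambda>j. pvm_int (X j) (\<lambda>\<omega>. f j (\<omega>, \<sigma>))" and ?A' = "\<lambda>j. pvm_int (X j) (\<lambda>\<omega>. scale_ipd a c f j (\<omega>, \<sigma>))"
    have eq: "op_chain ?A' B (Suc a) n = op_chain ?A B (Suc a) n" by (rule op_chain_cong) (auto simp: scale_ipd_def)
    have "bounded_op (hsp (X (Suc a + n))) (hsp (X (Suc a))) (op_chain ?A B (Suc a) n)"
      by (rule op_chain_bounded[where H="\<lambda>j. hsp (X j)"]) (use Pb Bb hs b s in auto)
    then have "op_chain ?A B (Suc a) n h \<in> vecs (hsp (X (Suc a)))" using h b bounded_op_mem by auto
    then have "B a (op_chain ?A B (Suc a) n h) \<in> vecs (hsp (X a))" using bounded_op_mem[OF Bb[of a]] b by simp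
    then show ?thesis unfolding chain_op_def Suc op_chain_Suc_left eq using s by (rule sc)
  qed
  have cm: "chain_op a b X f B \<sigma> h \<in> vecs (hsp (X a))" if "h \<in> vecs (hsp (X b))" "\<sigma> \<in> space \<rho>" for h \<sigma>
  proof -
    have "bounded_op (hsp (X (a + (b - a)))) (hsp (X a)) (chain_op a b X f B \<sigma>)"
      unfolding chain_op_def by (rule op_chain_bounded[where H="\<lambda>j. hsp (X j)"]) (use Pb Bb hs ab that in auto)
    then show ?thesis using ab that bounded_op_mem by auto
  qed
  have Tb: "bounded_op (hsp (X b)) (hsp (X a)) T"
    and i1: "\<And>h k. \<lbrakk>h \<in> vecs (hsp (X b)); k \<in> vecs (hsp (X a))\<rbrakk> \<Longrightarrow> has_bochner_integral \<rho> (\<lambda>\<sigma>. ip (hsp (X a)) (chain_op a b X f B \<sigma> h) k) (ip (hsp (X a)) (T h) k)"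
    using T by (auto simp: ipd_pettis_def is_pettis_integral_def)
  obtain C where C: "\<forall>x\<in>vecs (hsp (X b)). hnorm (hsp (X a)) (T x) \<le> C * hnorm (hsp (X b)) x"
    using Tb by (auto simp: bounded_op_def)
  have "bounded_op (hsp (X b)) (hsp (X a)) (\<lambda>h. c *\<^sub>C T h)"
    unfolding bounded_op_def
  proof (intro conjI ballI allI exI[of _ "cmod c * C"])
    fix x assume x: "x \<in> vecs (hsp (X b))"
    note m = bounded_op_mem[OF Tb x]
    show "c *\<^sub>C T x \<in> vecs (hsp (X a))" using m by (rule A.scaleC_mem)
    show "c *\<^sub>C T (x + y) = c *\<^sub>C T x + c *\<^sub>C T y" if "y \<in> vecs (hsp (X b))" for y
      using bounded_op_add[OF Tb x that] by (simp add: scaleC_add_right)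
    show "c *\<^sub>C T (d *\<^sub>C x) = d *\<^sub>C c *\<^sub>C T x" for d
      using bounded_op_scaleC[OF Tb x] by (simp add: scaleC_scaleC mult.commute)
    show "hnorm (hsp (X a)) (c *\<^sub>C T x) \<le> cmod c * C * hnorm (hsp (X b)) x"
      using mult_left_mono[OF bspec[OF C x], of "cmod c"] by (simp add: A.hnorm_scaleC[OF m] mult.assoc)
  qed
  moreover have "has_bochner_integral \<rho> (\<lambda>\<sigma>. ip (hsp (X a)) (chain_op a b X (scale_ipd a c f) B \<sigma> h) k) (ip (hsp (X a)) (c *\<^sub>C T h) k)"
    if h: "h \<in> vecs (hsp (X b))" and k: "k \<in> vecs (hsp (X a))" for h k
  proof -
    have eq: "ip (hsp (X a)) (c *\<^sub>C T h) k = c * ip (hsp (X a)) (T h) k"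
      using bounded_op_mem[OF Tb h] k by (rule A.ip_scaleC)
    have "has_bochner_integral \<rho> (\<lambda>\<sigma>. c * ip (hsp (X a)) (chain_op a b X f B \<sigma> h) k) (ip (hsp (X a)) (c *\<^sub>C T h) k)"
      unfolding eq using i1[OF h k] by (rule has_bochner_integral_mult_right)
    then show ?thesis
      by (rule has_bochner_integral_cong[THEN iffD1, rotated -1]) (auto simp: ch h A.ip_scaleC cm k)
  qed
  ultimately show ?thesis by (simp add: ipd_pettis_def is_pettis_integral_def)
qed

section \<open>Independence of the decomposition\<close>

text \<open>For \<open>a < b\<close> this opens the \<open>SOME\<close> of \<open>moi\<close>. For
  \<open>a = b\<close>, where \<open>moi\<close> is a spectral integral by convention, a one-point
  parameter space turns it into a Pettis integral too, so that the later arguments need not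
  distinguish the two cases.\<close>

lemma iptp_decomposition:
  fixes X :: "nat \<Rightarrow> ('w, 'h::complex_vector) pvms"
  assumes \<phi>: "\<phi> \<in> iptp TYPE('s) a b X" and ab: "a \<le> b" and pvm: "\<And>j. \<lbrakk>a \<le> j; j \<le> b\<rbrakk> \<Longrightarrow> pvm_space (X j)"
    and B: "B \<in> op_args a b X"
  shows "\<exists>(\<rho> :: 's measure) f. is_ipd a b X \<phi> \<rho> f \<and> ipd_pettis a b X \<rho> f B (moi TYPE('s) a b X \<phi> B)"
proof (cases "a = b")
  case False
  then obtain \<rho> :: "'s measure" and f where d: "is_ipd a b X \<phi> \<rho> f" using \<phi> by (auto simp: iptp_def)
  obtain T where "ipd_pettis a b X \<rho> f B T" using ex_ipd_pettis[OF d ab pvm B] by blast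
  then have "\<exists>T. \<exists>(\<rho> :: 's measure) f. is_ipd a b X \<phi> \<rho> f \<and> ipd_pettis a b X \<rho> f B T" using d by blast
  from someI_ex[OF this] show ?thesis
    using False unfolding moi_def ipd_pettis_def chain_op_def[abs_def] by simp
next
  case True
  interpret pvm_space "X a" using pvm ab by simp
  define \<phi>' where "\<phi>' x = \<phi> (\<lambda>i\<in>{a}. x)" for x
  have L: "\<phi>' \<in> Linf (X a)" using \<phi> True by (simp add: iptp_def \<phi>'_def[abs_def])
  then obtain g where g: "g \<in> bdd_meas (msp (X a))" "pvm_AE (X a) (\<lambda>\<omega>. \<phi>' \<omega> = g \<omega>)" by (auto simp: Linf_def)
  have gL: "g \<in> Linf (X a)" using g(1) by (rule bdd_meas_Linf)
  \<comment> \<open>Types are nonempty; an arbitrary point of \<open>'s\<close> becomes the whole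
    parameter space, with mass 1.\<close>
  obtain s0 :: 's where True by blast
  define \<rho> where "\<rho> = count_space {s0}"
  \<comment> \<open>The bounded measurable \<open>g\<close> is used in place of
    \<open>\<phi>'\<close>, since factors of a decomposition must be measurable and
    \<open>\<phi>'\<close> is so only up to a null set.\<close>
  define f :: "nat \<Rightarrow> 'w \<times> 's \<Rightarrow> complex" where "f j = (\<lambda>(\<omega>, \<sigma>). g \<omega>)" for j
  have hb: "has_bochner_integral \<rho> (\<lambda>\<sigma>. c) c" for c :: complex
    unfolding \<rho>_def has_bochner_integral_iff
    by (simp add: integrable_count_space lebesgue_integral_count_space_finite)
  interpret T: pvm_space "tensor_pvms {a..b} X" using ab pvm by (intro pvm_space_tensor(1)) auto
  have Tm: "msp (tensor_pvms {a..b} X) = (\<Pi>\<^sub>M i\<in>{a..b}. msp (X i))" using ab pvm by (intro pvm_space_tensor(2)) auto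
  have "is_ipd a b X \<phi> \<rho> f"
  proof (rule is_ipdI)
    show "sigma_finite_measure \<rho>" unfolding \<rho>_def by (rule sigma_finite_measure_count_space_finite) simp
    show "f j \<in> borel_measurable (msp (X j) \<Otimes>\<^sub>M \<rho>)" if "a \<le> j" "j \<le> b" for j
    proof -
      have "j = a" using that True by simp
      then show ?thesis unfolding f_def case_prod_beta'
        using measurable_compose[OF measurable_fst bdd_meas_measurable[OF g(1)]] by simp
    qed
    show "(\<lambda>\<omega>. f j (\<omega>, \<sigma>)) \<in> Linf (X j)" if "a \<le> j" "j \<le> b" for j \<sigma>
    proof -
      have "j = a" using that True by simp
      then show ?thesis using gL by (simp add: f_def)
    qed
    show "integrable \<rho> (\<lambda>\<sigma>. \<Prod>j=a..b. Linf_norm (X j) (\<lambda>\<omega>. f j (\<omega>, \<sigma>)))"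
      unfolding \<rho>_def by (simp add: integrable_count_space)
    have "pvm_AE (tensor_pvms {a..b} X) (\<lambda>\<omega>. \<phi>' (\<omega> a) = g (\<omega> a))"
      using tensor_pvm_AE_singleton[where X=X and a=a, OF pvm_space_axioms g(2)] True by simp
    then show "pvm_AE (tensor_pvms {a..b} X) (\<lambda>\<omega>. has_bochner_integral \<rho> (\<lambda>\<sigma>. \<Prod>j=a..b. f j (\<omega> j, \<sigma>)) (\<phi> \<omega>))"
    proof (rule T.pvm_AE_mp)
      fix \<omega> assume w: "\<omega> \<in> space (msp (tensor_pvms {a..b} X))" and eq: "\<phi>' (\<omega> a) = g (\<omega> a)"
      have "\<omega> \<in> extensional {a}" using w True unfolding Tm by (simp add: space_PiM PiE_iff)
      then have "(\<lambda>i\<in>{a}. \<omega> a) = \<omega>" by (auto simp: extensional_def fun_eq_iff)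
      then have "\<phi> \<omega> = g (\<omega> a)" using eq by (simp add: \<phi>'_def)
      then show "has_bochner_integral \<rho> (\<lambda>\<sigma>. \<Prod>j=a..b. f j (\<omega> j, \<sigma>)) (\<phi> \<omega>)" using hb True by (simp add: f_def)
    qed
  qed simp
  moreover have "ipd_pettis a b X \<rho> f B (moi TYPE('s) a b X \<phi> B)"
  proof -
    have m: "moi TYPE('s) a b X \<phi> B = pvm_int (X a) \<phi>'" using True by (simp add: moi_def \<phi>'_def[abs_def])
    have "chain_op a b X f B \<sigma> h = pvm_int (X a) \<phi>' h" if "h \<in> vecs (hsp (X a))" for \<sigma> h
    proof -
      have "pvm_AE (X a) (\<lambda>\<omega>. g \<omega> = \<phi>' \<omega>)" using g(2) by (rule pvm_AE_mp) simp
      then show ?thesis using True pvm_int_cong[OF gL L _ that] by (simp add: chain_op_def f_def)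
    qed
    then show ?thesis
      unfolding ipd_pettis_def is_pettis_integral_def m using pvm_int_char(1)[OF L] hb True by simp
  qed
  ultimately show ?thesis by blast
qed

text \<open>The given decomposition may live on another type \<open>'t\<close>. The decomposition of
  0 formed from it and from one on \<open>'s\<close> lives on the sum of the two types, where
  \<open>ipd_pettis_zero\<close> applies.\<close>

lemma moi_eq:
  fixes X :: "nat \<Rightarrow> ('w, 'h::complex_vector) pvms" and \<rho> :: "'t measure"
  assumes \<phi>: "\<phi> \<in> iptp TYPE('s) a b X" and ab: "a \<le> b" and pvm: "\<And>j. \<lbrakk>a \<le> j; j \<le> b\<rbrakk> \<Longrightarrow> pvm_space (X j)"
    and B: "B \<in> op_args a b X" and d: "is_ipd a b X \<phi> \<rho> f" and T: "ipd_pettis a b X \<rho> f B T"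
    and h: "h \<in> vecs (hsp (X b))"
  shows "moi TYPE('s) a b X \<phi> B h = T h"
proof -
  have hs: "hilbert_space (hsp (X j))" if "a \<le> j" "j \<le> b" for j using pvm[OF that] by (simp add: pvm_space_def)
  obtain \<rho>' :: "'s measure" and f' where d': "is_ipd a b X \<phi> \<rho>' f'"
    and T': "ipd_pettis a b X \<rho>' f' B (moi TYPE('s) a b X \<phi> B)"
    using iptp_decomposition[OF \<phi> ab pvm B] by blast
  have "is_ipd a b X (\<lambda>\<omega>. \<phi> \<omega> + (- 1) * \<phi> \<omega>) (sum_measure \<rho>' \<rho>) (sum_ipd f' (scale_ipd a (- 1) f))"
    using d' is_ipd_scale[OF d ab pvm] ab pvm by (rule is_ipd_sum)
  then have 0: "is_ipd a b X (\<lambda>_. 0) (sum_measure \<rho>' \<rho>) (sum_ipd f' (scale_ipd a (- 1) f))" by simp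
  have "ipd_pettis a b X (sum_measure \<rho>' \<rho>) (sum_ipd f' (scale_ipd a (- 1) f)) B (\<lambda>h. moi TYPE('s) a b X \<phi> B h + (- 1) *\<^sub>C T h)"
    using hs ab by (intro ipd_pettis_sum T' ipd_pettis_scale[OF d ab pvm B T]) auto
  from ipd_pettis_zero[OF 0 ab pvm B this h] show ?thesis by (simp add: scaleC_minus1)
qed

text \<open>Membership asks for a parameter space on \<open>'s\<close> itself, hence the transport
  along \<open>u\<close>.\<close>

lemma iptpI:
  fixes X :: "nat \<Rightarrow> ('w, 'h::complex_vector) pvms" and \<rho> :: "'t measure" and u :: "'t \<Rightarrow> 's"
  assumes "inj u" "a < b" "\<And>j. \<lbrakk>a \<le> j; j \<le> b\<rbrakk> \<Longrightarrow> pvm_space (X j)" "is_ipd a b X \<phi> \<rho> f"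
  shows "\<phi> \<in> iptp TYPE('s) a b X"
  using is_ipd_embed[OF assms(1,4) less_imp_le[OF assms(2)] assms(3)] assms(2) unfolding iptp_def by auto

section \<open>Products of decompositions\<close>

lemma has_bochner_integral_times_pair:
  fixes F :: "'s \<Rightarrow> 'v::{real_normed_field, banach, second_countable_topology}" and G :: "'t \<Rightarrow> 'v"
  assumes M: "sigma_finite_measure M" and N: "sigma_finite_measure N"
    and F: "has_bochner_integral M F y" and G: "has_bochner_integral N G z"
  shows "has_bochner_integral (M \<Otimes>\<^sub>M N) (\<lambda>x. F (fst x) * G (snd x)) (y * z)"
proof -
  interpret M: sigma_finite_measure M by fact
  interpret N: sigma_finite_measure N by fact
  interpret pair_sigma_finite M N ..
  have Fi: "integrable M F" "integral\<^sup>L M F = y" and Gi: "integrable N G" "integral\<^sup>L N G = z"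
    using F G by (auto simp: has_bochner_integral_iff)
  have m: "(\<lambda>x. F (fst x) * G (snd x)) \<in> borel_measurable (M \<Otimes>\<^sub>M N)"
    using Fi(1) Gi(1)
    by (intro borel_measurable_times measurable_compose[OF measurable_fst] measurable_compose[OF measurable_snd] borel_measurable_integrable)
  have i: "integrable (M \<Otimes>\<^sub>M N) (\<lambda>x. F (fst x) * G (snd x))"
  proof (rule Fubini_integrable[OF m])
    show "integrable M (\<lambda>x. LINT y|N. norm (F (fst (x, y)) * G (snd (x, y))))"
      using Fi(1) by (simp add: norm_mult)
    show "AE x in M. integrable N (\<lambda>y. F (fst (x, y)) * G (snd (x, y)))" using Gi(1) by simp
  qed
  have "integral\<^sup>L (M \<Otimes>\<^sub>M N) (\<lambda>x. F (fst x) * G (snd x)) = y * z"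
    using integral_fst'[OF i] Fi(2) Gi(2) by simp
  then show ?thesis using i by (simp add: has_bochner_integral_iff)
qed

section \<open>Decompositions over product parameter spaces\<close>

lemma AE_pair_fst:
  assumes "sigma_finite_measure N" "AE x in M. p x"
  shows "AE x in M \<Otimes>\<^sub>M N. p (fst x)"
proof -
  obtain A where A: "A \<in> null_sets M" "{x\<in>space M. \<not> p x} \<subseteq> A" using assms(2) by (auto simp: eventually_ae_filter)
  show ?thesis
    using A(2) by (intro AE_I'[OF sigma_finite_measure.times_in_null_sets1[OF assms(1) A(1) sets.top]])
      (auto simp: space_pair_measure)
qed

lemma AE_pair_snd:
  assumes "sigma_finite_measure N" "AE x in N. p x"
  shows "AE x in M \<Otimes>\<^sub>M N. p (snd x)"
proof -
  obtain A where A: "A \<in> null_sets N" "{x\<in>space N. \<not> p x} \<subseteq> A" using assms(2) by (auto simp: eventually_ae_filter)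
  show ?thesis
    using A(2) by (intro AE_I'[OF sigma_finite_measure.times_in_null_sets2[OF assms(1) sets.top A(1)]])
      (auto simp: space_pair_measure)
qed

text \<open>Slots outside \<open>I\<close> receive the constant 1, so that families over different
  index intervals can be multiplied slot by slot.\<close>

definition pad_ipd :: "nat set \<Rightarrow> (nat \<Rightarrow> 'w \<times> 's \<Rightarrow> complex) \<Rightarrow> nat \<Rightarrow> 'w \<times> 's \<Rightarrow> complex" where
  "pad_ipd I f j = (if j \<in> I then f j else (\<lambda>_. 1))"

text \<open>With disjoint \<open>I\<close> and \<open>J\<close> this concatenates two
  decompositions, as for (ii). With \<open>J\<close> inside \<open>I\<close> it multiplies the
  factors in the common slots, as for (iii).\<close>

definition times_ipd ::
    "nat set \<Rightarrow> (nat \<Rightarrow> 'w \<times> 's \<Rightarrow> complex) \<Rightarrow> nat set \<Rightarrow> (nat \<Rightarrow> 'w \<times> 't \<Rightarrow> complex) \<Rightarrow> nat \<Rightarrow> 'w \<times> ('s \<times> 't) \<Rightarrow> complex" where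
  "times_ipd I f J g j x = pad_ipd I f j (fst x, fst (snd x)) * pad_ipd J g j (fst x, snd (snd x))"

text \<open>The norm is estimated and not computed, because on a zero Hilbert space the constant 1
  has essential norm 0.\<close>

lemma
  assumes d: "is_ipd a b X \<phi> \<rho> f" and pvm: "pvm_space (X j)"
  shows pad_ipd_measurable: "pad_ipd {a..b} f j \<in> borel_measurable (msp (X j) \<Otimes>\<^sub>M \<rho>)"
    and pad_ipd_Linf: "s \<in> space \<rho> \<Longrightarrow> (\<lambda>\<omega>. pad_ipd {a..b} f j (\<omega>, s)) \<in> Linf_meas (X j)"
    and pad_ipd_norm: "Linf_norm (X j) (\<lambda>\<omega>. pad_ipd {a..b} f j (\<omega>, s)) \<le>
      (if j \<in> {a..b} then Linf_norm (X j) (\<lambda>\<omega>. f j (\<omega>, s)) else 1)"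
proof -
  interpret pvm_space "X j" by fact
  show m: "pad_ipd {a..b} f j \<in> borel_measurable (msp (X j) \<Otimes>\<^sub>M \<rho>)"
    using d by (auto simp: pad_ipd_def is_ipd_def)
  show "Linf_norm (X j) (\<lambda>\<omega>. pad_ipd {a..b} f j (\<omega>, s)) \<le>
      (if j \<in> {a..b} then Linf_norm (X j) (\<lambda>\<omega>. f j (\<omega>, s)) else 1)"
    using Linf_norm_const[of 1] by (auto simp: pad_ipd_def)
  show "(\<lambda>\<omega>. pad_ipd {a..b} f j (\<omega>, s)) \<in> Linf_meas (X j)" if s: "s \<in> space \<rho>"
  proof -
    have "(\<lambda>\<omega>. pad_ipd {a..b} f j (\<omega>, s)) \<in> Linf (X j)"
    proof (cases "j \<in> {a..b}")
      case True
      then show ?thesis using d s by (simp add: pad_ipd_def is_ipd_def)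
    next
      case False
      then show ?thesis using Linf_meas_const[of 1] by (simp only: pad_ipd_def if_False Linf_meas_def Int_iff)
    qed
    then show ?thesis using measurable_compose[OF measurable_Pair2'[OF s] m] by (simp add: Linf_meas_def)
  qed
qed

text \<open>Padding by 1 makes one argument cover disjoint and overlapping intervals: padded
  products reduce to the original ones, essential norms are submultiplicative, and the product of
  the two majorants is integrable on the product space.\<close>

lemma is_ipd_times:
  fixes X :: "nat \<Rightarrow> ('w, 'h::complex_vector) pvms"
  assumes d1: "is_ipd a1 b1 X \<phi> \<rho> f" and d2: "is_ipd a2 b2 X \<psi> \<rho>' g"
    and I1: "a \<le> a1" "a1 \<le> b1" "b1 \<le> b" and I2: "a \<le> a2" "a2 \<le> b2" "b2 \<le> b"
    and pvm: "\<And>j. \<lbrakk>a \<le> j; j \<le> b\<rbrakk> \<Longrightarrow> pvm_space (X j)"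
  shows "is_ipd a b X (\<lambda>\<omega>. \<phi> (restrict \<omega> {a1..b1}) * \<psi> (restrict \<omega> {a2..b2})) (\<rho> \<Otimes>\<^sub>M \<rho>') (times_ipd {a1..b1} f {a2..b2} g)"
proof -
  let ?F = "times_ipd {a1..b1} f {a2..b2} g"
  define f' where "f' = pad_ipd {a1..b1} f"
  define g' where "g' = pad_ipd {a2..b2} g"
  have sf: "sigma_finite_measure \<rho>" "sigma_finite_measure \<rho>'" using d1 d2 by (simp_all add: is_ipd_def)
  obtain u where u: "integrable \<rho> u" "AE \<sigma> in \<rho>. (\<Prod>j=a1..b1. Linf_norm (X j) (\<lambda>\<omega>. f j (\<omega>, \<sigma>))) \<le> u \<sigma>"
    by (rule is_ipd_dominated[OF d1])
  obtain v where v: "integrable \<rho>' v" "AE \<sigma> in \<rho>'. (\<Prod>j=a2..b2. Linf_norm (X j) (\<lambda>\<omega>. g j (\<omega>, \<sigma>))) \<le> v \<sigma>"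
    by (rule is_ipd_dominated[OF d2])
  have F: "?F j (\<omega>, s, t) = f' j (\<omega>, s) * g' j (\<omega>, t)" for j \<omega> s t by (simp add: times_ipd_def f'_def g'_def)
  note fm' = pad_ipd_measurable[OF d1 pvm, folded f'_def] pad_ipd_measurable[OF d2 pvm, folded g'_def]
  note L = pad_ipd_Linf[OF d1 pvm, folded f'_def] pad_ipd_norm[OF d1 pvm, folded f'_def]
  note L' = pad_ipd_Linf[OF d2 pvm, folded g'_def] pad_ipd_norm[OF d2 pvm, folded g'_def]
  have sub: "{a..b} \<inter> {a1..b1} = {a1..b1}" "{a..b} \<inter> {a2..b2} = {a2..b2}" using I1 I2 by auto
  have prod1: "(\<Prod>j=a..b. if j \<in> {a1..b1} then h j else 1) = (\<Prod>j=a1..b1. h j)"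
    and prod2: "(\<Prod>j=a..b. if j \<in> {a2..b2} then h j else 1) = (\<Prod>j=a2..b2. h j)"
    for h :: "nat \<Rightarrow> 'c::comm_monoid_mult"
    using prod.inter_restrict[of "{a..b}" h "{a1..b1}"] prod.inter_restrict[of "{a..b}" h "{a2..b2}"] unfolding sub by simp_all
  interpret T: pvm_space "tensor_pvms {a..b} X" using I1 pvm by (intro pvm_space_tensor(1)) auto
  show ?thesis
  proof (rule is_ipdI)
    show "sigma_finite_measure (\<rho> \<Otimes>\<^sub>M \<rho>')" using sf by (rule sigma_finite_pair_measure)
    show "?F j \<in> borel_measurable (msp (X j) \<Otimes>\<^sub>M (\<rho> \<Otimes>\<^sub>M \<rho>'))" if j: "a \<le> j" "j \<le> b" for j
    proof -
      have p1: "(\<lambda>x. (fst x, fst (snd x))) \<in> measurable (msp (X j) \<Otimes>\<^sub>M (\<rho> \<Otimes>\<^sub>M \<rho>')) (msp (X j) \<Otimes>\<^sub>M \<rho>)"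
        by (intro measurable_Pair measurable_fst measurable_compose[OF measurable_snd measurable_fst])
      have p2: "(\<lambda>x. (fst x, snd (snd x))) \<in> measurable (msp (X j) \<Otimes>\<^sub>M (\<rho> \<Otimes>\<^sub>M \<rho>')) (msp (X j) \<Otimes>\<^sub>M \<rho>')"
        by (intro measurable_Pair measurable_fst measurable_compose[OF measurable_snd measurable_snd])
      show ?thesis unfolding times_ipd_def[abs_def] f'_def[symmetric] g'_def[symmetric]
        using measurable_compose[OF p1 fm'(1)[OF j]] measurable_compose[OF p2 fm'(2)[OF j]] by (rule borel_measurable_times)
    qed
    show "(\<lambda>\<omega>. ?F j (\<omega>, \<sigma>)) \<in> Linf (X j)" if j: "a \<le> j" "j \<le> b" and s: "\<sigma> \<in> space (\<rho> \<Otimes>\<^sub>M \<rho>')" for j \<sigma>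
    proof -
      interpret pvm_space "X j" using pvm j .
      obtain s t where st: "\<sigma> = (s, t)" "s \<in> space \<rho>" "t \<in> space \<rho>'" using s by (auto simp: space_pair_measure)
      show ?thesis using Linf_meas_mult(1)[OF L(1)[OF j st(2)] L'(1)[OF j st(3)]] by (simp add: st(1) F Linf_meas_def)
    qed
    have "has_bochner_integral (\<rho> \<Otimes>\<^sub>M \<rho>') (\<lambda>x. u (fst x) * v (snd x)) (integral\<^sup>L \<rho> u * integral\<^sup>L \<rho>' v)"
      using sf u(1) v(1) by (intro has_bochner_integral_times_pair has_bochner_integral_integrable)
    then show "integrable (\<rho> \<Otimes>\<^sub>M \<rho>') (\<lambda>x. u (fst x) * v (snd x))" by (rule integrable.intros)
    have "AE x in \<rho> \<Otimes>\<^sub>M \<rho>'. x \<in> space (\<rho> \<Otimes>\<^sub>M \<rho>')" by (rule AE_space)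
    then show "AE \<sigma> in \<rho> \<Otimes>\<^sub>M \<rho>'. (\<Prod>j=a..b. Linf_norm (X j) (\<lambda>\<omega>. ?F j (\<omega>, \<sigma>))) \<le> u (fst \<sigma>) * v (snd \<sigma>)"
      using AE_pair_fst[OF sf(2) u(2)] AE_pair_snd[OF sf(2) v(2)]
    proof eventually_elim
      case (elim \<sigma>)
      obtain s t where st: "\<sigma> = (s, t)" "s \<in> space \<rho>" "t \<in> space \<rho>'" using elim(1) by (auto simp: space_pair_measure)
      define x where "x j = (if j \<in> {a1..b1} then Linf_norm (X j) (\<lambda>\<omega>. f j (\<omega>, s)) else 1)" for j
      define y where "y j = (if j \<in> {a2..b2} then Linf_norm (X j) (\<lambda>\<omega>. g j (\<omega>, t)) else 1)" for j
      have xy: "0 \<le> Linf_norm (X j) (\<lambda>\<omega>. ?F j (\<omega>, \<sigma>)) \<and> Linf_norm (X j) (\<lambda>\<omega>. ?F j (\<omega>, \<sigma>)) \<le> x j * y j \<and> 0 \<le> x j \<and> 0 \<le> y j"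
        if j: "j \<in> {a..b}" for j
      proof -
        have j': "a \<le> j" "j \<le> b" using j by auto
        interpret pvm_space "X j" using pvm j' .
        note m = Linf_meas_mult[OF L(1)[OF j' st(2)] L'(1)[OF j' st(3)]]
        have x: "0 \<le> Linf_norm (X j) (\<lambda>\<omega>. f' j (\<omega>, s))" "Linf_norm (X j) (\<lambda>\<omega>. f' j (\<omega>, s)) \<le> x j"
          using Linf_norm_nonneg[OF L(1)[OF j' st(2)]] L(2)[OF j', of s] by (auto simp: x_def)
        have y: "0 \<le> Linf_norm (X j) (\<lambda>\<omega>. g' j (\<omega>, t))" "Linf_norm (X j) (\<lambda>\<omega>. g' j (\<omega>, t)) \<le> y j"
          using Linf_norm_nonneg[OF L'(1)[OF j' st(3)]] L'(2)[OF j', of t] by (auto simp: y_def)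
        have "Linf_norm (X j) (\<lambda>\<omega>. f' j (\<omega>, s)) * Linf_norm (X j) (\<lambda>\<omega>. g' j (\<omega>, t)) \<le> x j * y j"
          using x y by (intro mult_mono) auto
        then show ?thesis using m(2) Linf_norm_nonneg[OF m(1)] x y by (simp add: st(1) F)
      qed
      have "(\<Prod>j=a..b. Linf_norm (X j) (\<lambda>\<omega>. ?F j (\<omega>, \<sigma>))) \<le> (\<Prod>j=a..b. x j * y j)"
        using xy by (intro prod_mono) blast
      also have "\<dots> = (\<Prod>j=a1..b1. Linf_norm (X j) (\<lambda>\<omega>. f j (\<omega>, s))) * (\<Prod>j=a2..b2. Linf_norm (X j) (\<lambda>\<omega>. g j (\<omega>, t)))"
        unfolding prod.distrib by (simp only: x_def y_def prod1 prod2)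
      also have "\<dots> \<le> u s * v t"
      proof (rule mult_mono)
        \<comment> \<open>Nonnegativity is taken from the padded bounds, which are known to be
          nonnegative in all slots, and then read back on the smaller intervals.\<close>
        have "0 \<le> (\<Prod>j=a1..b1. x j)" "0 \<le> (\<Prod>j=a2..b2. y j)" using xy I1 I2 by (auto intro!: prod_nonneg)
        moreover have "(\<Prod>j=a1..b1. x j) = (\<Prod>j=a1..b1. Linf_norm (X j) (\<lambda>\<omega>. f j (\<omega>, s)))"
          "(\<Prod>j=a2..b2. y j) = (\<Prod>j=a2..b2. Linf_norm (X j) (\<lambda>\<omega>. g j (\<omega>, t)))"
          by (rule prod.cong; simp add: x_def y_def)+
        ultimately have n: "0 \<le> (\<Prod>j=a1..b1. Linf_norm (X j) (\<lambda>\<omega>. f j (\<omega>, s)))" "0 \<le> (\<Prod>j=a2..b2. Linf_norm (X j) (\<lambda>\<omega>. g j (\<omega>, t)))"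
          by (simp_all only:)
        show "(\<Prod>j=a1..b1. Linf_norm (X j) (\<lambda>\<omega>. f j (\<omega>, s))) \<le> u s" using elim(2) st(1) by simp
        then show "0 \<le> u s" using n(1) by linarith
        show "(\<Prod>j=a2..b2. Linf_norm (X j) (\<lambda>\<omega>. g j (\<omega>, t))) \<le> v t" using elim(3) st(1) by simp
        show "0 \<le> (\<Prod>j=a2..b2. Linf_norm (X j) (\<lambda>\<omega>. g j (\<omega>, t)))" by fact
      qed
      finally show ?case by (simp add: st(1))
    qed
    have r1: "pvm_AE (tensor_pvms {a..b} X) (\<lambda>\<omega>. has_bochner_integral \<rho> (\<lambda>\<sigma>. \<Prod>j=a1..b1. f j (restrict \<omega> {a1..b1} j, \<sigma>)) (\<phi> (restrict \<omega> {a1..b1})))"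
      using I1 pvm by (intro tensor_pvm_AE_restrict[OF _ _ _ _ is_ipd_AE[OF d1]]) auto
    have r2: "pvm_AE (tensor_pvms {a..b} X) (\<lambda>\<omega>. has_bochner_integral \<rho>' (\<lambda>\<sigma>. \<Prod>j=a2..b2. g j (restrict \<omega> {a2..b2} j, \<sigma>)) (\<psi> (restrict \<omega> {a2..b2})))"
      using I2 pvm by (intro tensor_pvm_AE_restrict[OF _ _ _ _ is_ipd_AE[OF d2]]) auto
    show "pvm_AE (tensor_pvms {a..b} X) (\<lambda>\<omega>. has_bochner_integral (\<rho> \<Otimes>\<^sub>M \<rho>') (\<lambda>\<sigma>. \<Prod>j=a..b. ?F j (\<omega> j, \<sigma>))
       (\<phi> (restrict \<omega> {a1..b1}) * \<psi> (restrict \<omega> {a2..b2})))"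
    proof (rule T.pvm_AE_mp2[OF r1 r2])
      fix \<omega> assume "has_bochner_integral \<rho> (\<lambda>\<sigma>. \<Prod>j=a1..b1. f j (restrict \<omega> {a1..b1} j, \<sigma>)) (\<phi> (restrict \<omega> {a1..b1}))"
        "has_bochner_integral \<rho>' (\<lambda>\<sigma>. \<Prod>j=a2..b2. g j (restrict \<omega> {a2..b2} j, \<sigma>)) (\<psi> (restrict \<omega> {a2..b2}))"
      from has_bochner_integral_times_pair[OF sf this]
      have hb: "has_bochner_integral (\<rho> \<Otimes>\<^sub>M \<rho>') (\<lambda>\<sigma>. (\<Prod>j=a1..b1. f j (restrict \<omega> {a1..b1} j, fst \<sigma>)) * (\<Prod>j=a2..b2. g j (restrict \<omega> {a2..b2} j, snd \<sigma>)))
        (\<phi> (restrict \<omega> {a1..b1}) * \<psi> (restrict \<omega> {a2..b2}))" .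
      have eq: "(\<Prod>j=a..b. ?F j (\<omega> j, \<sigma>)) =
          (\<Prod>j=a1..b1. f j (restrict \<omega> {a1..b1} j, fst \<sigma>)) * (\<Prod>j=a2..b2. g j (restrict \<omega> {a2..b2} j, snd \<sigma>))" for \<sigma>
        unfolding prod1[symmetric] prod2[symmetric] prod.distrib[symmetric] by (rule prod.cong) (auto simp: times_ipd_def pad_ipd_def)
      show "has_bochner_integral (\<rho> \<Otimes>\<^sub>M \<rho>') (\<lambda>\<sigma>. \<Prod>j=a..b. ?F j (\<omega> j, \<sigma>)) (\<phi> (restrict \<omega> {a1..b1}) * \<psi> (restrict \<omega> {a2..b2}))"
        unfolding eq by (fact hb)
    qed
  qed
qed

text \<open>Fubini for operator integrals. For fixed \<open>s\<close>, the integral over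
  \<open>t\<close> acts only on \<open>G\<close>, which stands between \<open>L s\<close> and
  \<open>R s\<close>, and yields \<open>I\<close> in its place. For (ii) the right factor is the
  identity; for (iii) \<open>L\<close> and \<open>R\<close> are the outer parts of the chain and
  \<open>G\<close> is a chain of two slots.\<close>

lemma ipd_pettis_pair:
  fixes X :: "nat \<Rightarrow> ('w, 'h::complex_vector) pvms" and M :: "'s measure" and N :: "'t measure"
  assumes d: "is_ipd a b X \<phi> (M \<Otimes>\<^sub>M N) F" and ab: "a \<le> b" and pvm: "\<And>j. \<lbrakk>a \<le> j; j \<le> b\<rbrakk> \<Longrightarrow> pvm_space (X j)"
    and B: "B \<in> op_args a b X" and sf: "sigma_finite_measure M" "sigma_finite_measure N"
    and H: "hilbert_space H" and L: "\<And>s. s \<in> space M \<Longrightarrow> bounded_op H (hsp (X a)) (L s)"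
    and R: "\<And>s h. \<lbrakk>s \<in> space M; h \<in> vecs (hsp (X b))\<rbrakk> \<Longrightarrow> R s h \<in> vecs K"
    and Gm: "\<And>t x. \<lbrakk>t \<in> space N; x \<in> vecs K\<rbrakk> \<Longrightarrow> G t x \<in> vecs H"
    and G: "is_pettis_integral K H N G I"
    and F: "\<And>s t h. \<lbrakk>s \<in> space M; t \<in> space N; h \<in> vecs (hsp (X b))\<rbrakk> \<Longrightarrow> chain_op a b X F B (s, t) h = L s (G t (R s h))"
    and T: "is_pettis_integral (hsp (X b)) (hsp (X a)) M (\<lambda>s h. L s (I (R s h))) T"
  shows "ipd_pettis a b X (M \<Otimes>\<^sub>M N) F B T"
proof -
  interpret M: sigma_finite_measure M by (rule sf)
  interpret N: sigma_finite_measure N by (rule sf)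
  interpret pair_sigma_finite M N ..
  obtain g where g: "ipd_ops a b X (M \<Otimes>\<^sub>M N) F B g" using is_ipd_ops[OF d ab pvm B] by blast
  have A: "hilbert_space (hsp (X a))" using pvm[of a] ab by (simp add: pvm_space_def)
  have Tb: "bounded_op (hsp (X b)) (hsp (X a)) T" using T by (simp add: is_pettis_integral_def)
  have Ib: "bounded_op K H I" using G by (simp add: is_pettis_integral_def)
  have "has_bochner_integral (M \<Otimes>\<^sub>M N) (\<lambda>\<sigma>. ip (hsp (X a)) (chain_op a b X F B \<sigma> h) k) (ip (hsp (X a)) (T h) k)"
    if h: "h \<in> vecs (hsp (X b))" and k: "k \<in> vecs (hsp (X a))" for h k
  proof -
    let ?c = "\<lambda>\<sigma>. ip (hsp (X a)) (chain_op a b X F B \<sigma> h) k"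
    have i: "integrable (M \<Otimes>\<^sub>M N) ?c"
      using ipd_ops.chain_ip_integrable[OF g h k] by (simp add: chain_op_chain[OF g])
    have inner: "(LINT t|N. ?c (s, t)) = ip (hsp (X a)) (L s (I (R s h))) k" if s: "s \<in> space M" for s
    proof -
      \<comment> \<open>Moving \<open>L s\<close> to the other side of the inner product turns the
        inner integral into the weak integral that defines \<open>I\<close>.\<close>
      obtain w where w: "w \<in> vecs H" "\<And>x. x \<in> vecs H \<Longrightarrow> ip (hsp (X a)) (L s x) k = ip H x w"
        using bounded_op_adjoint[OF L[OF s] H A k] by blast
      have Rm: "R s h \<in> vecs K" using R[OF s h] .
      have "(LINT t|N. ?c (s, t)) = (LINT t|N. ip H (G t (R s h)) w)"
        using Rm by (intro Bochner_Integration.integral_cong) (simp_all add: F[OF s _ h] w(2) Gm)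
      also have "\<dots> = ip H (I (R s h)) w"
        using G Rm w(1) by (auto simp: is_pettis_integral_def dest: has_bochner_integral_integral_eq)
      also have "\<dots> = ip (hsp (X a)) (L s (I (R s h))) k"
        by (rule w(2)[OF bounded_op_mem[OF Ib Rm], symmetric])
      finally show ?thesis .
    qed
    have "integral\<^sup>L (M \<Otimes>\<^sub>M N) ?c = (LINT s|M. LINT t|N. ?c (s, t))" by (rule integral_fst'[OF i, symmetric])
    also have "\<dots> = (LINT s|M. ip (hsp (X a)) (L s (I (R s h))) k)"
      by (intro Bochner_Integration.integral_cong inner refl)
    also have "\<dots> = ip (hsp (X a)) (T h) k"
      using T h k by (auto simp: is_pettis_integral_def dest: has_bochner_integral_integral_eq)
    finally show ?thesis using i by (simp add: has_bochner_integral_iff)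
  qed
  then show ?thesis using Tb by (simp add: ipd_pettis_def is_pettis_integral_def)
qed

section \<open>Splitting and modifying operator chains\<close>

lemma op_chain_append:
  "op_chain A B a (n + Suc l) x = op_chain A B a n (B (a + n) (op_chain A B (Suc (a + n)) l x))"
proof (induction n arbitrary: a)
  case 0
  show ?case by (simp only: add_0 add_0_right op_chain_Suc_left op_chain.simps(1))
next
  case (Suc n)
  show ?case using Suc[of "Suc a"] by (simp only: op_chain_Suc_left add_Suc add_Suc_right)
qed

text \<open>In the product decomposition of (iii), the operator at slot \<open>m\<close> is a
  composition whose right factor comes from \<psi>. This detaches that factor from the right end of
  the left chain.\<close>

lemma op_chain_modify_last:
  assumes "\<And>j. \<lbrakk>a \<le> j; j < a + n\<rbrakk> \<Longrightarrow> A' j = A j" "A' (a + n) x = A (a + n) (G x)"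
  shows "op_chain A' B a n x = op_chain A B a n (G x)"
proof (cases n)
  case (Suc l)
  have "op_chain A' B a l = op_chain A B a l" by (rule op_chain_cong) (simp_all add: assms(1) Suc)
  then show ?thesis using assms(2) by (simp add: Suc)
qed (use assms(2) in simp)

text \<open>The counterpart at slot \<open>m + 1\<close>, where the factor from \<psi> must come out
  at the left end. The replacement is an identity on \<open>vecs (H a)\<close> only, so the vector
  reaching that slot has to be shown to lie there.\<close>

lemma op_chain_modify_first:
  assumes "\<And>j. \<lbrakk>a < j; j \<le> a + n\<rbrakk> \<Longrightarrow> A' j = A j" "\<And>y. y \<in> vecs (H a) \<Longrightarrow> A' a y = G (A a y)"
    "\<And>j. \<lbrakk>a \<le> j; j \<le> a + n\<rbrakk> \<Longrightarrow> bounded_op (H j) (H j) (A j)"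
    "\<And>j. \<lbrakk>a \<le> j; j < a + n\<rbrakk> \<Longrightarrow> bounded_op (H (Suc j)) (H j) (B j)"
    "\<And>j. \<lbrakk>a \<le> j; j \<le> a + n\<rbrakk> \<Longrightarrow> hilbert_space (H j)" "x \<in> vecs (H (a + n))"
  shows "op_chain A' B a n x = G (op_chain A B a n x)"
proof (cases n)
  case 0
  then show ?thesis using assms(2)[of x] assms(6) by simp
next
  case (Suc l)
  have eq: "op_chain A' B (Suc a) l = op_chain A B (Suc a) l" by (rule op_chain_cong) (simp_all add: assms(1) Suc)
  have "bounded_op (H (Suc a + l)) (H (Suc a)) (op_chain A B (Suc a) l)"
    by (rule op_chain_bounded; rule assms(3-5); simp add: Suc)
  then have "op_chain A B (Suc a) l x \<in> vecs (H (Suc a))" by (rule bounded_op_mem) (use assms(6) Suc in simp)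
  then have "B a (op_chain A B (Suc a) l x) \<in> vecs (H a)" by (rule bounded_op_mem[rotated]) (rule assms(4); simp add: Suc)
  from assms(2)[OF this] show ?thesis unfolding Suc op_chain_Suc_left eq .
qed

section \<open>Injections into an infinite parameter type\<close>

lemma ex_inj_Times:
  assumes "infinite (UNIV :: 's set)"
  shows "\<exists>u :: 's \<times> 's \<Rightarrow> 's. inj u"
proof -
  have "(card_of (UNIV \<times> UNIV :: ('s \<times> 's) set), card_of (UNIV :: 's set)) \<in> ordIso" using assms by (rule card_of_Times_same_infinite)
  then obtain u :: "'s \<times> 's \<Rightarrow> 's" where "bij_betw u (UNIV \<times> UNIV) UNIV" using card_of_ordIso by blast
  then show ?thesis by (auto simp: bij_betw_def)
qed

lemma ex_inj_sum:
  assumes "infinite (UNIV :: 's set)"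
  shows "\<exists>u :: 's + 's \<Rightarrow> 's. inj u"
proof -
  obtain v :: "'s \<times> 's \<Rightarrow> 's" where v: "inj v" using ex_inj_Times[OF assms] by blast
  obtain p :: 's where True by blast
  obtain q :: 's where pq: "q \<noteq> p" using ex_new_if_finite[of "{p}"] assms by auto
  \<comment> \<open>Two distinct tags embed the sum into the product, for which an injection is
    available.\<close>
  define u where "u x = (case x of Inl s \<Rightarrow> v (p, s) | Inr s \<Rightarrow> v (q, s))" for x
  have "inj u"
  proof (rule injI)
    fix x y assume "u x = u y"
    then show "x = y" using pq by (cases x; cases y) (auto simp: u_def dest!: injD[OF v])
  qed
  then show ?thesis by blast
qed

lemma iptp_moi:
  fixes X :: "nat \<Rightarrow> ('w, 'h::complex_vector) pvms" and \<rho> :: "'t measure" and u :: "'t \<Rightarrow> 's"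
  assumes u: "inj u" and ab: "a < b" and pvm: "\<And>j. \<lbrakk>a \<le> j; j \<le> b\<rbrakk> \<Longrightarrow> pvm_space (X j)"
    and d: "is_ipd a b X \<phi> \<rho> f" and B: "B \<in> op_args a b X" and T: "ipd_pettis a b X \<rho> f B T" and h: "h \<in> vecs (hsp (X b))"
  shows "moi TYPE('s) a b X \<phi> B h = T h"
proof -
  have m: "\<phi> \<in> iptp TYPE('s) a b X" using u ab pvm d by (rule iptpI)
  show ?thesis using m less_imp_le[OF ab] pvm B d T h by (rule moi_eq)
qed

lemma zero_op_args:
  assumes "\<And>j. \<lbrakk>a \<le> j; j \<le> b\<rbrakk> \<Longrightarrow> pvm_space (X j)"
  shows "(\<lambda>_ _. 0) \<in> op_args a b X"
proof -
  have "bounded_op (hsp (X (Suc j))) (hsp (X j)) (\<lambda>_. 0)" if j: "j \<in> {a..<b}" for j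
  proof -
    interpret pvm_space "X j" using assms j by simp
    interpret S: pvm_space "X (Suc j)" using assms j by simp
    have "hnorm (hsp (X j)) 0 \<le> 1 * hnorm (hsp (X (Suc j))) x" if "x \<in> vecs (hsp (X (Suc j)))" for x
      using S.hnorm_nonneg[of x] that by simp
    then show ?thesis unfolding bounded_op_def
      using zero_mem scaleC_zero_right by (intro conjI ballI allI exI[of _ 1]) auto
  qed
  then show ?thesis by (simp add: op_args_def)
qed

lemma op_args_subset: "\<lbrakk>B \<in> op_args a b X; a \<le> a'; b' \<le> b\<rbrakk> \<Longrightarrow> B \<in> op_args a' b' X"
  by (auto simp: op_args_def)

lemma iptp_ex_ipd:
  fixes X :: "nat \<Rightarrow> ('w, 'h::complex_vector) pvms"
  assumes \<phi>: "\<phi> \<in> iptp TYPE('s) a b X" and ab: "a \<le> b" and pvm: "\<And>j. \<lbrakk>a \<le> j; j \<le> b\<rbrakk> \<Longrightarrow> pvm_space (X j)"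
  shows "\<exists>(\<rho> :: 's measure) f. is_ipd a b X \<phi> \<rho> f"
proof -
  \<comment> \<open>\<open>iptp_decomposition\<close> expects operator arguments; zero operators are
    always available, and only the decomposition is kept.\<close>
  have "(\<lambda>_ _. 0) \<in> op_args a b X" using pvm by (rule zero_op_args)
  from iptp_decomposition[OF \<phi> ab pvm this] show ?thesis by blast
qed

text \<open>Points of the product space are extensional tuples, so restricting a tuple to
  \<open>{a..b}\<close> changes nothing almost everywhere although it does as a function of
  arbitrary tuples.\<close>

lemma is_ipd_cong:
  fixes X :: "nat \<Rightarrow> ('w, 'h::complex_vector) pvms"
  assumes d: "is_ipd a b X \<phi> \<rho> f" and ab: "a \<le> b" and pvm: "\<And>j. \<lbrakk>a \<le> j; j \<le> b\<rbrakk> \<Longrightarrow> pvm_space (X j)"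
    and eq: "\<And>\<omega>. \<omega> \<in> extensional {a..b} \<Longrightarrow> \<phi> \<omega> = \<psi> \<omega>"
  shows "is_ipd a b X \<psi> \<rho> f"
proof -
  interpret T: pvm_space "tensor_pvms {a..b} X" using ab pvm by (intro pvm_space_tensor(1)) auto
  have Tm: "msp (tensor_pvms {a..b} X) = (\<Pi>\<^sub>M i\<in>{a..b}. msp (X i))" using ab pvm by (intro pvm_space_tensor(2)) auto
  have "pvm_AE (tensor_pvms {a..b} X) (\<lambda>\<omega>. has_bochner_integral \<rho> (\<lambda>\<sigma>. \<Prod>j=a..b. f j (\<omega> j, \<sigma>)) (\<psi> \<omega>))"
  proof (rule T.pvm_AE_mp[OF is_ipd_AE[OF d]])
    fix \<omega> assume "\<omega> \<in> space (msp (tensor_pvms {a..b} X))" and hb: "has_bochner_integral \<rho> (\<lambda>\<sigma>. \<Prod>j=a..b. f j (\<omega> j, \<sigma>)) (\<phi> \<omega>)"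
    then have "\<omega> \<in> extensional {a..b}" unfolding Tm by (simp add: space_PiM PiE_iff)
    then show "has_bochner_integral \<rho> (\<lambda>\<sigma>. \<Prod>j=a..b. f j (\<omega> j, \<sigma>)) (\<psi> \<omega>)" using hb eq[of \<omega>] by simp
  qed
  then show ?thesis using d by (simp add: is_ipd_def)
qed

lemma chain_op_bounded:
  fixes X :: "nat \<Rightarrow> ('w, 'h::complex_vector) pvms"
  assumes d: "is_ipd a b X \<phi> \<rho> f" and pvm: "\<And>j. \<lbrakk>a \<le> j; j \<le> b\<rbrakk> \<Longrightarrow> pvm_space (X j)"
    and B: "B \<in> op_args a b X" and r: "a \<le> a'" "a' \<le> b'" "b' \<le> b" and s: "s \<in> space \<rho>"
  shows "bounded_op (hsp (X b')) (hsp (X a')) (chain_op a' b' X f B s)"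
proof -
  have "bounded_op (hsp (X (a' + (b' - a')))) (hsp (X a')) (chain_op a' b' X f B s)"
    unfolding chain_op_def
  proof (rule op_chain_bounded[where H = "\<lambda>j. hsp (X j)"])
    fix j assume "a' \<le> j" "j \<le> a' + (b' - a')"
    then have j: "a \<le> j" "j \<le> b" using r by auto
    then show "hilbert_space (hsp (X j))" using pvm by (simp add: pvm_space_def)
    have "(\<lambda>\<omega>. f j (\<omega>, s)) \<in> Linf (X j)" using d j s by (simp add: is_ipd_def)
    then show "bounded_op (hsp (X j)) (hsp (X j)) (pvm_int (X j) (\<lambda>\<omega>. f j (\<omega>, s)))"
      by (rule pvm_space.pvm_int_char(1)[OF pvm[OF j]])
  next
    fix j assume "a' \<le> j" "j < a' + (b' - a')"
    then show "bounded_op (hsp (X (Suc j))) (hsp (X j)) (B j)" using r B by (simp add: op_args_def)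
  qed
  then show ?thesis using r by simp
qed

lemma chain_op_append:
  assumes "a \<le> m" "m < b"
  shows "chain_op a b X f B s h = chain_op a m X f B s (B m (chain_op (Suc m) b X f B s h))"
proof -
  have "b - a = (m - a) + Suc (b - Suc m)" "a + (m - a) = m" using assms by auto
  then show ?thesis unfolding chain_op_def by (simp only: op_chain_append)
qed

section \<open>Algebraic properties of multiple operator integrals\<close>

context
  fixes X :: "nat \<Rightarrow> ('w, 'h::complex_vector) pvms" and a b :: nat
  assumes inf: "infinite (UNIV :: 's set)" and ab: "a < b"
    and pvm: "\<And>j. \<lbrakk>a \<le> j; j \<le> b\<rbrakk> \<Longrightarrow> pvm_space (X j)"
begin

lemma hs: "\<lbrakk>a \<le> j; j \<le> b\<rbrakk> \<Longrightarrow> hilbert_space (hsp (X j))"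
  using pvm by (simp add: pvm_space_def)

text \<open>The combined decomposition lives on the sum of two copies of \<open>'s\<close> and is
  brought back by an injection, which is where infinitude enters.\<close>

lemma moi_linear:
  assumes \<phi>: "\<phi> \<in> iptp TYPE('s) a b X" and \<psi>: "\<psi> \<in> iptp TYPE('s) a b X"
  shows iptp_linear: "(\<lambda>\<omega>. \<phi> \<omega> + \<alpha> * \<psi> \<omega>) \<in> iptp TYPE('s) a b X"
    and "\<lbrakk>B \<in> op_args a b X; h \<in> vecs (hsp (X b))\<rbrakk> \<Longrightarrow>
      moi TYPE('s) a b X (\<lambda>\<omega>. \<phi> \<omega> + \<alpha> * \<psi> \<omega>) B h = moi TYPE('s) a b X \<phi> B h + \<alpha> *\<^sub>C moi TYPE('s) a b X \<psi> B h"
proof -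
  obtain u :: "'s + 's \<Rightarrow> 's" where u: "inj u" using ex_inj_sum[OF inf] by blast
  note ab' = less_imp_le[OF ab]
  have d: "is_ipd a b X (\<lambda>\<omega>. \<phi> \<omega> + \<alpha> * \<psi> \<omega>) (sum_measure \<rho> \<rho>') (sum_ipd f (scale_ipd a \<alpha> f'))"
    if "is_ipd a b X \<phi> \<rho> f" "is_ipd a b X \<psi> \<rho>' f'" for \<rho> \<rho>' :: "'s measure" and f f'
    using that(1) is_ipd_scale[OF that(2) ab' pvm] ab' pvm by (rule is_ipd_sum)
  obtain \<rho> \<rho>' :: "'s measure" and f f' where "is_ipd a b X \<phi> \<rho> f" "is_ipd a b X \<psi> \<rho>' f'"
    using iptp_ex_ipd[OF \<phi> ab' pvm] iptp_ex_ipd[OF \<psi> ab' pvm] by blast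
  from iptpI[OF u ab pvm d[OF this]]
  show "(\<lambda>\<omega>. \<phi> \<omega> + \<alpha> * \<psi> \<omega>) \<in> iptp TYPE('s) a b X" .
  assume B: "B \<in> op_args a b X" and h: "h \<in> vecs (hsp (X b))"
  obtain \<rho> :: "'s measure" and f where 1: "is_ipd a b X \<phi> \<rho> f" "ipd_pettis a b X \<rho> f B (moi TYPE('s) a b X \<phi> B)"
    using iptp_decomposition[OF \<phi> ab' pvm B] by blast
  obtain \<rho>' :: "'s measure" and f' where 2: "is_ipd a b X \<psi> \<rho>' f'" "ipd_pettis a b X \<rho>' f' B (moi TYPE('s) a b X \<psi> B)"
    using iptp_decomposition[OF \<psi> ab' pvm B] by blast
  have "ipd_pettis a b X (sum_measure \<rho> \<rho>') (sum_ipd f (scale_ipd a \<alpha> f')) B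
      (\<lambda>h. moi TYPE('s) a b X \<phi> B h + \<alpha> *\<^sub>C moi TYPE('s) a b X \<psi> B h)"
    using hs ab' by (intro ipd_pettis_sum 1(2) ipd_pettis_scale[OF 2(1) ab' pvm B 2(2)]) auto
  from iptp_moi[OF u ab pvm d[OF 1(1) 2(1)] B this h]
  show "moi TYPE('s) a b X (\<lambda>\<omega>. \<phi> \<omega> + \<alpha> * \<psi> \<omega>) B h = moi TYPE('s) a b X \<phi> B h + \<alpha> *\<^sub>C moi TYPE('s) a b X \<psi> B h" .
qed

text \<open>At \<open>(s, t)\<close> the chain splits at \<open>B m\<close> into a part that depends
  on \<open>s\<close> and a part that depends on \<open>t\<close>, so the two integrations
  separate.\<close>

lemma moi_tensor:
  assumes m: "a \<le> m" "m < b" and \<phi>: "\<phi> \<in> iptp TYPE('s) a m X" and \<psi>: "\<psi> \<in> iptp TYPE('s) (Suc m) b X"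
  shows iptp_tensor: "(\<lambda>\<omega>. \<phi> (restrict \<omega> {a..m}) * \<psi> (restrict \<omega> {Suc m..b})) \<in> iptp TYPE('s) a b X"
    and "\<lbrakk>B \<in> op_args a b X; h \<in> vecs (hsp (X b))\<rbrakk> \<Longrightarrow>
      moi TYPE('s) a b X (\<lambda>\<omega>. \<phi> (restrict \<omega> {a..m}) * \<psi> (restrict \<omega> {Suc m..b})) B h =
      moi TYPE('s) a m X \<phi> B (B m (moi TYPE('s) (Suc m) b X \<psi> B h))"
proof -
  let ?\<theta> = "\<lambda>\<omega>. \<phi> (restrict \<omega> {a..m}) * \<psi> (restrict \<omega> {Suc m..b})"
  obtain u :: "'s \<times> 's \<Rightarrow> 's" where u: "inj u" using ex_inj_Times[OF inf] by blast
  have pvm1: "pvm_space (X j)" if "a \<le> j" "j \<le> m" for j using that m by (intro pvm) auto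
  have pvm2: "pvm_space (X j)" if "Suc m \<le> j" "j \<le> b" for j using that m by (intro pvm) auto
  have m': "Suc m \<le> b" using m by simp
  have d: "is_ipd a b X ?\<theta> (\<rho> \<Otimes>\<^sub>M \<rho>') (times_ipd {a..m} f {Suc m..b} g)"
    if "is_ipd a m X \<phi> \<rho> f" "is_ipd (Suc m) b X \<psi> \<rho>' g" for \<rho> \<rho>' :: "'s measure" and f g
    using that by (rule is_ipd_times) (use m pvm in auto)
  obtain \<rho> \<rho>' :: "'s measure" and f g where "is_ipd a m X \<phi> \<rho> f" "is_ipd (Suc m) b X \<psi> \<rho>' g"
    using iptp_ex_ipd[OF \<phi> m(1) pvm1] iptp_ex_ipd[OF \<psi> m' pvm2] by blast
  from iptpI[OF u ab pvm d[OF this]] show "?\<theta> \<in> iptp TYPE('s) a b X" .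
  assume B: "B \<in> op_args a b X" and h: "h \<in> vecs (hsp (X b))"
  have B1: "B \<in> op_args a m X" and B2: "B \<in> op_args (Suc m) b X" using m by (auto intro: op_args_subset[OF B])
  have Bm: "bounded_op (hsp (X (Suc m))) (hsp (X m)) (B m)" using B m by (simp add: op_args_def)
  obtain \<rho> :: "'s measure" and f where 1: "is_ipd a m X \<phi> \<rho> f" "ipd_pettis a m X \<rho> f B (moi TYPE('s) a m X \<phi> B)"
    using iptp_decomposition[OF \<phi> m(1) pvm1 B1] by blast
  obtain \<rho>' :: "'s measure" and g where 2: "is_ipd (Suc m) b X \<psi> \<rho>' g" "ipd_pettis (Suc m) b X \<rho>' g B (moi TYPE('s) (Suc m) b X \<psi> B)"
    using iptp_decomposition[OF \<psi> m' pvm2 B2] by blast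
  define T1 where "T1 = moi TYPE('s) a m X \<phi> B"
  define T2 where "T2 = moi TYPE('s) (Suc m) b X \<psi> B"
  have P1: "is_pettis_integral (hsp (X m)) (hsp (X a)) \<rho> (chain_op a m X f B) T1" using 1(2) by (simp add: ipd_pettis_def T1_def)
  have P2: "is_pettis_integral (hsp (X b)) (hsp (X (Suc m))) \<rho>' (chain_op (Suc m) b X g B) T2" using 2(2) by (simp add: ipd_pettis_def T2_def)
  have T1: "bounded_op (hsp (X m)) (hsp (X a)) T1" and T2: "bounded_op (hsp (X b)) (hsp (X (Suc m))) T2"
    using P1 P2 by (simp_all add: is_pettis_integral_def)
  have BT: "bounded_op (hsp (X b)) (hsp (X m)) (\<lambda>h. B m (T2 h))"
    using bounded_op_comp[OF T2 Bm] hs m by simp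
  have BT1: "bounded_op (hsp (X b)) (hsp (X a)) (\<lambda>h. T1 (B m (T2 h)))"
    using bounded_op_comp[OF BT T1] hs m by simp
  \<comment> \<open>Outside its own interval each family is padded by 1, so the left part sees only
    \<open>s\<close> and, in \<open>c2\<close>, the right part only \<open>t\<close>.\<close>
  have c1: "chain_op a m X (times_ipd {a..m} f {Suc m..b} g) B (s, t) = chain_op a m X f B s" for s t
    by (rule chain_op_cong) (use m in \<open>auto simp: times_ipd_def pad_ipd_def\<close>)
  have c2: "chain_op (Suc m) b X (times_ipd {a..m} f {Suc m..b} g) B (s, t) = chain_op (Suc m) b X g B t" for s t
    by (rule chain_op_cong) (use m in \<open>auto simp: times_ipd_def pad_ipd_def\<close>)
  have "ipd_pettis a b X (\<rho> \<Otimes>\<^sub>M \<rho>') (times_ipd {a..m} f {Suc m..b} g) B (\<lambda>h. T1 (B m (T2 h)))"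
  proof (rule ipd_pettis_pair[OF d[OF 1(1) 2(1)] less_imp_le[OF ab] pvm B])
    show "sigma_finite_measure \<rho>" "sigma_finite_measure \<rho>'" using 1(1) 2(1) by (simp_all add: is_ipd_def)
    show "hilbert_space (hsp (X (Suc m)))" using hs m by simp
    show "bounded_op (hsp (X (Suc m))) (hsp (X a)) (\<lambda>x. chain_op a m X f B s (B m x))" if "s \<in> space \<rho>" for s
      using bounded_op_comp[OF Bm chain_op_bounded[OF 1(1) pvm1 B1 order_refl m(1) order_refl that]] hs m by simp
    show "chain_op (Suc m) b X g B t x \<in> vecs (hsp (X (Suc m)))" if "t \<in> space \<rho>'" "x \<in> vecs (hsp (X b))" for t x
      using bounded_op_mem[OF chain_op_bounded[OF 2(1) pvm2 B2 order_refl m' order_refl that(1)] that(2)] .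
    show "is_pettis_integral (hsp (X b)) (hsp (X (Suc m))) \<rho>' (chain_op (Suc m) b X g B) T2" by (rule P2)
    show "chain_op a b X (times_ipd {a..m} f {Suc m..b} g) B (s, t) h = chain_op a m X f B s (B m (chain_op (Suc m) b X g B t h))" for s t h
      by (simp only: chain_op_append[OF m] c1 c2)
    show "is_pettis_integral (hsp (X b)) (hsp (X a)) \<rho> (\<lambda>s h. chain_op a m X f B s (B m (T2 h))) (\<lambda>h. T1 (B m (T2 h)))"
      using BT1 P1 bounded_op_mem[OF BT] by (simp add: is_pettis_integral_def)
  qed
  from iptp_moi[OF u ab pvm d[OF 1(1) 2(1)] B this h]
  show "moi TYPE('s) a b X ?\<theta> B h = moi TYPE('s) a m X \<phi> B (B m (moi TYPE('s) (Suc m) b X \<psi> B h))"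
    by (simp add: T1_def T2_def)
qed

text \<open>Multiplicativity of the spectral integrals at slots \<open>m\<close> and
  \<open>m + 1\<close> isolates a two-slot chain for \<psi> around \<open>B m\<close>. Integrating
  it over \<open>t\<close> with \<open>s\<close> fixed puts the operator integral of \<psi> into
  slot \<open>m\<close> of the chain for \<phi>.\<close>

lemma moi_mult:
  assumes m: "a \<le> m" "m < b" and \<phi>: "\<phi> \<in> iptp TYPE('s) a b X" and \<psi>: "\<psi> \<in> iptp TYPE('s) m (Suc m) X"
  shows iptp_mult: "(\<lambda>\<omega>. \<phi> \<omega> * \<psi> (restrict \<omega> {m..Suc m})) \<in> iptp TYPE('s) a b X"
    and "\<lbrakk>B \<in> op_args a b X; h \<in> vecs (hsp (X b))\<rbrakk> \<Longrightarrow>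
      moi TYPE('s) a b X (\<lambda>\<omega>. \<phi> \<omega> * \<psi> (restrict \<omega> {m..Suc m})) B h =
      moi TYPE('s) a b X \<phi> (B(m := moi TYPE('s) m (Suc m) X \<psi> B)) h"
proof -
  let ?\<theta> = "\<lambda>\<omega>. \<phi> \<omega> * \<psi> (restrict \<omega> {m..Suc m})"
  obtain u :: "'s \<times> 's \<Rightarrow> 's" where u: "inj u" using ex_inj_Times[OF inf] by blast
  note ab' = less_imp_le[OF ab]
  have pvm2: "pvm_space (X j)" if "m \<le> j" "j \<le> Suc m" for j using that m by (intro pvm) auto
  have m': "m \<le> Suc m" "Suc m \<le> b" using m by simp_all
  have d: "is_ipd a b X ?\<theta> (\<rho> \<Otimes>\<^sub>M \<rho>') (times_ipd {a..b} f {m..Suc m} g)"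
    if d1: "is_ipd a b X \<phi> \<rho> f" and d2: "is_ipd m (Suc m) X \<psi> \<rho>' g" for \<rho> \<rho>' :: "'s measure" and f g
  proof (rule is_ipd_cong[OF _ ab' pvm])
    show "is_ipd a b X (\<lambda>\<omega>. \<phi> (restrict \<omega> {a..b}) * \<psi> (restrict \<omega> {m..Suc m})) (\<rho> \<Otimes>\<^sub>M \<rho>') (times_ipd {a..b} f {m..Suc m} g)"
      using d1 d2 by (rule is_ipd_times) (use m pvm in auto)
  qed (simp_all add: extensional_restrict)
  obtain \<rho> \<rho>' :: "'s measure" and f g where "is_ipd a b X \<phi> \<rho> f" "is_ipd m (Suc m) X \<psi> \<rho>' g"
    using iptp_ex_ipd[OF \<phi> ab' pvm] iptp_ex_ipd[OF \<psi> m'(1) pvm2] by blast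
  from iptpI[OF u ab pvm d[OF this]] show "?\<theta> \<in> iptp TYPE('s) a b X" .
  assume B: "B \<in> op_args a b X" and h: "h \<in> vecs (hsp (X b))"
  define I where "I = moi TYPE('s) m (Suc m) X \<psi> B"
  have B2: "B \<in> op_args m (Suc m) X" using m by (auto intro: op_args_subset[OF B])
  obtain \<rho>' :: "'s measure" and g where 2: "is_ipd m (Suc m) X \<psi> \<rho>' g" "ipd_pettis m (Suc m) X \<rho>' g B I"
    using iptp_decomposition[OF \<psi> m'(1) pvm2 B2] unfolding I_def by blast
  have P2: "is_pettis_integral (hsp (X (Suc m))) (hsp (X m)) \<rho>' (chain_op m (Suc m) X g B) I" using 2(2) by (simp add: ipd_pettis_def)
  have Ib: "bounded_op (hsp (X (Suc m))) (hsp (X m)) I" using P2 by (simp add: is_pettis_integral_def)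
  have BI: "B(m := I) \<in> op_args a b X" using B Ib by (simp add: op_args_def)
  define T where "T = moi TYPE('s) a b X \<phi> (B(m := I))"
  obtain \<rho> :: "'s measure" and f where 1: "is_ipd a b X \<phi> \<rho> f" "ipd_pettis a b X \<rho> f (B(m := I)) T"
    using iptp_decomposition[OF \<phi> ab' pvm BI] unfolding T_def by blast
  have P1: "is_pettis_integral (hsp (X b)) (hsp (X a)) \<rho> (chain_op a b X f (B(m := I))) T" using 1(2) by (simp add: ipd_pettis_def)
  let ?F = "times_ipd {a..b} f {m..Suc m} g"
  let ?L = "chain_op a m X f B" and ?R = "chain_op (Suc m) b X f B"
  \<comment> \<open>Only slot \<open>m\<close> of the arguments is altered, so the outer chains are
    those for the original \<open>B\<close>.\<close>
  have C: "chain_op a b X f (B(m := I)) = (\<lambda>s h. ?L s (I (?R s h)))"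
  proof (intro ext)
    fix s h
    have "chain_op a m X f (B(m := I)) s = ?L s" "chain_op (Suc m) b X f (B(m := I)) s = ?R s"
      using m by (auto intro!: chain_op_cong)
    then show "chain_op a b X f (B(m := I)) s h = ?L s (I (?R s h))" by (simp add: chain_op_append[OF m])
  qed
  have Lb: "bounded_op (hsp (X m)) (hsp (X a)) (?L s)" if "s \<in> space \<rho>" for s
    by (rule chain_op_bounded[OF 1(1) pvm B _ _ _ that]) (use m in auto)
  have Rb: "bounded_op (hsp (X b)) (hsp (X (Suc m))) (?R s)" if "s \<in> space \<rho>" for s
    by (rule chain_op_bounded[OF 1(1) pvm B _ _ _ that]) (use m in auto)
  have Gb: "bounded_op (hsp (X (Suc m))) (hsp (X m)) (chain_op m (Suc m) X g B t)" if "t \<in> space \<rho>'" for t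
    by (rule chain_op_bounded[OF 2(1) pvm2 B2 _ _ _ that]) auto
  have factor: "chain_op a b X ?F B (s, t) h = ?L s (chain_op m (Suc m) X g B t (?R s h))"
    if s: "s \<in> space \<rho>" and t: "t \<in> space \<rho>'" and h: "h \<in> vecs (hsp (X b))" for s t h
  proof -
    define A where "A j = pvm_int (X j) (\<lambda>\<omega>. f j (\<omega>, s))" for j
    define A' where "A' j = pvm_int (X j) (\<lambda>\<omega>. ?F j (\<omega>, (s, t)))" for j
    define G where "G j = pvm_int (X j) (\<lambda>\<omega>. g j (\<omega>, t))" for j
    have fL: "(\<lambda>\<omega>. f j (\<omega>, s)) \<in> Linf_meas (X j)" if "a \<le> j" "j \<le> b" for j
      using pad_ipd_Linf[OF 1(1) pvm[OF that] s] that by (simp add: pad_ipd_def)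
    have gL: "(\<lambda>\<omega>. g j (\<omega>, t)) \<in> Linf_meas (X j)" if "m \<le> j" "j \<le> Suc m" for j
      using pad_ipd_Linf[OF 2(1) pvm2[OF that] t] that by (simp add: pad_ipd_def)
    have A'_eq: "A' j = A j" if "a \<le> j" "j \<le> b" "j < m \<or> Suc m < j" for j
      using that by (auto simp: A'_def A_def times_ipd_def pad_ipd_def)
    \<comment> \<open>Both orders are available because functions commute. The first is used at slot
      \<open>m\<close>, the second at slot \<open>m + 1\<close>, so that the two factors from \<psi>
      enclose \<open>B m\<close>.\<close>
    have A'_mult: "A' j x = A j (G j x)" "A' j x = G j (A j x)" if j: "m \<le> j" "j \<le> Suc m" and x: "x \<in> vecs (hsp (X j))" for j x
    proof -
      have j': "a \<le> j" "j \<le> b" using j m by auto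
      have eq: "A' j = pvm_int (X j) (\<lambda>\<omega>. f j (\<omega>, s) * g j (\<omega>, t))"
        using j j' by (simp add: A'_def times_ipd_def pad_ipd_def)
      show "A' j x = A j (G j x)"
        unfolding eq A_def G_def by (rule pvm_space.pvm_int_mult[OF pvm[OF j'] fL[OF j'] gL[OF j] x])
      show "A' j x = G j (A j x)"
        unfolding eq A_def G_def using pvm_space.pvm_int_mult[OF pvm[OF j'] gL[OF j] fL[OF j'] x] by (simp add: mult.commute)
    qed
    have Am: "bounded_op (hsp (X j)) (hsp (X j)) (A j)" if "a \<le> j" "j \<le> b" for j
      unfolding A_def using fL[OF that] by (intro pvm_space.pvm_int_char(1)[OF pvm[OF that]]) (simp add: Linf_meas_def)
    have r: "op_chain A' B (Suc m) (b - Suc m) h = G (Suc m) (op_chain A B (Suc m) (b - Suc m) h)"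
    proof (rule op_chain_modify_first[where H = "\<lambda>j. hsp (X j)"])
      show "A' (Suc m) y = G (Suc m) (A (Suc m) y)" if "y \<in> vecs (hsp (X (Suc m)))" for y
        using that by (intro A'_mult) auto
      show "bounded_op (hsp (X (Suc j))) (hsp (X j)) (B j)" if "Suc m \<le> j" "j < Suc m + (b - Suc m)" for j
        using B that m by (simp add: op_args_def)
    qed (use m h in \<open>auto intro!: A'_eq Am hs\<close>)
    have Rm: "?R s h \<in> vecs (hsp (X (Suc m)))" using bounded_op_mem[OF Rb[OF s] h] .
    have "(\<lambda>\<omega>. g (Suc m) (\<omega>, t)) \<in> Linf (X (Suc m))" using gL[of "Suc m"] by (simp add: Linf_meas_def)
    then have "bounded_op (hsp (X (Suc m))) (hsp (X (Suc m))) (G (Suc m))"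
      unfolding G_def using pvm_space.pvm_int_char(1)[OF pvm2[of "Suc m"]] by simp
    then have "G (Suc m) (?R s h) \<in> vecs (hsp (X (Suc m)))" using Rm by (rule bounded_op_mem)
    moreover have "bounded_op (hsp (X (Suc m))) (hsp (X m)) (B m)" using B m by (simp add: op_args_def)
    ultimately have z: "B m (G (Suc m) (?R s h)) \<in> vecs (hsp (X m))" using bounded_op_mem by blast
    have l: "op_chain A' B a (m - a) (B m (G (Suc m) (?R s h))) = op_chain A B a (m - a) (G m (B m (G (Suc m) (?R s h))))"
    proof (rule op_chain_modify_last)
      show "A' j = A j" if "a \<le> j" "j < a + (m - a)" for j using that m by (intro A'_eq) auto
      have "A' m (B m (G (Suc m) (?R s h))) = A m (G m (B m (G (Suc m) (?R s h))))" using z by (intro A'_mult) auto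
      then show "A' (a + (m - a)) (B m (G (Suc m) (?R s h))) = A (a + (m - a)) (G m (B m (G (Suc m) (?R s h))))" using m by simp
    qed
    have Rr: "?R s = op_chain A B (Suc m) (b - Suc m)" and Ll: "?L s = op_chain A B a (m - a)"
      by (simp_all add: chain_op_def A_def[abs_def])
    have "chain_op a b X ?F B (s, t) h = chain_op a m X ?F B (s, t) (B m (chain_op (Suc m) b X ?F B (s, t) h))"
      by (rule chain_op_append[OF m])
    also have "\<dots> = op_chain A' B a (m - a) (B m (op_chain A' B (Suc m) (b - Suc m) h))"
      by (simp add: chain_op_def A'_def[abs_def])
    also have "\<dots> = op_chain A B a (m - a) (G m (B m (G (Suc m) (?R s h))))" unfolding r Rr[symmetric] l ..
    also have "\<dots> = ?L s (chain_op m (Suc m) X g B t (?R s h))" unfolding Ll by (simp add: chain_op_def[of m] G_def)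
    finally show ?thesis .
  qed
  have "ipd_pettis a b X (\<rho> \<Otimes>\<^sub>M \<rho>') ?F B T"
  proof (rule ipd_pettis_pair[OF d[OF 1(1) 2(1)] ab' pvm B])
    show "sigma_finite_measure \<rho>" "sigma_finite_measure \<rho>'" using 1(1) 2(1) by (simp_all add: is_ipd_def)
    show "hilbert_space (hsp (X m))" using hs m by simp
    show "is_pettis_integral (hsp (X (Suc m))) (hsp (X m)) \<rho>' (chain_op m (Suc m) X g B) I" by (rule P2)
    show "is_pettis_integral (hsp (X b)) (hsp (X a)) \<rho> (\<lambda>s h. ?L s (I (?R s h))) T" using P1 unfolding C .
  qed (assumption | fact Lb factor bounded_op_mem[OF Rb] bounded_op_mem[OF Gb])+
  from iptp_moi[OF u ab pvm d[OF 1(1) 2(1)] B this h]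
  show "moi TYPE('s) a b X ?\<theta> B h = moi TYPE('s) a b X \<phi> (B(m := moi TYPE('s) m (Suc m) X \<psi> B)) h"
    by (simp add: T_def I_def)
qed

end

text \<open>Infinitude of \<open>'s\<close> makes the admissible parameter spaces closed under
  disjoint sums and products up to injection. Operators are compared on
  \<open>vecs (hsp (X (k+1)))\<close>, where they are determined, and \<open>restrict\<close> forms
  the shorter tuples to which the factors are applied.\<close>

theorem proposition4p3p1:
  fixes X :: "nat \<Rightarrow> ('w, 'h::complex_vector) pvms" and k m :: nat
  assumes "infinite (UNIV :: 's set)"
    and "1 \<le> k"
    and "\<And>j. j \<in> {1..k+1} \<Longrightarrow> pvm_space (X j)"
    and "1 \<le> m" and "m \<le> k"
  shows
    "(\<forall>\<phi> \<psi> \<alpha>. \<phi> \<in> iptp TYPE('s) 1 (k+1) X \<longrightarrow> \<psi> \<in> iptp TYPE('s) 1 (k+1) X \<longrightarrow>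
        (\<lambda>\<omega>. \<phi> \<omega> + \<alpha> * \<psi> \<omega>) \<in> iptp TYPE('s) 1 (k+1) X \<and>
        (\<forall>B\<in>op_args 1 (k+1) X. \<forall>h\<in>vecs (hsp (X (k+1))).
           moi TYPE('s) 1 (k+1) X (\<lambda>\<omega>. \<phi> \<omega> + \<alpha> * \<psi> \<omega>) B h =
             moi TYPE('s) 1 (k+1) X \<phi> B h + \<alpha> *\<^sub>C moi TYPE('s) 1 (k+1) X \<psi> B h))
     \<and>
     (\<forall>\<psi>\<^sub>1 \<psi>\<^sub>2. \<psi>\<^sub>1 \<in> iptp TYPE('s) 1 m X \<longrightarrow> \<psi>\<^sub>2 \<in> iptp TYPE('s) (m+1) (k+1) X \<longrightarrow>
        (\<lambda>\<omega>. \<psi>\<^sub>1 (restrict \<omega> {1..m}) * \<psi>\<^sub>2 (restrict \<omega> {m+1..k+1})) \<in> iptp TYPE('s) 1 (k+1) X \<and>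
        (\<forall>B\<in>op_args 1 (k+1) X. \<forall>h\<in>vecs (hsp (X (k+1))).
           moi TYPE('s) 1 (k+1) X
               (\<lambda>\<omega>. \<psi>\<^sub>1 (restrict \<omega> {1..m}) * \<psi>\<^sub>2 (restrict \<omega> {m+1..k+1})) B h =
             moi TYPE('s) 1 m X \<psi>\<^sub>1 B (B m (moi TYPE('s) (m+1) (k+1) X \<psi>\<^sub>2 B h))))
     \<and>
     (\<forall>\<psi> \<phi>. \<psi> \<in> iptp TYPE('s) m (m+1) X \<longrightarrow> \<phi> \<in> iptp TYPE('s) 1 (k+1) X \<longrightarrow>
        (\<lambda>\<omega>. \<phi> \<omega> * \<psi> (restrict \<omega> {m, m+1})) \<in> iptp TYPE('s) 1 (k+1) X \<and>
        (\<forall>B\<in>op_args 1 (k+1) X. \<forall>h\<in>vecs (hsp (X (k+1))).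
           moi TYPE('s) 1 (k+1) X (\<lambda>\<omega>. \<phi> \<omega> * \<psi> (restrict \<omega> {m, m+1})) B h =
             moi TYPE('s) 1 (k+1) X \<phi> (B(m := moi TYPE('s) m (m+1) X \<psi> B)) h))"
proof -
  have ab: "1 < k + 1" and m: "1 \<le> m" "m < k + 1" using assms(2,4,5) by auto
  have pvm: "pvm_space (X j)" if "1 \<le> j" "j \<le> k + 1" for j using assms(3) that by simp
  note lin = moi_linear[OF assms(1) ab pvm]
  note ten = moi_tensor[OF assms(1) ab pvm m, unfolded Suc_eq_plus1]
  have pair: "{m..Suc m} = {m, m + 1}" by auto
  note mul = moi_mult[OF assms(1) ab pvm m, unfolded pair, unfolded Suc_eq_plus1]
  show ?thesis
    by (intro conjI allI impI ballI; (rule lin ten mul; assumption))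
qed

end
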